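(* Let $E_0:L^2(\Omega)\to\mathbb{R}$ be given by $$E_0(D)=\frac12\int_\Omega\left(|\nabla\bar h|^2+(\bar h-\sigma)^2\right)dx+\pi\gamma\int_\Omega\Phi(D(x))\,dx,$$ where $\bar h=\bar h(D)$ is the unique solution of $-\Delta\bar h+\bar h=2\pi D$ in $\Omega$, $\bar h=\sigma$ on $\partial\Omega$, and $\Phi(t)=(2k+1)|t|-k-k^2$ if $k\le|t|<k+1$, $k=0,1,2,\dots$. Then the functionals $\tilde E_\varepsilon$ $\Gamma$-converge to $E_0$ as $\varepsilon\to0$ with respect to the weak convergence of vorticity measures, i.e.: (i) ($\Gamma$-liminf inequality) if a sequence of tuples of integers $\{d_j^\varepsilon\}$ satisfies $\sum_j(d_j^\varepsilon)^2\le C/\varepsilon^2$ with $C$ independent of $\varepsilon$, and $\varepsilon^2\sum_j d_j^\varepsilon\delta_{a_j^\varepsilon}\rightharpoonup D$ in the sense of distributions on $\Omega$ with $D\in L^2(\Omega)$, then $\liminf_{\varepsilon\to0}\tilde E_\varepsilon(\{d_j^\varepsilon\})\ge E_0(D)$; (ii) ($\Gamma$-limsup inequality) for every $D\in L^2(\Omega)$ there is a sequence of tuples of integers $\{d_j^\varepsilon\}$ satisfying $\sum_j(d_j^\varepsilon)^2\le C/\varepsilon^2$ with $C$ independent of $\varepsilon$ and $\varepsilon^2\sum_j d_j^\varepsilon\delta_{a_j^\varepsilon}\rightharpoonup D$ in the sense of distributions on $\Omega$, such that $\limsup_{\varepsilon\to0}\tilde E_\varepsilon(\{d_j^\varepsilon\})\le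 E_0(D)$.
   Context: $\Omega\subset\mathbb{R}^2$ is a simply connected bounded domain; $\sigma,\gamma>0$ are fixed. For small $\varepsilon>0$, the holes $\omega_j^\varepsilon$, $j=1,\dots,N_\varepsilon$, are disks of radius $\rho_\varepsilon=e^{-\gamma/\varepsilon^2}$ centered at points $a_j^\varepsilon$, which are the centers of those cells $\Pi_j^\varepsilon$ of an $\varepsilon$-periodic square lattice (cells of side $\varepsilon$) that lie in $\Omega$; $\Omega_\varepsilon=\Omega\setminus\bigcup_j\omega_j^\varepsilon$. For a tuple of integers $\{d_j^\varepsilon\}_{j=1}^{N_\varepsilon}$, let $\tilde h^\varepsilon\in H^1(\Omega)$ be the unique function with $\nabla\tilde h^\varepsilon=0$ in every $\omega_j^\varepsilon$, $\tilde h^\varepsilon=\sigma$ on $\partial\Omega$, and $$\int_\Omega(\nabla\tilde h^\varepsilon\cdot\nabla v+\tilde h^\varepsilon v)\,dx=2\pi\varepsilon^2\sum_j d_j^\varepsilon\, v|_{\omega_j^\varepsilon}$$ for every $v\in H_0^1(\Omega)$ with $\nabla v=0$ in all $\omega_j^\varepsilon$. The functional $\tilde E_\varepsilon$ is $$\tilde E_\varepsilon(\{d_j^\varepsilon\})=\frac12\int_{\Omega_\varepsilon}|\nabla\tilde h^\varepsilon|^2dx+\frac12\int_\Omega(\tilde h^\varepsilon-\sigma)^2dx .$$ *)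

theory Defs
  imports "HOL-Analysis.Analysis"
begin

text \<open>Sobolev spaces on an open subset of the plane. Elements are represented by functions;
  equality of elements is equality almost everywhere.\<close>

definition grad :: "(real^2 \<Rightarrow> real) \<Rightarrow> real^2 \<Rightarrow> real^2" where
  "grad f x = (THE g. GDERIV f x :> g)"

primrec cont_diff :: "nat \<Rightarrow> (real^2 \<Rightarrow> real) \<Rightarrow> bool" where
  "cont_diff 0 f \<longleftrightarrow> continuous_on UNIV f"
| "cont_diff (Suc n) f \<longleftrightarrow>
     (\<forall>x. GDERIV f x :> grad f x) \<and> (\<forall>i. cont_diff n (\<lambda>x. grad f x $ i))"

definition test_function :: "(real^2) set \<Rightarrow> (real^2 \<Rightarrow> real) \<Rightarrow> bool" where
  "test_function \<Omega> \<phi> \<longleftrightarrow> (\<forall>n. cont_diff n \<phi>) \<and>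
     compact (closure {x. \<phi> x \<noteq> 0}) \<and> closure {x. \<phi> x \<noteq> 0} \<subseteq> \<Omega>"

definition L2 :: "(real^2) set \<Rightarrow> (real^2 \<Rightarrow> 'b::euclidean_space) \<Rightarrow> bool" where
  "L2 \<Omega> f \<longleftrightarrow> f \<in> borel_measurable (lebesgue_on \<Omega>) \<and>
     integrable (lebesgue_on \<Omega>) (\<lambda>x. (norm (f x))\<^sup>2)"

definition has_weak_grad :: "(real^2) set \<Rightarrow> (real^2 \<Rightarrow> real) \<Rightarrow> (real^2 \<Rightarrow> real^2) \<Rightarrow> bool" where
  "has_weak_grad \<Omega> u g \<longleftrightarrow> L2 \<Omega> u \<and> L2 \<Omega> g \<and>
     (\<forall>\<phi>. test_function \<Omega> \<phi> \<longrightarrow>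
        (\<integral>x. u x *\<^sub>R grad \<phi> x \<partial>lebesgue_on \<Omega>) = - (\<integral>x. \<phi> x *\<^sub>R g x \<partial>lebesgue_on \<Omega>))"

definition H1 :: "(real^2) set \<Rightarrow> (real^2 \<Rightarrow> real) \<Rightarrow> bool" where
  "H1 \<Omega> u \<longleftrightarrow> (\<exists>g. has_weak_grad \<Omega> u g)"

text \<open>For \<open>u\<close> in \<open>H1\<close> the weak gradient is unique up to a null set, so the choice
  below is immaterial.\<close>

definition weak_grad :: "(real^2) set \<Rightarrow> (real^2 \<Rightarrow> real) \<Rightarrow> real^2 \<Rightarrow> real^2" where
  "weak_grad \<Omega> u = (SOME g. has_weak_grad \<Omega> u g)"

text \<open>\<open>H10\<close> is the closure of the test functions in the norm of \<open>H1\<close>. The boundary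
  condition \<open>u = \<sigma>\<close> on the frontier of \<open>\<Omega>\<close> means \<open>u - \<sigma> \<in> H10\<close>.\<close>

definition H10 :: "(real^2) set \<Rightarrow> (real^2 \<Rightarrow> real) \<Rightarrow> bool" where
  "H10 \<Omega> u \<longleftrightarrow> H1 \<Omega> u \<and> (\<exists>\<phi>::nat \<Rightarrow> real^2 \<Rightarrow> real. (\<forall>n. test_function \<Omega> (\<phi> n)) \<and>
     (\<lambda>n. \<integral>x. (u x - \<phi> n x)\<^sup>2 \<partial>lebesgue_on \<Omega>) \<longlonglongrightarrow> 0 \<and>
     (\<lambda>n. \<integral>x. (norm (weak_grad \<Omega> u x - grad (\<phi> n) x))\<^sup>2 \<partial>lebesgue_on \<Omega>) \<longlonglongrightarrow> 0)"

text \<open>The lattice for parameter \<open>\<epsilon>\<close> consists of the closed squares of side \<open>\<epsilon>\<close> with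
  vertices in \<open>p + \<epsilon> \<int>\<^sup>2\<close>, where \<open>p\<close> is an arbitrary origin. The cells contained in \<open>\<Omega>\<close> are
  indexed by their centers, so a tuple \<open>d\<close> of integers is a function on \<open>centers \<Omega> p \<epsilon>\<close>,
  which is finite for bounded \<open>\<Omega>\<close> and \<open>\<epsilon> > 0\<close>.\<close>

definition centers :: "(real^2) set \<Rightarrow> real^2 \<Rightarrow> real \<Rightarrow> (real^2) set" where
  "centers \<Omega> p \<epsilon> = {a. (\<exists>k::int^2. a = p + \<epsilon> *\<^sub>R (\<chi> i. of_int (k $ i) + 1/2)) \<and>
     cbox (a - vec (\<epsilon>/2)) (a + vec (\<epsilon>/2)) \<subseteq> \<Omega>}"

definition hole :: "real \<Rightarrow> real \<Rightarrow> real^2 \<Rightarrow> (real^2) set" where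
  "hole \<gamma> \<epsilon> a = cball a (exp (- \<gamma> / \<epsilon>\<^sup>2))"

definition perforated :: "(real^2) set \<Rightarrow> real \<Rightarrow> real^2 \<Rightarrow> real \<Rightarrow> (real^2) set" where
  "perforated \<Omega> \<gamma> p \<epsilon> = \<Omega> - (\<Union>a\<in>centers \<Omega> p \<epsilon>. hole \<gamma> \<epsilon> a)"

definition grad_zero_in_holes ::
    "(real^2) set \<Rightarrow> real \<Rightarrow> real^2 \<Rightarrow> real \<Rightarrow> (real^2 \<Rightarrow> real) \<Rightarrow> bool" where
  "grad_zero_in_holes \<Omega> \<gamma> p \<epsilon> v \<longleftrightarrow>
     (\<forall>a\<in>centers \<Omega> p \<epsilon>. AE x in lebesgue_on (hole \<gamma> \<epsilon> a). weak_grad \<Omega> v x = 0)"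

text \<open>The constant value on \<open>\<omega>\<close> of a function that is constant almost everywhere there.\<close>

definition value_on :: "(real^2) set \<Rightarrow> (real^2 \<Rightarrow> real) \<Rightarrow> real" where
  "value_on \<omega> v = (THE c. AE x in lebesgue_on \<omega>. v x = c)"

definition is_h_tilde ::
    "(real^2) set \<Rightarrow> real \<Rightarrow> real \<Rightarrow> real^2 \<Rightarrow> real \<Rightarrow> (real^2 \<Rightarrow> int) \<Rightarrow> (real^2 \<Rightarrow> real) \<Rightarrow> bool" where
  "is_h_tilde \<Omega> \<sigma> \<gamma> p \<epsilon> d h \<longleftrightarrow>
     H1 \<Omega> h \<and> grad_zero_in_holes \<Omega> \<gamma> p \<epsilon> h \<and> H10 \<Omega> (\<lambda>x. h x - \<sigma>) \<and>
     (\<forall>v. H10 \<Omega> v \<and> grad_zero_in_holes \<Omega> \<gamma> p \<epsilon> v \<longrightarrow>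
        (\<integral>x. weak_grad \<Omega> h x \<bullet> weak_grad \<Omega> v x + h x * v x \<partial>lebesgue_on \<Omega>) =
        2 * pi * \<epsilon>\<^sup>2 * (\<Sum>a\<in>centers \<Omega> p \<epsilon>. of_int (d a) * value_on (hole \<gamma> \<epsilon> a) v))"

text \<open>The solutions \<open>h_tilde\<close> and \<open>h_bar\<close> are unique up to a null set; the choice operator
  selects a representative.\<close>

definition h_tilde ::
    "(real^2) set \<Rightarrow> real \<Rightarrow> real \<Rightarrow> real^2 \<Rightarrow> real \<Rightarrow> (real^2 \<Rightarrow> int) \<Rightarrow> real^2 \<Rightarrow> real" where
  "h_tilde \<Omega> \<sigma> \<gamma> p \<epsilon> d = (SOME h. is_h_tilde \<Omega> \<sigma> \<gamma> p \<epsilon> d h)"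

definition E_tilde ::
    "(real^2) set \<Rightarrow> real \<Rightarrow> real \<Rightarrow> real^2 \<Rightarrow> real \<Rightarrow> (real^2 \<Rightarrow> int) \<Rightarrow> real" where
  "E_tilde \<Omega> \<sigma> \<gamma> p \<epsilon> d = (let h = h_tilde \<Omega> \<sigma> \<gamma> p \<epsilon> d in
     1/2 * (\<integral>x. (norm (weak_grad \<Omega> h x))\<^sup>2 \<partial>lebesgue_on (perforated \<Omega> \<gamma> p \<epsilon>)) +
     1/2 * (\<integral>x. (h x - \<sigma>)\<^sup>2 \<partial>lebesgue_on \<Omega>))"

definition is_h_bar ::
    "(real^2) set \<Rightarrow> real \<Rightarrow> (real^2 \<Rightarrow> real) \<Rightarrow> (real^2 \<Rightarrow> real) \<Rightarrow> bool" where
  "is_h_bar \<Omega> \<sigma> D h \<longleftrightarrow> H1 \<Omega> h \<and> H10 \<Omega> (\<lambda>x. h x - \<sigma>) \<and>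
     (\<forall>v. H10 \<Omega> v \<longrightarrow>
        (\<integral>x. weak_grad \<Omega> h x \<bullet> weak_grad \<Omega> v x + h x * v x \<partial>lebesgue_on \<Omega>) =
        2 * pi * (\<integral>x. D x * v x \<partial>lebesgue_on \<Omega>))"

definition h_bar :: "(real^2) set \<Rightarrow> real \<Rightarrow> (real^2 \<Rightarrow> real) \<Rightarrow> real^2 \<Rightarrow> real" where
  "h_bar \<Omega> \<sigma> D = (SOME h. is_h_bar \<Omega> \<sigma> D h)"

definition Phi :: "real \<Rightarrow> real" where
  "Phi t = (let k = of_int \<lfloor>\<bar>t\<bar>\<rfloor> in (2 * k + 1) * \<bar>t\<bar> - k - k\<^sup>2)"

definition E_0 :: "(real^2) set \<Rightarrow> real \<Rightarrow> real \<Rightarrow> (real^2 \<Rightarrow> real) \<Rightarrow> real" where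
  "E_0 \<Omega> \<sigma> \<gamma> D = (let h = h_bar \<Omega> \<sigma> D in
     1/2 * (\<integral>x. (norm (weak_grad \<Omega> h x))\<^sup>2 + (h x - \<sigma>)\<^sup>2 \<partial>lebesgue_on \<Omega>) +
     pi * \<gamma> * (\<integral>x. Phi (D x) \<partial>lebesgue_on \<Omega>))"

text \<open>In the next two notions \<open>p \<epsilon>\<close> is the origin of the lattice and \<open>d \<epsilon>\<close> the tuple for
  parameter \<open>\<epsilon>\<close>.\<close>

definition charges_bounded ::
    "(real^2) set \<Rightarrow> (real \<Rightarrow> real^2) \<Rightarrow> (real \<Rightarrow> real^2 \<Rightarrow> int) \<Rightarrow> bool" where
  "charges_bounded \<Omega> p d \<longleftrightarrow> (\<exists>C. \<forall>\<^sub>F \<epsilon> in at_right 0.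
     (\<Sum>a\<in>centers \<Omega> (p \<epsilon>) \<epsilon>. (real_of_int (d \<epsilon> a))\<^sup>2) \<le> C / \<epsilon>\<^sup>2)"

definition vorticity_converges ::
    "(real^2) set \<Rightarrow> (real \<Rightarrow> real^2) \<Rightarrow> (real \<Rightarrow> real^2 \<Rightarrow> int) \<Rightarrow> (real^2 \<Rightarrow> real) \<Rightarrow> bool" where
  "vorticity_converges \<Omega> p d D \<longleftrightarrow> (\<forall>\<phi>. test_function \<Omega> \<phi> \<longrightarrow>
     ((\<lambda>\<epsilon>. \<epsilon>\<^sup>2 * (\<Sum>a\<in>centers \<Omega> (p \<epsilon>) \<epsilon>. of_int (d \<epsilon> a) * \<phi> a))
        \<longlongrightarrow> (\<integral>x. D x * \<phi> x \<partial>lebesgue_on \<Omega>)) (at_right 0))"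

end

theory Submission
  imports Defs
begin

text \<open>
  Subtracting \<open>\<sigma>\<close> and pairing a function with its gradient turns both boundary value problems
  into Riesz representations in the closure \<open>Z\<close> of the pairs \<open>(\<phi>, \<nabla>\<phi>)\<close>, \<open>\<phi>\<close> a test function, in
  \<open>L\<^sup>2\<close>: the Dirichlet part of \<open>E_0\<close> is \<open>\<parallel>w\<parallel>\<^sup>2 / 2\<close> with \<open>w \<in> Z\<close>, and \<open>E_tilde\<close> is
  \<open>\<parallel>w\<^sub>\<epsilon>\<parallel>\<^sup>2 / 2\<close> with \<open>w\<^sub>\<epsilon>\<close> in the subspace where the gradient vanishes on the holes.

  Lower bound: \<open>\<parallel>w\<^sub>\<epsilon>\<parallel>\<^sup>2 / 2 \<ge> l\<^sub>\<epsilon> u - \<parallel>u\<parallel>\<^sup>2 / 2\<close> for every competitor \<open>u\<close>, where \<open>l\<^sub>\<epsilon>\<close> is the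
  functional represented by \<open>w\<^sub>\<epsilon>\<close>. The competitor is a test function close to \<open>w\<close>, flattened near
  the holes, plus logarithmic vortices of strength \<open>\<epsilon>\<^sup>2 d\<^sub>a\<close>. As \<open>\<epsilon>\<^sup>2 ln (1/\<rho>) = \<gamma>\<close>, the vortices
  contribute \<open>\<pi> \<gamma> \<epsilon>\<^sup>2 \<Sum> d\<^sub>a\<^sup>2\<close>.

  Upper bound: the value of \<open>w\<^sub>\<epsilon>\<close> on a hole is its average over the disk of radius \<open>\<epsilon>/2\<close> minus a
  flux against a radial field. The averages converge by weak convergence in \<open>L\<^sup>2\<close> and compactness;
  the fields sum to a field \<open>F\<close> with \<open>\<parallel>F\<parallel>\<^sup>2 \<le> 2 \<pi> \<gamma> \<epsilon>\<^sup>2 \<Sum> d\<^sub>a\<^sup>2\<close> that tends to zero in \<open>L\<^sup>1\<close>. Hence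
  \<open>\<parallel>w\<^sub>\<epsilon>\<parallel>\<close> is at most about \<open>\<parallel>w - (0, F)\<parallel>\<close>, whose cross term is negligible.

  It remains to compare \<open>\<epsilon>\<^sup>2 \<Sum> d\<^sub>a\<^sup>2\<close> with \<open>\<integral> \<Phi>(D)\<close>. For integers \<open>d\<close>, \<open>k\<close> one has
  \<open>d\<^sup>2 \<ge> (2 k + 1) d - k - k\<^sup>2\<close>, with equality if \<open>d\<close> is \<open>k\<close> or \<open>k + 1\<close>, and \<open>\<Phi>\<close> is the upper envelope
  of these affine functions. With \<open>k = \<lfloor>D\<rfloor>\<close> this gives lower semicontinuity. For recovery, the
  partial sums of the cell averages of \<open>D\<close> along each row of the lattice are shifted by a common
  \<open>\<theta> \<in> [0, 1]\<close> and rounded down: the rounding errors telescope along the rows, and the mean over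
  \<open>\<theta>\<close> of \<open>\<Sum> d\<^sub>a\<^sup>2\<close> is \<open>\<Sum> \<Phi>(m\<^sub>a)\<close>, where \<open>m\<^sub>a\<close> are the cell averages.
\<close>

text \<open>Each hole carries the weight \<open>\<epsilon>^2 d_a\<close> and there are about
  \<open>\<epsilon>^-2\<close> holes, so the natural bounded quantity is
  \<open>Q = \<epsilon>^2 * \<Sum> d_a^2\<close>. Mean field and self-energy decouple because vortex
  gradients are bounded in \<open>L^2\<close> but concentrate on small annuli: against the bounded
  gradient of a test function they disappear. This is why both bounds replace \<open>w\<close> by a
  test function before any cross term is estimated. The upper bound for \<open>E_tilde\<close> holds
  for every tuple with bounded \<open>Q\<close> and convergent vorticity, not only for recovery
  tuples. The gap between the two inequalities therefore lies in \<open>Q\<close> alone, which is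
  only lower semicontinuous under weak convergence. Recovery charges must keep the weak limit and at
  the same time take only the two integers next to each cell average. Rounding every average
  separately would destroy the limit (think of \<open>D = 1/2\<close>), whence the rounding of
  partial sums. The origin of the lattice may vary with \<open>\<epsilon>\<close>; it enters none of
  the constants.\<close>

abbreviation ind :: "'a set \<Rightarrow> 'a \<Rightarrow> real" where
  "ind \<equiv> indicat_real"

section \<open>Smooth functions on the plane\<close>

lemma GDERIV_unique: "GDERIV f x :> a \<Longrightarrow> GDERIV f x :> b \<Longrightarrow> a = b"
  unfolding gderiv_def
  by (metis has_derivative_unique inner_commute vector_eq_ldot)

lemma grad_eq: "GDERIV f x :> g \<Longrightarrow> grad f x = g"
  unfolding grad_def by (rule the_equality) (auto intro: GDERIV_unique)

lemma grad_eqI: "(\<And>x. GDERIV f x :> g x) \<Longrightarrow> grad f = g"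
  by (rule ext) (rule grad_eq)

text \<open>The recursion of \<open>cont_diff\<close> refers to the chosen \<open>grad\<close>; this
  lets any explicitly known gradient take its place.\<close>

lemma cont_diff_SucI:
  assumes "\<And>x. GDERIV f x :> g x" and "\<And>i. cont_diff n (\<lambda>x. g x $ i)"
  shows "cont_diff (Suc n) f"
  using assms grad_eqI[OF assms(1)] by simp

lemma cont_diff_imp_continuous: "cont_diff n f \<Longrightarrow> continuous_on UNIV f"
proof (cases n)
  case (Suc m)
  assume "cont_diff n f"
  then have "\<forall>x. GDERIV f x :> grad f x" by (simp add: Suc)
  then show ?thesis
    by (auto simp: gderiv_def continuous_on_eq_continuous_at dest: has_derivative_continuous)
qed simp

text \<open>In the product and chain rules the gradient contains the functions themselves, so the
  inductions also use them one order lower.\<close>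

lemma cont_diff_Suc_imp: "cont_diff (Suc n) f \<Longrightarrow> cont_diff n f"
proof (induction n arbitrary: f)
  case 0 then show ?case using cont_diff_imp_continuous by fastforce
next
  case (Suc n) then show ?case by auto
qed

lemma cont_diff_const: "cont_diff n (\<lambda>x. c)"
proof (induction n arbitrary: c)
  case (Suc n)
  show ?case
    by (rule cont_diff_SucI[where g="\<lambda>x. 0"]) (use GDERIV_const Suc in auto)
qed simp

lemma cont_diff_coord: "cont_diff n (\<lambda>x. x $ i)"
proof (cases n)
  case 0 show ?thesis by (auto simp: 0 intro!: continuous_intros)
next
  case (Suc m)
  have "GDERIV (\<lambda>x. x $ i) x :> axis i 1" for x :: "real^2"
    unfolding gderiv_def
    by (simp add: inner_axis bounded_linear_imp_has_derivative bounded_linear_vec_nth)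
  then show ?thesis unfolding Suc
    by (rule cont_diff_SucI) (simp add: cont_diff_const axis_def)
qed

lemma cont_diff_add: "cont_diff n f \<Longrightarrow> cont_diff n g \<Longrightarrow> cont_diff n (\<lambda>x. f x + g x)"
proof (induction n arbitrary: f g)
  case 0 then show ?case by (simp add: continuous_on_add)
next
  case (Suc n)
  show ?case
    by (rule cont_diff_SucI[where g="\<lambda>x. grad f x + grad g x"])
       (use Suc in \<open>auto intro: GDERIV_add\<close>)
qed

lemma cont_diff_mult: "cont_diff n f \<Longrightarrow> cont_diff n g \<Longrightarrow> cont_diff n (\<lambda>x. f x * g x)"
proof (induction n arbitrary: f g)
  case 0 then show ?case by (simp add: continuous_on_mult)
next
  case (Suc n)
  show ?case
  proof (rule cont_diff_SucI[where g="\<lambda>x. f x *\<^sub>R grad g x + g x *\<^sub>R grad f x"])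
    show "GDERIV (\<lambda>x. f x * g x) x :> f x *\<^sub>R grad g x + g x *\<^sub>R grad f x" for x
      using Suc.prems by (auto intro: GDERIV_mult)
    have "cont_diff n f" "cont_diff n g" using Suc.prems cont_diff_Suc_imp by blast+
    then show "cont_diff n (\<lambda>x. (f x *\<^sub>R grad g x + g x *\<^sub>R grad f x) $ i)" for i
      using Suc by (auto intro!: cont_diff_add)
  qed
qed

lemma cont_diff_diff: "cont_diff n f \<Longrightarrow> cont_diff n g \<Longrightarrow> cont_diff n (\<lambda>x. f x - g x)"
  using cont_diff_add[OF _ cont_diff_mult[OF cont_diff_const[of n "-1"]], of f g] by simp

lemma cont_diff_prod: "(\<And>a. a \<in> A \<Longrightarrow> cont_diff n (f a)) \<Longrightarrow> cont_diff n (\<lambda>x. \<Prod>a\<in>A. f a x)"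
  by (induction A rule: infinite_finite_induct) (auto intro: cont_diff_const cont_diff_mult)

lemma cont_diff_power: "cont_diff n f \<Longrightarrow> cont_diff n (\<lambda>x. f x ^ m)"
  by (induction m) (auto intro: cont_diff_const cont_diff_mult)

text \<open>Radial functions are composed with the squared distance, a polynomial, because the
  distance itself is not differentiable at the centre.\<close>

lemma GDERIV_dist_sq: "GDERIV (\<lambda>x. (norm (x - a))^2) x :> 2 *\<^sub>R (x - a)"
  unfolding gderiv_def power2_norm_eq_inner
  by (auto intro!: derivative_eq_intros simp: inner_commute algebra_simps)

lemma cont_diff_dist_sq: "cont_diff n (\<lambda>x. (norm (x - a))^2)"
proof -
  have "(\<lambda>x::real^2. (norm (x - a))^2) = (\<lambda>x. (x$1 - a$1)*(x$1 - a$1) + (x$2 - a$2)*(x$2-a$2))"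
    by (auto simp: power2_norm_eq_inner inner_vec_def sum_2)
  then show ?thesis
    by (auto intro!: cont_diff_add cont_diff_mult cont_diff_diff cont_diff_coord cont_diff_const)
qed

section \<open>Smooth functions of one variable and the flat exponential\<close>

primrec smooth1 :: "nat \<Rightarrow> (real \<Rightarrow> real) \<Rightarrow> bool" where
  "smooth1 0 f \<longleftrightarrow> continuous_on UNIV f"
| "smooth1 (Suc n) f \<longleftrightarrow> (\<exists>f'. (\<forall>x. DERIV f x :> f' x) \<and> smooth1 n f')"

lemma smooth1_Suc_imp: "smooth1 (Suc n) f \<Longrightarrow> smooth1 n f"
proof (induction n arbitrary: f)
  case 0 then show ?case by (auto simp: continuous_on_eq_continuous_at intro: DERIV_isCont)
next
  case (Suc n) 
  then obtain f' where f': "\<forall>x. DERIV f x :> f' x" "smooth1 (Suc n) f'" by auto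
  from Suc.IH[OF f'(2)] f'(1) show ?case by auto
qed

lemma smooth1_const: "smooth1 n (\<lambda>x. c)"
  by (induction n arbitrary: c) (auto intro!: exI[of _ "\<lambda>x. 0"])

lemma smooth1_add: "smooth1 n f \<Longrightarrow> smooth1 n g \<Longrightarrow> smooth1 n (\<lambda>x. f x + g x)"
proof (induction n arbitrary: f g)
  case 0 then show ?case by (simp add: continuous_on_add)
next
  case (Suc n)
  then obtain f' g' where *: "\<forall>x. DERIV f x :> f' x" "smooth1 n f'" "\<forall>x. DERIV g x :> g' x" "smooth1 n g'" by auto
  show ?case unfolding smooth1.simps
    by (rule exI[of _ "\<lambda>x. f' x + g' x"]) (use * Suc.IH in \<open>auto intro!: derivative_intros\<close>)
qed

lemma smooth1_mult: "smooth1 n f \<Longrightarrow> smooth1 n g \<Longrightarrow> smooth1 n (\<lambda>x. f x * g x)"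
proof (induction n arbitrary: f g)
  case 0 then show ?case by (simp add: continuous_on_mult)
next
  case (Suc n)
  then obtain f' g' where *: "\<forall>x. DERIV f x :> f' x" "smooth1 n f'" "\<forall>x. DERIV g x :> g' x" "smooth1 n g'" by auto
  have **: "smooth1 n f" "smooth1 n g" using Suc.prems smooth1_Suc_imp by blast+
  show ?case unfolding smooth1.simps
  proof (rule exI[of _ "\<lambda>x. f' x * g x + g' x * f x"], safe)
    show "DERIV (\<lambda>x. f x * g x) x :> f' x * g x + g' x * f x" for x
      using * by (auto intro!: DERIV_mult)
    show "smooth1 n (\<lambda>x. f' x * g x + g' x * f x)"
      by (intro smooth1_add Suc.IH * **)
  qed
qed

lemma smooth1_affine:
  assumes "smooth1 n f" shows "smooth1 n (\<lambda>x. f (a * x + b))"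
  using assms
proof (induction n arbitrary: f)
  case 0 then show ?case by (auto intro!: continuous_on_compose2[of UNIV f] continuous_intros)
next
  case (Suc n)
  then obtain f' where *: "\<forall>x. DERIV f x :> f' x" "smooth1 n f'" by auto
  show ?case unfolding smooth1.simps
  proof (rule exI[of _ "\<lambda>x. f' (a*x+b) * a"], safe)
    show "DERIV (\<lambda>x. f (a * x + b)) x :> f' (a * x + b) * a" for x
    proof -
      have "DERIV (\<lambda>x. a * x + b) x :> a" by (auto intro!: derivative_eq_intros)
      with *(1) show ?thesis using DERIV_chain2[of f "f' (a*x+b)" "\<lambda>x. a*x+b" x a UNIV] by blast
    qed
    show "smooth1 n (\<lambda>x. f' (a*x+b) * a)" by (intro smooth1_mult smooth1_const Suc.IH *)
  qed
qed

lemma smooth1_inverse: "smooth1 n f \<Longrightarrow> (\<And>x. f x \<noteq> 0) \<Longrightarrow> smooth1 n (\<lambda>x. inverse (f x))"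
proof (induction n arbitrary: f)
  case 0 then show ?case by (auto intro: continuous_on_inverse)
next
  case (Suc n)
  then obtain f' where *: "\<forall>x. DERIV f x :> f' x" "smooth1 n f'" by auto
  have i: "smooth1 n (\<lambda>x. inverse (f x))" using Suc smooth1_Suc_imp by blast
  show ?case unfolding smooth1.simps
  proof (rule exI[of _ "\<lambda>x. (-1) * (inverse (f x) * f' x * inverse (f x))"], safe)
    show "DERIV (\<lambda>x. inverse (f x)) x :> (-1) * (inverse (f x) * f' x * inverse (f x))" for x
      using DERIV_inverse'[of f "f' x" x UNIV] * Suc.prems(2) by auto
    show "smooth1 n (\<lambda>x. (-1) * (inverse (f x) * f' x * inverse (f x)))"
      by (intro smooth1_mult smooth1_const i *)
  qed
qed

text \<open>The condition near \<open>0\<close> makes division by the argument harmless.\<close>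

lemma smooth1_div_ident:
  assumes "smooth1 n f" "c > 0" "\<And>t. t < c \<Longrightarrow> f t = 0"
  shows "smooth1 n (\<lambda>t. f t / t)"
  using assms
proof (induction n arbitrary: f)
  case 0
  have "isCont (\<lambda>t. f t / t) t" for t
  proof (cases "t < c")
    case True
    have "\<forall>\<^sub>F s in nhds t. s < c" using True by (intro order_tendstoD(2)[of "\<lambda>x. x"]) (auto simp: filterlim_ident)
    then have "\<forall>\<^sub>F s in nhds t. f s / s = 0" by eventually_elim (simp add: 0)
    then show ?thesis by (subst isCont_cong[where g="\<lambda>s. 0"]) auto
  next
    case False
    then show ?thesis using 0 by (auto simp: continuous_on_eq_continuous_at intro!: continuous_intros)
  qed
  then show ?case by (simp add: continuous_on_eq_continuous_at)
next
  case (Suc n)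
  then obtain f' where *: "\<And>x. DERIV f x :> f' x" "smooth1 n f'" by auto
  have loc: "\<forall>\<^sub>F s in nhds t. f s = 0 \<and> f s / s = 0" if "t < c" for t
  proof -
    have "\<forall>\<^sub>F s in nhds t. s < c" using that by (intro order_tendstoD(2)[of "\<lambda>x. x"]) (auto simp: filterlim_ident)
    then show ?thesis by eventually_elim (simp add: Suc)
  qed
  have z: "f' t = 0" if "t < c" for t
  proof -
    have "DERIV f t :> 0 \<longleftrightarrow> DERIV (\<lambda>s. 0::real) t :> 0"
      by (rule DERIV_cong_ev) (use loc[OF that] in \<open>auto elim: eventually_mono\<close>)
    then have "DERIV f t :> 0" by simp
    then show ?thesis using *(1) DERIV_unique by blast
  qed
  have i: "smooth1 n (\<lambda>x. f x / x)" "smooth1 n (\<lambda>x. f' x / x)"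
    using Suc smooth1_Suc_imp * z by auto
  have zero: "(f t / t) / t = 0" if "t < c" for t using Suc.prems that by auto
  \<comment> \<open>The term \<open>f / x^2\<close> of the derivative is written as an iterated
    quotient, so that the induction hypothesis, applied twice, covers it.\<close>
  have j: "smooth1 n (\<lambda>x. f x / x / x)" using Suc.IH[OF i(1)] Suc.prems by auto
  show ?case unfolding smooth1.simps
  proof (rule exI[of _ "\<lambda>x. f' x / x + (-1) * (f x / x / x)"], safe)
    fix x show "DERIV (\<lambda>t. f t / t) x :> f' x / x + (-1) * (f x / x / x)"
    proof (cases "x < c")
      case True
      have "DERIV (\<lambda>t. f t / t) x :> 0 \<longleftrightarrow> DERIV (\<lambda>s. 0::real) x :> 0"
        by (rule DERIV_cong_ev) (use loc[OF True] in \<open>auto elim: eventually_mono\<close>)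
      then show ?thesis using True Suc.prems z by auto
    next
      case False
      then show ?thesis using Suc.prems
        by (auto intro!: derivative_eq_intros * simp: field_simps)
    qed
    show "smooth1 n (\<lambda>x. f' x / x + (-1) * (f x / x / x))"
      by (intro smooth1_add smooth1_mult smooth1_const i j)
  qed
qed

lemma GDERIV_compose1:
  assumes "GDERIV g x :> g'" "DERIV f (g x) :> f'"
  shows "GDERIV (\<lambda>x. f (g x)) x :> f' *\<^sub>R g'"
  by (rule GDERIV_DERIV_compose[OF assms])

lemma cont_diff_compose: "smooth1 n f \<Longrightarrow> cont_diff n g \<Longrightarrow> cont_diff n (\<lambda>x. f (g x))"
proof (induction n arbitrary: f)
  case 0 then show ?case by (auto intro: continuous_on_compose2[of UNIV f])
next
  case (Suc n)
  then obtain f' where *: "\<forall>x. DERIV f x :> f' x" "smooth1 n f'" by auto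
  have "cont_diff n g" using Suc.prems cont_diff_Suc_imp by blast
  show ?case
  proof (rule cont_diff_SucI[where g="\<lambda>x. f' (g x) *\<^sub>R grad g x"])
    show "GDERIV (\<lambda>x. f (g x)) x :> f' (g x) *\<^sub>R grad g x" for x
      by (rule GDERIV_compose1) (use * Suc.prems in auto)
    show "cont_diff n (\<lambda>x. (f' (g x) *\<^sub>R grad g x) $ i)" for i
      using Suc * \<open>cont_diff n g\<close> by (auto intro!: cont_diff_mult)
  qed
qed

text \<open>The classical \<open>exp (- 1/t)\<close> is the member \<open>m = 0\<close>. The
  derivative of a member is a combination of the members \<open>m + 1\<close> and
  \<open>m + 2\<close>, so one differentiability proof for the whole family gives smoothness of all
  orders.\<close>

definition flatexp :: "nat \<Rightarrow> real \<Rightarrow> real" where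
  "flatexp m t = (if t > 0 then inverse t ^ m * exp (- inverse t) else 0)"

lemma flatexp_tendsto_0: "((\<lambda>t. inverse t ^ m * exp (- inverse t)) \<longlongrightarrow> 0) (at_right (0::real))"
proof -
  have "((\<lambda>x::real. x ^ m / exp x) \<longlongrightarrow> 0) at_top" by (rule tendsto_power_div_exp_0)
  then have "((\<lambda>t. (inverse t) ^ m / exp (inverse t)) \<longlongrightarrow> 0) (at_right (0::real))"
    by (rule filterlim_compose) (rule filterlim_inverse_at_top_right)
  then show ?thesis by (simp add: exp_minus divide_inverse)
qed

lemma DERIV_flatexp: "DERIV (flatexp m) t :> (- real m) * flatexp (Suc m) t + flatexp (Suc (Suc m)) t"
proof -
  consider "t > 0" | "t < 0" | "t = 0" by linarith
  then show ?thesis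
  proof cases
    case 1
    have ev: "\<forall>\<^sub>F s in nhds t. s > 0" using 1 by (intro order_tendstoD(1)[of "\<lambda>x. x"]) (auto simp: filterlim_ident)
    define i where "i = inverse t"
    have di: "DERIV inverse t :> - (i ^ Suc (Suc 0))" using DERIV_inverse[of t UNIV] 1 by (simp add: i_def)
    have "DERIV (\<lambda>s. inverse s ^ m * exp (- inverse s)) t :>
        (real m * (- (i ^ Suc (Suc 0)) * i ^ (m - Suc 0))) * exp (- i) + (exp (- i) * (- (- (i ^ Suc (Suc 0))))) * i ^ m"
      using DERIV_mult[OF DERIV_power[OF di, of m] DERIV_fun_exp[OF DERIV_minus[OF di]]]
      by (simp add: i_def)
    also have "(real m * (- (i ^ Suc (Suc 0)) * i ^ (m - Suc 0))) * exp (- i) + (exp (- i) * (- (- (i ^ Suc (Suc 0))))) * i ^ m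
      = (- real m) * flatexp (Suc m) t + flatexp (Suc (Suc m)) t"
      using 1 by (cases m) (simp_all add: flatexp_def i_def[symmetric] algebra_simps)
    finally have "DERIV (\<lambda>s. inverse s ^ m * exp (- inverse s)) t :> (- real m) * flatexp (Suc m) t + flatexp (Suc (Suc m)) t" .
    moreover have "DERIV (flatexp m) t :> d \<longleftrightarrow> DERIV (\<lambda>s. inverse s ^ m * exp (- inverse s)) t :> d" for d
      by (rule DERIV_cong_ev) (use ev in \<open>auto simp: flatexp_def elim: eventually_mono\<close>)
    ultimately show ?thesis by simp
  next
    case 2
    have ev: "\<forall>\<^sub>F s in nhds t. s < 0" using 2 by (intro order_tendstoD(2)[of "\<lambda>x. x"]) (auto simp: filterlim_ident)
    have "DERIV (flatexp m) t :> 0 \<longleftrightarrow> DERIV (\<lambda>s. 0::real) t :> 0"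
      by (rule DERIV_cong_ev) (use ev in \<open>auto simp: flatexp_def elim: eventually_mono\<close>)
    then show ?thesis using 2 by (simp add: flatexp_def)
  next
    case 3
    \<comment> \<open>To the right of 0 the difference quotient is the next member of the family,
      which tends to 0 there.\<close>
    have "((\<lambda>h. (flatexp m h - flatexp m 0) / h) \<longlongrightarrow> 0) (at_right 0)"
    proof (rule Lim_transform_eventually[OF flatexp_tendsto_0[of "Suc m"]])
      show "\<forall>\<^sub>F t in at_right 0. inverse t ^ Suc m * exp (- inverse t) = (flatexp m t - flatexp m 0) / t"
        using eventually_at_right_less[of "0::real"]
        by eventually_elim (simp add: flatexp_def field_simps)
    qed
    moreover have "((\<lambda>h. (flatexp m h - flatexp m 0) / h) \<longlongrightarrow> 0) (at_left 0)"
    proof (rule Lim_transform_eventually[OF tendsto_const[of 0]])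
      show "\<forall>\<^sub>F t in at_left 0. 0 = (flatexp m t - flatexp m 0) / t"
        by (auto simp: flatexp_def eventually_at_filter)
    qed
    ultimately have "((\<lambda>h. (flatexp m h - flatexp m 0) / h) \<longlongrightarrow> 0) (at 0)"
      by (simp add: filterlim_at_split)
    then show ?thesis using 3 by (simp add: DERIV_def flatexp_def)
  qed
qed

lemma smooth1_flatexp: "smooth1 n (flatexp m)"
proof (induction n arbitrary: m)
  case 0 then show ?case
    using DERIV_isCont[OF DERIV_flatexp] by (auto simp: continuous_on_eq_continuous_at)
next
  case (Suc n)
  show ?case unfolding smooth1.simps
    by (rule exI, rule conjI, rule allI, rule DERIV_flatexp) (intro smooth1_add smooth1_mult smooth1_const Suc)
qed

lemma flatexp_pos_iff: "flatexp m t > 0 \<longleftrightarrow> t > 0" and flatexp_nonneg: "flatexp m t \<ge> 0"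
  and flatexp_eq_0_iff: "flatexp m t = 0 \<longleftrightarrow> t \<le> 0"
  by (auto simp: flatexp_def)

lemma flatexp_0_le_1: "flatexp 0 t \<le> 1"
  by (auto simp: flatexp_def)

definition smooth_step :: "real \<Rightarrow> real" where
  "smooth_step t = flatexp 0 t * inverse (flatexp 0 t + flatexp 0 (1 - t))"

text \<open>At least one of \<open>t\<close> and \<open>1 - t\<close> is positive.\<close>

lemma step_denominator_pos: "flatexp 0 t + flatexp 0 (1 - t) > 0"
  by (cases "t > 0") (auto simp: flatexp_pos_iff flatexp_nonneg intro: add_pos_nonneg add_nonneg_pos)

lemma smooth1_step: "smooth1 n smooth_step"
proof -
  have a: "smooth1 n (\<lambda>t. flatexp 0 (1 - t))" using smooth1_affine[OF smooth1_flatexp, of n 0 "-1" 1] by simp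
  have "\<And>t. flatexp 0 t + flatexp 0 (1 - t) \<noteq> 0" using step_denominator_pos by (simp add: less_imp_neq[symmetric])
  then show ?thesis
    unfolding smooth_step_def[abs_def] by (intro smooth1_mult smooth1_inverse smooth1_add smooth1_flatexp a)
qed

lemma smooth_step_0: "t \<le> 0 \<Longrightarrow> smooth_step t = 0" and smooth_step_1: "t \<ge> 1 \<Longrightarrow> smooth_step t = 1"
  using step_denominator_pos[of t] by (auto simp: smooth_step_def flatexp_eq_0_iff flatexp_def)

lemma smooth_step_nonneg: "smooth_step t \<ge> 0" 
  using step_denominator_pos[of t] flatexp_nonneg[of 0 t] by (simp add: smooth_step_def)

lemma smooth_step_le_1: "smooth_step t \<le> 1"
proof -
  have "flatexp 0 t / (flatexp 0 t + flatexp 0 (1 - t)) \<le> 1"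
    using step_denominator_pos[of t] flatexp_nonneg[of 0 "1-t"] by (subst divide_le_eq_1_pos) auto
  then show ?thesis by (simp add: smooth_step_def divide_inverse)
qed

section \<open>Test functions: closure properties and uniform bounds\<close>

lemma test_functionI:
  assumes "\<And>n. cont_diff n \<phi>" "compact K" "K \<subseteq> \<Omega>" "\<And>x. x \<notin> K \<Longrightarrow> \<phi> x = 0"
  shows "test_function \<Omega> \<phi>"
proof -
  have "{x. \<phi> x \<noteq> 0} \<subseteq> K" using assms by auto
  then have "closure {x. \<phi> x \<noteq> 0} \<subseteq> K" using assms(2) by (simp add: closure_minimal compact_imp_closed)
  then show ?thesis using assms unfolding test_function_def
    by (meson bounded_subset closed_closure compact_eq_bounded_closed dual_order.trans)
qed

lemma grad_eq_0_outside_support: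
  assumes "x \<notin> closure {x. \<phi> x \<noteq> 0}" shows "grad \<phi> x = 0"
proof (rule grad_eq)
  let ?S = "- closure {x. \<phi> x \<noteq> 0}"
  have S: "open ?S" "x \<in> ?S" using assms by auto
  have "0 = \<phi> y" if "y \<in> ?S" for y using that closure_subset[of "{x. \<phi> x \<noteq> 0}"] by auto
  then have "(\<phi> has_derivative (\<lambda>h. 0)) (at x)"
    by (rule has_derivative_transform_within_open[OF has_derivative_const[of 0] S])
  then show "GDERIV \<phi> x :> 0" by (simp add: gderiv_def)
qed

lemma test_function_support:
  assumes "test_function \<Omega> \<phi>"
  obtains K where "compact K" "K \<subseteq> \<Omega>" "\<And>x. x \<notin> K \<Longrightarrow> \<phi> x = 0" "\<And>x. x \<notin> K \<Longrightarrow> grad \<phi> x = 0"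
proof (rule that)
  show "compact (closure {x. \<phi> x \<noteq> 0})" "closure {x. \<phi> x \<noteq> 0} \<subseteq> \<Omega>"
    using assms by (simp_all add: test_function_def)
  show "\<phi> x = 0" if "x \<notin> closure {x. \<phi> x \<noteq> 0}" for x
    using that closure_subset[of "{x. \<phi> x \<noteq> 0}"] by auto
qed (rule grad_eq_0_outside_support)

lemma test_function_GDERIV: "test_function \<Omega> \<phi> \<Longrightarrow> GDERIV \<phi> x :> grad \<phi> x"
  unfolding test_function_def by (metis cont_diff.simps(2))

lemma test_function_continuous: "test_function \<Omega> \<phi> \<Longrightarrow> continuous_on UNIV \<phi>"
  unfolding test_function_def using cont_diff.simps(1) by blast

lemma test_function_grad_continuous: 
  assumes "test_function \<Omega> \<phi>" shows "continuous_on UNIV (grad \<phi>)"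
proof -
  have "continuous_on UNIV (\<lambda>x. grad \<phi> x $ i)" for i
    using assms unfolding test_function_def by (metis cont_diff.simps(2) cont_diff.simps(1))
  then have "continuous_on UNIV (\<lambda>x. \<chi> i. grad \<phi> x $ i)" by (rule continuous_on_vec_lambda)
  then show ?thesis by simp
qed

lemma test_function_add: 
  assumes "test_function \<Omega> f" "test_function \<Omega> g" shows "test_function \<Omega> (\<lambda>x. f x + c * g x)"
proof -
  obtain K where K: "compact K" "K \<subseteq> \<Omega>" "\<And>x. x \<notin> K \<Longrightarrow> f x = 0" using test_function_support[OF assms(1)] by metis
  obtain L where L: "compact L" "L \<subseteq> \<Omega>" "\<And>x. x \<notin> L \<Longrightarrow> g x = 0" using test_function_support[OF assms(2)] by metis
  show ?thesis
  proof (rule test_functionI[of _ "K \<union> L"])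
    show "cont_diff n (\<lambda>x. f x + c * g x)" for n
      using assms by (auto simp: test_function_def intro!: cont_diff_add cont_diff_mult cont_diff_const)
  qed (use K L in auto)
qed

lemma test_function_zero: "test_function \<Omega> (\<lambda>x. 0)"
  by (rule test_functionI[of _ "{}"]) (auto intro: cont_diff_const)

lemma test_function_sum:
  assumes "finite A" "\<And>a. a \<in> A \<Longrightarrow> test_function \<Omega> (f a)" shows "test_function \<Omega> (\<lambda>x. \<Sum>a\<in>A. f a x)"
  using assms
proof (induction A rule: finite_induct)
  case empty then show ?case by (simp add: test_function_zero)
next
  case (insert a F)
  then show ?case using test_function_add[of \<Omega> "f a" "\<lambda>x. \<Sum>b\<in>F. f b x" 1] by simp
qed

lemma grad_add: 
  assumes "test_function \<Omega> f" "test_function \<Omega> g" shows "grad (\<lambda>x. f x + c * g x) = (\<lambda>x. grad f x + c *\<^sub>R grad g x)"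
proof (rule grad_eqI)
  fix x
  have "GDERIV (\<lambda>x. f x + c * g x) x :> grad f x + (c *\<^sub>R grad g x + g x *\<^sub>R 0)"
    by (intro GDERIV_add GDERIV_mult GDERIV_const test_function_GDERIV[OF assms(1)] test_function_GDERIV[OF assms(2)])
  then show "GDERIV (\<lambda>x. f x + c * g x) x :> grad f x + c *\<^sub>R grad g x" by simp
qed

lemma grad_sum:
  assumes "finite A" "\<And>a. a \<in> A \<Longrightarrow> test_function \<Omega> (f a)"
  shows "grad (\<lambda>x. \<Sum>a\<in>A. f a x) = (\<lambda>x. \<Sum>a\<in>A. grad (f a) x)"
  using assms
proof (induction A rule: finite_induct)
  case empty then show ?case using grad_eqI[of "\<lambda>x. 0" "\<lambda>x. 0"] GDERIV_const by auto
next
  case (insert a F)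
  then show ?case using grad_add[of \<Omega> "f a" "\<lambda>x. \<Sum>a\<in>F. f a x" 1] test_function_sum[of F] by auto
qed

lemma compact_bounded_real:
  assumes "compact K" "continuous_on UNIV (f :: real^2 \<Rightarrow> 'b::real_normed_vector)" "\<And>x. x \<notin> K \<Longrightarrow> f x = 0"
  obtains B where "B \<ge> 0" "\<And>x. norm (f x) \<le> B"
proof -
  have "bounded (f ` K)" using assms by (meson compact_continuous_image compact_imp_bounded continuous_on_subset subset_UNIV)
  then obtain B where B: "\<And>x. x \<in> K \<Longrightarrow> norm (f x) \<le> B" by (auto simp: bounded_iff)
  show ?thesis
  proof (rule that[of "max B 0"])
    show "norm (f x) \<le> max B 0" for x using B[of x] assms(3)[of x] by (cases "x \<in> K") auto
  qed simp
qed

text \<open>One constant serves for the values, the gradient and the Lipschitz estimate; the last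
  comes from the mean value inequality on the convex plane.\<close>

lemma test_function_bounded:
  assumes "test_function \<Omega> \<phi>"
  obtains B where "B \<ge> 0" "\<And>x. \<bar>\<phi> x\<bar> \<le> B" "\<And>x. norm (grad \<phi> x) \<le> B" "\<And>x y. \<bar>\<phi> x - \<phi> y\<bar> \<le> B * norm (x - y)"
proof -
  obtain K where K: "compact K" "\<And>x. x \<notin> K \<Longrightarrow> \<phi> x = 0" "\<And>x. x \<notin> K \<Longrightarrow> grad \<phi> x = 0" using test_function_support[OF assms] by metis
  obtain B where B: "B \<ge> 0" "\<And>x. norm (\<phi> x) \<le> B" using compact_bounded_real K test_function_continuous[OF assms] by metis
  obtain C where C: "C \<ge> 0" "\<And>x. norm (grad \<phi> x) \<le> C" using compact_bounded_real K test_function_grad_continuous[OF assms] by metis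
  have lip: "norm (\<phi> x - \<phi> y) \<le> C * norm (x - y)" for x y
  proof (rule differentiable_bound[OF convex_UNIV])
    show "(\<phi> has_derivative (\<lambda>h. inner h (grad \<phi> z))) (at z within UNIV)" for z
      using test_function_GDERIV[OF assms, of z] by (simp add: gderiv_def)
    show "onorm (\<lambda>h. inner h (grad \<phi> z)) \<le> C" for z
      by (rule onorm_le) (metis C(2) Cauchy_Schwarz_ineq2 mult.commute mult_left_mono norm_ge_zero order_trans real_norm_def)
  qed auto
  show ?thesis
  proof (rule that[of "max B C"])
    show "\<bar>\<phi> x - \<phi> y\<bar> \<le> max B C * norm (x - y)" for x y
      using lip[of x y] by (smt (verit) mult_right_mono norm_ge_zero real_norm_def)
  qed (use B C in \<open>auto simp: le_max_iff_disj\<close>)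
qed

definition bump :: "real^2 \<Rightarrow> real \<Rightarrow> real^2 \<Rightarrow> real" where
  "bump a r x = flatexp 0 (r^2 - (norm (x - a))^2)"

lemma cont_diff_bump: "cont_diff n (bump a r)"
  unfolding bump_def[abs_def]
  by (intro cont_diff_compose[OF smooth1_flatexp, of n "\<lambda>x. r^2 - (norm (x - a))^2"] cont_diff_diff cont_diff_const cont_diff_dist_sq)

lemma bump_range: "0 \<le> bump a r x" "bump a r x \<le> 1"
  by (auto simp: bump_def flatexp_nonneg flatexp_0_le_1)

lemma bump_pos_iff: 
  assumes "r > 0" shows "bump a r x > 0 \<longleftrightarrow> x \<in> ball a r"
proof -
  have "(norm (x - a))^2 < r^2 \<longleftrightarrow> norm (x - a) < r"
    using power_mono_iff[of r "norm (x - a)" 2] assms by (simp add: not_le[symmetric])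
  then show ?thesis by (simp add: bump_def flatexp_pos_iff dist_norm norm_minus_commute[of a])
qed

section \<open>Square integrable functions\<close>

text \<open>The measure is a parameter because the arguments move between
  \<open>lebesgue_on \<Omega>\<close> and \<open>lborel\<close>, where translations act.\<close>

definition sqi :: "'a measure \<Rightarrow> ('a \<Rightarrow> 'b::euclidean_space) \<Rightarrow> bool" where
  "sqi M f \<longleftrightarrow> f \<in> borel_measurable M \<and> integrable M (\<lambda>x. (norm (f x))^2)"

lemma L2_iff: "L2 \<Omega> f \<longleftrightarrow> sqi (lebesgue_on \<Omega>) f"
  by (simp add: L2_def sqi_def)

definition nrm2 :: "'a measure \<Rightarrow> ('a \<Rightarrow> 'b::euclidean_space) \<Rightarrow> real" where
  "nrm2 M f = sqrt (\<integral>x. (norm (f x))^2 \<partial>M)"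

lemma nrm2_nonneg [simp]: "nrm2 M f \<ge> 0"
  by (simp add: nrm2_def)

lemma nrm2_sq: "(nrm2 M f)^2 = (\<integral>x. (norm (f x))^2 \<partial>M)"
  by (simp add: nrm2_def)

lemma sqi_inner: 
  assumes "sqi M f" "sqi M g" shows "integrable M (\<lambda>x. f x \<bullet> g x)"
proof (rule Bochner_Integration.integrable_bound[where f="\<lambda>x. (norm (f x))^2 + (norm (g x))^2"])
  show "integrable M (\<lambda>x. (norm (f x))^2 + (norm (g x))^2)" using assms by (auto simp: sqi_def)
  show "(\<lambda>x. f x \<bullet> g x) \<in> borel_measurable M" using assms by (auto simp: sqi_def)
  have "\<bar>f x \<bullet> g x\<bar> \<le> (norm (f x))^2 + (norm (g x))^2" for x
  proof -
    have "\<bar>f x \<bullet> g x\<bar> \<le> norm (f x) * norm (g x)" by (rule Cauchy_Schwarz_ineq2)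
    moreover have "0 \<le> (norm (f x) - norm (g x))^2" "0 \<le> norm (f x) * norm (g x)" by auto
    ultimately show ?thesis by (simp add: power2_diff) 
  qed
  then show "AE x in M. norm (f x \<bullet> g x) \<le> norm ((norm (f x))^2 + (norm (g x))^2)" by auto
qed

lemma sqi_mult:
  fixes f g :: "'a \<Rightarrow> real"
  assumes "sqi M f" "sqi M g" shows "integrable M (\<lambda>x. f x * g x)"
  using sqi_inner[OF assms] by simp

lemma norm_add_sq_le: "(norm (a + b :: 'a::real_inner))^2 \<le> 2 * (norm a)^2 + 2 * (norm b)^2"
proof -
  have "0 \<le> (norm (a - b))^2" by simp
  then show ?thesis by (simp add: power2_norm_eq_inner inner_simps inner_commute)
qed

lemma sqi_add:
  assumes "sqi M f" "sqi M g" shows "sqi M (\<lambda>x. f x + g x)"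
  unfolding sqi_def
proof
  show "integrable M (\<lambda>x. (norm (f x + g x))^2)"
  proof (rule Bochner_Integration.integrable_bound[where f="\<lambda>x. 2 * (norm (f x))^2 + 2 * (norm (g x))^2"])
    show "AE x in M. norm ((norm (f x + g x))^2) \<le> norm (2 * (norm (f x))^2 + 2 * (norm (g x))^2)"
      using norm_add_sq_le by auto
  qed (use assms in \<open>auto simp: sqi_def\<close>)
qed (use assms in \<open>auto simp: sqi_def\<close>)

lemma sqi_scaleR:
  assumes "sqi M f" shows "sqi M (\<lambda>x. c *\<^sub>R f x)"
  using assms by (auto simp: sqi_def power_mult_distrib)

lemma sqi_cmult:
  fixes f :: "'a \<Rightarrow> real"
  assumes "sqi M f" shows "sqi M (\<lambda>x. c * f x)"
  using sqi_scaleR[OF assms, of c] by simp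

lemma sqi_minus:
  assumes "sqi M f" shows "sqi M (\<lambda>x. - f x)"
  using assms by (auto simp: sqi_def)

lemma sqi_diff:
  assumes "sqi M f" "sqi M g" shows "sqi M (\<lambda>x. f x - g x)"
  using sqi_add[OF assms(1) sqi_minus[OF assms(2)]] by simp

lemma sqi_sum:
  assumes "finite A" "\<And>a. a \<in> A \<Longrightarrow> sqi M (f a)" shows "sqi M (\<lambda>x. \<Sum>a\<in>A. f a x)"
  using assms by (induction A rule: finite_induct) (auto intro: sqi_add simp: sqi_def[of _ "\<lambda>x. 0"])

lemma sqi_zero: "sqi M (\<lambda>x. 0)"
  by (simp add: sqi_def)

lemma sqi_bounded:
  assumes "finite_measure M" "f \<in> borel_measurable M" "\<And>x. norm (f x) \<le> B"
  shows "sqi M f"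
proof -
  interpret finite_measure M by fact
  have "integrable M (\<lambda>x. (norm (f x))^2)"
    by (rule integrable_const_bound[where B="B^2"]) (use assms in \<open>auto intro!: power_mono\<close>)
  then show ?thesis using assms by (simp add: sqi_def)
qed

lemma sqi_const: "finite_measure M \<Longrightarrow> sqi M (\<lambda>x. c)"
  by (rule sqi_bounded[where B="norm c"]) auto

lemma sqi_norm: "sqi M f \<Longrightarrow> sqi M (\<lambda>x. norm (f x))"
  by (auto simp: sqi_def)

lemma sqi_integrable:
  assumes "finite_measure M" "sqi M f" shows "integrable M f"
proof -
  have "integrable M (\<lambda>x. norm (f x) * 1)" by (rule sqi_mult[OF sqi_norm sqi_const]) (use assms in auto)
  then show ?thesis using assms(2) by (simp add: integrable_norm_iff sqi_def)
qed

lemma sqi_fst_snd: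
  fixes w :: "'a \<Rightarrow> 'b::euclidean_space \<times> 'c::euclidean_space"
  shows "sqi M w \<longleftrightarrow> sqi M (\<lambda>x. fst (w x)) \<and> sqi M (\<lambda>x. snd (w x))"
proof
  assume w: "sqi M w"
  then have "w \<in> borel_measurable M" by (simp add: sqi_def)
  then have m: "(\<lambda>x. fst (w x)) \<in> borel_measurable M" "(\<lambda>x. snd (w x)) \<in> borel_measurable M"
    by (auto intro!: borel_measurable_continuous_on[where f=fst] borel_measurable_continuous_on[where f=snd] continuous_intros)
  have le: "norm (fst p) \<le> norm p" "norm (snd p) \<le> norm p" for p :: "'b \<times> 'c"
    using norm_fst_le[of "fst p" "snd p"] norm_snd_le[of "snd p" "fst p"] by auto
  have "integrable M (\<lambda>x. (norm (fst (w x)))^2)"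
    by (rule Bochner_Integration.integrable_bound[where f="\<lambda>x. (norm (w x))^2"])
       (use w m in \<open>auto simp: sqi_def le intro!: power_mono AE_I2\<close>)
  moreover have "integrable M (\<lambda>x. (norm (snd (w x)))^2)"
    by (rule Bochner_Integration.integrable_bound[where f="\<lambda>x. (norm (w x))^2"])
       (use w m in \<open>auto simp: sqi_def le intro!: power_mono AE_I2\<close>)
  ultimately show "sqi M (\<lambda>x. fst (w x)) \<and> sqi M (\<lambda>x. snd (w x))"
    using m by (simp add: sqi_def)
next
  assume *: "sqi M (\<lambda>x. fst (w x)) \<and> sqi M (\<lambda>x. snd (w x))"
  have "(\<lambda>x. (fst (w x), snd (w x))) \<in> borel_measurable M"
    using * by (intro borel_measurable_Pair) (auto simp: sqi_def)
  moreover have "(norm (w x))^2 = (norm (fst (w x)))^2 + (norm (snd (w x)))^2" for x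
    by (simp add: norm_prod_def)
  ultimately show "sqi M w" using * by (simp add: sqi_def)
qed

text \<open>A quadratic polynomial that vanishes at 0 and is nowhere negative has no linear part.
  This serves the degenerate case of the Cauchy-Schwarz inequality and the first variation in the
  projection theorem.\<close>

lemma square_discriminant_trick:
  assumes "\<And>t::real. 0 \<le> t^2 * c - 2 * t * b" shows "b = 0"
proof (rule ccontr)
  assume b: "b \<noteq> 0"
  show False
  proof (cases "c \<le> 0")
    case True
    from assms[of b] have "2 * b^2 \<le> b^2 * c" by (simp add: power2_eq_square)
    moreover have "b^2 * c \<le> 0" using True by (simp add: mult_nonneg_nonpos)
    moreover have "b^2 > 0" using b by simp
    ultimately show False by linarith
  next
    case False
    from assms[of "b/c"] False have "b^2 * 2 \<le> b^2" by (simp add: power2_eq_square field_simps)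
    moreover have "b^2 > 0" using b by simp
    ultimately show False by linarith
  qed
qed

lemma Cauchy_Schwarz_integral:
  assumes f: "sqi M f" and g: "sqi M g"
  shows "\<bar>\<integral>x. f x \<bullet> g x \<partial>M\<bar> \<le> nrm2 M f * nrm2 M g"
proof -
  let ?a = "\<integral>x. (norm (f x))^2 \<partial>M" and ?b = "\<integral>x. f x \<bullet> g x \<partial>M" and ?c = "\<integral>x. (norm (g x))^2 \<partial>M"
  have i: "integrable M (\<lambda>x. (norm (f x))^2)" "integrable M (\<lambda>x. (norm (g x))^2)" "integrable M (\<lambda>x. f x \<bullet> g x)"
    using f g sqi_inner by (auto simp: sqi_def)
  have nn: "?a \<ge> 0" "?c \<ge> 0" by auto
  have q: "0 \<le> s^2 * ?a - 2 * s * t * ?b + t^2 * ?c" for s t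
  proof -
    have "(\<integral>x. (norm (s *\<^sub>R f x - t *\<^sub>R g x))^2 \<partial>M) = (\<integral>x. s^2 * (norm (f x))^2 - 2 * s * t * (f x \<bullet> g x) + t^2 * (norm (g x))^2 \<partial>M)"
      by (rule Bochner_Integration.integral_cong)
         (auto simp: power2_norm_eq_inner inner_simps inner_commute, simp add: power2_eq_square algebra_simps)
    also have "\<dots> = s^2 * ?a - 2 * s * t * ?b + t^2 * ?c"
      using i by simp
    finally have "(\<integral>x. (norm (s *\<^sub>R f x - t *\<^sub>R g x))^2 \<partial>M) = s^2 * ?a - 2 * s * t * ?b + t^2 * ?c" .
    moreover have "0 \<le> (\<integral>x. (norm (s *\<^sub>R f x - t *\<^sub>R g x))^2 \<partial>M)" by simp
    ultimately show ?thesis by simp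
  qed
  have "?b\<^sup>2 \<le> ?a * ?c"
  proof (cases "?c = 0")
    case True
    have "?b = 0"
      by (rule square_discriminant_trick[of ?a]) (use q[of _ 1] True in simp)
    then show ?thesis using True by simp
  next
    case False
    \<comment> \<open>The choice \<open>s = ?c\<close>, \<open>t = ?b\<close> is the minimising
      ratio cleared of denominators; the form then factors as
      \<open>?c * (?a * ?c - ?b^2)\<close>.\<close>
    have "0 \<le> ?c\<^sup>2 * ?a - 2 * ?c * ?b * ?b + ?b\<^sup>2 * ?c" by (rule q)
    also have "\<dots> = ?c * (?a * ?c - ?b\<^sup>2)" by (simp add: power2_eq_square algebra_simps)
    finally have "0 \<le> ?c * (?a * ?c - ?b\<^sup>2)" .
    moreover have "?c > 0" using False nn(2) by linarith
    moreover have "0 \<le> y" if "0 \<le> x * y" "x > 0" for x y :: real using that by (simp add: zero_le_mult_iff)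
    ultimately have "0 \<le> ?a * ?c - ?b\<^sup>2" by blast
    then show ?thesis by linarith
  qed
  then have "sqrt (?b\<^sup>2) \<le> sqrt (?a * ?c)" by (rule real_sqrt_le_mono)
  then show ?thesis by (simp only: nrm2_def real_sqrt_mult real_sqrt_abs)
qed

lemma Cauchy_Schwarz_integral_norm:
  assumes f: "sqi M f" and g: "sqi M g"
  shows "(\<integral>x. norm (f x) * norm (g x) \<partial>M) \<le> nrm2 M f * nrm2 M g"
  using Cauchy_Schwarz_integral[OF sqi_norm[OF f] sqi_norm[OF g]] by (simp add: nrm2_def)

lemma nrm2_triangle:
  assumes f: "sqi M f" and g: "sqi M g"
  shows "nrm2 M (\<lambda>x. f x + g x) \<le> nrm2 M f + nrm2 M g"
proof -
  have i: "integrable M (\<lambda>x. (norm (f x))^2)" "integrable M (\<lambda>x. (norm (g x))^2)" "integrable M (\<lambda>x. f x \<bullet> g x)"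
    using f g sqi_inner by (auto simp: sqi_def)
  have "(\<integral>x. (norm (f x + g x))^2 \<partial>M) = (\<integral>x. (norm (f x))^2 + 2 * (f x \<bullet> g x) + (norm (g x))^2 \<partial>M)"
    by (rule Bochner_Integration.integral_cong) (auto simp: power2_norm_eq_inner inner_simps inner_commute)
  also have "\<dots> = (nrm2 M f)^2 + 2 * (\<integral>x. f x \<bullet> g x \<partial>M) + (nrm2 M g)^2" using i by (simp add: nrm2_sq)
  also have "\<dots> \<le> (nrm2 M f + nrm2 M g)^2"
    using Cauchy_Schwarz_integral[OF f g] by (simp add: power2_sum)
  finally have "(nrm2 M (\<lambda>x. f x + g x))^2 \<le> (nrm2 M f + nrm2 M g)^2" by (simp add: nrm2_sq)
  then show ?thesis by (rule power2_le_imp_le) simp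
qed

lemma sqi_integral_norm_le:
  assumes "finite_measure M" "sqi M f"
  shows "(\<integral>x. norm (f x) \<partial>M) \<le> nrm2 M f * sqrt (measure M (space M))"
  using Cauchy_Schwarz_integral_norm[OF assms(2) sqi_const[OF assms(1), of "1::real"]] by (simp add: nrm2_def)

section \<open>Completeness of \<open>L^2\<close> and projection onto closed subspaces\<close>

lemma L2_complete:
  fixes f :: "nat \<Rightarrow> 'a \<Rightarrow> 'b::euclidean_space"
  assumes fin: "finite_measure M" and f: "\<And>n. sqi M (f n)"
    and cauchy: "\<And>n m. n \<le> m \<Longrightarrow> (\<integral>x. (norm (f m x - f n x))^2 \<partial>M) \<le> C / 4 ^ n"
  obtains g where "sqi M g" "\<And>n. (\<integral>x. (norm (g x - f n x))^2 \<partial>M) \<le> C / 4 ^ n"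
proof -
  have [measurable]: "f n \<in> borel_measurable M" for n using f by (auto simp: sqi_def)
  have C: "C \<ge> 0" using order_trans[OF _ cauchy[of 0 0]] by auto
  let ?d = "\<lambda>n x. norm (f (Suc n) x - f n x)"
  have d: "sqi M (\<lambda>x. f (Suc n) x - f n x)" for n by (rule sqi_diff[OF f f])
  define K where "K = sqrt C * sqrt (measure M (space M))"
  have K: "K \<ge> 0" using C by (simp add: K_def)
  \<comment> \<open>Squared norms of order \<open>4^-n\<close> are norms of order
    \<open>2^-n\<close>, and the finite measure passes to \<open>L^1\<close>. The increments are
    therefore summable almost everywhere and the whole sequence converges pointwise; Fatou's lemma
    then keeps the rate.\<close>
  have dn: "(\<integral>x. ?d n x \<partial>M) \<le> K * (1/2) ^ n" for n
  proof -
    have "nrm2 M (\<lambda>x. f (Suc n) x - f n x) \<le> sqrt (C / 4 ^ n)"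
      unfolding nrm2_def using cauchy[of n "Suc n"] by simp
    also have "sqrt (C / 4 ^ n) = sqrt C * (1/2) ^ n"
    proof -
      have "(4::real) ^ n = (2 ^ n)^2" by (simp add: power2_eq_square power_mult_distrib[symmetric])
      then show ?thesis by (simp add: real_sqrt_divide power_divide)
    qed
    finally have "nrm2 M (\<lambda>x. f (Suc n) x - f n x) * sqrt (measure M (space M)) \<le> sqrt C * (1/2) ^ n * sqrt (measure M (space M))"
      by (rule mult_right_mono) simp
    then show ?thesis using sqi_integral_norm_le[OF fin d[of n]] by (simp add: K_def mult_ac)
  qed
  have "(\<integral>\<^sup>+x. (\<Sum>n. ennreal (?d n x)) \<partial>M) = (\<Sum>n. \<integral>\<^sup>+x. ennreal (?d n x) \<partial>M)"
    by (rule nn_integral_suminf) measurable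
  also have "\<dots> = (\<Sum>n. ennreal (\<integral>x. ?d n x \<partial>M))"
    by (intro suminf_cong nn_integral_eq_integral integrable_norm sqi_integrable[OF fin] d) auto
  also have "\<dots> \<le> (\<Sum>n. ennreal (K * (1/2) ^ n))"
    by (intro suminf_le ennreal_leI dn) auto
  also have "\<dots> = ennreal (\<Sum>n. K * (1/2) ^ n)"
    by (rule suminf_ennreal2) (use K in \<open>auto intro!: summable_mult summable_geometric\<close>)
  also have "\<dots> < \<infinity>" by simp
  finally have "AE x in M. (\<Sum>n. ennreal (?d n x)) \<noteq> \<infinity>"
    by (intro nn_integral_PInf_AE) auto
  then have AEc: "AE x in M. convergent (\<lambda>n. f n x)"
  proof eventually_elim
    case (elim x)
    then have "summable (\<lambda>n. ?d n x)" by (intro summable_suminf_not_top) auto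
    then have "summable (\<lambda>n. f (Suc n) x - f n x)" by (rule summable_norm_cancel)
    then have "convergent (\<lambda>n. \<Sum>k<n. f (Suc k) x - f k x)" by (simp add: summable_iff_convergent)
    then have "convergent (\<lambda>n. f n x - f 0 x)" unfolding sum_lessThan_telescope[of "\<lambda>n. f n x"] .
    then show ?case using convergent_add[OF _ convergent_const[of "f 0 x"], of "\<lambda>n. f n x - f 0 x"] by simp
  qed
  define g where "g x = lim (\<lambda>n. f n x)" for x
  have [measurable]: "g \<in> borel_measurable M" unfolding g_def[abs_def] by measurable
  have lim: "AE x in M. (\<lambda>m. f m x) \<longlonglongrightarrow> g x" using AEc by eventually_elim (simp add: g_def convergent_LIMSEQ_iff)
  have bd: "(\<integral>\<^sup>+x. ennreal ((norm (g x - f n x))^2) \<partial>M) \<le> ennreal (C / 4 ^ n)" for n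
  proof -
    have "(\<integral>\<^sup>+x. ennreal ((norm (g x - f n x))^2) \<partial>M) = (\<integral>\<^sup>+x. liminf (\<lambda>m. ennreal ((norm (f m x - f n x))^2)) \<partial>M)"
    proof (rule nn_integral_cong_AE)
      show "AE x in M. ennreal ((norm (g x - f n x))^2) = liminf (\<lambda>m. ennreal ((norm (f m x - f n x))^2))"
        using lim
      proof eventually_elim
        case (elim x)
        then have "(\<lambda>m. ennreal ((norm (f m x - f n x))^2)) \<longlonglongrightarrow> ennreal ((norm (g x - f n x))^2)"
          by (intro tendsto_ennrealI tendsto_intros)
        then show ?case using lim_imp_Liminf[of sequentially] by (metis trivial_limit_sequentially)
      qed
    qed
    also have "\<dots> \<le> liminf (\<lambda>m. \<integral>\<^sup>+x. ennreal ((norm (f m x - f n x))^2) \<partial>M)"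
      by (rule nn_integral_liminf) measurable
    also have "\<dots> \<le> limsup (\<lambda>m. \<integral>\<^sup>+x. ennreal ((norm (f m x - f n x))^2) \<partial>M)"
      by (rule Liminf_le_Limsup) simp
    also have "\<dots> \<le> ennreal (C / 4 ^ n)"
    proof (rule Limsup_bounded)
      show "\<forall>\<^sub>F m in sequentially. (\<integral>\<^sup>+x. ennreal ((norm (f m x - f n x))^2) \<partial>M) \<le> ennreal (C / 4 ^ n)"
        using eventually_ge_at_top[of n]
      proof eventually_elim
        case (elim m)
        have "sqi M (\<lambda>x. f m x - f n x)" by (rule sqi_diff[OF f f])
        then have "(\<integral>\<^sup>+x. ennreal ((norm (f m x - f n x))^2) \<partial>M) = ennreal (\<integral>x. (norm (f m x - f n x))^2 \<partial>M)"
          by (intro nn_integral_eq_integral) (auto simp: sqi_def)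
        then show ?case using cauchy[OF elim] by (simp add: ennreal_leI)
      qed
    qed
    finally show ?thesis .
  qed
  have si: "sqi M (\<lambda>x. g x - f n x)" for n
    unfolding sqi_def
  proof
    show "integrable M (\<lambda>x. (norm (g x - f n x))^2)"
      by (rule integrableI_bounded) (use le_less_trans[OF bd[of n]] in auto)
  qed measurable
  have sg: "sqi M g" using sqi_add[OF si[of 0] f[of 0]] by simp
  have "(\<integral>x. (norm (g x - f n x))^2 \<partial>M) \<le> C / 4 ^ n" for n
  proof -
    have "ennreal (\<integral>x. (norm (g x - f n x))^2 \<partial>M) = (\<integral>\<^sup>+x. ennreal ((norm (g x - f n x))^2) \<partial>M)"
      by (rule nn_integral_eq_integral[symmetric]) (use si[of n] in \<open>auto simp: sqi_def\<close>)
    then have "ennreal (\<integral>x. (norm (g x - f n x))^2 \<partial>M) \<le> ennreal (C / 4 ^ n)" using bd[of n] by simp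
    then show ?thesis using C by (subst (asm) ennreal_le_iff) auto
  qed
  then show ?thesis using that sg by blast
qed

text \<open>Riesz representation of \<open>v \<mapsto> \<integral> k \<bullet> v\<close> by the
  point of \<open>X\<close> nearest to \<open>k\<close>. Closedness is expressed by approximation
  because \<open>X\<close> consists of functions, not of classes modulo null sets.\<close>

lemma L2_projection:
  fixes k :: "'a \<Rightarrow> 'b::euclidean_space"
  assumes fin: "finite_measure M" and k: "sqi M k"
    and X: "\<And>f. f \<in> X \<Longrightarrow> sqi M f" and zero: "(\<lambda>x. 0) \<in> X"
    and lin: "\<And>f g c. f \<in> X \<Longrightarrow> g \<in> X \<Longrightarrow> (\<lambda>x. f x + c *\<^sub>R g x) \<in> X"
    and closed: "\<And>f. sqi M f \<Longrightarrow> (\<And>\<delta>. \<delta> > 0 \<Longrightarrow> \<exists>g\<in>X. (\<integral>x. (norm (f x - g x))^2 \<partial>M) < \<delta>) \<Longrightarrow> f \<in> X"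
  obtains w where "w \<in> X" "\<And>v. v \<in> X \<Longrightarrow> (\<integral>x. w x \<bullet> v x \<partial>M) = (\<integral>x. k x \<bullet> v x \<partial>M)"
proof -
  define J where "J f = (\<integral>x. (norm (k x - f x))^2 \<partial>M)" for f
  define d where "d = (INF f\<in>X. J f)"
  have J0: "J f \<ge> 0" for f by (simp add: J_def)
  have bdd: "bdd_below (J ` X)" by (rule bdd_belowI2[of _ 0]) (rule J0)
  have dle: "d \<le> J f" if "f \<in> X" for f unfolding d_def using bdd that by (rule cINF_lower)
  have "\<exists>f\<in>X. J f < d + e" if "e > 0" for e
  proof -
    have "d < d + e" using that by simp
    then show ?thesis unfolding d_def[symmetric] using cINF_less_iff[of X J "d + e"] bdd zero unfolding d_def by auto
  qed
  then have "\<exists>f\<in>X. J f < d + 1 / 4 ^ n" for n by simp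
  then obtain w where w: "\<And>n. w n \<in> X" "\<And>n. J (w n) < d + 1 / 4 ^ n" by metis
  \<comment> \<open>Parallelogram law for \<open>k - f\<close> and \<open>k - g\<close>: the
    midpoint \<open>h\<close> lies in \<open>X\<close>, so \<open>J h\<close> is at least the
    infimum. Near-minimisers are thus close to each other, with the rate that
    \<open>L2_complete\<close> asks for.\<close>
  have par: "(\<integral>x. (norm (f x - g x))^2 \<partial>M) \<le> 2 * (J f + J g - 2 * d)" if "f \<in> X" "g \<in> X" for f g
  proof -
    define h where "h x = (1/2) *\<^sub>R (f x + 1 *\<^sub>R g x)" for x
    have "(\<lambda>x. 0 + (1/2) *\<^sub>R (f x + 1 *\<^sub>R g x)) \<in> X" using lin[OF zero lin[OF that, of 1], of "1/2"] by simp
    then have hX: "h \<in> X" by (simp add: h_def[abs_def])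
    have i: "integrable M (\<lambda>x. (norm (k x - f x))^2)" "integrable M (\<lambda>x. (norm (k x - g x))^2)" "integrable M (\<lambda>x. (norm (k x - h x))^2)"
      using sqi_diff[OF k X] that hX by (auto simp: sqi_def)
    have "(\<integral>x. (norm (f x - g x))^2 \<partial>M) = (\<integral>x. 2 * (norm (k x - f x))^2 + 2 * (norm (k x - g x))^2 - 4 * (norm (k x - h x))^2 \<partial>M)"
      by (rule Bochner_Integration.integral_cong) (auto simp: h_def power2_norm_eq_inner inner_simps inner_commute algebra_simps)
    also have "\<dots> = 2 * J f + 2 * J g - 4 * J h" using i by (simp add: J_def)
    finally show ?thesis using dle[OF hX] by simp
  qed
  have cau: "(\<integral>x. (norm (w m x - w n x))^2 \<partial>M) \<le> 4 / 4 ^ n" if "n \<le> m" for n m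
  proof -
    have "(1::real) / 4 ^ m \<le> 1 / 4 ^ n" using that by (simp add: frac_le)
    moreover have "2 * (A + B - 2 * d) \<le> 4 * b" if "a \<le> b" "A < d + a" "B < d + b" for A B a b :: real
      using that by argo
    ultimately have "2 * (J (w m) + J (w n) - 2 * d) \<le> 4 * (1 / 4 ^ n)" using w(2) by blast
    then show ?thesis using par[OF w(1) w(1), of m n] by simp
  qed
  obtain g where g: "sqi M g" "\<And>n. (\<integral>x. (norm (g x - w n x))^2 \<partial>M) \<le> 4 / 4 ^ n"
    using L2_complete[OF fin X[OF w(1)] cau] by blast
  have small: "(\<lambda>n. c / (4::real) ^ n) \<longlonglongrightarrow> 0" for c
    using tendsto_mult_right_zero[OF LIMSEQ_realpow_zero[of "1/4"], of c] by (simp add: power_divide)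
  have gX: "g \<in> X"
  proof (rule closed[OF g(1)])
    fix \<delta> :: real assume "\<delta> > 0"
    then have "\<forall>\<^sub>F n in sequentially. 4 / (4::real) ^ n < \<delta>" using order_tendstoD(2)[OF small] by blast
    then obtain n where "4 / (4::real) ^ n < \<delta>" by (auto simp: eventually_sequentially)
    then show "\<exists>f\<in>X. (\<integral>x. (norm (g x - f x))^2 \<partial>M) < \<delta>" using g(2)[of n] w(1)[of n] by (intro bexI[of _ "w n"]) auto
  qed
  have "sqrt (J g) \<le> sqrt d"
  proof (rule LIMSEQ_le_const)
    show "(\<lambda>n. sqrt (d + 1 / 4 ^ n) + sqrt (4 / 4 ^ n)) \<longlonglongrightarrow> sqrt d"
      using tendsto_add[OF tendsto_real_sqrt[OF tendsto_add[OF tendsto_const[of d] small[of 1]]] tendsto_real_sqrt[OF small[of 4]]] by simp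
    have "sqrt (J g) \<le> sqrt (d + 1 / 4 ^ n) + sqrt (4 / 4 ^ n)" for n
    proof -
      have "sqrt (J g) = nrm2 M (\<lambda>x. (k x - w n x) + (w n x - g x))" by (simp add: J_def nrm2_def)
      also have "\<dots> \<le> nrm2 M (\<lambda>x. k x - w n x) + nrm2 M (\<lambda>x. w n x - g x)"
        by (rule nrm2_triangle) (use sqi_diff k g(1) X[OF w(1)] in blast)+
      also have "nrm2 M (\<lambda>x. k x - w n x) \<le> sqrt (d + 1 / 4 ^ n)" unfolding nrm2_def J_def[symmetric] using w(2)[of n] by simp
      also have "nrm2 M (\<lambda>x. w n x - g x) \<le> sqrt (4 / 4 ^ n)" unfolding nrm2_def using g(2)[of n] by (simp add: norm_minus_commute)
      finally show ?thesis by simp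
    qed
    then show "\<exists>N. \<forall>n\<ge>N. sqrt (J g) \<le> sqrt (d + 1 / 4 ^ n) + sqrt (4 / 4 ^ n)" by blast
  qed
  then have Jg: "J g = d" using dle[OF gX] by simp
  have "(\<integral>x. g x \<bullet> v x \<partial>M) = (\<integral>x. k x \<bullet> v x \<partial>M)" if v: "v \<in> X" for v
  proof -
    have kg: "sqi M (\<lambda>x. k x - g x)" by (rule sqi_diff[OF k g(1)])
    \<comment> \<open>Moving from the minimiser \<open>g\<close> in the direction \<open>v\<close>
      cannot decrease \<open>J\<close>, and the change of \<open>J\<close> is a quadratic in
      \<open>t\<close> without constant term.\<close>
    have "(\<integral>x. (k x - g x) \<bullet> v x \<partial>M) = 0"
    proof (rule square_discriminant_trick[where c="\<integral>x. (norm (v x))^2 \<partial>M"])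
      fix t
      have i: "integrable M (\<lambda>x. (norm (k x - g x))^2)" "integrable M (\<lambda>x. (norm (v x))^2)" "integrable M (\<lambda>x. (k x - g x) \<bullet> v x)"
        using kg X[OF v] sqi_inner[OF kg X[OF v]] by (auto simp: sqi_def)
      have "J (\<lambda>x. g x + t *\<^sub>R v x) = (\<integral>x. (norm (k x - g x))^2 - 2 * t * ((k x - g x) \<bullet> v x) + t^2 * (norm (v x))^2 \<partial>M)"
        unfolding J_def 
        by (rule Bochner_Integration.integral_cong)
         (auto simp: power2_norm_eq_inner inner_simps inner_commute, simp add: power2_eq_square algebra_simps)
      also have "\<dots> = J g - 2 * t * (\<integral>x. (k x - g x) \<bullet> v x \<partial>M) + t^2 * (\<integral>x. (norm (v x))^2 \<partial>M)"
        using i by (simp add: J_def)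
      finally show "0 \<le> t^2 * (\<integral>x. (norm (v x))^2 \<partial>M) - 2 * t * (\<integral>x. (k x - g x) \<bullet> v x \<partial>M)"
        using dle[OF lin[OF gX v, of t]] Jg by simp
    qed
    then show ?thesis using sqi_inner[OF k X[OF v]] sqi_inner[OF g(1) X[OF v]] by (simp add: inner_diff_left)
  qed
  then show ?thesis using that gX by blast
qed

section \<open>Integrals of test functions\<close>

text \<open>Transfer to \<open>lborel\<close>, where Fubini's theorem, translations and dilations
  are available; it applies to Borel functions that vanish off the set.\<close>

lemma lebesgue_on_borel:
  fixes h :: "'a::euclidean_space \<Rightarrow> 'b::euclidean_space"
  assumes "S \<in> sets lebesgue" "h \<in> borel_measurable borel" "\<And>x. x \<notin> S \<Longrightarrow> h x = 0"
  shows integral_lebesgue_on_borel: "integral\<^sup>L (lebesgue_on S) h = integral\<^sup>L lborel h"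
    and integrable_lebesgue_on_borel: "integrable (lebesgue_on S) h \<longleftrightarrow> integrable lborel h"
proof -
  have S: "S \<inter> space lebesgue \<in> sets lebesgue" using assms(1) by simp
  have h: "(\<lambda>x. ind S x *\<^sub>R h x) = h" using assms(3) by (auto simp: indicator_def)
  show "integral\<^sup>L (lebesgue_on S) h = integral\<^sup>L lborel h"
    using integral_restrict_space[OF S, of h] integral_completion[of h lborel] assms(2) by (simp add: h)
  show "integrable (lebesgue_on S) h \<longleftrightarrow> integrable lborel h"
    using integrable_restrict_space[OF S, of h] integrable_completion[of h lborel] assms(2) by (simp add: h)
qed

lemma integrable_pair_bound:
  fixes f :: "'a::euclidean_space \<times> 'b::euclidean_space \<Rightarrow> real"
  assumes f: "f \<in> borel_measurable (lborel \<Otimes>\<^sub>M lborel)"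
    and u: "integrable lborel u" and v: "integrable lborel v" and b: "\<And>x y. \<bar>f (x, y)\<bar> \<le> u x * v y"
  shows "integrable (lborel \<Otimes>\<^sub>M lborel) f"
proof -
  have [measurable]: "u \<in> borel_measurable lborel" "v \<in> borel_measurable lborel" using u v by auto
  have "integrable (lborel \<Otimes>\<^sub>M lborel) (\<lambda>(x, y). u x * v y)"
  proof (rule lborel_pair.Fubini_integrable)
    show "(\<lambda>(x, y). u x * v y) \<in> borel_measurable (lborel \<Otimes>\<^sub>M lborel)" by measurable
    show "integrable lborel (\<lambda>x. \<integral>y. norm ((\<lambda>(x, y). u x * v y) (x, y)) \<partial>lborel)"
      using u by (simp add: abs_mult)
    show "AE x in lborel. integrable lborel (\<lambda>y. (\<lambda>(x, y). u x * v y) (x, y))" using v by simp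
  qed
  then show ?thesis
    by (rule Bochner_Integration.integrable_bound) (use f b in \<open>auto intro!: AE_I2 order_trans[OF b]\<close>)
qed

lemma lborel_pair_Fubini:
  fixes f :: "'a::euclidean_space \<Rightarrow> 'b::euclidean_space \<Rightarrow> real"
  assumes f: "case_prod f \<in> borel_measurable (lborel \<Otimes>\<^sub>M lborel)"
    and u: "integrable lborel u" and v: "integrable lborel v" and b: "\<And>x y. \<bar>f x y\<bar> \<le> u x * v y"
  shows "(\<integral>x. (\<integral>y. f x y \<partial>lborel) \<partial>lborel) = (\<integral>y. (\<integral>x. f x y \<partial>lborel) \<partial>lborel)"
proof -
  have "integrable (lborel \<Otimes>\<^sub>M lborel) (case_prod f)"
    by (rule integrable_pair_bound[OF f u v]) (use b in auto)
  from lborel_pair.Fubini_integral[OF this] show ?thesis by simp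
qed

lemma lborel_translation:
  fixes f :: "'a::euclidean_space \<Rightarrow> 'b::{banach, second_countable_topology}"
  assumes "f \<in> borel_measurable borel"
  shows integral_lborel_translation: "(\<integral>x. f (x + h) \<partial>lborel) = (\<integral>x. f x \<partial>lborel)"
    and integrable_lborel_translation: "integrable lborel (\<lambda>x. f (x + h)) \<longleftrightarrow> integrable lborel f"
proof -
  have "(\<integral>x. f x \<partial>lborel) = (\<integral>x. f x \<partial>(distr lborel borel ((+) h)))" by (simp add: lborel_distr_plus)
  also have "\<dots> = (\<integral>x. f (h + x) \<partial>lborel)" by (rule integral_distr) (use assms in auto)
  finally show "(\<integral>x. f (x + h) \<partial>lborel) = (\<integral>x. f x \<partial>lborel)" by (simp add: add.commute)
  have "integrable lborel f \<longleftrightarrow> integrable (distr lborel borel ((+) h)) f" by (simp add: lborel_distr_plus)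
  also have "\<dots> \<longleftrightarrow> integrable lborel (\<lambda>x. f (h + x))" by (rule integrable_distr_eq) (use assms in auto)
  finally show "integrable lborel (\<lambda>x. f (x + h)) \<longleftrightarrow> integrable lborel f" by (simp add: add.commute)
qed

lemma test_function_measurable [measurable_dest]: "test_function \<Omega> \<phi> \<Longrightarrow> \<phi> \<in> borel_measurable borel"
  by (intro borel_measurable_continuous_onI test_function_continuous)

lemma test_function_grad_measurable: "test_function \<Omega> \<phi> \<Longrightarrow> grad \<phi> \<in> borel_measurable borel"
  by (intro borel_measurable_continuous_onI test_function_grad_continuous)

lemma integrable_indicator_bounded:
  "bounded S \<Longrightarrow> S \<in> sets borel \<Longrightarrow> integrable lborel (ind (S :: 'a::euclidean_space set))"
  using emeasure_bounded_finite[of S] by (intro integrable_real_indicator) auto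

lemma integrable_bounded_support:
  fixes f :: "'a::euclidean_space \<Rightarrow> 'b::euclidean_space"
  assumes "f \<in> borel_measurable borel" "bounded S" "\<And>x. x \<notin> S \<Longrightarrow> f x = 0" "\<And>x. norm (f x) \<le> B"
  shows "integrable lborel f"
proof -
  obtain r where "S \<subseteq> cball 0 r" using assms(2) unfolding bounded_iff by (metis mem_cball_0 subsetI)
  then have "integrable lborel (\<lambda>x. B * ind (cball 0 r :: 'a set) x)"
    by (intro integrable_mult_right integrable_indicator_bounded) auto
  then show ?thesis
  proof (rule Bochner_Integration.integrable_bound)
    show "AE x in lborel. norm (f x) \<le> norm (B * ind (cball 0 r) x)"
    proof (rule AE_I2)
      fix x show "norm (f x) \<le> norm (B * ind (cball 0 r) x)"
        using assms(3)[of x] assms(4)[of x] \<open>S \<subseteq> cball 0 r\<close> by (cases "x \<in> S") (auto simp: indicator_def)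
    qed
  qed (use assms in auto)
qed

lemma test_function_integrable:
  assumes "test_function \<Omega> \<phi>" shows "integrable lborel \<phi>" "integrable lborel (grad \<phi>)"
proof -
  obtain K where K: "compact K" "\<And>x. x \<notin> K \<Longrightarrow> \<phi> x = 0" "\<And>x. x \<notin> K \<Longrightarrow> grad \<phi> x = 0"
    using test_function_support[OF assms] by metis
  obtain B where B: "\<And>x. \<bar>\<phi> x\<bar> \<le> B" "\<And>x. norm (grad \<phi> x) \<le> B" using test_function_bounded[OF assms] by metis
  show "integrable lborel \<phi>"
    by (rule integrable_bounded_support[OF _ compact_imp_bounded[OF K(1)] K(2)])
       (use B test_function_measurable[OF assms] in auto)
  show "integrable lborel (grad \<phi>)"
    by (rule integrable_bounded_support[OF _ compact_imp_bounded[OF K(1)] K(3)])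
       (use B test_function_grad_measurable[OF assms] in auto)
qed

section \<open>Translates of test functions and a Poincare inequality\<close>

lemma segment_FTC:
  assumes "test_function \<Omega> \<phi>"
  shows "\<phi> (x + h) - \<phi> x = (\<integral>t. ind {0..1} t * (grad \<phi> (x + t *\<^sub>R h) \<bullet> h) \<partial>lborel)"
proof -
  have cont: "continuous_on {0..1} (\<lambda>t. grad \<phi> (x + t *\<^sub>R h) \<bullet> h)"
    by (intro continuous_intros continuous_on_compose2[OF test_function_grad_continuous[OF assms]]) auto
  have der: "((\<lambda>t. \<phi> (x + t *\<^sub>R h)) has_real_derivative grad \<phi> (x + t *\<^sub>R h) \<bullet> h) (at t)" for t
  proof -
    have 1: "(\<phi> has_derivative (\<lambda>k. k \<bullet> grad \<phi> (x + t *\<^sub>R h))) (at (x + t *\<^sub>R h))"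
      using test_function_GDERIV[OF assms] by (simp add: gderiv_def)
    have 2: "((\<lambda>t. x + t *\<^sub>R h) has_derivative (\<lambda>s. s *\<^sub>R h)) (at t)"
      by (auto intro!: derivative_eq_intros)
    from diff_chain_at[OF 2 1] show ?thesis by (simp add: has_field_derivative_def o_def inner_commute mult_commute_abs)
  qed
  have "(\<integral>t. indicator {0..1} t *\<^sub>R (grad \<phi> (x + t *\<^sub>R h) \<bullet> h) \<partial>lborel) = \<phi> (x + 1 *\<^sub>R h) - \<phi> (x + 0 *\<^sub>R h)"
    by (rule integral_FTC_atLeastAtMost[where F="\<lambda>t. \<phi> (x + t *\<^sub>R h)"])
       (use cont der in \<open>auto simp: has_real_derivative_iff_has_vector_derivative[symmetric] intro: has_field_derivative_at_within\<close>)
  then show ?thesis by simp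
qed

text \<open>The weight \<open>w\<close> is arbitrary because the formula is used with three of them:
  the indicator of a large ball for the integral of a gradient, a sign function for the Poincare
  inequality, and a square integrable function for averaging.\<close>

lemma translation_formula:
  assumes \<phi>: "test_function \<Omega> \<phi>" and w: "integrable lborel w"
  shows "(\<integral>x. w x * (\<phi> (x + h) - \<phi> x) \<partial>lborel) =
    (\<integral>t. ind {0..1} t * (\<integral>x. w x * (grad \<phi> (x + t *\<^sub>R h) \<bullet> h) \<partial>lborel) \<partial>lborel)"
proof -
  obtain B where B: "B \<ge> 0" "\<And>x. norm (grad \<phi> x) \<le> B" using test_function_bounded[OF \<phi>] by metis
  have [measurable]: "w \<in> borel_measurable borel" "grad \<phi> \<in> borel_measurable borel"
    using w test_function_grad_measurable[OF \<phi>] by auto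
  have "(\<integral>x. w x * (\<phi> (x + h) - \<phi> x) \<partial>lborel) =
      (\<integral>x. (\<integral>t. w x * (ind {0..1} t * (grad \<phi> (x + t *\<^sub>R h) \<bullet> h)) \<partial>lborel) \<partial>lborel)"
    by (subst segment_FTC[OF \<phi>]) simp
  also have "\<dots> = (\<integral>t. (\<integral>x. w x * (ind {0..1} t * (grad \<phi> (x + t *\<^sub>R h) \<bullet> h)) \<partial>lborel) \<partial>lborel)"
  proof (rule lborel_pair_Fubini)
    show "integrable lborel (\<lambda>x. \<bar>w x\<bar>)" using w by simp
    show "integrable lborel (\<lambda>t::real. (B * norm h) * ind {0..1} t)"
      by (intro integrable_mult_right integrable_indicator_bounded) auto
    show "\<bar>w x * (ind {0..1} t * (grad \<phi> (x + t *\<^sub>R h) \<bullet> h))\<bar> \<le> \<bar>w x\<bar> * (B * norm h * ind {0..1} t)" for x and t :: real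
    proof -
      have "\<bar>grad \<phi> (x + t *\<^sub>R h) \<bullet> h\<bar> \<le> B * norm h"
        using Cauchy_Schwarz_ineq2[of "grad \<phi> (x + t *\<^sub>R h)" h] B(2)[of "x + t *\<^sub>R h"]
        by (meson mult_right_mono norm_ge_zero order_trans)
      then show ?thesis by (auto simp: abs_mult indicator_def intro!: mult_left_mono)
    qed
  qed measurable
  also have "\<dots> = (\<integral>t. ind {0..1} t * (\<integral>x. w x * (grad \<phi> (x + t *\<^sub>R h) \<bullet> h) \<partial>lborel) \<partial>lborel)"
    by (simp add: mult.left_commute[of "w _"])
  finally show ?thesis .
qed

lemma translation_bound:
  assumes \<phi>: "test_function \<Omega> \<phi>" and w: "integrable lborel w"
    and C: "\<And>t. t \<in> {0..1} \<Longrightarrow> \<bar>\<integral>x. w x * (grad \<phi> (x + t *\<^sub>R h) \<bullet> h) \<partial>lborel\<bar> \<le> C"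
  shows "\<bar>\<integral>x. w x * (\<phi> (x + h) - \<phi> x) \<partial>lborel\<bar> \<le> C"
proof -
  let ?g = "\<lambda>t. ind {0..1} t * (\<integral>x. w x * (grad \<phi> (x + t *\<^sub>R h) \<bullet> h) \<partial>lborel)"
  have [measurable]: "w \<in> borel_measurable borel" "grad \<phi> \<in> borel_measurable borel"
    using w test_function_grad_measurable[OF \<phi>] by auto
  have C0: "C \<ge> 0" using C[of 0] by auto
  have "\<bar>\<integral>t. ?g t \<partial>lborel\<bar> \<le> (\<integral>t. \<bar>?g t\<bar> \<partial>lborel)" by (rule integral_abs_bound)
  also have "\<dots> \<le> (\<integral>t. C * ind {0..1} t \<partial>(lborel :: real measure))"
  proof (rule integral_mono')
    show "integrable lborel (\<lambda>t::real. C * ind {0..1} t)"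
      by (intro integrable_mult_right integrable_indicator_bounded) auto
    show "\<bar>?g t\<bar> \<le> C * ind {0..1} t" for t using C[of t] by (auto simp: indicator_def)
  qed (use C0 in auto)
  also have "\<dots> = C" by simp
  finally show ?thesis using translation_formula[OF \<phi> w] by simp
qed

text \<open>The weight is the indicator of a ball so large that it cuts nothing off. The increment
  of \<open>\<phi>\<close> then integrates to zero by translation invariance, while the other side
  of \<open>translation_formula\<close> is the integral of
  \<open>grad \<phi> \<bullet> h\<close>.\<close>

lemma integral_grad_zero:
  assumes \<phi>: "test_function \<Omega> \<phi>"
  shows "(\<integral>x. grad \<phi> x \<partial>lborel) = 0"
proof -
  obtain K where K: "compact K" "\<And>x. x \<notin> K \<Longrightarrow> \<phi> x = 0" "\<And>x. x \<notin> K \<Longrightarrow> grad \<phi> x = 0"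
    using test_function_support[OF \<phi>] by metis
  have [measurable]: "\<phi> \<in> borel_measurable borel" "grad \<phi> \<in> borel_measurable borel"
    using test_function_measurable[OF \<phi>] test_function_grad_measurable[OF \<phi>] by auto
  have "(\<integral>x. grad \<phi> x \<bullet> h \<partial>lborel) = 0" for h
  proof -
    obtain r where r: "K \<subseteq> cball 0 r" using compact_imp_bounded[OF K(1)] unfolding bounded_iff by (metis mem_cball_0 subsetI)
    define w where "w = ind (cball 0 (r + norm h) :: (real^2) set)"
    have w: "integrable lborel w" unfolding w_def by (rule integrable_indicator_bounded) auto
    have inb: "x \<in> cball 0 (r + norm h)" if "x + t *\<^sub>R h \<in> K" "t \<in> {0..1}" for x t
    proof -
      have "norm (x + t *\<^sub>R h) \<le> r" using that r by auto
      then have "norm x \<le> r + norm (t *\<^sub>R h)" using norm_triangle_ineq4[of "x + t *\<^sub>R h" "t *\<^sub>R h"] by simp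
      also have "norm (t *\<^sub>R h) \<le> norm h" using that by (simp add: mult_left_le_one_le)
      finally show ?thesis by simp
    qed
    have 1: "w x * (\<phi> (x + h) - \<phi> x) = \<phi> (x + h) - \<phi> x" for x
      using inb[of x 1] inb[of x 0] K(2) by (cases "x \<in> K \<or> x + h \<in> K") (auto simp: w_def indicator_def)
    have 2: "ind {0..1} t * (\<integral>x. w x * (grad \<phi> (x + t *\<^sub>R h) \<bullet> h) \<partial>lborel) =
             ind {0..1} t * (\<integral>x. grad \<phi> x \<bullet> h \<partial>lborel)" for t
    proof (cases "t \<in> {0..1}")
      case True
      have "w x * (grad \<phi> (x + t *\<^sub>R h) \<bullet> h) = grad \<phi> (x + t *\<^sub>R h) \<bullet> h" for x
        using inb[of x t] True K(3) by (cases "x + t *\<^sub>R h \<in> K") (auto simp: w_def indicator_def)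
      then show ?thesis using integral_lborel_translation[of "\<lambda>x. grad \<phi> x \<bullet> h" "t *\<^sub>R h"] by (simp only:) simp
    qed auto
    have "integrable lborel (\<lambda>x. \<phi> (x + h))"
      using integrable_lborel_translation[of \<phi> h] test_function_integrable[OF \<phi>] by simp
    then have "(\<integral>x. w x * (\<phi> (x + h) - \<phi> x) \<partial>lborel) = 0"
      unfolding 1 using test_function_integrable[OF \<phi>] integral_lborel_translation[of \<phi> h] by simp
    then show ?thesis using translation_formula[OF \<phi> w, of h] unfolding 2 by simp
  qed
  then have "(\<integral>x. grad \<phi> x \<partial>lborel) \<bullet> h = 0" for h
    using integral_inner_left[of h lborel "grad \<phi>"] test_function_integrable[OF \<phi>] by simp
  then show ?thesis using inner_eq_zero_iff by blast
qed

lemma test_function_mult: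
  assumes "test_function \<Omega> f" "test_function \<Omega> g" 
  shows "test_function \<Omega> (\<lambda>x. f x * g x)" "grad (\<lambda>x. f x * g x) = (\<lambda>x. f x *\<^sub>R grad g x + g x *\<^sub>R grad f x)"
proof -
  obtain K where K: "compact K" "K \<subseteq> \<Omega>" "\<And>x. x \<notin> K \<Longrightarrow> f x = 0" using test_function_support[OF assms(1)] by metis
  show "test_function \<Omega> (\<lambda>x. f x * g x)"
    by (rule test_functionI[OF _ K(1,2)]) (use K assms in \<open>auto simp: test_function_def intro!: cont_diff_mult\<close>)
  show "grad (\<lambda>x. f x * g x) = (\<lambda>x. f x *\<^sub>R grad g x + g x *\<^sub>R grad f x)"
    by (intro grad_eqI GDERIV_mult test_function_GDERIV[OF assms(1)] test_function_GDERIV[OF assms(2)])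
qed

lemma integral_test_lebesgue_on:
  fixes h :: "real^2 \<Rightarrow> 'b::euclidean_space"
  assumes "open \<Omega>" "test_function \<Omega> \<phi>" "h \<in> borel_measurable borel" "\<And>x. \<phi> x = 0 \<Longrightarrow> grad \<phi> x = 0 \<Longrightarrow> h x = 0"
  shows "integral\<^sup>L (lebesgue_on \<Omega>) h = integral\<^sup>L lborel h"
proof -
  obtain K where K: "K \<subseteq> \<Omega>" "\<And>x. x \<notin> K \<Longrightarrow> \<phi> x = 0" "\<And>x. x \<notin> K \<Longrightarrow> grad \<phi> x = 0"
    using test_function_support[OF assms(2)] by metis
  show ?thesis by (rule integral_lebesgue_on_borel) (use K assms in auto)
qed

lemma test_function_sqi:
  assumes "open \<Omega>" "test_function \<Omega> \<phi>" 
  shows "sqi (lebesgue_on \<Omega>) \<phi>" "sqi (lebesgue_on \<Omega>) (grad \<phi>)"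
proof -
  obtain K where K: "compact K" "K \<subseteq> \<Omega>" "\<And>x. x \<notin> K \<Longrightarrow> \<phi> x = 0" "\<And>x. x \<notin> K \<Longrightarrow> grad \<phi> x = 0"
    using test_function_support[OF assms(2)] by metis
  obtain B where B: "B \<ge> 0" "\<And>x. \<bar>\<phi> x\<bar> \<le> B" "\<And>x. norm (grad \<phi> x) \<le> B" using test_function_bounded[OF assms(2)] by metis
  have m: "\<phi> \<in> borel_measurable borel" "grad \<phi> \<in> borel_measurable borel"
    using test_function_measurable test_function_grad_measurable assms by blast+
  have mm: "f \<in> borel_measurable (lebesgue_on \<Omega>)" if "f \<in> borel_measurable borel" for f :: "real^2 \<Rightarrow> 'c::euclidean_space"
    using that by (intro measurable_restrict_space1 measurable_completion) auto
  have bnd: "\<phi> x ^ 2 \<le> B^2" "(norm (grad \<phi> x))^2 \<le> B^2" for x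
    using power_mono[OF B(2), of x 2] power_mono[OF B(3), of x 2] by auto
  have "integrable lborel (\<lambda>x. (norm (\<phi> x))^2)"
    by (rule integrable_bounded_support[OF _ compact_imp_bounded[OF K(1)], where B="B^2"]) (use K m bnd in auto)
  moreover have "integrable lborel (\<lambda>x. (norm (grad \<phi> x))^2)"
    by (rule integrable_bounded_support[OF _ compact_imp_bounded[OF K(1)], where B="B^2"]) (use K m bnd in auto)
  moreover have z: "\<phi> x = 0" "grad \<phi> x = 0" if "x \<notin> \<Omega>" for x using that K by auto
  moreover have "\<Omega> \<in> sets lebesgue" using assms(1) by auto
  ultimately have "integrable (lebesgue_on \<Omega>) (\<lambda>x. (norm (\<phi> x))^2)" "integrable (lebesgue_on \<Omega>) (\<lambda>x. (norm (grad \<phi> x))^2)"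
    using m by (subst integrable_lebesgue_on_borel; auto)+
  then show "sqi (lebesgue_on \<Omega>) \<phi>" "sqi (lebesgue_on \<Omega>) (grad \<phi>)"
    unfolding sqi_def using mm[OF m(1)] mm[OF m(2)] by blast+
qed

lemma test_function_by_parts:
  assumes \<Omega>: "open \<Omega>" and f: "test_function \<Omega> f" and g: "test_function \<Omega> g"
  shows "(\<integral>x. f x *\<^sub>R grad g x + g x *\<^sub>R grad f x \<partial>lebesgue_on \<Omega>) = 0"
proof -
  have m [measurable]: "f \<in> borel_measurable borel" "grad f \<in> borel_measurable borel" "g \<in> borel_measurable borel" "grad g \<in> borel_measurable borel"
    using test_function_measurable test_function_grad_measurable f g by blast+
  have "(\<integral>x. f x *\<^sub>R grad g x + g x *\<^sub>R grad f x \<partial>lebesgue_on \<Omega>) = (\<integral>x. f x *\<^sub>R grad g x + g x *\<^sub>R grad f x \<partial>lborel)"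
    by (rule integral_test_lebesgue_on[OF \<Omega> f]) auto
  also have "\<dots> = 0" using integral_grad_zero[OF test_function_mult(1)[OF f g]] test_function_mult(2)[OF f g] by simp
  finally show ?thesis .
qed

text \<open>Substituting \<open>y = x + h\<close> and applying the translation bound for each \<open>h\<close>
  gives a Poincare inequality in \<open>L\<^sup>1\<close> without any change of variables.\<close>

lemma ball_Poincare:
  assumes \<phi>: "test_function \<Omega> \<phi>" and r: "r > 0"
  obtains c where "(\<integral>x. ind (cball a r) x * \<bar>\<phi> x - c\<bar> \<partial>lborel) \<le> 8 * r * (\<integral>x. ind (cball a r) x * norm (grad \<phi> x) \<partial>lborel)"
proof -
  let ?B = "cball a r" 
  have [measurable]: "\<phi> \<in> borel_measurable borel" "grad \<phi> \<in> borel_measurable borel"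
    using test_function_measurable[OF \<phi>] test_function_grad_measurable[OF \<phi>] by auto
  obtain b where b: "b \<ge> 0" "\<And>x. \<bar>\<phi> x\<bar> \<le> b" "\<And>x. norm (grad \<phi> x) \<le> b" using test_function_bounded[OF \<phi>] by metis
  have vol: "measure lborel (cball y s) = pi * s^2" if "s \<ge> 0" for y :: "real^2" and s
    using content_cball[OF that, of y] by (simp add: unit_ball_vol_2)
  define V where "V = measure lborel ?B"
  have V: "V = pi * r^2" "V > 0" using vol r by (auto simp: V_def)
  define c where "c = (\<integral>y. ind ?B y * \<phi> y \<partial>lborel) / V"
  \<comment> \<open>The sign of \<open>\<phi> - c\<close> on the ball: it makes
    \<open>\<bar>\<phi> - c\<bar>\<close> linear in \<open>\<phi>\<close>, so that Fubini and the
    translation bound apply.\<close>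
  define s where "s x = ind ?B x * (if c \<le> \<phi> x then 1 else - 1)" for x
  have [measurable]: "?B \<in> sets borel" by (rule borel_closed[OF closed_cball])
  have [measurable]: "s \<in> borel_measurable borel" unfolding s_def[abs_def] by measurable
  have s: "\<bar>s x\<bar> \<le> 1" "\<bar>s x\<bar> \<le> ind ?B x" for x by (auto simp: s_def indicator_def )
  have i\<phi>: "integrable lborel (\<lambda>y. ind ?B y * \<phi> y)"
    by (rule integrable_bounded_support[where S="?B" and B=b]) (use b in \<open>auto simp: indicator_def\<close>)
  have iG: "integrable lborel (\<lambda>x. ind ?B x * norm (grad \<phi> x))"
    by (rule integrable_bounded_support[where S="?B" and B=b]) (use b in \<open>auto simp: indicator_def\<close>)
  have iB: "integrable lborel (ind ?B)" by (rule integrable_indicator_bounded) auto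
  let ?G = "\<integral>x. ind ?B x * norm (grad \<phi> x) \<partial>lborel"
  have G: "?G \<ge> 0" by (rule integral_nonneg_AE) auto
  have "V * (\<integral>x. ind ?B x * \<bar>\<phi> x - c\<bar> \<partial>lborel) = V * (\<integral>x. s x * (\<phi> x - c) \<partial>lborel)"
    by (rule arg_cong[where f="(*) V"], rule Bochner_Integration.integral_cong) (auto simp: s_def)
  also have "\<dots> = (\<integral>x. s x * (V * (\<phi> x - c)) \<partial>lborel)" by (simp flip: integral_mult_right_zero add: mult_ac)
  also have "\<dots> = (\<integral>x. (\<integral>y. s x * (ind ?B y * (\<phi> x - \<phi> y)) \<partial>lborel) \<partial>lborel)"
  proof (rule Bochner_Integration.integral_cong)
    fix x
    have "(\<integral>y. ind ?B y * (\<phi> x - \<phi> y) \<partial>lborel) = (\<integral>y. \<phi> x * ind ?B y - ind ?B y * \<phi> y \<partial>lborel)"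
      by (rule Bochner_Integration.integral_cong) (auto simp: algebra_simps)
    also have "\<dots> = \<phi> x * V - c * V" using i\<phi> iB V(2) by (simp add: V_def[symmetric] c_def)
    finally have "(\<integral>y. ind ?B y * (\<phi> x - \<phi> y) \<partial>lborel) = V * (\<phi> x - c)" by (simp add: right_diff_distrib mult.commute)
    then show "s x * (V * (\<phi> x - c)) = (\<integral>y. s x * (ind ?B y * (\<phi> x - \<phi> y)) \<partial>lborel)" by simp
  qed simp
  also have "\<dots> = (\<integral>x. (\<integral>h. s x * (ind ?B (x + h) * (\<phi> x - \<phi> (x + h))) \<partial>lborel) \<partial>lborel)"
  proof (rule Bochner_Integration.integral_cong[OF refl])
    fix x
    show "(\<integral>y. s x * (ind ?B y * (\<phi> x - \<phi> y)) \<partial>lborel) = (\<integral>h. s x * (ind ?B (x + h) * (\<phi> x - \<phi> (x + h))) \<partial>lborel)"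
      using integral_lborel_translation[of "\<lambda>y. s x * (ind ?B y * (\<phi> x - \<phi> y))" x, symmetric] by (simp add: add.commute)
  qed
  also have "\<dots> = (\<integral>h. (\<integral>x. s x * (ind ?B (x + h) * (\<phi> x - \<phi> (x + h))) \<partial>lborel) \<partial>lborel)"
  proof (rule lborel_pair_Fubini)
    show "integrable lborel (\<lambda>x. 2 * b * ind ?B x)" using iB by simp
    show "integrable lborel (ind (cball 0 (2 * r) :: (real^2) set))" by (rule integrable_indicator_bounded) auto
    show "\<bar>s x * (ind ?B (x + h) * (\<phi> x - \<phi> (x + h)))\<bar> \<le> 2 * b * ind ?B x * ind (cball 0 (2 * r)) h" for x h
    proof (cases "x \<in> ?B \<and> x + h \<in> ?B")
      case True
      then have "h \<in> cball 0 (2 * r)" by (auto simp: dist_norm) norm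
      moreover have "\<bar>\<phi> x - \<phi> (x + h)\<bar> \<le> 2 * b" using b(2)[of x] b(2)[of "x + h"] by linarith
      moreover have "\<bar>s x\<bar> * \<bar>\<phi> x - \<phi> (x + h)\<bar> \<le> 1 * (2 * b)" 
        using s(1) calculation by (intro mult_mono) auto
      ultimately show ?thesis using True by (simp add: abs_mult)
    qed (use b(1) in \<open>auto simp: s_def indicator_def\<close>)
    show "(\<lambda>(x, h). s x * (ind ?B (x + h) * (\<phi> x - \<phi> (x + h)))) \<in> borel_measurable (lborel \<Otimes>\<^sub>M lborel)"
      by measurable
  qed
  \<comment> \<open>Differences of two points of the ball fill at most the ball of radius
    \<open>2 r\<close>, whose area is \<open>4 V\<close>; with \<open>norm h \<le> 2 r\<close> this
    yields the constant \<open>8 r\<close>.\<close>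
  also have "\<dots> \<le> (\<integral>h. (2 * r * ?G) * ind (cball 0 (2 * r) :: (real^2) set) h \<partial>lborel)"
  proof (rule integral_mono')
    show "integrable lborel (\<lambda>h::real^2. 2 * r * ?G * ind (cball 0 (2 * r)) h)"
      by (intro integrable_mult_right integrable_indicator_bounded) auto
    fix h :: "real^2"
    show "(\<integral>x. s x * (ind ?B (x + h) * (\<phi> x - \<phi> (x + h))) \<partial>lborel) \<le> 2 * r * ?G * ind (cball 0 (2 * r)) h"
    proof (cases "norm h \<le> 2 * r")
      case False
      have "s x * (ind ?B (x + h) * (\<phi> x - \<phi> (x + h))) = 0" for x
      proof (rule ccontr)
        assume "\<not> ?thesis"
        then have "x \<in> ?B" "x + h \<in> ?B" by (auto simp: s_def indicator_def split: if_splits)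
        then have "norm h \<le> 2 * r" by (auto simp: dist_norm) norm
        then show False using False by simp
      qed
      then have "(\<integral>x. s x * (ind ?B (x + h) * (\<phi> x - \<phi> (x + h))) \<partial>lborel) = 0" by (simp only:) simp
      then show ?thesis using False G r by (simp add: indicator_def)
    next
      case True
      \<comment> \<open>Where \<open>w\<close> is nonzero, \<open>x\<close> and \<open>x + h\<close>
        lie in the ball; by convexity so does the segment between them, and only the gradient inside
        the ball enters.\<close>
      define w where "w x = s x * ind ?B (x + h)" for x
      have [measurable]: "w \<in> borel_measurable borel" unfolding w_def[abs_def] by measurable
      have wi: "integrable lborel w"
        by (rule integrable_bounded_support[where S="?B" and B=1]) (use s in \<open>auto simp: w_def s_def indicator_def \<close>)
      have "\<bar>\<integral>x. w x * (\<phi> (x + h) - \<phi> x) \<partial>lborel\<bar> \<le> 2 * r * ?G"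
      proof (rule translation_bound[OF \<phi> wi])
        fix t :: real assume t: "t \<in> {0..1}"
        have "\<bar>\<integral>x. w x * (grad \<phi> (x + t *\<^sub>R h) \<bullet> h) \<partial>lborel\<bar> \<le> (\<integral>x. \<bar>w x * (grad \<phi> (x + t *\<^sub>R h) \<bullet> h)\<bar> \<partial>lborel)"
          by (rule integral_abs_bound)
        also have "\<dots> \<le> (\<integral>x. 2 * r * (ind ?B (x + t *\<^sub>R h) * norm (grad \<phi> (x + t *\<^sub>R h))) \<partial>lborel)"
        proof (rule integral_mono')
          show "integrable lborel (\<lambda>x. 2 * r * (ind ?B (x + t *\<^sub>R h) * norm (grad \<phi> (x + t *\<^sub>R h))))"
            using integrable_lborel_translation[of "\<lambda>x. ind ?B x * norm (grad \<phi> x)" "t *\<^sub>R h"] iG by simp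
          fix x
          show "\<bar>w x * (grad \<phi> (x + t *\<^sub>R h) \<bullet> h)\<bar> \<le> 2 * r * (ind ?B (x + t *\<^sub>R h) * norm (grad \<phi> (x + t *\<^sub>R h)))"
          proof (cases "x \<in> ?B \<and> x + h \<in> ?B")
            case xB: True
            then have "(1 - t) *\<^sub>R x + t *\<^sub>R (x + h) \<in> ?B" using t by (intro convexD_alt[OF convex_cball]) auto
            then have B: "x + t *\<^sub>R h \<in> ?B" by (simp add: algebra_simps)
            have "\<bar>w x\<bar> \<le> 1" using s(1)[of x] by (auto simp: w_def indicator_def)
            moreover have "\<bar>grad \<phi> (x + t *\<^sub>R h) \<bullet> h\<bar> \<le> norm (grad \<phi> (x + t *\<^sub>R h)) * (2 * r)"
              using Cauchy_Schwarz_ineq2[of "grad \<phi> (x + t *\<^sub>R h)" h] True by (meson mult_left_mono norm_ge_zero order_trans)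
            ultimately have "\<bar>w x\<bar> * \<bar>grad \<phi> (x + t *\<^sub>R h) \<bullet> h\<bar> \<le> 1 * (norm (grad \<phi> (x + t *\<^sub>R h)) * (2 * r))"
              by (intro mult_mono) auto
            then show ?thesis using B by (simp add: abs_mult mult_ac)
          next
            case False
            then have "w x = 0" by (auto simp: w_def s_def indicator_def)
            then show ?thesis using r by simp
          qed
        qed (use r in auto)
        also have "\<dots> = 2 * r * ?G"
          using integral_lborel_translation[of "\<lambda>x. ind ?B x * norm (grad \<phi> x)" "t *\<^sub>R h"] by simp
        finally show "\<bar>\<integral>x. w x * (grad \<phi> (x + t *\<^sub>R h) \<bullet> h) \<partial>lborel\<bar> \<le> 2 * r * ?G" .
      qed
      moreover have "(\<integral>x. s x * (ind ?B (x + h) * (\<phi> x - \<phi> (x + h))) \<partial>lborel) = - (\<integral>x. w x * (\<phi> (x + h) - \<phi> x) \<partial>lborel)"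
        unfolding integral_minus[symmetric] by (rule Bochner_Integration.integral_cong) (auto simp: w_def algebra_simps)
      ultimately show ?thesis using True by (auto simp: abs_le_iff)
    qed
  qed (use G r in auto)
  also have "\<dots> = 2 * r * ?G * (pi * (2 * r)^2)" using vol[of "2 * r" 0] r by simp
  also have "\<dots> = V * (8 * r * ?G)" by (simp add: V power2_eq_square)
  finally have "V * (\<integral>x. ind ?B x * \<bar>\<phi> x - c\<bar> \<partial>lborel) \<le> V * (8 * r * ?G)" .
  then have "(\<integral>x. ind ?B x * \<bar>\<phi> x - c\<bar> \<partial>lborel) \<le> 8 * r * ?G" using V(2) by simp
  then show ?thesis by (rule that)
qed

section \<open>Density of test functions\<close>

definition l2closure :: "'a measure \<Rightarrow> ('a \<Rightarrow> 'b::euclidean_space) set \<Rightarrow> ('a \<Rightarrow> 'b) set" where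
  "l2closure M P = {f. sqi M f \<and> (\<forall>\<delta>>0. \<exists>p\<in>P. (\<integral>x. (norm (f x - p x))^2 \<partial>M) < \<delta>)}"

lemma l2closureD: "f \<in> l2closure M P \<Longrightarrow> sqi M f"
  by (simp add: l2closure_def)

lemma l2closureE:
  assumes "f \<in> l2closure M P" "\<delta> > 0"
  obtains p where "p \<in> P" "(\<integral>x. (norm (f x - p x))^2 \<partial>M) < \<delta>"
  using assms unfolding l2closure_def by blast

lemma integral_norm_add_sq_le:
  assumes "sqi M f" "sqi M g"
  shows "(\<integral>x. (norm (f x + g x))^2 \<partial>M) \<le> 2 * (\<integral>x. (norm (f x))^2 \<partial>M) + 2 * (\<integral>x. (norm (g x))^2 \<partial>M)"
proof -
  have "(\<integral>x. (norm (f x + g x))^2 \<partial>M) \<le> (\<integral>x. 2 * (norm (f x))^2 + 2 * (norm (g x))^2 \<partial>M)"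
    by (rule integral_mono) (use assms sqi_add[OF assms] norm_add_sq_le in \<open>auto simp: sqi_def\<close>)
  also have "\<dots> = 2 * (\<integral>x. (norm (f x))^2 \<partial>M) + 2 * (\<integral>x. (norm (g x))^2 \<partial>M)"
    using assms by (simp add: sqi_def)
  finally show ?thesis .
qed

context
  fixes M :: "'a measure" and P :: "('a \<Rightarrow> 'b::euclidean_space) set"
  assumes P: "\<And>f. f \<in> P \<Longrightarrow> sqi M f"
begin

lemma l2closure_superset: "f \<in> P \<Longrightarrow> f \<in> l2closure M P"
  unfolding l2closure_def using P by (auto intro!: bexI[of _ f])

lemma l2closure_lin:
  assumes lin: "\<And>f g c. f \<in> P \<Longrightarrow> g \<in> P \<Longrightarrow> (\<lambda>x. f x + c *\<^sub>R g x) \<in> P"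
    and f: "f \<in> l2closure M P" and g: "g \<in> l2closure M P"
  shows "(\<lambda>x. f x + c *\<^sub>R g x) \<in> l2closure M P"
  unfolding l2closure_def mem_Collect_eq
proof (intro conjI allI impI)
  show "sqi M (\<lambda>x. f x + c *\<^sub>R g x)" using f g by (intro sqi_add sqi_scaleR l2closureD)
  fix \<delta> :: real assume \<delta>: "\<delta> > 0"
  obtain p where p: "p \<in> P" "(\<integral>x. (norm (f x - p x))^2 \<partial>M) < \<delta> / 4" using l2closureE[OF f, of "\<delta> / 4"] \<delta> by auto
  \<comment> \<open>The summand 1 in \<open>c^2 + 1\<close> covers the case
    \<open>c = 0\<close>.\<close>
  have "\<delta> / (4 * (c^2 + 1)) > 0" using \<delta> by (intro divide_pos_pos mult_pos_pos) (auto simp: add_nonneg_pos)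
  then obtain q where q: "q \<in> P" "(\<integral>x. (norm (g x - q x))^2 \<partial>M) < \<delta> / (4 * (c^2 + 1))" using g unfolding l2closure_def by blast
  have c1: "c^2 + 1 > 0" by (simp add: add_nonneg_pos)
  have s: "sqi M (\<lambda>x. f x - p x)" "sqi M (\<lambda>x. c *\<^sub>R (g x - q x))"
    using p q P l2closureD[OF f] l2closureD[OF g] by (auto intro!: sqi_diff sqi_scaleR)
  have A: "(\<integral>x. (norm ((f x - p x) + c *\<^sub>R (g x - q x)))^2 \<partial>M) \<le> 2 * (\<integral>x. (norm (f x - p x))^2 \<partial>M) + 2 * (\<integral>x. (norm (c *\<^sub>R (g x - q x)))^2 \<partial>M)"
    by (rule integral_norm_add_sq_le[OF s])
  have "(\<integral>x. (norm (c *\<^sub>R (g x - q x)))^2 \<partial>M) = c^2 * (\<integral>x. (norm (g x - q x))^2 \<partial>M)" by (simp add: power_mult_distrib)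
  also have "\<dots> \<le> (c^2 + 1) * (\<delta> / (4 * (c^2 + 1)))"
    using q(2) by (intro mult_mono) auto
  also have "(c^2 + 1) * (\<delta> / (4 * (c^2 + 1))) = \<delta> / 4" using c1 by (simp add: field_simps)
  finally have "(\<integral>x. (norm ((f x - p x) + c *\<^sub>R (g x - q x)))^2 \<partial>M) < \<delta>" using p(2) A by argo
  moreover have "(f x - p x) + c *\<^sub>R (g x - q x) = (f x + c *\<^sub>R g x) - (p x + c *\<^sub>R q x)" for x by (simp add: algebra_simps)
  ultimately have "(\<integral>x. (norm ((f x + c *\<^sub>R g x) - (p x + c *\<^sub>R q x)))^2 \<partial>M) < \<delta>" by simp
  then show "\<exists>p\<in>P. (\<integral>x. (norm (f x + c *\<^sub>R g x - p x))^2 \<partial>M) < \<delta>"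
    by (rule bexI[OF _ lin[OF p(1) q(1), of c]])
qed

lemma l2closure_closed:
  assumes f: "sqi M f" and ap: "\<And>\<delta>. \<delta> > 0 \<Longrightarrow> \<exists>g\<in>l2closure M P. (\<integral>x. (norm (f x - g x))^2 \<partial>M) < \<delta>"
  shows "f \<in> l2closure M P"
  unfolding l2closure_def mem_Collect_eq
proof (intro conjI allI impI f)
  fix \<delta> :: real assume \<delta>: "\<delta> > 0"
  obtain g where g: "g \<in> l2closure M P" "(\<integral>x. (norm (f x - g x))^2 \<partial>M) < \<delta> / 4" using ap[of "\<delta>/4"] \<delta> by auto
  obtain p where p: "p \<in> P" "(\<integral>x. (norm (g x - p x))^2 \<partial>M) < \<delta> / 4" using l2closureE[OF g(1), of "\<delta> / 4"] \<delta> by auto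
  have "(\<integral>x. (norm ((f x - g x) + (g x - p x)))^2 \<partial>M) \<le> 2 * (\<integral>x. (norm (f x - g x))^2 \<partial>M) + 2 * (\<integral>x. (norm (g x - p x))^2 \<partial>M)"
    by (rule integral_norm_add_sq_le) (use f l2closureD[OF g(1)] p P in \<open>auto intro!: sqi_diff\<close>)
  then show "\<exists>p\<in>P. (\<integral>x. (norm (f x - p x))^2 \<partial>M) < \<delta>" using g p by (intro bexI[of _ p]) auto
qed

lemma l2closure_approx:
  assumes f: "f \<in> l2closure M P" and e: "e > 0"
  obtains p where "p \<in> P" "nrm2 M (\<lambda>x. f x - p x) < e"
proof -
  obtain p where p: "p \<in> P" "(\<integral>x. (norm (f x - p x))^2 \<partial>M) < e^2" using l2closureE[OF f, of "e^2"] e by auto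
  have "nrm2 M (\<lambda>x. f x - p x) < e" using p(2) e by (auto simp: nrm2_def intro!: real_less_lsqrt)
  then show ?thesis using that p by blast
qed

lemma nrm2_approx: 
  assumes "sqi M f" "sqi M (g :: 'a \<Rightarrow> 'b)" 
  shows "nrm2 M f \<le> nrm2 M g + nrm2 M (\<lambda>x. f x - g x)" "nrm2 M g \<le> nrm2 M f + nrm2 M (\<lambda>x. f x - g x)"
proof -
  show "nrm2 M f \<le> nrm2 M g + nrm2 M (\<lambda>x. f x - g x)" using nrm2_triangle[OF assms(2) sqi_diff[OF assms]] by simp
  show "nrm2 M g \<le> nrm2 M f + nrm2 M (\<lambda>x. f x - g x)" using nrm2_triangle[OF assms(1) sqi_diff[OF assms(2,1)]] 
    by (simp add: nrm2_def norm_minus_commute)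
qed

text \<open>Both sides are continuous in the \<open>L^2\<close> norm. With \<open>c = 0\<close> this
  carries orthogonality from test functions to their closure, which is how each integral identity
  below is extended to all of \<open>Z\<close>.\<close>

lemma l2closure_bound:
  assumes f: "f \<in> l2closure M P" and k: "sqi M k" and c: "c \<ge> 0"
    and b: "\<And>p. p \<in> P \<Longrightarrow> \<bar>\<integral>x. k x \<bullet> p x \<partial>M\<bar> \<le> c * nrm2 M p"
  shows "\<bar>\<integral>x. k x \<bullet> f x \<partial>M\<bar> \<le> c * nrm2 M f"
proof (rule field_le_epsilon)
  fix e :: real assume e: "e > 0"
  have n: "nrm2 M k + c + 1 > 0" using c nrm2_nonneg[of M k] by linarith
  obtain p where p: "p \<in> P" "nrm2 M (\<lambda>x. f x - p x) < e / (nrm2 M k + c + 1)" using l2closure_approx[OF f] e n by (metis divide_pos_pos)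
  have sf: "sqi M f" "sqi M p" using f p P by (auto intro: l2closureD)
  have "(\<integral>x. k x \<bullet> f x \<partial>M) = (\<integral>x. k x \<bullet> p x \<partial>M) + (\<integral>x. k x \<bullet> (f x - p x) \<partial>M)"
    using sqi_inner[OF k sf(1)] sqi_inner[OF k sf(2)] by (simp add: inner_diff_right)
  moreover have "\<bar>\<integral>x. k x \<bullet> (f x - p x) \<partial>M\<bar> \<le> nrm2 M k * nrm2 M (\<lambda>x. f x - p x)"
    by (rule Cauchy_Schwarz_integral[OF k sqi_diff[OF sf]])
  moreover have "c * nrm2 M p \<le> c * (nrm2 M f + nrm2 M (\<lambda>x. f x - p x))"
    using nrm2_approx(2)[OF sf] c by (rule mult_left_mono)
  ultimately have "\<bar>\<integral>x. k x \<bullet> f x \<partial>M\<bar> \<le> c * nrm2 M f + (nrm2 M k + c) * nrm2 M (\<lambda>x. f x - p x)"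
    using b[OF p(1)] by (simp add: algebra_simps)
  also have "(nrm2 M k + c) * nrm2 M (\<lambda>x. f x - p x) \<le> (nrm2 M k + c + 1) * (e / (nrm2 M k + c + 1))"
    using p(2) c n by (intro mult_mono) auto
  also have "\<dots> = e" using n by simp
  finally show "\<bar>\<integral>x. k x \<bullet> f x \<partial>M\<bar> \<le> c * nrm2 M f + e" by simp
qed

end

text \<open>For an exhaustion of the open set by balls with bumps \<open>\<psi>\<^sub>i\<close>, the functions
  \<open>1 - (\<Prod>i<n. (1 - \<psi>\<^sub>i) ^ n)\<close> increase to the indicator function.\<close>

lemma open_indicator_approx:
  fixes S :: "(real^2) set"
  assumes S: "open S"
  obtains \<phi> where "\<And>n. test_function S (\<phi> n)" "\<And>n x. 0 \<le> \<phi> n x \<and> \<phi> n x \<le> 1" "\<And>x. (\<lambda>n. \<phi> n x) \<longlonglongrightarrow> indicator S x"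
proof (cases "S = {}")
  case True
  then show ?thesis using that[of "\<lambda>n x. 0"] test_function_zero by auto
next
  case False
  \<comment> \<open>Requiring the closed balls to lie in \<open>S\<close> keeps the supports of the
    finite products compact in \<open>S\<close>; the Lindelof property makes the family
    countable.\<close>
  define F where "F = {B. \<exists>a r. B = ball a r \<and> r > 0 \<and> cball a r \<subseteq> S}"
  have UF: "\<Union>F = S"
  proof
    show "S \<subseteq> \<Union>F"
    proof
      fix x assume "x \<in> S"
      then obtain r where "r > 0" "cball x r \<subseteq> S" using S open_contains_cball by blast
      then show "x \<in> \<Union>F" unfolding F_def by (auto intro!: exI[of _ "ball x r"])
    qed
    show "\<Union>F \<subseteq> S" unfolding F_def using ball_subset_cball by blast
  qed
  obtain F' where F': "F' \<subseteq> F" "countable F'" "\<Union>F' = S" using Lindelof[of F] UF by (auto simp: F_def)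
  then have ne: "F' \<noteq> {}" using False by auto
  define f where "f = from_nat_into F'"
  have f: "range f = F'" unfolding f_def using F'(2) ne by (simp add: range_from_nat_into)
  have "\<forall>n. \<exists>a r. f n = ball a r \<and> r > 0 \<and> cball a r \<subseteq> S" using f F'(1) unfolding F_def by blast
  then obtain c r where cr: "\<And>n. f n = ball (c n) (r n)" "\<And>n. r n > 0" "\<And>n. cball (c n) (r n) \<subseteq> S" by metis
  have US: "x \<in> S \<longleftrightarrow> (\<exists>j. x \<in> ball (c j) (r j))" for x
    using F'(3) f cr(1) by (metis UnionE UnionI imageE rangeI)
  have b0: "bump (c i) (r i) x = 0" if "x \<notin> ball (c i) (r i)" for i x
    using bump_pos_iff[OF cr(2)[of i]] bump_range[of "c i" "r i" x] that by (metis less_eq_real_def)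
  \<comment> \<open>At a point where some bump is positive, the growing exponent drives that factor,
    and with it the product, to zero; for each \<open>n\<close> only finitely many bumps
    occur.\<close>
  define \<phi> where "\<phi> n x = 1 - (\<Prod>i<n. (1 - bump (c i) (r i) x) ^ n)" for n x
  have rng: "0 \<le> (1 - bump (c i) (r i) x) ^ n \<and> (1 - bump (c i) (r i) x) ^ n \<le> 1" for i x n
    using bump_range[of "c i" "r i" x] by (auto intro: power_le_one)
  show ?thesis
  proof (rule that)
    show "test_function S (\<phi> n)" for n
    proof (rule test_functionI[where K="\<Union>i<n. cball (c i) (r i)"])
      show "cont_diff m (\<phi> n)" for m unfolding \<phi>_def[abs_def]
        by (intro cont_diff_diff cont_diff_const cont_diff_prod cont_diff_power cont_diff_bump)
      show "compact (\<Union>i<n. cball (c i) (r i))" by auto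
      show "(\<Union>i<n. cball (c i) (r i)) \<subseteq> S" using cr(3) by auto
      show "\<phi> n x = 0" if "x \<notin> (\<Union>i<n. cball (c i) (r i))" for x
      proof -
        have "bump (c i) (r i) x = 0" if "i < n" for i
        proof -
          have "x \<notin> cball (c i) (r i)" using that \<open>x \<notin> (\<Union>i<n. cball (c i) (r i))\<close> by blast
          then show ?thesis using b0 by auto
        qed
        then have "(\<Prod>i<n. (1 - bump (c i) (r i) x) ^ n) = 1" by (intro prod.neutral) auto
        then show ?thesis by (simp add: \<phi>_def)
      qed
    qed
    show "0 \<le> \<phi> n x \<and> \<phi> n x \<le> 1" for n x
      unfolding \<phi>_def using rng by (auto intro!: prod_le_1 prod_nonneg)
    show "(\<lambda>n. \<phi> n x) \<longlonglongrightarrow> indicator S x" for x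
    proof (cases "x \<in> S")
      case False
      then have "bump (c i) (r i) x = 0" for i using b0 US by blast
      then have "\<phi> n x = 0" for n unfolding \<phi>_def by simp
      then show ?thesis using False by simp
    next
      case True
      then obtain j where j: "x \<in> ball (c j) (r j)" using US by blast
      define b where "b = bump (c j) (r j) x"
      have b: "0 < b" "b \<le> 1" using bump_pos_iff[OF cr(2)[of j]] j bump_range unfolding b_def by blast+
      have "(\<lambda>n. \<Prod>i<n. (1 - bump (c i) (r i) x) ^ n) \<longlonglongrightarrow> 0"
      proof (rule tendsto_sandwich[of "\<lambda>n. 0" _ _ "\<lambda>n. (1 - b) ^ n"])
        show "\<forall>\<^sub>F n in sequentially. 0 \<le> (\<Prod>i<n. (1 - bump (c i) (r i) x) ^ n)"
          using rng by (auto intro!: always_eventually prod_nonneg)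
        show "\<forall>\<^sub>F n in sequentially. (\<Prod>i<n. (1 - bump (c i) (r i) x) ^ n) \<le> (1 - b) ^ n"
          using eventually_gt_at_top[of j]
        proof eventually_elim
          case (elim n)
          have "(\<Prod>i<n. (1 - bump (c i) (r i) x) ^ n) = (1 - b) ^ n * (\<Prod>i\<in>{..<n} - {j}. (1 - bump (c i) (r i) x) ^ n)"
            using elim by (subst prod.remove[of _ j]) (auto simp: b_def)
          also have "\<dots> \<le> (1 - b) ^ n * 1"
            using rng b by (intro mult_left_mono prod_le_1) auto
          finally show ?case by simp
        qed
        show "(\<lambda>n. (1 - b) ^ n) \<longlonglongrightarrow> 0" using b by (intro LIMSEQ_realpow_zero) auto
      qed simp
      then have "(\<lambda>n. 1 - (\<Prod>i<n. (1 - bump (c i) (r i) x) ^ n)) \<longlonglongrightarrow> 1 - 0" by (intro tendsto_intros)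
      then show ?thesis using True by (simp add: \<phi>_def)
    qed
  qed
qed

lemma test_function_mono: "test_function S \<phi> \<Longrightarrow> S \<subseteq> T \<Longrightarrow> test_function T \<phi>"
  by (auto simp: test_function_def)

definition with_grad :: "(real^2 \<Rightarrow> real) \<Rightarrow> real^2 \<Rightarrow> real \<times> (real^2)" where
  "with_grad \<phi> x = (\<phi> x, grad \<phi> x)"

section \<open>The fundamental lemma and density of test functions\<close>

locale bounded_domain =
  fixes \<Omega> :: "(real^2) set"
  assumes open_domain: "open \<Omega>" and bounded_domain: "bounded \<Omega>"
begin

abbreviation "M \<equiv> lebesgue_on \<Omega>"

lemma domain_lmeasurable: "\<Omega> \<in> lmeasurable"
  using open_domain bounded_domain by (simp add: bounded_set_imp_lmeasurable)

lemma domain_sets: "\<Omega> \<in> sets lebesgue"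
  using domain_lmeasurable by blast

lemma finite_measure_M: "finite_measure M"
  by (rule finite_measure_lebesgue_on[OF domain_lmeasurable])

lemma borel_measurable_M: "f \<in> borel_measurable borel \<Longrightarrow> f \<in> borel_measurable M"
  for f :: "real^2 \<Rightarrow> 'b::euclidean_space"
  by (intro measurable_restrict_space1 measurable_completion) auto

text \<open>Orthogonality passes from test functions to indicators of open sets by dominated
  convergence, from these to measurable sets by outer regularity, and is then applied to the sets
  where \<open>g\<close> and \<open>- g\<close> are positive.\<close>

lemma fundamental_lemma:
  fixes g :: "real^2 \<Rightarrow> real"
  assumes g: "sqi M g" and orth: "\<And>\<phi>. test_function \<Omega> \<phi> \<Longrightarrow> (\<integral>x. g x * \<phi> x \<partial>M) = 0"
  shows "AE x in M. g x = 0"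
proof -
  have gi: "integrable M g" by (rule sqi_integrable[OF finite_measure_M g])
  have 1: "(\<integral>x. g x * ind S x \<partial>M) = 0" if S: "open S" "S \<subseteq> \<Omega>" for S
  proof -
    obtain \<phi> where \<phi>: "\<And>n. test_function S (\<phi> n)" "\<And>n x. 0 \<le> \<phi> n x \<and> \<phi> n x \<le> 1" "\<And>x. (\<lambda>n. \<phi> n x) \<longlonglongrightarrow> indicator S x"
      using open_indicator_approx[OF S(1)] by blast
    have "(\<lambda>n. \<integral>x. g x * \<phi> n x \<partial>M) \<longlonglongrightarrow> (\<integral>x. g x * ind S x \<partial>M)"
    proof (rule integral_dominated_convergence[where w="\<lambda>x. \<bar>g x\<bar>"])
      show "(\<lambda>x. g x * ind S x) \<in> borel_measurable M" 
        using g S borel_measurable_M[of "ind S"] by (intro borel_measurable_times) (auto simp: sqi_def)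
      show "(\<lambda>x. g x * \<phi> n x) \<in> borel_measurable M" for n
        using g borel_measurable_M[OF test_function_measurable[OF \<phi>(1)]] by (intro borel_measurable_times) (auto simp: sqi_def)
      show "AE x in M. (\<lambda>n. g x * \<phi> n x) \<longlonglongrightarrow> g x * ind S x" using \<phi>(3) by (auto intro!: tendsto_intros)
      show "AE x in M. norm (g x * \<phi> n x) \<le> \<bar>g x\<bar>" for n using \<phi>(2)[of n] by (auto simp: abs_mult intro!: mult_left_le)
    qed (use gi in auto)
    moreover have "(\<integral>x. g x * \<phi> n x \<partial>M) = 0" for n
      by (rule orth[OF test_function_mono[OF \<phi>(1) S(2)]])
    ultimately show ?thesis by (simp add: LIMSEQ_const_iff)
  qed
  have indm: "sqi M (ind B)" if "B \<in> sets lebesgue" for B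
    by (rule sqi_bounded[OF finite_measure_M, of _ 1]) (use that in \<open>auto simp: indicator_def intro!: measurable_restrict_space1\<close>)
  have 2: "(\<integral>x. g x * ind A x \<partial>M) = 0" if A: "A \<in> sets lebesgue" "A \<subseteq> \<Omega>" for A
  proof -
    have "\<bar>\<integral>x. g x * ind A x \<partial>M\<bar> \<le> 0 + e" if e: "e > 0" for e
    proof -
      have np: "nrm2 M g + 1 > 0" using nrm2_nonneg[of M g] by linarith
      \<comment> \<open>The measure tolerance is a square because the norm of an indicator is the
        square root of the measure.\<close>
      then have "(e / (nrm2 M g + 1))^2 > 0" using e by (intro zero_less_power divide_pos_pos) auto
      then obtain T where T: "open T" "A \<subseteq> T" "T - A \<in> lmeasurable" "emeasure lebesgue (T - A) < ennreal ((e / (nrm2 M g + 1))^2)"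
        using sets_lebesgue_outer_open[OF A(1)] by metis
      let ?T = "T \<inter> \<Omega>"
      have T': "open ?T" "?T \<subseteq> \<Omega>" "?T \<in> sets lebesgue" using T open_domain domain_sets by auto
      have iv: "ind ?T x - ind A x = ind (?T - A) x" if "x \<in> \<Omega>" for x
        using that T(2) by (auto simp: indicator_def)
      have "(\<integral>x. g x * ind ?T x \<partial>M) - (\<integral>x. g x * ind A x \<partial>M) = (\<integral>x. g x * ind ?T x - g x * ind A x \<partial>M)"
        by (rule Bochner_Integration.integral_diff[symmetric]; intro sqi_mult g indm T' A)
      also have "\<dots> = (\<integral>x. g x * ind (?T - A) x \<partial>M)"
        by (rule Bochner_Integration.integral_cong) (auto simp flip: iv right_diff_distrib simp: space_restrict_space)
      finally have "\<bar>\<integral>x. g x * ind A x \<partial>M\<bar> = \<bar>\<integral>x. g x \<bullet> ind (?T - A) x \<partial>M\<bar>"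
        using 1[OF T'(1,2)] by simp
      also have "\<dots> \<le> nrm2 M g * nrm2 M (ind (?T - A))"
        by (rule Cauchy_Schwarz_integral[OF g indm]) (use T' A in auto)
      also have "nrm2 M (ind (?T - A)) \<le> e / (nrm2 M g + 1)"
      proof -
        have "(norm (ind (?T - A) x))^2 = ind (?T - A) x" for x by (auto simp: indicator_def)
        then have "(\<integral>x. (norm (ind (?T - A) x))^2 \<partial>M) = measure M ((?T - A) \<inter> space M)"
          by simp
        also have "(?T - A) \<inter> space M = ?T - A" by (auto simp: space_restrict_space)
        also have "measure M (?T - A) = measure lebesgue (?T - A)"
          by (rule measure_restrict_space) (use domain_sets in auto)
        also have "\<dots> \<le> measure lebesgue (T - A)"
          by (rule measure_mono_fmeasurable) (use T T' A in auto)
        also have "\<dots> \<le> (e / (nrm2 M g + 1))^2"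
          using T(3,4) by (simp add: emeasure_eq_measure2 ennreal_less_iff less_imp_le)
        finally have "(nrm2 M (ind (?T - A)))^2 \<le> (e / (nrm2 M g + 1))^2" by (simp only: nrm2_sq)
        then show ?thesis by (rule power2_le_imp_le) (use e np in simp)
      qed
      finally have "\<bar>\<integral>x. g x * ind A x \<partial>M\<bar> \<le> nrm2 M g * (e / (nrm2 M g + 1))" by (simp add: mult_left_mono)
      also have "\<dots> \<le> (nrm2 M g + 1) * (e / (nrm2 M g + 1))" using e np by (intro mult_right_mono) auto
      finally show ?thesis using np by simp
    qed
    then have "\<bar>\<integral>x. g x * ind A x \<partial>M\<bar> \<le> 0" by (rule field_le_epsilon)
    then show ?thesis by simp
  qed
  have 3: "AE x in M. h x * ind {x \<in> \<Omega>. h x > 0} x = 0" if h: "sqi M h" "h = g \<or> h = (\<lambda>x. - g x)" for h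
  proof -
    have [measurable]: "h \<in> borel_measurable M" using h(1) by (simp add: sqi_def)
    have "{x \<in> space M. h x > 0} \<in> sets M" by measurable
    then have "{x \<in> \<Omega>. h x > 0} \<in> sets M" by (simp add: space_restrict_space)
    then have A: "{x \<in> \<Omega>. h x > 0} \<in> sets lebesgue" using domain_sets by (simp add: sets_restrict_space_iff)
    have "(\<integral>x. h x * ind {x \<in> \<Omega>. h x > 0} x \<partial>M) = 0"
      using 2[OF A] h(2) by auto
    moreover have "integrable M (\<lambda>x. h x * ind {x \<in> \<Omega>. h x > 0} x)"
      by (rule sqi_mult[OF h(1) indm[OF A]])
    ultimately show ?thesis
      by (subst (asm) integral_nonneg_eq_0_iff_AE) (auto simp: indicator_def)
  qed
  have "AE x in M. x \<in> \<Omega>" by (auto intro!: AE_I2 simp: space_restrict_space)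
  moreover have "AE x in M. g x * ind {x \<in> \<Omega>. g x > 0} x = 0" using 3[OF g] by simp
  moreover have "AE x in M. - g x * ind {x \<in> \<Omega>. - g x > 0} x = 0" using 3[OF sqi_minus[OF g]] by simp
  ultimately show ?thesis
  proof eventually_elim
    case (elim x)
    then show ?case by (cases "g x" "0::real" rule: linorder_cases) auto
  qed
qed

text \<open>The difference between \<open>g\<close> and its projection onto the closure of the test
  functions is orthogonal to every test function, hence zero almost everywhere.\<close>

lemma test_functions_dense:
  fixes g :: "real^2 \<Rightarrow> real"
  assumes g: "sqi M g" and e: "e > 0"
  obtains \<phi> where "test_function \<Omega> \<phi>" "nrm2 M (\<lambda>x. g x - \<phi> x) < e"
proof -
  let ?P = "{\<phi>. test_function \<Omega> \<phi>}"
  have P: "\<And>f. f \<in> ?P \<Longrightarrow> sqi M f" using test_function_sqi(1)[OF open_domain] by blast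
  have lin: "\<And>f g c. f \<in> ?P \<Longrightarrow> g \<in> ?P \<Longrightarrow> (\<lambda>x. f x + c *\<^sub>R g x) \<in> ?P" using test_function_add by auto
  obtain w where w: "w \<in> l2closure M ?P" "\<And>v. v \<in> l2closure M ?P \<Longrightarrow> (\<integral>x. w x \<bullet> v x \<partial>M) = (\<integral>x. g x \<bullet> v x \<partial>M)"
  proof (rule L2_projection[OF finite_measure_M g, where X="l2closure M ?P"])
    show "(\<lambda>x. 0) \<in> l2closure M ?P" by (rule l2closure_superset[OF P]) (auto intro: test_function_zero)
  qed (use l2closureD l2closure_lin[OF P lin] l2closure_closed[OF P] in blast)+
  have sw: "sqi M w" using w(1) by (rule l2closureD)
  have "AE x in M. g x - w x = 0"
  proof (rule fundamental_lemma[OF sqi_diff[OF g sw]])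
    fix \<phi> assume \<phi>: "test_function \<Omega> \<phi>"
    then have "(\<integral>x. w x \<bullet> \<phi> x \<partial>M) = (\<integral>x. g x \<bullet> \<phi> x \<partial>M)" using w(2) l2closure_superset[of ?P M \<phi>, OF P] by blast
    then show "(\<integral>x. (g x - w x) * \<phi> x \<partial>M) = 0"
      using sqi_mult[OF g P, of \<phi>] sqi_mult[OF sw P, of \<phi>] \<phi> by (simp add: left_diff_distrib)
  qed
  moreover obtain \<phi> where \<phi>: "test_function \<Omega> \<phi>" "nrm2 M (\<lambda>x. w x - \<phi> x) < e"
    using l2closure_approx[OF P w(1) e] by blast
  moreover have "nrm2 M (\<lambda>x. g x - \<phi> x) = nrm2 M (\<lambda>x. w x - \<phi> x)"
    unfolding nrm2_def
  proof (rule arg_cong[where f=sqrt], rule integral_cong_AE)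
    show "(\<lambda>x. (norm (g x - \<phi> x))^2) \<in> borel_measurable M" "(\<lambda>x. (norm (w x - \<phi> x))^2) \<in> borel_measurable M"
      using sqi_diff[OF g P] sqi_diff[OF sw P] \<phi>(1) by (auto simp: sqi_def)
    show "AE x in M. (norm (g x - \<phi> x))^2 = (norm (w x - \<phi> x))^2"
      using \<open>AE x in M. g x - w x = 0\<close> by eventually_elim simp
  qed
  ultimately show ?thesis using that by simp
qed


section \<open>Pairs \<open>(u, \<nabla>u)\<close> with zero boundary values\<close>

definition Z :: "(real^2 \<Rightarrow> real \<times> (real^2)) set" where
  "Z = l2closure M (with_grad ` {\<phi>. test_function \<Omega> \<phi>})"

lemma with_grad_sqi: "test_function \<Omega> \<phi> \<Longrightarrow> sqi M (with_grad \<phi>)"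
  unfolding with_grad_def by (subst sqi_fst_snd) (simp add: test_function_sqi[OF open_domain])

lemma with_grad_image_sqi: "f \<in> with_grad ` {\<phi>. test_function \<Omega> \<phi>} \<Longrightarrow> sqi M f"
  using with_grad_sqi by auto

lemma with_grad_image_lin:
  assumes "f \<in> with_grad ` {\<phi>. test_function \<Omega> \<phi>}" "g \<in> with_grad ` {\<phi>. test_function \<Omega> \<phi>}"
  shows "(\<lambda>x. f x + c *\<^sub>R g x) \<in> with_grad ` {\<phi>. test_function \<Omega> \<phi>}"
proof -
  obtain \<phi> \<psi> where *: "f = with_grad \<phi>" "test_function \<Omega> \<phi>" "g = with_grad \<psi>" "test_function \<Omega> \<psi>" using assms by auto
  then have "(\<lambda>x. f x + c *\<^sub>R g x) = with_grad (\<lambda>x. \<phi> x + c * \<psi> x)"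
    using grad_add[OF *(2,4)] by (auto simp: with_grad_def)
  then show ?thesis using test_function_add[OF *(2,4)] by auto
qed

lemma Z_sqi: "w \<in> Z \<Longrightarrow> sqi M w"
  unfolding Z_def by (rule l2closureD)

lemma Z_fst: "w \<in> Z \<Longrightarrow> sqi M (\<lambda>x. fst (w x))"
  and Z_snd: "w \<in> Z \<Longrightarrow> sqi M (\<lambda>x. snd (w x))"
  using Z_sqi sqi_fst_snd by blast+

lemma Z_test: "test_function \<Omega> \<phi> \<Longrightarrow> with_grad \<phi> \<in> Z"
  unfolding Z_def by (rule l2closure_superset[OF with_grad_image_sqi]) auto

lemma Z_lin: "v \<in> Z \<Longrightarrow> w \<in> Z \<Longrightarrow> (\<lambda>x. v x + c *\<^sub>R w x) \<in> Z"
  unfolding Z_def by (rule l2closure_lin[OF with_grad_image_sqi with_grad_image_lin])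

lemma Z_zero: "(\<lambda>x. 0) \<in> Z"
proof -
  have "grad (\<lambda>x. 0) = (\<lambda>x. 0)" by (rule grad_eqI) (rule GDERIV_const)
  then have "with_grad (\<lambda>x. 0) = (\<lambda>x. 0)" by (simp add: with_grad_def fun_eq_iff zero_prod_def)
  then show ?thesis using Z_test[OF test_function_zero] by simp
qed

lemma Z_closed:
  "sqi M f \<Longrightarrow> (\<And>\<delta>. \<delta> > 0 \<Longrightarrow> \<exists>g\<in>Z. (\<integral>x. (norm (f x - g x))^2 \<partial>M) < \<delta>) \<Longrightarrow> f \<in> Z"
  unfolding Z_def by (rule l2closure_closed[OF with_grad_image_sqi])

lemma Z_approx:
  assumes "w \<in> Z" "e > 0"
  obtains \<phi> where "test_function \<Omega> \<phi>" "nrm2 M (\<lambda>x. w x - with_grad \<phi> x) < e"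
  using l2closure_approx[OF with_grad_image_sqi assms[unfolded Z_def]] by auto

lemma Z_bound:
  assumes "w \<in> Z" "sqi M k" "c \<ge> 0"
    and "\<And>\<phi>. test_function \<Omega> \<phi> \<Longrightarrow> \<bar>\<integral>x. k x \<bullet> with_grad \<phi> x \<partial>M\<bar> \<le> c * nrm2 M (with_grad \<phi>)"
  shows "\<bar>\<integral>x. k x \<bullet> w x \<partial>M\<bar> \<le> c * nrm2 M w"
  by (rule l2closure_bound[OF with_grad_image_sqi assms(1)[unfolded Z_def] assms(2,3)]) (use assms(4) in auto)

lemma Z_orthogonal:
  assumes "w \<in> Z" "sqi M k"
    and "\<And>\<phi>. test_function \<Omega> \<phi> \<Longrightarrow> (\<integral>x. k x \<bullet> with_grad \<phi> x \<partial>M) = 0"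
  shows "(\<integral>x. k x \<bullet> w x \<partial>M) = 0"
  using Z_bound[OF assms(1,2), of 0] assms(3) by simp

lemma sqi_AE_cong:
  assumes "sqi M f" "g \<in> borel_measurable M" "AE x in M. g x = f x"
  shows "sqi M g"
proof -
  have "integrable M (\<lambda>x. (norm (g x))^2) \<longleftrightarrow> integrable M (\<lambda>x. (norm (f x))^2)"
    by (rule integrable_cong_AE) (use assms in \<open>auto simp: sqi_def elim: eventually_mono\<close>)
  then show ?thesis using assms by (simp add: sqi_def)
qed

lemma integral_norm_sq_AE_cong:
  assumes "f \<in> borel_measurable M" "g \<in> borel_measurable M" "AE x in M. g x = f x"
  shows "(\<integral>x. (norm (g x))^2 \<partial>M) = (\<integral>x. (norm (f x))^2 \<partial>M)"
  by (rule integral_cong_AE) (use assms in \<open>auto elim: eventually_mono\<close>)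

text \<open>Gradients of \<open>H10\<close> functions are chosen representatives; membership in
  \<open>Z\<close> must survive a change of representative.\<close>

lemma Z_AE_cong:
  assumes f: "f \<in> Z" and g: "g \<in> borel_measurable M" "AE x in M. g x = f x"
  shows "g \<in> Z"
proof (rule Z_closed[OF sqi_AE_cong[OF Z_sqi[OF f] g]])
  fix \<delta> :: real assume "\<delta> > 0"
  have "(\<integral>x. (norm (g x - f x))^2 \<partial>M) = 0"
  proof -
    have "AE x in M. (norm (g x - f x))^2 = 0" using g(2) by eventually_elim simp
    then show ?thesis by (rule integral_eq_zero_AE)
  qed
  then show "\<exists>h\<in>Z. (\<integral>x. (norm (g x - h x))^2 \<partial>M) < \<delta>" using f \<open>\<delta> > 0\<close> by (intro bexI[of _ f]) auto
qed

lemma test_product_integrable: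
  assumes "test_function \<Omega> \<phi>" "sqi M (g :: real^2 \<Rightarrow> real^2)" "sqi M (u :: real^2 \<Rightarrow> real)"
  shows "integrable M (\<lambda>x. \<phi> x *\<^sub>R g x)" "integrable M (\<lambda>x. u x *\<^sub>R grad \<phi> x)"
proof -
  note t = test_function_sqi[OF open_domain assms(1)]
  have "integrable M (\<lambda>x. norm (\<phi> x) * norm (g x))" by (rule sqi_mult) (intro sqi_norm t assms)+
  then show "integrable M (\<lambda>x. \<phi> x *\<^sub>R g x)"
    by (rule Bochner_Integration.integrable_bound) (use t assms in \<open>auto simp: sqi_def\<close>)
  have "integrable M (\<lambda>x. norm (u x) * norm (grad \<phi> x))" by (rule sqi_mult) (intro sqi_norm t assms)+
  then show "integrable M (\<lambda>x. u x *\<^sub>R grad \<phi> x)"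
    by (rule Bochner_Integration.integrable_bound) (use t assms in \<open>auto simp: sqi_def\<close>)
qed

lemma has_weak_grad_unique:
  assumes "has_weak_grad \<Omega> u g" "has_weak_grad \<Omega> u' g'" "AE x in M. u x = u' x"
  shows "AE x in M. g x = g' x"
proof -
  have sg: "sqi M g" "sqi M g'" and su: "sqi M u" "sqi M u'"
    using assms by (auto simp: has_weak_grad_def L2_iff)
  have "AE x in M. (g x - g' x) \<bullet> b = 0" for b
  proof (rule fundamental_lemma)
    have "sqi M (\<lambda>x. g x - g' x)" by (rule sqi_diff[OF sg])
    then have m: "(\<lambda>x. g x - g' x) \<in> borel_measurable M" "integrable M (\<lambda>x. (norm (g x - g' x))^2)" by (auto simp: sqi_def)
    have "integrable M (\<lambda>x. (norm ((g x - g' x) \<bullet> b))^2)"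
    proof (rule Bochner_Integration.integrable_bound[OF integrable_mult_right[OF m(2), of "(norm b)^2"]])
      show "AE x in M. norm ((norm ((g x - g' x) \<bullet> b))^2) \<le> norm ((norm b)^2 * (norm (g x - g' x))^2)"
      proof (rule AE_I2)
        fix x
        have "\<bar>(g x - g' x) \<bullet> b\<bar>\<^sup>2 \<le> (norm (g x - g' x) * norm b)^2"
          by (rule power_mono[OF Cauchy_Schwarz_ineq2]) simp
        then show "norm ((norm ((g x - g' x) \<bullet> b))^2) \<le> norm ((norm b)^2 * (norm (g x - g' x))^2)"
          by (simp add: power_mult_distrib mult.commute)
      qed
    qed (use m(1) in auto)
    then show "sqi M (\<lambda>x. (g x - g' x) \<bullet> b)" using m by (simp add: sqi_def)
    fix \<phi> assume \<phi>: "test_function \<Omega> \<phi>"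
    have "(\<integral>x. \<phi> x *\<^sub>R g x \<partial>M) = - (\<integral>x. u x *\<^sub>R grad \<phi> x \<partial>M)" using assms(1) \<phi> by (simp add: has_weak_grad_def)
    also have "(\<integral>x. u x *\<^sub>R grad \<phi> x \<partial>M) = (\<integral>x. u' x *\<^sub>R grad \<phi> x \<partial>M)"
      by (rule integral_cong_AE) (use test_product_integrable[OF \<phi> sg(1) su(1)] test_product_integrable[OF \<phi> sg(1) su(2)] assms(3) in \<open>auto elim: eventually_mono\<close>)
    also have "- \<dots> = (\<integral>x. \<phi> x *\<^sub>R g' x \<partial>M)" using assms(2) \<phi> by (simp add: has_weak_grad_def)
    finally have "(\<integral>x. \<phi> x *\<^sub>R g x - \<phi> x *\<^sub>R g' x \<partial>M) \<bullet> b = 0"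
      using test_product_integrable[OF \<phi> sg(1) su(1)] test_product_integrable[OF \<phi> sg(2) su(1)] by simp
    moreover have "(\<integral>x. (\<phi> x *\<^sub>R g x - \<phi> x *\<^sub>R g' x) \<bullet> b \<partial>M) = (\<integral>x. \<phi> x *\<^sub>R g x - \<phi> x *\<^sub>R g' x \<partial>M) \<bullet> b"
      by (rule integral_inner_left) (use test_product_integrable[OF \<phi> sg(1) su(1)] test_product_integrable[OF \<phi> sg(2) su(1)] in simp)
    moreover have "(\<integral>x. (\<phi> x *\<^sub>R g x - \<phi> x *\<^sub>R g' x) \<bullet> b \<partial>M) = (\<integral>x. (g x - g' x) \<bullet> b * \<phi> x \<partial>M)"
      by (rule Bochner_Integration.integral_cong) (auto simp: inner_diff_left algebra_simps)
    ultimately show "(\<integral>x. (g x - g' x) \<bullet> b * \<phi> x \<partial>M) = 0" by simp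
  qed
  then have "AE x in M. \<forall>b\<in>Basis. (g x - g' x) \<bullet> b = 0" by (subst AE_finite_all) auto
  then show ?thesis
  proof eventually_elim
    case (elim x)
    then show ?case using euclidean_all_zero_iff[of "g x - g' x"] by simp
  qed
qed

lemma H1_weak_grad: "H1 \<Omega> u \<Longrightarrow> has_weak_grad \<Omega> u (weak_grad \<Omega> u)"
  unfolding H1_def weak_grad_def by (rule someI_ex[of "has_weak_grad \<Omega> u"])

lemma weak_grad_AE: "has_weak_grad \<Omega> u g \<Longrightarrow> AE x in M. weak_grad \<Omega> u x = g x"
  by (rule has_weak_grad_unique[OF H1_weak_grad]) (auto simp: H1_def)

text \<open>The component along \<open>e\<close> of the defining identity says that \<open>w\<close>
  is orthogonal to the pair \<open>(grad \<psi> \<bullet> e, \<psi> *\<^sub>R e)\<close>. For test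
  functions this is integration by parts, and orthogonality passes to the closure.\<close>

lemma Z_has_weak_grad:
  assumes w: "w \<in> Z" shows "has_weak_grad \<Omega> (\<lambda>x. fst (w x)) (\<lambda>x. snd (w x))"
  unfolding has_weak_grad_def L2_iff
proof (intro conjI allI impI Z_fst[OF w] Z_snd[OF w])
  fix \<psi> assume \<psi>: "test_function \<Omega> \<psi>"
  note sq = test_function_sqi[OF open_domain \<psi>]
  note ti = test_product_integrable[OF \<psi> Z_snd[OF w] Z_fst[OF w]]
  have "(\<integral>x. fst (w x) *\<^sub>R grad \<psi> x + \<psi> x *\<^sub>R snd (w x) \<partial>M) \<bullet> e = 0" for e
  proof -
    define k where "k x = (grad \<psi> x \<bullet> e, \<psi> x *\<^sub>R e)" for x
    have "sqi M k"
    proof -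
      have [measurable]: "\<psi> \<in> borel_measurable borel" "grad \<psi> \<in> borel_measurable borel"
        using test_function_measurable[OF \<psi>] test_function_grad_measurable[OF \<psi>] by auto
      obtain B where B: "B \<ge> 0" "\<And>x. \<bar>\<psi> x\<bar> \<le> B" "\<And>x. norm (grad \<psi> x) \<le> B" using test_function_bounded[OF \<psi>] by metis
      have "sqi M (\<lambda>x. grad \<psi> x \<bullet> e)"
      proof (rule sqi_bounded[OF finite_measure_M])
        show "norm (grad \<psi> x \<bullet> e) \<le> B * norm e" for x
          using Cauchy_Schwarz_ineq2[of "grad \<psi> x" e] B(3)[of x] by (metis mult_right_mono norm_ge_zero order_trans real_norm_def)
      qed (rule borel_measurable_M, measurable)
      moreover have "sqi M (\<lambda>x. \<psi> x *\<^sub>R e)"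
      proof (rule sqi_bounded[OF finite_measure_M])
        show "norm (\<psi> x *\<^sub>R e) \<le> B * norm e" for x
          using B(2)[of x] by (auto intro: mult_right_mono)
      qed (rule borel_measurable_M, measurable)
      ultimately show ?thesis unfolding sqi_fst_snd[of M k] by (simp add: k_def)
    qed
    then have "(\<integral>x. k x \<bullet> w x \<partial>M) = 0"
    proof (rule Z_orthogonal[OF w])
      fix \<phi> assume \<phi>: "test_function \<Omega> \<phi>"
      have "(\<integral>x. k x \<bullet> with_grad \<phi> x \<partial>M) = (\<integral>x. (\<phi> x *\<^sub>R grad \<psi> x + \<psi> x *\<^sub>R grad \<phi> x) \<bullet> e \<partial>M)"
        by (rule Bochner_Integration.integral_cong) (auto simp: k_def with_grad_def inner_simps inner_commute mult.commute)
      also have "\<dots> = (\<integral>x. \<phi> x *\<^sub>R grad \<psi> x + \<psi> x *\<^sub>R grad \<phi> x \<partial>M) \<bullet> e"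
        by (rule integral_inner_left) (use test_product_integrable[OF \<psi> test_function_sqi(2,1)[OF open_domain \<phi>]] in auto)
      also have "\<dots> = 0" using test_function_by_parts[OF open_domain \<phi> \<psi>] by simp
      finally show "(\<integral>x. k x \<bullet> with_grad \<phi> x \<partial>M) = 0" .
    qed
    also have "(\<integral>x. k x \<bullet> w x \<partial>M) = (\<integral>x. (fst (w x) *\<^sub>R grad \<psi> x + \<psi> x *\<^sub>R snd (w x)) \<bullet> e \<partial>M)"
      by (rule Bochner_Integration.integral_cong) (auto simp: k_def inner_prod_def inner_simps inner_commute mult.commute)
    also have "\<dots> = (\<integral>x. fst (w x) *\<^sub>R grad \<psi> x + \<psi> x *\<^sub>R snd (w x) \<partial>M) \<bullet> e"
      by (rule integral_inner_left) (use ti in auto)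
    finally show ?thesis .
  qed
  then have "(\<integral>x. fst (w x) *\<^sub>R grad \<psi> x + \<psi> x *\<^sub>R snd (w x) \<partial>M) = 0" using inner_eq_zero_iff by blast
  then show "(\<integral>x. fst (w x) *\<^sub>R grad \<psi> x \<partial>M) = - (\<integral>x. \<psi> x *\<^sub>R snd (w x) \<partial>M)"
    using ti by (simp add: eq_neg_iff_add_eq_0)
qed

lemma norm_pair_sq: "(norm (p :: real \<times> (real^2)))^2 = (fst p)^2 + (norm (snd p))^2"
  by (simp add: norm_prod_def)

lemma H10_imp_Z:
  assumes "H10 \<Omega> u" shows "(\<lambda>x. (u x, weak_grad \<Omega> u x)) \<in> Z"
proof -
  have wg: "has_weak_grad \<Omega> u (weak_grad \<Omega> u)" using assms H1_weak_grad by (simp add: H10_def)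
  then have s: "sqi M u" "sqi M (weak_grad \<Omega> u)" by (auto simp: has_weak_grad_def L2_iff)
  obtain \<phi> where \<phi>: "\<And>n::nat. test_function \<Omega> (\<phi> n)" "(\<lambda>n. \<integral>x. (u x - \<phi> n x)^2 \<partial>M) \<longlonglongrightarrow> 0"
     "(\<lambda>n. \<integral>x. (norm (weak_grad \<Omega> u x - grad (\<phi> n) x))^2 \<partial>M) \<longlonglongrightarrow> 0" using assms unfolding H10_def by blast
  show ?thesis
  proof (rule Z_closed)
    show "sqi M (\<lambda>x. (u x, weak_grad \<Omega> u x))" by (subst sqi_fst_snd) (simp add: s)
    fix \<delta> :: real assume "\<delta> > 0"
    have "(\<lambda>n. (\<integral>x. (u x - \<phi> n x)^2 \<partial>M) + (\<integral>x. (norm (weak_grad \<Omega> u x - grad (\<phi> n) x))^2 \<partial>M)) \<longlonglongrightarrow> 0"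
      using tendsto_add[OF \<phi>(2,3)] by simp
    then obtain n where n: "(\<integral>x. (u x - \<phi> n x)^2 \<partial>M) + (\<integral>x. (norm (weak_grad \<Omega> u x - grad (\<phi> n) x))^2 \<partial>M) < \<delta>"
      using order_tendstoD(2)[of _ 0 sequentially \<delta>] \<open>\<delta> > 0\<close> by (fastforce simp: eventually_sequentially)
    have "(\<integral>x. (norm ((u x, weak_grad \<Omega> u x) - with_grad (\<phi> n) x))^2 \<partial>M) = (\<integral>x. (u x - \<phi> n x)^2 + (norm (weak_grad \<Omega> u x - grad (\<phi> n) x))^2 \<partial>M)"
      by (rule Bochner_Integration.integral_cong) (auto simp: norm_pair_sq with_grad_def)
    also have "\<dots> = (\<integral>x. (u x - \<phi> n x)^2 \<partial>M) + (\<integral>x. (norm (weak_grad \<Omega> u x - grad (\<phi> n) x))^2 \<partial>M)"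
      using sqi_diff[OF s(1) test_function_sqi(1)[OF open_domain \<phi>(1)[of n]]] sqi_diff[OF s(2) test_function_sqi(2)[OF open_domain \<phi>(1)[of n]]]
      by (intro Bochner_Integration.integral_add) (auto simp: sqi_def)
    finally show "\<exists>g\<in>Z. (\<integral>x. (norm ((u x, weak_grad \<Omega> u x) - g x))^2 \<partial>M) < \<delta>"
      using n by (intro bexI[OF _ Z_test[OF \<phi>(1)[of n]]]) simp
  qed
qed

lemma Z_imp_H10:
  assumes w: "w \<in> Z" shows "H10 \<Omega> (\<lambda>x. fst (w x))"
proof -
  have wg: "has_weak_grad \<Omega> (\<lambda>x. fst (w x)) (\<lambda>x. snd (w x))" by (rule Z_has_weak_grad[OF w])
  then have H: "H1 \<Omega> (\<lambda>x. fst (w x))" unfolding H1_def by blast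
  have sw: "sqi M (weak_grad \<Omega> (\<lambda>x. fst (w x)))" using H1_weak_grad[OF H] by (simp add: has_weak_grad_def L2_iff)
  have "\<exists>\<phi>. test_function \<Omega> \<phi> \<and> nrm2 M (\<lambda>x. w x - with_grad \<phi> x) < 1 / real (Suc n)" for n
    by (rule Z_approx[OF w, of "1 / real (Suc n)"]) auto
  then obtain \<phi> where \<phi>: "\<And>n. test_function \<Omega> (\<phi> n)" "\<And>n. nrm2 M (\<lambda>x. w x - with_grad (\<phi> n) x) < 1 / real (Suc n)" by metis
  have "(\<lambda>n. 1 / real (Suc n)) \<longlonglongrightarrow> 0" by (rule LIMSEQ_Suc[OF lim_1_over_n])
  from tendsto_power[OF this, of 2] have lim: "(\<lambda>n. (1 / real (Suc n))^2) \<longlonglongrightarrow> 0" by (simp del: of_nat_Suc)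
  have b: "(\<integral>x. (norm (w x - with_grad (\<phi> n) x))^2 \<partial>M) \<le> (1 / real (Suc n))^2" for n
    using power_mono[OF less_imp_le[OF \<phi>(2)[of n]], of 2] by (simp add: nrm2_sq)
  have s: "sqi M (\<lambda>x. w x - with_grad (\<phi> n) x)" for n by (rule sqi_diff[OF Z_sqi[OF w] with_grad_sqi[OF \<phi>(1)]])
  have eq: "(\<integral>x. (norm (w x - with_grad (\<phi> n) x))^2 \<partial>M) = (\<integral>x. (fst (w x) - \<phi> n x)^2 \<partial>M) + (\<integral>x. (norm (snd (w x) - grad (\<phi> n) x))^2 \<partial>M)" for n
  proof -
    have "(\<integral>x. (norm (w x - with_grad (\<phi> n) x))^2 \<partial>M) = (\<integral>x. (fst (w x) - \<phi> n x)^2 + (norm (snd (w x) - grad (\<phi> n) x))^2 \<partial>M)"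
      by (rule Bochner_Integration.integral_cong) (auto simp: norm_pair_sq with_grad_def)
    also have "\<dots> = (\<integral>x. (fst (w x) - \<phi> n x)^2 \<partial>M) + (\<integral>x. (norm (snd (w x) - grad (\<phi> n) x))^2 \<partial>M)"
      using s[of n] unfolding sqi_fst_snd[of M "\<lambda>x. w x - with_grad (\<phi> n) x"]
      by (intro Bochner_Integration.integral_add) (auto simp: sqi_def with_grad_def)
    finally show ?thesis .
  qed
  \<comment> \<open>\<open>H10\<close> refers to the chosen weak gradient, which agrees with the
    second component of \<open>w\<close> almost everywhere only.\<close>
  have eq2: "(\<integral>x. (norm (weak_grad \<Omega> (\<lambda>x. fst (w x)) x - grad (\<phi> n) x))^2 \<partial>M) = (\<integral>x. (norm (snd (w x) - grad (\<phi> n) x))^2 \<partial>M)" for n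
  proof (rule integral_norm_sq_AE_cong)
    note t = test_function_sqi(2)[OF open_domain \<phi>(1)[of n]]
    show "(\<lambda>x. snd (w x) - grad (\<phi> n) x) \<in> borel_measurable M" "(\<lambda>x. weak_grad \<Omega> (\<lambda>x. fst (w x)) x - grad (\<phi> n) x) \<in> borel_measurable M"
      using sqi_diff[OF Z_snd[OF w] t] sqi_diff[OF sw t] by (auto simp: sqi_def)
    show "AE x in M. weak_grad \<Omega> (\<lambda>x. fst (w x)) x - grad (\<phi> n) x = snd (w x) - grad (\<phi> n) x"
      using weak_grad_AE[OF wg] by eventually_elim simp
  qed
  have nn: "0 \<le> (\<integral>x. (fst (w x) - \<phi> n x)^2 \<partial>M)" "0 \<le> (\<integral>x. (norm (snd (w x) - grad (\<phi> n) x))^2 \<partial>M)" for n by simp_all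
  have up: "(\<integral>x. (fst (w x) - \<phi> n x)^2 \<partial>M) \<le> (1 / real (Suc n))^2" "(\<integral>x. (norm (snd (w x) - grad (\<phi> n) x))^2 \<partial>M) \<le> (1 / real (Suc n))^2" for n
    using b[of n] nn[of n] unfolding eq by linarith+
  show ?thesis unfolding H10_def
  proof (intro conjI H exI[of _ \<phi>] allI \<phi>(1))
    show "(\<lambda>n. \<integral>x. (fst (w x) - \<phi> n x)^2 \<partial>M) \<longlonglongrightarrow> 0"
      by (rule tendsto_sandwich[OF always_eventually always_eventually tendsto_const lim]) (use nn up in blast)+
    show "(\<lambda>n. \<integral>x. (norm (weak_grad \<Omega> (\<lambda>x. fst (w x)) x - grad (\<phi> n) x))^2 \<partial>M) \<longlonglongrightarrow> 0"
      unfolding eq2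
      by (rule tendsto_sandwich[OF always_eventually always_eventually tendsto_const lim]) (use nn up in blast)+
  qed
qed

text \<open>Constants have weak gradient zero because \<open>grad \<phi>\<close> has integral
  zero.\<close>

lemma has_weak_grad_add_const:
  assumes "has_weak_grad \<Omega> u g" shows "has_weak_grad \<Omega> (\<lambda>x. u x + c) g"
proof -
  have s: "sqi M u" "sqi M g" using assms by (auto simp: has_weak_grad_def L2_iff)
  have c: "sqi M (\<lambda>x. c)" by (rule sqi_const[OF finite_measure_M])
  show ?thesis unfolding has_weak_grad_def L2_iff
  proof (intro conjI allI impI sqi_add s c)
    fix \<phi> assume \<phi>: "test_function \<Omega> \<phi>"
    have "(\<integral>x. (u x + c) *\<^sub>R grad \<phi> x \<partial>M) = (\<integral>x. u x *\<^sub>R grad \<phi> x \<partial>M) + (\<integral>x. c *\<^sub>R grad \<phi> x \<partial>M)"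
      unfolding scaleR_add_left
      by (rule Bochner_Integration.integral_add) (use test_product_integrable[OF \<phi> s(2,1)] test_product_integrable[OF \<phi> s(2) c] in auto)
    also have "(\<integral>x. c *\<^sub>R grad \<phi> x \<partial>M) = (\<integral>x. c *\<^sub>R grad \<phi> x \<partial>lborel)"
      by (rule integral_test_lebesgue_on[OF open_domain \<phi>]) (use test_function_grad_measurable[OF \<phi>] in auto)
    also have "\<dots> = 0" using integral_grad_zero[OF \<phi>] by simp
    finally show "(\<integral>x. (u x + c) *\<^sub>R grad \<phi> x \<partial>M) = - (\<integral>x. \<phi> x *\<^sub>R g x \<partial>M)" using assms \<phi> by (simp add: has_weak_grad_def)
  qed
qed

lemma integral_indicator_cball:
  assumes "cball a r \<subseteq> \<Omega>" "r \<ge> 0" shows "(\<integral>x. ind (cball a r) x \<partial>M) = pi * r^2"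
proof -
  have "(\<integral>x. ind (cball a r) x \<partial>M) = (\<integral>x. ind (cball a r) x \<partial>lborel)"
  proof (rule integral_lebesgue_on_borel[OF domain_sets])
    show "ind (cball a r) \<in> borel_measurable borel" by (intro borel_measurable_indicator borel_closed closed_cball)
    show "ind (cball a r) x = 0" if "x \<notin> \<Omega>" for x using that assms(1) by (auto simp: indicator_def)
  qed
  also have "\<dots> = pi * r^2" using content_cball[OF assms(2), of a] by (simp add: unit_ball_vol_2)
  finally show ?thesis .
qed

text \<open>\<open>value_on\<close> is a definite description, meaningful only after almost
  everywhere constancy is known. The Poincare inequality is applied to approximating test functions;
  as its constant \<open>c\<close> depends on the approximant, the fixed mean \<open>m\<close> of
  \<open>fst w\<close> takes its place.\<close>

lemma Z_constant_on_ball: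
  assumes w: "w \<in> Z" and r: "r > 0" and sub: "cball a r \<subseteq> \<Omega>"
    and z: "AE x in M. x \<in> cball a r \<longrightarrow> snd (w x) = 0"
  obtains c where "AE x in M. x \<in> cball a r \<longrightarrow> fst (w x) = c"
proof -
  let ?I = "\<lambda>x. ind (cball a r) x"
  have Im: "?I \<in> borel_measurable borel" by (intro borel_measurable_indicator borel_closed closed_cball)
  have Is: "sqi M ?I" by (rule sqi_bounded[OF finite_measure_M, of _ 1]) (auto intro!: borel_measurable_M simp: indicator_def)
  define V where "V = (\<integral>x. ?I x \<partial>M)"
  have V: "V = pi * r^2"
    unfolding V_def using integral_indicator_cball[OF sub] r by simp
  have V0: "V > 0" using V r by simp
  have out: "?I x = 0" if "x \<notin> \<Omega>" for x using that sub by (auto simp: indicator_def)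
  define N where "N = sqrt (measure M (space M))"
  have N: "N \<ge> 0" by (simp add: N_def)
  have l1: "(\<integral>x. ?I x * norm (f x) \<partial>M) \<le> N * nrm2 M f" if f: "sqi M f" for f :: "real^2 \<Rightarrow> 'b::euclidean_space"
  proof -
    have "(\<integral>x. ?I x * norm (f x) \<partial>M) \<le> (\<integral>x. norm (f x) \<partial>M)"
    proof (rule integral_mono')
      show "integrable M (\<lambda>x. norm (f x))" by (intro integrable_norm sqi_integrable[OF finite_measure_M f])
    qed (auto simp: indicator_def)
    then show ?thesis using sqi_integral_norm_le[OF finite_measure_M f] by (simp add: N_def mult.commute)
  qed
  have fs: "sqi M (\<lambda>x. fst (w x))" by (rule Z_fst[OF w])
  define m where "m = (\<integral>x. ?I x * fst (w x) \<partial>M) / V"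
  \<comment> \<open>\<open>N e\<close> pays for replacing \<open>fst w\<close> by the test function,
    \<open>8 r N e\<close> is the Poincare bound; both are doubled on passing from \<open>c\<close>
    to the mean \<open>m\<close>.\<close>
  define K where "K = 2 * (N + 8 * r * N)"
  have K: "K \<ge> 0" using N r by (simp add: K_def)
  have le: "(\<integral>x. ?I x * \<bar>fst (w x) - m\<bar> \<partial>M) \<le> K * e" if e: "e > 0" for e
  proof -
    obtain \<phi> where \<phi>: "test_function \<Omega> \<phi>" "nrm2 M (\<lambda>x. w x - with_grad \<phi> x) < e" using Z_approx[OF w e] by blast
    note tm = test_function_measurable[OF \<phi>(1)] test_function_grad_measurable[OF \<phi>(1)]
    note ts = test_function_sqi[OF open_domain \<phi>(1)]
    have s: "sqi M (\<lambda>x. fst (w x) - \<phi> x)" "sqi M (\<lambda>x. snd (w x) - grad \<phi> x)"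
      by (intro sqi_diff fs Z_snd[OF w] ts)+
    have sw: "sqi M (\<lambda>x. w x - with_grad \<phi> x)" by (rule sqi_diff[OF Z_sqi[OF w] with_grad_sqi[OF \<phi>(1)]])
    have n: "nrm2 M (\<lambda>x. fst (w x) - \<phi> x) \<le> e" "nrm2 M (\<lambda>x. snd (w x) - grad \<phi> x) \<le> e"
    proof -
      have "nrm2 M (\<lambda>x. fst (w x) - \<phi> x) \<le> nrm2 M (\<lambda>x. w x - with_grad \<phi> x)"
        unfolding nrm2_def by (intro real_sqrt_le_mono integral_mono) (use s sw in \<open>auto simp: sqi_def norm_pair_sq with_grad_def\<close>)
      then show "nrm2 M (\<lambda>x. fst (w x) - \<phi> x) \<le> e" using \<phi>(2) by simp
      have "nrm2 M (\<lambda>x. snd (w x) - grad \<phi> x) \<le> nrm2 M (\<lambda>x. w x - with_grad \<phi> x)"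
        unfolding nrm2_def by (intro real_sqrt_le_mono integral_mono) (use s sw in \<open>auto simp: sqi_def norm_pair_sq with_grad_def\<close>)
      then show "nrm2 M (\<lambda>x. snd (w x) - grad \<phi> x) \<le> e" using \<phi>(2) by simp
    qed
    obtain c where c: "(\<integral>x. ?I x * \<bar>\<phi> x - c\<bar> \<partial>lborel) \<le> 8 * r * (\<integral>x. ?I x * norm (grad \<phi> x) \<partial>lborel)"
      using ball_Poincare[OF \<phi>(1) r] by blast
    have "(\<integral>x. ?I x * \<bar>\<phi> x - c\<bar> \<partial>lborel) = (\<integral>x. ?I x * \<bar>\<phi> x - c\<bar> \<partial>M)"
      by (rule integral_lebesgue_on_borel[OF domain_sets, symmetric]) (use tm Im out in auto)
    moreover have "(\<integral>x. ?I x * norm (grad \<phi> x) \<partial>lborel) = (\<integral>x. ?I x * norm (grad \<phi> x) \<partial>M)"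
      by (rule integral_lebesgue_on_borel[OF domain_sets, symmetric]) (use tm Im out in auto)
    moreover have "(\<integral>x. ?I x * norm (grad \<phi> x) \<partial>M) = (\<integral>x. ?I x * norm (snd (w x) - grad \<phi> x) \<partial>M)"
    proof (rule integral_cong_AE)
      show "AE x in M. ?I x * norm (grad \<phi> x) = ?I x * norm (snd (w x) - grad \<phi> x)"
        using z by eventually_elim (auto simp: indicator_def)
    qed (use s ts borel_measurable_M[OF Im] in \<open>auto simp: sqi_def\<close>)
    moreover have "(\<integral>x. ?I x * norm (snd (w x) - grad \<phi> x) \<partial>M) \<le> N * e"
      using l1[OF s(2)] mult_left_mono[OF n(2) N] by linarith
    ultimately have c1: "(\<integral>x. ?I x * \<bar>\<phi> x - c\<bar> \<partial>M) \<le> 8 * r * (N * e)"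
      using c r by (simp add: mult_left_mono order_trans)
    have cs: "sqi M (\<lambda>x. \<phi> x - c)" "sqi M (\<lambda>x. fst (w x) - c)" "sqi M (\<lambda>x. fst (w x) - m)"
      by (intro sqi_diff ts fs sqi_const[OF finite_measure_M])+
    have ii: "integrable M (\<lambda>x. ?I x * \<bar>f x\<bar>)" if "sqi M f" for f :: "real^2 \<Rightarrow> real"
      using sqi_mult[OF Is sqi_norm[OF that]] by simp
    have c2: "(\<integral>x. ?I x * \<bar>fst (w x) - c\<bar> \<partial>M) \<le> N * e + 8 * r * (N * e)"
    proof -
      have "(\<integral>x. ?I x * \<bar>fst (w x) - c\<bar> \<partial>M) \<le> (\<integral>x. ?I x * \<bar>fst (w x) - \<phi> x\<bar> + ?I x * \<bar>\<phi> x - c\<bar> \<partial>M)"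
        by (rule integral_mono) (use ii cs s in \<open>auto simp: indicator_def\<close>)
      also have "\<dots> = (\<integral>x. ?I x * \<bar>fst (w x) - \<phi> x\<bar> \<partial>M) + (\<integral>x. ?I x * \<bar>\<phi> x - c\<bar> \<partial>M)"
        by (rule Bochner_Integration.integral_add) (use ii cs s in auto)
      also have "(\<integral>x. ?I x * \<bar>fst (w x) - \<phi> x\<bar> \<partial>M) \<le> N * e"
        using l1[OF s(1)] mult_left_mono[OF n(1) N] by simp
      finally show ?thesis using c1 by simp
    qed
    have c3: "V * \<bar>c - m\<bar> \<le> (\<integral>x. ?I x * \<bar>fst (w x) - c\<bar> \<partial>M)"
    proof -
      have "(\<integral>x. ?I x * (fst (w x) - c) \<partial>M) = (\<integral>x. ?I x * fst (w x) - c * ?I x \<partial>M)" by (simp add: algebra_simps)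
      also have "\<dots> = (\<integral>x. ?I x * fst (w x) \<partial>M) - c * V"
        using sqi_mult[OF Is fs] sqi_integrable[OF finite_measure_M Is] by (simp add: V_def)
      also have "\<dots> = V * (m - c)" using V0 by (simp add: m_def algebra_simps)
      finally have "V * \<bar>c - m\<bar> = \<bar>\<integral>x. ?I x * (fst (w x) - c) \<partial>M\<bar>" using V0 by (simp add: abs_mult abs_minus_commute)
      also have "\<dots> \<le> (\<integral>x. \<bar>?I x * (fst (w x) - c)\<bar> \<partial>M)" by (rule integral_abs_bound)
      finally show ?thesis by (simp add: abs_mult)
    qed
    have "(\<integral>x. ?I x * \<bar>fst (w x) - m\<bar> \<partial>M) \<le> (\<integral>x. ?I x * \<bar>fst (w x) - c\<bar> + \<bar>c - m\<bar> * ?I x \<partial>M)"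
      by (rule integral_mono) (use ii cs sqi_integrable[OF finite_measure_M Is] in \<open>auto simp: indicator_def\<close>)
    also have "\<dots> = (\<integral>x. ?I x * \<bar>fst (w x) - c\<bar> \<partial>M) + \<bar>c - m\<bar> * V"
      using ii[OF cs(2)] sqi_integrable[OF finite_measure_M Is] by (simp add: V_def)
    finally show ?thesis using c2 c3 by (simp add: K_def algebra_simps)
  qed
  have "(\<integral>x. ?I x * \<bar>fst (w x) - m\<bar> \<partial>M) \<le> 0 + e" if e: "e > 0" for e
  proof -
    have "(\<integral>x. ?I x * \<bar>fst (w x) - m\<bar> \<partial>M) \<le> K * (e / (K + 1))" using le[of "e / (K + 1)"] e K by simp
    also have "\<dots> \<le> (K + 1) * (e / (K + 1))" using e K by (intro mult_right_mono) auto
    finally show ?thesis using K by simp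
  qed
  then have "(\<integral>x. ?I x * \<bar>fst (w x) - m\<bar> \<partial>M) \<le> 0" by (rule field_le_epsilon)
  moreover have "(\<integral>x. ?I x * \<bar>fst (w x) - m\<bar> \<partial>M) \<ge> 0" by simp
  ultimately have "(\<integral>x. ?I x * \<bar>fst (w x) - m\<bar> \<partial>M) = 0" by linarith
  moreover have "integrable M (\<lambda>x. ?I x * \<bar>fst (w x) - m\<bar>)"
    using sqi_mult[OF Is sqi_norm[OF sqi_diff[OF fs sqi_const[OF finite_measure_M, of m]]]] by simp
  ultimately have "AE x in M. ?I x * \<bar>fst (w x) - m\<bar> = 0" by (subst (asm) integral_nonneg_eq_0_iff_AE) auto
  then have "AE x in M. x \<in> cball a r \<longrightarrow> fst (w x) = m" by eventually_elim (auto simp: indicator_def split: if_splits)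
  then show ?thesis by (rule that)
qed

lemma AE_lebesgue_on_subset:
  assumes "S \<in> sets lebesgue" "S \<subseteq> \<Omega>"
  shows "(AE x in lebesgue_on S. P x) \<longleftrightarrow> (AE x in M. x \<in> S \<longrightarrow> P x)"
  using assms domain_sets by (auto simp: AE_restrict_space_iff elim: eventually_mono)

text \<open>This replaces \<open>value_on\<close> by an average over the disk, a continuous
  functional on all of \<open>L^2\<close>, so that the right-hand side of the problem with holes can
  be represented.\<close>

lemma value_on_ball:
  assumes w: "w \<in> Z" and r: "r > 0" and sub: "cball a r \<subseteq> \<Omega>"
    and z: "AE x in M. x \<in> cball a r \<longrightarrow> snd (w x) = 0"
  shows "value_on (cball a r) (\<lambda>x. fst (w x)) = (\<integral>x. ind (cball a r) x * fst (w x) \<partial>M) / (pi * r^2)"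
proof -
  let ?I = "\<lambda>x. ind (cball a r) x"
  obtain c where c: "AE x in M. x \<in> cball a r \<longrightarrow> fst (w x) = c" using Z_constant_on_ball[OF assms] by blast
  have V: "(\<integral>x. ?I x \<partial>M) = pi * r^2" using integral_indicator_cball[OF sub] r by simp
  have Im: "?I \<in> borel_measurable M" by (intro borel_measurable_M borel_measurable_indicator borel_closed closed_cball)
  have fm: "(\<lambda>x. fst (w x)) \<in> borel_measurable M" using Z_fst[OF w] by (simp add: sqi_def)
  have eq: "(\<integral>x. ?I x * fst (w x) \<partial>M) = c' * (pi * r^2)" if "AE x in M. x \<in> cball a r \<longrightarrow> fst (w x) = c'" for c'
  proof -
    have "(\<integral>x. ?I x * fst (w x) \<partial>M) = (\<integral>x. c' * ?I x \<partial>M)"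
    proof (rule integral_cong_AE)
      show "AE x in M. ?I x * fst (w x) = c' * ?I x" using that by eventually_elim (auto simp: indicator_def)
    qed (use Im fm in auto)
    then show ?thesis using V by simp
  qed
  have "value_on (cball a r) (\<lambda>x. fst (w x)) = c" unfolding value_on_def
  proof (rule the_equality)
    show "AE x in lebesgue_on (cball a r). fst (w x) = c" using c by (subst AE_lebesgue_on_subset[OF _ sub]) auto
    show "c' = c" if "AE x in lebesgue_on (cball a r). fst (w x) = c'" for c'
      using that eq[OF c] eq[of c'] r by (subst (asm) AE_lebesgue_on_subset[OF _ sub]) auto
  qed
  then show ?thesis using eq[OF c] r by simp
qed


lemma indicator_cball_measurable: "ind (cball a r) \<in> borel_measurable M"
  by (intro borel_measurable_M borel_measurable_indicator borel_closed closed_cball)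

lemma indicator_cball_sqi: "sqi M (ind (cball a r))"
  by (rule sqi_bounded[OF finite_measure_M indicator_cball_measurable, of _ _ 1]) (simp add: indicator_def)

section \<open>Zero gradient on the holes, and the two boundary value problems\<close>

definition Z_holes :: "(real^2) set \<Rightarrow> real \<Rightarrow> (real^2 \<Rightarrow> real \<times> (real^2)) set" where
  "Z_holes A r = {w \<in> Z. \<forall>a\<in>A. AE x in M. x \<in> cball a r \<longrightarrow> snd (w x) = 0}"

text \<open>On a hole the gradient of any approximant \<open>g\<close> vanishes, so the integral of
  \<open>norm (snd f)^2\<close> over the hole is at most the squared distance from \<open>f\<close>
  to \<open>g\<close>.\<close>

lemma Z_holes_closed:
  assumes f: "sqi M f" and ap: "\<And>\<delta>. \<delta> > 0 \<Longrightarrow> \<exists>g\<in>Z_holes A r. (\<integral>x. (norm (f x - g x))^2 \<partial>M) < \<delta>"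
  shows "f \<in> Z_holes A r"
  unfolding Z_holes_def mem_Collect_eq
proof (intro conjI ballI)
  show "f \<in> Z" by (rule Z_closed[OF f]) (use ap in \<open>auto simp: Z_holes_def\<close>)
  fix a assume a: "a \<in> A"
  let ?I = "ind (cball a r)"
  note Im [measurable] = indicator_cball_measurable[of a r]
  have sf: "sqi M (\<lambda>x. snd (f x))" using f sqi_fst_snd by blast
  then have [measurable]: "(\<lambda>x. snd (f x)) \<in> borel_measurable M" by (simp add: sqi_def)
  have int: "integrable M (\<lambda>x. ?I x * (norm (snd (f x)))^2)"
  proof (rule Bochner_Integration.integrable_bound)
    show "integrable M (\<lambda>x. (norm (snd (f x)))^2)" using sf by (simp add: sqi_def)
    show "AE x in M. norm (?I x * (norm (snd (f x)))^2) \<le> norm ((norm (snd (f x)))^2)" by (simp add: indicator_def)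
  qed measurable
  have "(\<integral>x. ?I x * (norm (snd (f x)))^2 \<partial>M) \<le> 0 + \<delta>" if \<delta>: "\<delta> > 0" for \<delta>
  proof -
    obtain g where g: "g \<in> Z_holes A r" "(\<integral>x. (norm (f x - g x))^2 \<partial>M) < \<delta>" using ap[OF \<delta>] by blast
    have "sqi M g" using g(1) Z_sqi by (simp add: Z_holes_def)
    then have s: "sqi M (\<lambda>x. f x - g x)" by (rule sqi_diff[OF f])
    have "(\<integral>x. ?I x * (norm (snd (f x)))^2 \<partial>M) \<le> (\<integral>x. (norm (f x - g x))^2 \<partial>M)"
    proof (rule integral_mono_AE[OF int])
      have "AE x in M. x \<in> cball a r \<longrightarrow> snd (g x) = 0" using g(1) a by (simp add: Z_holes_def)
      then show "AE x in M. ?I x * (norm (snd (f x)))^2 \<le> (norm (f x - g x))^2"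
        by eventually_elim (auto simp: indicator_def norm_pair_sq)
    qed (use s in \<open>simp add: sqi_def\<close>)
    then show ?thesis using g(2) by simp
  qed
  then have "(\<integral>x. ?I x * (norm (snd (f x)))^2 \<partial>M) \<le> 0" by (rule field_le_epsilon)
  moreover have "(\<integral>x. ?I x * (norm (snd (f x)))^2 \<partial>M) \<ge> 0" by simp
  ultimately have "(\<integral>x. ?I x * (norm (snd (f x)))^2 \<partial>M) = 0" by linarith
  then have "AE x in M. ?I x * (norm (snd (f x)))^2 = 0" by (subst (asm) integral_nonneg_eq_0_iff_AE[OF int]) auto
  then show "AE x in M. x \<in> cball a r \<longrightarrow> snd (f x) = 0" by eventually_elim (auto simp: indicator_def split: if_splits)
qed

lemma Z_holes_lin:
  assumes "v \<in> Z_holes A r" "w \<in> Z_holes A r" shows "(\<lambda>x. v x + c *\<^sub>R w x) \<in> Z_holes A r"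
  unfolding Z_holes_def mem_Collect_eq
proof (intro conjI ballI)
  show "(\<lambda>x. v x + c *\<^sub>R w x) \<in> Z" using assms by (auto simp: Z_holes_def intro: Z_lin)
  fix a assume "a \<in> A"
  then have "AE x in M. x \<in> cball a r \<longrightarrow> snd (v x) = 0" "AE x in M. x \<in> cball a r \<longrightarrow> snd (w x) = 0"
    using assms by (auto simp: Z_holes_def)
  then show "AE x in M. x \<in> cball a r \<longrightarrow> snd (v x + c *\<^sub>R w x) = 0" by eventually_elim auto
qed

text \<open>With the empty set of holes the space is \<open>Z\<close> itself, so this one statement
  solves the limit problem as well.\<close>

lemma Z_holes_projection:
  assumes "sqi M k"
  obtains w where "w \<in> Z_holes A r" "\<And>v. v \<in> Z_holes A r \<Longrightarrow> (\<integral>x. w x \<bullet> v x \<partial>M) = (\<integral>x. k x \<bullet> v x \<partial>M)"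
proof (rule L2_projection[OF finite_measure_M assms, where X="Z_holes A r"])
  show "(\<lambda>x. 0) \<in> Z_holes A r" using Z_zero by (simp add: Z_holes_def)
  show "sqi M f" if "f \<in> Z_holes A r" for f using that Z_sqi by (simp add: Z_holes_def)
qed (use Z_holes_lin Z_holes_closed that in blast)+

lemma H10_pair_cong:
  assumes "H10 \<Omega> u" "has_weak_grad \<Omega> u g" shows "(\<lambda>x. (u x, g x)) \<in> Z"
proof (rule Z_AE_cong[OF H10_imp_Z[OF assms(1)]])
  have "sqi M (\<lambda>x. (u x, g x))" using assms(2) by (subst sqi_fst_snd) (simp add: has_weak_grad_def L2_iff)
  then show "(\<lambda>x. (u x, g x)) \<in> borel_measurable M" by (simp add: sqi_def)
  show "AE x in M. (u x, g x) = (u x, weak_grad \<Omega> u x)" using weak_grad_AE[OF assms(2)] by eventually_elim simp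
qed

text \<open>Correspondence between solutions of the weak formulations, which involve the chosen
  representative of the gradient, and elements \<open>(u, \<nabla>u)\<close> of the closed subspaces.\<close>

lemma weak_solution_pair:
  assumes h: "H1 \<Omega> h" "H10 \<Omega> (\<lambda>x. h x - \<sigma>)"
  defines "w \<equiv> \<lambda>x. (h x - \<sigma>, weak_grad \<Omega> h x)"
  shows "w \<in> Z"
    and "v \<in> Z \<Longrightarrow> (\<integral>x. weak_grad \<Omega> h x \<bullet> weak_grad \<Omega> (\<lambda>x. fst (v x)) x + h x * fst (v x) \<partial>M) =
       (\<integral>x. w x \<bullet> v x \<partial>M) + \<sigma> * (\<integral>x. fst (v x) \<partial>M)"
proof -
  have wg: "has_weak_grad \<Omega> h (weak_grad \<Omega> h)" by (rule H1_weak_grad[OF h(1)])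
  have wg': "has_weak_grad \<Omega> (\<lambda>x. h x - \<sigma>) (weak_grad \<Omega> h)" using has_weak_grad_add_const[OF wg, of "- \<sigma>"] by simp
  show wZ: "w \<in> Z" unfolding w_def by (rule H10_pair_cong[OF h(2) wg'])
  assume v: "v \<in> Z"
  let ?g = "weak_grad \<Omega> (\<lambda>x. fst (v x))"
  have vg: "has_weak_grad \<Omega> (\<lambda>x. fst (v x)) (\<lambda>x. snd (v x))" by (rule Z_has_weak_grad[OF v])
  have g: "has_weak_grad \<Omega> (\<lambda>x. fst (v x)) ?g" using vg H1_weak_grad unfolding H1_def by blast
  have s: "sqi M h" "sqi M (weak_grad \<Omega> h)" "sqi M ?g"
    using wg g by (auto simp: has_weak_grad_def L2_iff)
  have "(\<integral>x. weak_grad \<Omega> h x \<bullet> ?g x + h x * fst (v x) \<partial>M) = (\<integral>x. w x \<bullet> v x + \<sigma> * fst (v x) \<partial>M)"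
  proof (rule integral_cong_AE)
    show "AE x in M. weak_grad \<Omega> h x \<bullet> ?g x + h x * fst (v x) = w x \<bullet> v x + \<sigma> * fst (v x)"
      using weak_grad_AE[OF vg] by eventually_elim (simp add: w_def inner_prod_def algebra_simps)
  qed (use s Z_sqi[OF v] Z_sqi[OF wZ] Z_fst[OF v] in \<open>auto simp: sqi_def\<close>)
  also have "\<dots> = (\<integral>x. w x \<bullet> v x \<partial>M) + \<sigma> * (\<integral>x. fst (v x) \<partial>M)"
    using sqi_inner[OF Z_sqi[OF wZ] Z_sqi[OF v]] sqi_integrable[OF finite_measure_M Z_fst[OF v]] by simp
  finally show "(\<integral>x. weak_grad \<Omega> h x \<bullet> ?g x + h x * fst (v x) \<partial>M) = (\<integral>x. w x \<bullet> v x \<partial>M) + \<sigma> * (\<integral>x. fst (v x) \<partial>M)" .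
qed

lemma pair_weak_solution:
  fixes \<sigma> :: real
  assumes w: "w \<in> Z"
  defines "h \<equiv> \<lambda>x. fst (w x) + \<sigma>"
  shows "H1 \<Omega> h" "H10 \<Omega> (\<lambda>x. h x - \<sigma>)" "AE x in M. weak_grad \<Omega> h x = snd (w x)"
    and "v \<in> Z \<Longrightarrow> (\<integral>x. (h x - \<sigma>, weak_grad \<Omega> h x) \<bullet> v x \<partial>M) = (\<integral>x. w x \<bullet> v x \<partial>M)"
proof -
  have wg: "has_weak_grad \<Omega> h (\<lambda>x. snd (w x))" unfolding h_def by (rule has_weak_grad_add_const[OF Z_has_weak_grad[OF w]])
  then show H: "H1 \<Omega> h" unfolding H1_def by blast
  show H0: "H10 \<Omega> (\<lambda>x. h x - \<sigma>)" using Z_imp_H10[OF w] by (simp add: h_def)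
  show ae: "AE x in M. weak_grad \<Omega> h x = snd (w x)" by (rule weak_grad_AE[OF wg])
  assume v: "v \<in> Z"
  show "(\<integral>x. (h x - \<sigma>, weak_grad \<Omega> h x) \<bullet> v x \<partial>M) = (\<integral>x. w x \<bullet> v x \<partial>M)"
  proof (rule integral_cong_AE)
    show "AE x in M. (h x - \<sigma>, weak_grad \<Omega> h x) \<bullet> v x = w x \<bullet> v x"
      using ae by eventually_elim (simp add: h_def inner_prod_def)
  qed (use Z_sqi[OF weak_solution_pair(1)[OF H H0]] Z_sqi[OF v] Z_sqi[OF w] in \<open>auto simp: sqi_def\<close>)
qed

lemma h_bar_exists:
  assumes D: "sqi M D" shows "\<exists>h. is_h_bar \<Omega> \<sigma> D h"
proof -
  \<comment> \<open>Writing \<open>h = u + \<sigma>\<close> moves the zero order term of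
    \<open>\<sigma>\<close> to the right-hand side; the gradient component of the datum is
    zero.\<close>
  let ?k = "\<lambda>x. (2 * pi * D x - \<sigma>, 0 :: real^2)"
  have sk: "sqi M (\<lambda>x. 2 * pi * D x - \<sigma>)"
    by (rule sqi_diff[OF sqi_cmult[OF D, of "2*pi"] sqi_const[OF finite_measure_M]])
  have k: "sqi M ?k" by (subst sqi_fst_snd) (simp add: sk sqi_zero)
  obtain w where w: "w \<in> Z_holes {} 0" "\<And>v. v \<in> Z_holes {} 0 \<Longrightarrow> (\<integral>x. w x \<bullet> v x \<partial>M) = (\<integral>x. ?k x \<bullet> v x \<partial>M)"
    using Z_holes_projection[OF k] by blast
  have Zh: "Z_holes {} 0 = Z" by (simp add: Z_holes_def)
  have wZ: "w \<in> Z" using w(1) Zh by simp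
  define h where "h x = fst (w x) + \<sigma>" for x
  note p = pair_weak_solution[OF wZ, where \<sigma>=\<sigma>, folded h_def]
  have "is_h_bar \<Omega> \<sigma> D h" unfolding is_h_bar_def
  proof (intro conjI allI impI p(1,2))
    fix v assume v: "H10 \<Omega> v"
    let ?v = "\<lambda>x. (v x, weak_grad \<Omega> v x)"
    have vZ: "?v \<in> Z" by (rule H10_imp_Z[OF v])
    have vs: "sqi M v" using Z_fst[OF vZ] by simp
    have "(\<integral>x. weak_grad \<Omega> h x \<bullet> weak_grad \<Omega> v x + h x * v x \<partial>M) = (\<integral>x. ?k x \<bullet> ?v x \<partial>M) + \<sigma> * (\<integral>x. v x \<partial>M)"
      using weak_solution_pair(2)[OF p(1,2) vZ] p(4)[OF vZ] w(2)[of ?v] vZ Zh by simp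
    also have "(\<integral>x. ?k x \<bullet> ?v x \<partial>M) = (\<integral>x. 2 * pi * (D x * v x) - \<sigma> * v x \<partial>M)"
      by (rule Bochner_Integration.integral_cong) (auto simp: algebra_simps)
    also have "\<dots> = 2 * pi * (\<integral>x. D x * v x \<partial>M) - \<sigma> * (\<integral>x. v x \<partial>M)"
      using sqi_mult[OF D vs] sqi_integrable[OF finite_measure_M vs] by simp
    finally show "(\<integral>x. weak_grad \<Omega> h x \<bullet> weak_grad \<Omega> v x + h x * v x \<partial>M) = 2 * pi * (\<integral>x. D x * v x \<partial>M)" by simp
  qed
  then show ?thesis by blast
qed

lemma E_0_char:
  assumes D: "sqi M D"
  obtains w where "w \<in> Z" "\<And>v. v \<in> Z \<Longrightarrow> (\<integral>x. w x \<bullet> v x \<partial>M) = 2 * pi * (\<integral>x. D x * fst (v x) \<partial>M) - \<sigma> * (\<integral>x. fst (v x) \<partial>M)"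
    "E_0 \<Omega> \<sigma> \<gamma> D = (nrm2 M w)^2 / 2 + pi * \<gamma> * (\<integral>x. Phi (D x) \<partial>M)"
proof -
  define h where "h = h_bar \<Omega> \<sigma> D"
  have h: "is_h_bar \<Omega> \<sigma> D h" unfolding h_def h_bar_def by (rule someI_ex[OF h_bar_exists[OF D]])
  then have H: "H1 \<Omega> h" "H10 \<Omega> (\<lambda>x. h x - \<sigma>)" by (auto simp: is_h_bar_def)
  let ?w = "\<lambda>x. (h x - \<sigma>, weak_grad \<Omega> h x)"
  show ?thesis
  proof (rule that)
    show "?w \<in> Z" by (rule weak_solution_pair(1)[OF H])
    show "(\<integral>x. ?w x \<bullet> v x \<partial>M) = 2 * pi * (\<integral>x. D x * fst (v x) \<partial>M) - \<sigma> * (\<integral>x. fst (v x) \<partial>M)" if v: "v \<in> Z" for v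
      using weak_solution_pair(2)[OF H v] h Z_imp_H10[OF v] by (simp add: is_h_bar_def)
    show "E_0 \<Omega> \<sigma> \<gamma> D = (nrm2 M ?w)^2 / 2 + pi * \<gamma> * (\<integral>x. Phi (D x) \<partial>M)"
      by (simp add: E_0_def Let_def h_def[symmetric] nrm2_sq norm_pair_sq add.commute)
  qed
qed

lemma E_tilde_char:
  fixes p :: "real^2" and d :: "real^2 \<Rightarrow> int" and \<epsilon> \<gamma> :: real
  defines "A \<equiv> centers \<Omega> p \<epsilon>" and "\<rho> \<equiv> exp (- \<gamma> / \<epsilon>^2)"
  assumes fin: "finite A" and sub: "\<And>a. a \<in> A \<Longrightarrow> cball a \<rho> \<subseteq> \<Omega>"
  obtains w where "w \<in> Z_holes A \<rho>"
    "\<And>v. v \<in> Z_holes A \<rho> \<Longrightarrow> (\<integral>x. w x \<bullet> v x \<partial>M) =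
      2 * pi * \<epsilon>^2 * (\<Sum>a\<in>A. of_int (d a) * ((\<integral>x. ind (cball a \<rho>) x * fst (v x) \<partial>M) / (pi * \<rho>^2))) - \<sigma> * (\<integral>x. fst (v x) \<partial>M)"
    "E_tilde \<Omega> \<sigma> \<gamma> p \<epsilon> d = (nrm2 M w)^2 / 2"
proof -
  have r: "\<rho> > 0" by (simp add: \<rho>_def)
  have hole: "hole \<gamma> \<epsilon> a = cball a \<rho>" for a by (simp add: hole_def \<rho>_def)
  note Is = indicator_cball_sqi[of _ \<rho>]
  \<comment> \<open>Averages over the holes agree with \<open>value_on\<close> on
    \<open>Z_holes\<close>; written with indicator functions they are represented by a square
    integrable \<open>k\<close>, to which the projection applies.\<close>
  define k where "k x = (2 * pi * \<epsilon>^2 * (\<Sum>a\<in>A. of_int (d a) * (ind (cball a \<rho>) x / (pi * \<rho>^2))) - \<sigma>, 0 :: real^2)" for x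
  have "sqi M (\<lambda>x. of_int (d a) * (ind (cball a \<rho>) x / (pi * \<rho>^2)))" for a
    using sqi_cmult[OF Is[of a], of "of_int (d a) / (pi * \<rho>^2)"] by (simp add: field_simps)
  then have "sqi M (\<lambda>x. 2 * pi * \<epsilon>^2 * (\<Sum>a\<in>A. of_int (d a) * (ind (cball a \<rho>) x / (pi * \<rho>^2))) - \<sigma>)"
    by (intro sqi_diff[OF sqi_cmult[OF sqi_sum[OF fin]] sqi_const[OF finite_measure_M]]) simp
  then have sk: "sqi M k" unfolding sqi_fst_snd[of M k] by (simp add: k_def sqi_zero)
  have kv: "(\<integral>x. k x \<bullet> v x \<partial>M) = 2 * pi * \<epsilon>^2 * (\<Sum>a\<in>A. of_int (d a) * ((\<integral>x. ind (cball a \<rho>) x * fst (v x) \<partial>M) / (pi * \<rho>^2))) - \<sigma> * (\<integral>x. fst (v x) \<partial>M)"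
    if v: "v \<in> Z" for v
  proof -
    have i: "integrable M (\<lambda>x. of_int (d a) * (ind (cball a \<rho>) x * fst (v x) / (pi * \<rho>^2)))" for a
      using sqi_mult[OF Is[of a] Z_fst[OF v]] by simp
    have "(\<integral>x. k x \<bullet> v x \<partial>M) = (\<integral>x. 2 * pi * \<epsilon>^2 * (\<Sum>a\<in>A. of_int (d a) * (ind (cball a \<rho>) x * fst (v x) / (pi * \<rho>^2))) - \<sigma> * fst (v x) \<partial>M)"
    proof (rule Bochner_Integration.integral_cong[OF refl])
      fix x
      have e: "(\<Sum>a\<in>A. of_int (d a) * (ind (cball a \<rho>) x * fst (v x) / (pi * \<rho>^2))) = (\<Sum>a\<in>A. of_int (d a) * (ind (cball a \<rho>) x / (pi * \<rho>^2))) * fst (v x)"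
        unfolding sum_distrib_right by (rule sum.cong) auto
      show "k x \<bullet> v x = 2 * pi * \<epsilon>^2 * (\<Sum>a\<in>A. of_int (d a) * (ind (cball a \<rho>) x * fst (v x) / (pi * \<rho>^2))) - \<sigma> * fst (v x)"
        unfolding e by (simp add: k_def inner_prod_def left_diff_distrib mult.assoc)
    qed
    also have "\<dots> = 2 * pi * \<epsilon>^2 * (\<integral>x. (\<Sum>a\<in>A. of_int (d a) * (ind (cball a \<rho>) x * fst (v x) / (pi * \<rho>^2))) \<partial>M) - \<sigma> * (\<integral>x. fst (v x) \<partial>M)"
      using i sqi_integrable[OF finite_measure_M Z_fst[OF v]] by (subst Bochner_Integration.integral_diff) (auto intro!: integrable_sum)
    also have "(\<integral>x. (\<Sum>a\<in>A. of_int (d a) * (ind (cball a \<rho>) x * fst (v x) / (pi * \<rho>^2))) \<partial>M) = (\<Sum>a\<in>A. of_int (d a) * ((\<integral>x. ind (cball a \<rho>) x * fst (v x) \<partial>M) / (pi * \<rho>^2)))"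
      using i by (subst Bochner_Integration.integral_sum) auto
    finally show ?thesis .
  qed
  have gz: "grad_zero_in_holes \<Omega> \<gamma> p \<epsilon> u \<longleftrightarrow> (\<forall>a\<in>A. AE x in M. x \<in> cball a \<rho> \<longrightarrow> weak_grad \<Omega> u x = 0)" for u
    unfolding grad_zero_in_holes_def A_def[symmetric] hole by (intro ball_cong refl AE_lebesgue_on_subset sub) auto
  have ex: "\<exists>h. is_h_tilde \<Omega> \<sigma> \<gamma> p \<epsilon> d h"
  proof -
    obtain w where w: "w \<in> Z_holes A \<rho>" "\<And>v. v \<in> Z_holes A \<rho> \<Longrightarrow> (\<integral>x. w x \<bullet> v x \<partial>M) = (\<integral>x. k x \<bullet> v x \<partial>M)"
      using Z_holes_projection[OF sk] by blast
    have wZ: "w \<in> Z" and w0: "\<And>a. a \<in> A \<Longrightarrow> AE x in M. x \<in> cball a \<rho> \<longrightarrow> snd (w x) = 0" using w(1) by (auto simp: Z_holes_def)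
    define h where "h x = fst (w x) + \<sigma>" for x
    note p = pair_weak_solution[OF wZ, where \<sigma>=\<sigma>, folded h_def]
    have "is_h_tilde \<Omega> \<sigma> \<gamma> p \<epsilon> d h" unfolding is_h_tilde_def
    proof (intro conjI allI impI p(1,2))
      show "grad_zero_in_holes \<Omega> \<gamma> p \<epsilon> h" unfolding gz
      proof
        fix a assume "a \<in> A"
        show "AE x in M. x \<in> cball a \<rho> \<longrightarrow> weak_grad \<Omega> h x = 0" using w0[OF \<open>a \<in> A\<close>] p(3) by eventually_elim auto
      qed
      fix v assume v: "H10 \<Omega> v \<and> grad_zero_in_holes \<Omega> \<gamma> p \<epsilon> v"
      let ?v = "\<lambda>x. (v x, weak_grad \<Omega> v x)"
      have vZ: "?v \<in> Z" using H10_imp_Z v by blast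
      have v0: "AE x in M. x \<in> cball a \<rho> \<longrightarrow> snd (?v x) = 0" if "a \<in> A" for a using v that unfolding gz by simp
      have vh: "?v \<in> Z_holes A \<rho>" using vZ v0 by (simp add: Z_holes_def)
      have val: "value_on (cball a \<rho>) v = (\<integral>x. ind (cball a \<rho>) x * v x \<partial>M) / (pi * \<rho>^2)" if "a \<in> A" for a
        using value_on_ball[OF vZ r sub[OF that] v0[OF that]] by simp
      have "(\<integral>x. weak_grad \<Omega> h x \<bullet> weak_grad \<Omega> v x + h x * v x \<partial>M) = (\<integral>x. k x \<bullet> ?v x \<partial>M) + \<sigma> * (\<integral>x. v x \<partial>M)"
        using weak_solution_pair(2)[OF p(1,2) vZ] p(4)[OF vZ] w(2)[OF vh] by simp
      also have "\<dots> = 2 * pi * \<epsilon>^2 * (\<Sum>a\<in>A. of_int (d a) * value_on (cball a \<rho>) v)"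
        using kv[OF vZ] val by (simp cong: sum.cong)
      finally show "(\<integral>x. weak_grad \<Omega> h x \<bullet> weak_grad \<Omega> v x + h x * v x \<partial>M) = 2 * pi * \<epsilon>^2 * (\<Sum>a\<in>centers \<Omega> p \<epsilon>. of_int (d a) * value_on (hole \<gamma> \<epsilon> a) v)"
        by (simp add: A_def hole)
    qed
    then show ?thesis by blast
  qed
  define h where "h = h_tilde \<Omega> \<sigma> \<gamma> p \<epsilon> d"
  have h: "is_h_tilde \<Omega> \<sigma> \<gamma> p \<epsilon> d h" unfolding h_def h_tilde_def by (rule someI_ex[OF ex])
  then have H: "H1 \<Omega> h" "H10 \<Omega> (\<lambda>x. h x - \<sigma>)" and hz: "\<forall>a\<in>A. AE x in M. x \<in> cball a \<rho> \<longrightarrow> weak_grad \<Omega> h x = 0"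
    using gz by (auto simp: is_h_tilde_def)
  let ?w = "\<lambda>x. (h x - \<sigma>, weak_grad \<Omega> h x)"
  have wZ: "?w \<in> Z" by (rule weak_solution_pair(1)[OF H])
  show ?thesis
  proof (rule that)
    show "?w \<in> Z_holes A \<rho>" using wZ hz by (simp add: Z_holes_def)
    fix v assume v: "v \<in> Z_holes A \<rho>"
    then have vZ: "v \<in> Z" and v0: "\<And>a. a \<in> A \<Longrightarrow> AE x in M. x \<in> cball a \<rho> \<longrightarrow> snd (v x) = 0" by (auto simp: Z_holes_def)
    have "grad_zero_in_holes \<Omega> \<gamma> p \<epsilon> (\<lambda>x. fst (v x))" unfolding gz
    proof
      fix a assume "a \<in> A"
      show "AE x in M. x \<in> cball a \<rho> \<longrightarrow> weak_grad \<Omega> (\<lambda>x. fst (v x)) x = 0"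
        using v0[OF \<open>a \<in> A\<close>] weak_grad_AE[OF Z_has_weak_grad[OF vZ]] by eventually_elim auto
    qed
    then have "(\<integral>x. weak_grad \<Omega> h x \<bullet> weak_grad \<Omega> (\<lambda>x. fst (v x)) x + h x * fst (v x) \<partial>M) = 
        2 * pi * \<epsilon>^2 * (\<Sum>a\<in>A. of_int (d a) * value_on (cball a \<rho>) (\<lambda>x. fst (v x)))"
      using h Z_imp_H10[OF vZ] by (simp add: is_h_tilde_def A_def hole)
    also have "\<dots> = 2 * pi * \<epsilon>^2 * (\<Sum>a\<in>A. of_int (d a) * ((\<integral>x. ind (cball a \<rho>) x * fst (v x) \<partial>M) / (pi * \<rho>^2)))"
      using value_on_ball[OF vZ r sub v0] by (simp cong: sum.cong)
    finally show "(\<integral>x. ?w x \<bullet> v x \<partial>M) = 2 * pi * \<epsilon>^2 * (\<Sum>a\<in>A. of_int (d a) * ((\<integral>x. ind (cball a \<rho>) x * fst (v x) \<partial>M) / (pi * \<rho>^2))) - \<sigma> * (\<integral>x. fst (v x) \<partial>M)"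
      using weak_solution_pair(2)[OF H vZ] by simp
  next
    let ?P = "perforated \<Omega> \<gamma> p \<epsilon>"
    have Peq: "?P = \<Omega> - (\<Union>a\<in>A. cball a \<rho>)" by (simp add: perforated_def A_def hole)
    have Ps: "?P \<in> sets lebesgue" unfolding Peq using domain_sets fin by (intro sets.Diff sets.finite_UN) auto
    have hs: "sqi M (weak_grad \<Omega> h)" using Z_snd[OF wZ] by simp
    have hm: "(\<lambda>x. ind \<Omega> x * (norm (weak_grad \<Omega> h x))^2) \<in> borel_measurable lebesgue"
    proof -
      have "(\<lambda>x. (norm (weak_grad \<Omega> h x))^2) \<in> borel_measurable M"
        using hs unfolding sqi_def by (blast intro: borel_measurable_integrable)
      then show ?thesis using domain_sets by (subst (asm) borel_measurable_restrict_space_iff) auto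
    qed
    have "(\<integral>x. (norm (weak_grad \<Omega> h x))^2 \<partial>lebesgue_on ?P) = (\<integral>x. ind ?P x * (norm (weak_grad \<Omega> h x))^2 \<partial>lebesgue)"
      using integral_restrict_space[of ?P lebesgue "\<lambda>x. (norm (weak_grad \<Omega> h x))^2"] Ps by simp
    \<comment> \<open>The energy is taken over the perforated domain, but the gradient vanishes on
      the holes, so the integral over \<open>\<Omega>\<close> is the same and the energy becomes a
      full norm.\<close>
    also have "\<dots> = (\<integral>x. ind \<Omega> x * (norm (weak_grad \<Omega> h x))^2 \<partial>lebesgue)"
    proof (rule integral_cong_AE)
      have "(\<lambda>x. ind ?P x * (norm (weak_grad \<Omega> h x))^2) = (\<lambda>x. ind ?P x * (ind \<Omega> x * (norm (weak_grad \<Omega> h x))^2))"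
        unfolding Peq by (auto simp: indicator_def)
      then show "(\<lambda>x. ind ?P x * (norm (weak_grad \<Omega> h x))^2) \<in> borel_measurable lebesgue"
        using hm Ps by (simp add: borel_measurable_times borel_measurable_indicator)
      have "AE x in M. \<forall>a\<in>A. x \<in> cball a \<rho> \<longrightarrow> weak_grad \<Omega> h x = 0" using hz fin by (subst AE_finite_all) auto
      then have "AE x in lebesgue. x \<in> \<Omega> \<longrightarrow> (\<forall>a\<in>A. x \<in> cball a \<rho> \<longrightarrow> weak_grad \<Omega> h x = 0)"
        using domain_sets by (simp add: AE_restrict_space_iff)
      then show "AE x in lebesgue. ind ?P x * (norm (weak_grad \<Omega> h x))^2 = ind \<Omega> x * (norm (weak_grad \<Omega> h x))^2"
        unfolding Peq by eventually_elim (auto simp: indicator_def)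
    qed (rule hm)
    also have "\<dots> = (\<integral>x. (norm (weak_grad \<Omega> h x))^2 \<partial>M)"
      using integral_restrict_space[of \<Omega> lebesgue "\<lambda>x. (norm (weak_grad \<Omega> h x))^2"] domain_sets by simp
    finally have "E_tilde \<Omega> \<sigma> \<gamma> p \<epsilon> d = 1/2 * ((\<integral>x. (norm (weak_grad \<Omega> h x))^2 \<partial>M) + (\<integral>x. (h x - \<sigma>)^2 \<partial>M))"
      by (simp add: E_tilde_def Let_def h_def[symmetric])
    also have "(\<integral>x. (norm (weak_grad \<Omega> h x))^2 \<partial>M) + (\<integral>x. (h x - \<sigma>)^2 \<partial>M) = (\<integral>x. (norm (weak_grad \<Omega> h x))^2 + (h x - \<sigma>)^2 \<partial>M)"
      using hs Z_fst[OF wZ] by (intro Bochner_Integration.integral_add[symmetric]) (auto simp: sqi_def)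
    also have "\<dots> = (nrm2 M ?w)^2" by (simp add: nrm2_sq norm_pair_sq add.commute)
    finally show "E_tilde \<Omega> \<sigma> \<gamma> p \<epsilon> d = (nrm2 M ?w)^2 / 2" by simp
  qed
qed

end

section \<open>Radial integrals and lattice cells\<close>

lemma emeasure_cball_plane: "r \<ge> 0 \<Longrightarrow> emeasure lborel (cball (a::real^2) r) = ennreal (pi * r^2)"
  using emeasure_cball[of r a] by (simp add: unit_ball_vol_2)

text \<open>This takes the place of polar coordinates for radial integrands: on half-lines the two
  measures agree because the disk of radius \<open>r\<close> has area \<open>pi * r^2\<close>, the
  integral of \<open>2 * pi * s\<close> from 0 to \<open>r\<close>.\<close>

lemma distr_norm_plane:
  "distr lborel borel (norm :: real^2 \<Rightarrow> real) = density lborel (\<lambda>r. ennreal (2 * pi * r) * indicator {0..} r)"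
proof (rule measure_eqI_generator_eq[where E="range atMost" and \<Omega>=UNIV and A="\<lambda>n. {..real n}"])
  show "Int_stable (range (atMost :: real \<Rightarrow> real set))" by (auto simp: Int_stable_def)
  show "sets (distr lborel borel (norm :: real^2 \<Rightarrow> real)) = sigma_sets UNIV (range atMost)"
    by (simp add: borel_eq_atMost sets_measure_of)
  show "sets (density lborel (\<lambda>r. ennreal (2 * pi * r) * indicator {0..} r)) = sigma_sets UNIV (range atMost)"
    by (simp add: borel_eq_atMost sets_measure_of)
  show "(\<Union>n. {..real n}) = UNIV" using real_arch_simple by auto
  have L: "emeasure (distr lborel borel (norm :: real^2 \<Rightarrow> real)) {..r} = emeasure lborel (cball (0::real^2) r)" for r
    by (subst emeasure_distr) (auto intro!: arg_cong[where f="emeasure lborel"])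
  show "emeasure (distr lborel borel (norm :: real^2 \<Rightarrow> real)) {..real n} \<noteq> \<infinity>" for n
    unfolding L by (simp add: emeasure_cball_plane)
  fix X assume "X \<in> range (atMost :: real \<Rightarrow> real set)"
  then obtain r where X: "X = {..r}" by auto
  have R: "emeasure (density lborel (\<lambda>r. ennreal (2 * pi * r) * indicator {0..} r)) X = (\<integral>\<^sup>+s. ennreal (2 * pi * s) * indicator {0..r} s \<partial>lborel)"
    unfolding X by (subst emeasure_density) (auto intro!: nn_integral_cong simp: indicator_def)
  show "emeasure (distr lborel borel (norm :: real^2 \<Rightarrow> real)) X = emeasure (density lborel (\<lambda>r. ennreal (2 * pi * r) * indicator {0..} r)) X"
  proof (cases "r \<ge> 0")
    case True
    have "(\<integral>\<^sup>+s. ennreal (2 * pi * s) * indicator {0..r} s \<partial>lborel) = ennreal (pi * r^2 - pi * 0^2)"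
      by (rule nn_integral_FTC_Icc[where F="\<lambda>s. pi * s^2"]) (use True in \<open>auto intro!: derivative_eq_intros\<close>)
    then show ?thesis unfolding R unfolding X L using True by (simp add: emeasure_cball_plane)
  next
    case False
    then have "cball (0::real^2) r = {}" "{0..r} = {}" by auto
    then show ?thesis unfolding R unfolding X L by simp
  qed
qed auto

lemma nn_integral_radial:
  assumes [measurable]: "h \<in> borel_measurable borel"
  shows "(\<integral>\<^sup>+x. h (norm (x::real^2)) \<partial>lborel) = (\<integral>\<^sup>+r. ennreal (2 * pi * r) * indicator {0..} r * h r \<partial>lborel)"
proof -
  have "(\<integral>\<^sup>+x. h (norm (x::real^2)) \<partial>lborel) = (\<integral>\<^sup>+r. h r \<partial>distr lborel borel (norm :: real^2 \<Rightarrow> real))"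
    by (subst nn_integral_distr) auto
  also have "\<dots> = (\<integral>\<^sup>+r. ennreal (2 * pi * r) * indicator {0..} r * h r \<partial>lborel)"
    unfolding distr_norm_plane by (subst nn_integral_density) auto
  finally show ?thesis .
qed

text \<open>The radial density \<open>G\<close> is given separately since at radius 0 the product
  \<open>2 * pi * s * f s\<close> may miss the continuous value: for \<open>f s = 1 / s\<close> it
  is 0 there, while \<open>G\<close> is the constant \<open>2 * pi\<close>.\<close>

lemma has_integral_radial:
  fixes f F G :: "real \<Rightarrow> real"
  assumes [measurable]: "f \<in> borel_measurable borel" "G \<in> borel_measurable borel" and ab: "0 \<le> \<alpha>" "\<alpha> \<le> \<beta>"
    and nn: "\<And>s. s \<in> {\<alpha>..\<beta>} \<Longrightarrow> f s \<ge> 0" "\<And>s. s \<in> {\<alpha>..\<beta>} \<Longrightarrow> G s \<ge> 0"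
    and G: "\<And>s. s \<in> {\<alpha>..\<beta>} \<Longrightarrow> s > 0 \<Longrightarrow> G s = 2 * pi * s * f s"
    and F: "\<And>s. s \<in> {\<alpha>..\<beta>} \<Longrightarrow> DERIV F s :> G s"
  shows "has_bochner_integral lborel (\<lambda>x::real^2. indicator {\<alpha>..\<beta>} (norm (x - a)) * f (norm (x - a))) (F \<beta> - F \<alpha>)"
proof -
  have le: "F \<alpha> \<le> F \<beta>" by (rule DERIV_nonneg_imp_nondecreasing[OF ab(2)]) (use F nn in \<open>auto intro!: exI[of _ "G _"]\<close>)
  have "(\<integral>\<^sup>+x. ennreal (indicator {\<alpha>..\<beta>} (norm x) * f (norm x)) \<partial>(lborel :: (real^2) measure)) = 
     (\<integral>\<^sup>+r. ennreal (2 * pi * r) * indicator {0..} r * ennreal (indicator {\<alpha>..\<beta>} r * f r) \<partial>lborel)"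
    by (rule nn_integral_radial) measurable
  also have "\<dots> = (\<integral>\<^sup>+r. ennreal (G r) * indicator {\<alpha>..\<beta>} r \<partial>lborel)"
  proof (rule nn_integral_cong_AE)
    have "AE r in lborel. r \<noteq> (0::real)" by (rule AE_lborel_singleton)
    then show "AE r in lborel. ennreal (2 * pi * r) * indicator {0..} r * ennreal (indicator {\<alpha>..\<beta>} r * f r) = ennreal (G r) * indicator {\<alpha>..\<beta>} r"
    proof eventually_elim
      case (elim r)
      show ?case
      proof (cases "r \<in> {\<alpha>..\<beta>}")
        case True
        then have "r > 0" using elim ab(1) by auto
        then show ?thesis using True G[OF True] nn(1)[OF True] by (simp flip: ennreal_mult)
      qed auto
    qed
  qed
  also have "\<dots> = ennreal (F \<beta> - F \<alpha>)"
    by (rule nn_integral_FTC_Icc) (use F nn ab in auto)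
  finally have "has_bochner_integral lborel (\<lambda>x::real^2. indicator {\<alpha>..\<beta>} (norm x) * f (norm x)) (F \<beta> - F \<alpha>)"
    by (intro has_bochner_integral_nn_integral) (use nn le in \<open>auto simp: indicator_def\<close>)
  moreover have m: "(\<lambda>x::real^2. indicator {\<alpha>..\<beta>} (norm x) * f (norm x)) \<in> borel_measurable borel" by measurable
  ultimately show ?thesis
    using integral_lborel_translation[OF m, of "-a"] integrable_lborel_translation[OF m, of "-a"]
    by (simp add: has_bochner_integral_iff)
qed

lemma has_integral_inverse_norm_sq:
  assumes "0 < \<rho>" "\<rho> \<le> R"
  shows "has_bochner_integral lborel (\<lambda>x::real^2. indicator {\<rho>..R} (norm (x - a)) * (1 / (norm (x - a))^2)) (2 * pi * ln (R / \<rho>))"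
proof -
  have "has_bochner_integral lborel (\<lambda>x::real^2. indicator {\<rho>..R} (norm (x - a)) * (1 / (norm (x - a))^2)) (2 * pi * ln R - 2 * pi * ln \<rho>)"
    by (rule has_integral_radial[where f="\<lambda>s. 1 / s^2" and G="\<lambda>s. 2 * pi / s" and F="\<lambda>s. 2 * pi * ln s"])
       (use assms in \<open>auto intro!: derivative_eq_intros simp: power2_eq_square\<close>)
  then show ?thesis using assms by (simp add: ln_div right_diff_distrib)
qed

lemma has_integral_inverse_norm:
  assumes "0 \<le> R"
  shows "has_bochner_integral lborel (\<lambda>x::real^2. indicator {0..R} (norm (x - a)) * (1 / norm (x - a))) (2 * pi * R)"
proof -
  have "has_bochner_integral lborel (\<lambda>x::real^2. indicator {0..R} (norm (x - a)) * (1 / norm (x - a))) (2 * pi * R - 2 * pi * 0)"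
    by (rule has_integral_radial[where f="\<lambda>s. 1 / s" and G="\<lambda>s. 2 * pi" and F="\<lambda>s. 2 * pi * s"])
       (use assms in \<open>auto intro!: derivative_eq_intros\<close>)
  then show ?thesis by simp
qed

section \<open>Geometry of the lattice\<close>

lemma center_coordinates:
  assumes "a \<in> centers \<Omega> p e"
  obtains k :: "2 \<Rightarrow> int" where "\<And>i. a $ i = p $ i + e * (of_int (k i) + 1/2)"
proof -
  obtain k :: "int^2" where "a = p + e *\<^sub>R (\<chi> i. of_int (k $ i) + 1/2)" using assms by (auto simp: centers_def)
  then show ?thesis by (intro that[of "\<lambda>i. k $ i"]) simp
qed

lemma centers_separated:
  assumes "a \<in> centers \<Omega> p e" "b \<in> centers \<Omega> p e" "a \<noteq> b" "e > 0"
  obtains i where "\<bar>a $ i - b $ i\<bar> \<ge> e"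
proof -
  obtain k l :: "2 \<Rightarrow> int" where k: "\<And>i. a $ i = p $ i + e * (of_int (k i) + 1/2)" and l: "\<And>i. b $ i = p $ i + e * (of_int (l i) + 1/2)"
    using center_coordinates[OF assms(1)] center_coordinates[OF assms(2)] by metis
  obtain i where "a $ i \<noteq> b $ i" using assms(3) by (auto simp: vec_eq_iff)
  then have "k i \<noteq> l i" using k[of i] l[of i] by auto
  then have "\<bar>real_of_int (k i) - real_of_int (l i)\<bar> \<ge> 1" by linarith
  then have "e * \<bar>real_of_int (k i) - real_of_int (l i)\<bar> \<ge> e" using assms(4) by simp
  moreover have "a $ i - b $ i = e * (real_of_int (k i) - real_of_int (l i))" using k l by (simp add: algebra_simps)
  ultimately show ?thesis using that[of i] assms(4) by (simp add: abs_mult)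
qed

text \<open>The open square, so that distinct cells are truly disjoint; the grid lines left out form
  a null set.\<close>

definition cell :: "real \<Rightarrow> real^2 \<Rightarrow> (real^2) set" where
  "cell e a = box (a - vec (e/2)) (a + vec (e/2))"

lemma mem_cell: "x \<in> cell e a \<longleftrightarrow> (\<forall>i. \<bar>x $ i - a $ i\<bar> < e / 2)"
proof -
  have "(a - vec (e/2)) $ i < x $ i \<and> x $ i < (a + vec (e/2)) $ i \<longleftrightarrow> \<bar>x $ i - a $ i\<bar> < e / 2" for i
    by (simp add: abs_less_iff) argo
  then show ?thesis unfolding cell_def mem_box_cart by simp
qed

lemma cells_disjoint:
  assumes "a \<in> centers \<Omega> p e" "b \<in> centers \<Omega> p e" "a \<noteq> b" "e > 0"
  shows "cell e a \<inter> cell e b = {}"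
proof -
  obtain i where "\<bar>a $ i - b $ i\<bar> \<ge> e" using centers_separated[OF assms] by blast
  moreover have False if "\<bar>x - u\<bar> < e/2" "\<bar>x - v\<bar> < e/2" "\<bar>u - v\<bar> \<ge> e" for x u v :: real using that by argo
  ultimately show ?thesis unfolding disjoint_iff mem_cell by blast
qed

lemma ball_subset_cell: "ball a (e/2) \<subseteq> cell e a"
proof
  fix x assume "x \<in> ball a (e/2)"
  then have "norm (x - a) < e / 2" by (simp add: dist_norm norm_minus_commute)
  moreover have "\<bar>x $ i - a $ i\<bar> \<le> norm (x - a)" for i using component_le_norm_cart[of "x - a" i] by simp
  ultimately show "x \<in> cell e a" unfolding mem_cell using le_less_trans by blast
qed

lemma cell_subset: "a \<in> centers \<Omega> p e \<Longrightarrow> cell e a \<subseteq> \<Omega>"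
  using box_subset_cbox unfolding centers_def cell_def by fastforce

lemma cball_subset_domain:
  assumes "a \<in> centers \<Omega> p e" "r \<le> e/2" shows "cball a r \<subseteq> \<Omega>"
proof -
  have "x \<in> cbox (a - vec (e/2)) (a + vec (e/2))" if "x \<in> cball a r" for x
  proof -
    have "norm (x - a) \<le> e / 2" using that assms by (simp add: dist_norm norm_minus_commute)
    then have "\<bar>x $ i - a $ i\<bar> \<le> e / 2" for i using component_le_norm_cart[of "x - a" i] by simp
    then show ?thesis unfolding mem_box_cart
    proof (intro allI)
      fix i
      show "(a - vec (e/2)) $ i \<le> x $ i \<and> x $ i \<le> (a + vec (e/2)) $ i" using \<open>\<bar>x $ i - a $ i\<bar> \<le> e / 2\<close>
        by (simp add: abs_le_iff) argo
    qed
  qed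
  then show ?thesis using assms by (auto simp: centers_def)
qed

lemma center_in_domain: "a \<in> centers \<Omega> p e \<Longrightarrow> e > 0 \<Longrightarrow> a \<in> \<Omega>"
  using cball_subset_domain[of a \<Omega> p e 0] by simp

lemma measure_cell: 
  assumes "e > 0" shows "emeasure lborel (cell e a) = ennreal (e^2)"
proof -
  have "emeasure lborel (cell e a) = ennreal (\<Prod>b\<in>Basis. ((a + vec (e/2)) - (a - vec (e/2))) \<bullet> b)"
    unfolding cell_def using assms by (intro emeasure_lborel_box) (auto simp: Basis_vec_def inner_axis)
  also have "(\<Prod>b\<in>Basis. ((a + vec (e/2)) - (a - vec (e/2))) \<bullet> b) = (\<Prod>b\<in>(Basis :: (real^2) set). e)"
    by (intro prod.cong) (auto simp: Basis_vec_def inner_axis)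
  also have "\<dots> = e^2" by simp
  finally show ?thesis .
qed

lemma cell_subset_cball: "cell e a \<subseteq> cball a e"
proof
  fix x assume x: "x \<in> cell e a"
  have "norm (x - a) \<le> (\<Sum>i\<in>UNIV. \<bar>(x - a) $ i\<bar>)" by (rule norm_le_l1_cart)
  also have "\<dots> \<le> e / 2 + e / 2" using x unfolding mem_cell sum_2 by (intro add_mono) (auto intro: less_imp_le)
  finally show "x \<in> cball a e" by (simp add: dist_norm norm_minus_commute)
qed

context bounded_domain
begin

lemma finite_centers: 
  assumes "e > 0" shows "finite (centers \<Omega> p e)"
proof -
  obtain B where B: "\<And>x. x \<in> \<Omega> \<Longrightarrow> norm x \<le> B" using bounded_domain by (auto simp: bounded_iff)
  define L where "L = \<lceil>(B + norm p) / e\<rceil> + 1"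
  define f where "f ij = (\<chi> i::2. p $ i + e * (of_int (if i = 1 then fst ij else snd ij) + 1/2))" for ij :: "int \<times> int"
  have "centers \<Omega> p e \<subseteq> f ` ({-L..L} \<times> {-L..L})"
  proof
    fix a assume a: "a \<in> centers \<Omega> p e"
    obtain k :: "2 \<Rightarrow> int" where k: "\<And>i. a $ i = p $ i + e * (of_int (k i) + 1/2)" using center_coordinates[OF a] by metis
    have kb: "k i \<in> {-L..L}" for i
    proof -
      have "\<bar>a $ i\<bar> \<le> B" "\<bar>p $ i\<bar> \<le> norm p" using component_le_norm_cart[of a i] component_le_norm_cart[of p i] B[OF center_in_domain[OF a assms]] by auto
      then have "\<bar>e * (of_int (k i) + 1/2)\<bar> \<le> B + norm p" using k[of i] by linarith
      then have "e * \<bar>of_int (k i) + 1/2\<bar> \<le> B + norm p" using assms by (simp add: abs_mult)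
      then have "\<bar>of_int (k i) + 1/2\<bar> \<le> (B + norm p) / e" using assms by (simp add: pos_le_divide_eq mult.commute)
      then show ?thesis unfolding L_def by (auto simp: abs_le_iff) linarith+
    qed
    have "i = 1 \<or> i = 2" for i :: 2 using exhaust_2 by blast
    then have "a = f (k 1, k 2)" unfolding f_def vec_eq_iff using k by (auto; metis)
    then show "a \<in> f ` ({-L..L} \<times> {-L..L})" using kb by auto
  qed
  then show ?thesis by (rule finite_subset) auto
qed

text \<open>The cells are disjoint and lie in \<open>\<Omega>\<close>; there are thus at most of the
  order of \<open>e^-2\<close> holes.\<close>

lemma card_centers:
  assumes "e > 0" shows "real (card (centers \<Omega> p e)) * e^2 \<le> measure lebesgue \<Omega>"
proof -
  let ?A = "centers \<Omega> p e"
  have c: "cell e a \<in> lmeasurable" for a by (simp add: cell_def)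
  have m: "measure lebesgue (cell e a) = e^2" for a
    using measure_cell[OF assms, of a] by (simp add: measure_def cell_def)
  have "measure lebesgue (\<Union>a\<in>?A. cell e a) = (\<Sum>a\<in>?A. measure lebesgue (cell e a))"
    by (rule measure_UNION') (use c finite_centers[OF assms] cells_disjoint assms in \<open>auto simp: pairwise_def disjnt_def\<close>)
  then have "real (card ?A) * e^2 = measure lebesgue (\<Union>a\<in>?A. cell e a)" by (simp add: m)
  also have "\<dots> \<le> measure lebesgue \<Omega>"
  proof (rule measure_mono_fmeasurable[OF _ _ domain_lmeasurable])
    show "(\<Union>a\<in>?A. cell e a) \<subseteq> \<Omega>" using cell_subset by blast
    show "(\<Union>a\<in>?A. cell e a) \<in> sets lebesgue" using c finite_centers[OF assms] by (intro sets.finite_UN) auto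
  qed
  finally show ?thesis .
qed

end

section \<open>Logarithmic bumps\<close>

text \<open>The derivative is continuous, and off the unit interval the step is locally
  constant.\<close>

lemma smooth_step_derivative_bounded:
  obtains st' C where "\<And>t. DERIV smooth_step t :> st' t" "\<And>t. \<bar>st' t\<bar> \<le> C" "C \<ge> 0"
proof -
  obtain st' where d: "\<And>t. DERIV smooth_step t :> st' t" and c: "continuous_on UNIV st'"
    using smooth1_step[of "Suc 0"] by auto
  have loc: "st' t = 0" if "open S" "t \<in> S" "\<And>s. s \<in> S \<Longrightarrow> smooth_step s = k" for t k and S :: "real set"
  proof -
    have "(smooth_step has_derivative (\<lambda>h. 0)) (at t)"
      by (rule has_derivative_transform_within_open[OF has_derivative_const[of k] that(1,2)]) (use that(3) in simp)
    then have "DERIV smooth_step t :> 0" by (simp add: has_field_derivative_def lambda_zero)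
    then show ?thesis using d DERIV_unique by blast
  qed
  have z: "st' t = 0" if t: "t \<notin> {0..1}" for t
  proof (cases "t < 0")
    case True
    then show ?thesis by (intro loc[of "{..<0}" t 0]) (auto simp: smooth_step_0)
  next
    case False
    then show ?thesis using t by (intro loc[of "{1<..}" t 1]) (auto simp: smooth_step_1)
  qed
  have "bounded (st' ` {0..1})"
    by (intro compact_imp_bounded compact_continuous_image) (use c in \<open>auto intro: continuous_on_subset\<close>)
  then obtain C where "\<forall>y\<in>st' ` {0..1}. norm y \<le> C" unfolding bounded_iff by blast
  then have C: "\<bar>st' t\<bar> \<le> C" if "t \<in> {0..1}" for t using that by auto
  show ?thesis
  proof (rule that[OF d])
    show "\<bar>st' t\<bar> \<le> max C 0" for t using C[of t] z[of t] by (cases "t \<in> {0..1}") auto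
  qed simp
qed

text \<open>In the variable \<open>s = norm (x - a)^2\<close> the function
  \<open>ln (R / norm (x - a))\<close> has derivative \<open>- 1 / (2 s)\<close>. Here
  \<open>q\<close> is \<open>1 / (2 s)\<close> with smooth cut-offs on
  \<open>[2 \<rho>^2, 3 \<rho>^2]\<close> and \<open>[R^2 / 2, R^2]\<close>, and \<open>g\<close>
  integrates \<open>q\<close> from \<open>s\<close> to \<open>R^2\<close>. The plateau reaches up to
  \<open>2 \<rho>^2\<close>, beyond the hole, so that the gradient vanishes on the closed hole. The
  two cut-offs cost the factors 3 and 2, hence the 6 in the lower bound.\<close>

lemma logarithmic_profile:
  fixes \<rho> R :: real
  assumes \<rho>: "0 < \<rho>" and R: "6 * \<rho>^2 \<le> R^2" "0 < R"
  obtains g q where "\<And>n. smooth1 n g" "\<And>s. DERIV g s :> - q s" "\<And>s. q s \<ge> 0" "\<And>s. s \<le> 2 * \<rho>^2 \<or> R^2 \<le> s \<Longrightarrow> q s = 0"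
    "\<And>s. s > 0 \<Longrightarrow> q s \<le> 1 / (2 * s)" "\<And>s. s \<ge> R^2 \<Longrightarrow> g s = 0" "\<And>s. s \<le> 2 * \<rho>^2 \<Longrightarrow> g s = g 0"
    "g 0 \<ge> ln (R^2 / (6 * \<rho>^2)) / 2" "\<And>s. 0 \<le> g s" "\<And>s. 0 < s \<Longrightarrow> s \<le> R^2 \<Longrightarrow> g s \<le> ln (R^2 / s) / 2"
proof -
  have r2: "\<rho>^2 > 0" "R^2 > 0" using \<rho> R by auto
  define P where "P s = smooth_step ((1 / \<rho>^2) * s + (-2)) * smooth_step ((-2 / R^2) * s + 2)" for s
  have sP: "smooth1 n P" for n unfolding P_def[abs_def] by (intro smooth1_mult smooth1_affine smooth1_step)
  have P01: "0 \<le> P s" "P s \<le> 1" for s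
    unfolding P_def using smooth_step_nonneg smooth_step_le_1 by (auto intro!: mult_nonneg_nonneg mult_le_one)
  have P0: "P s = 0" if "s \<le> 2 * \<rho>^2 \<or> R^2 \<le> s" for s
  proof -
    have "(1 / \<rho>^2) * s + (-2) \<le> 0 \<or> (-2 / R^2) * s + 2 \<le> 0" using that r2 by (auto simp: field_simps)
    then show ?thesis unfolding P_def using smooth_step_0 by auto
  qed
  have P1: "P s = 1" if "3 * \<rho>^2 \<le> s" "s \<le> R^2 / 2" for s
  proof -
    have "(1 / \<rho>^2) * s + (-2) \<ge> 1" "(-2 / R^2) * s + 2 \<ge> 1" using that r2 by (auto simp: field_simps)
    then show ?thesis unfolding P_def using smooth_step_1 by simp
  qed
  define q where "q s = (1/2) * P s / s" for s
  have sq: "smooth1 n q" for n unfolding q_def[abs_def]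
  proof (rule smooth1_div_ident[of _ _ "2 * \<rho>^2"])
    show "smooth1 n (\<lambda>s. (1/2) * P s)" by (intro smooth1_mult smooth1_const sP)
  qed (use P0 r2 in auto)
  have q0: "q s = 0" if "s \<le> 2 * \<rho>^2 \<or> R^2 \<le> s" for s using P0[OF that] by (simp add: q_def)
  have qle: "q s \<le> 1 / (2 * s)" if "s > 0" for s using P01(2)[of s] that by (simp add: q_def field_simps)
  have qnn: "q s \<ge> 0" for s
  proof (cases "s > 0")
    case True then show ?thesis using P01(1)[of s] by (simp add: q_def)
  next
    case False
    then have "s \<le> 2 * \<rho>^2" using r2 by linarith
    then show ?thesis using q0[of s] by simp
  qed
  have contq: "continuous_on UNIV q" using sq[of 0] by simp
  obtain Q where "\<forall>x. - \<infinity> < ereal x \<longrightarrow> ereal x < \<infinity> \<longrightarrow> (Q has_vector_derivative q x) (at x)"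
    using einterval_antiderivative[of "-\<infinity>" "\<infinity>" q] contq by (auto simp: continuous_on_eq_continuous_at)
  then have Q: "DERIV Q x :> q x" for x by (simp add: has_real_derivative_iff_has_vector_derivative)
  define g where "g s = Q (R^2) - Q s" for s
  have g: "DERIV g s :> - q s" for s unfolding g_def[abs_def] by (auto intro!: derivative_eq_intros Q)
  have Qc: "Q s = Q t" if "s \<le> t" "\<And>x. s < x \<Longrightarrow> x < t \<Longrightarrow> q x = 0" for s t
  proof (cases "s < t")
    case True
    then obtain z where "s < z" "z < t" "Q t - Q s = (t - s) * q z" using MVT2[of s t Q q] Q by auto
    then show ?thesis using that(2) by simp
  qed (use that in auto)
  have Qmono: "Q s \<le> Q t" if "s \<le> t" for s t
    by (rule DERIV_nonneg_imp_nondecreasing[OF that]) (use Q qnn in blast)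
  have sg: "smooth1 n g" for n
  proof (cases n)
    case 0 then show ?thesis using g DERIV_isCont by (auto simp: continuous_on_eq_continuous_at)
  next
    case (Suc m)
    have "smooth1 m (\<lambda>s. (-1) * q s)" by (intro smooth1_mult smooth1_const sq)
    then show ?thesis using g unfolding Suc by (auto intro!: exI[of _ "\<lambda>s. - q s"])
  qed
  have gR: "g s = 0" if "s \<ge> R^2" for s using Qc[of "R^2" s] that q0 by (auto simp: g_def)
  have g0: "g s = g 0" if "s \<le> 2 * \<rho>^2" for s
  proof (cases "s \<le> 0")
    case True then show ?thesis using Qc[of s 0] q0 r2 by (auto simp: g_def)
  next
    case False then show ?thesis using Qc[of 0 s] q0 that by (auto simp: g_def)
  qed
  have gnn: "0 \<le> g s" for s
    using Qmono[of s "R^2"] gR[of s] by (cases "s \<le> R^2") (auto simp: g_def)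
  have low: "g 0 \<ge> ln (R^2 / (6 * \<rho>^2)) / 2"
  proof -
    have le: "3 * \<rho>^2 \<le> R^2 / 2" using R by simp
    \<comment> \<open>Where \<open>P = 1\<close> both functions have the same derivative, so the
      logarithmic increment between the cut-offs is kept in full; outside them \<open>Q\<close> can
      only grow.\<close>
    have "ln (R^2 / 2) / 2 - Q (R^2 / 2) \<le> ln (3 * \<rho>^2) / 2 - Q (3 * \<rho>^2)"
    proof (rule DERIV_nonpos_imp_nonincreasing[OF le, of "\<lambda>s. ln s / 2 - Q s"])
      fix x assume x: "3 * \<rho>^2 \<le> x" "x \<le> R^2 / 2"
      then have "x > 0" using r2 by linarith
      then have "DERIV (\<lambda>s. ln s / 2 - Q s) x :> 1 / x / 2 - q x" by (auto intro!: derivative_eq_intros Q)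
      moreover have "1 / x / 2 - q x = 0" using P1[OF x] by (simp add: q_def)
      ultimately show "\<exists>y. DERIV (\<lambda>s. ln s / 2 - Q s) x :> y \<and> y \<le> 0" by auto
    qed
    moreover have "Q 0 \<le> Q (3 * \<rho>^2)" "Q (R^2 / 2) \<le> Q (R^2)" using r2 by (auto intro!: Qmono)
    moreover have "ln (R^2 / (6 * \<rho>^2)) = ln (R^2 / 2) - ln (3 * \<rho>^2)"
    proof -
      have "R^2 / (6 * \<rho>^2) = (R^2 / 2) / (3 * \<rho>^2)" by simp
      then show ?thesis using r2 ln_div[of "R^2 / 2" "3 * \<rho>^2"] by simp
    qed
    ultimately show ?thesis unfolding g_def by argo
  qed
  have upp: "g s \<le> ln (R^2 / s) / 2" if s: "0 < s" "s \<le> R^2" for s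
  proof -
    have "Q (R^2) - ln (R^2) / 2 \<le> Q s - ln s / 2"
    proof (rule DERIV_nonpos_imp_nonincreasing[OF s(2), of "\<lambda>s. Q s - ln s / 2"])
      fix x assume x: "s \<le> x" "x \<le> R^2"
      then have "DERIV (\<lambda>s. Q s - ln s / 2) x :> q x - 1 / x / 2" using s by (auto intro!: derivative_eq_intros Q)
      moreover have "q x - 1 / x / 2 \<le> 0" using qle[of x] s x by simp
      ultimately show "\<exists>y. DERIV (\<lambda>s. Q s - ln s / 2) x :> y \<and> y \<le> 0" by blast
    qed
    moreover have "ln (R^2 / s) = ln (R^2) - ln s" using s r2 by (simp add: ln_div)
    ultimately show ?thesis unfolding g_def by argo
  qed
  show ?thesis by (rule that[OF sg g qnn q0 qle gR g0 low gnn upp])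
qed

text \<open>This trades the square of the logarithmic singularity for
  \<open>R / norm (x - a)\<close>, whose radial integral is already computed.\<close>

lemma ln_sq_le: "0 < y \<Longrightarrow> 1 \<le> y \<Longrightarrow> (ln y)^2 \<le> 4 * (y::real)"
proof -
  assume y: "0 < y" "1 \<le> y"
  have "ln (sqrt y) \<le> sqrt y" using y by (intro ln_bound) auto
  then have "ln y \<le> 2 * sqrt y" using y by (simp add: ln_sqrt)
  then have "(ln y)^2 \<le> (2 * sqrt y)^2" using y by (intro power_mono) auto
  then show ?thesis using y by (simp add: power_mult_distrib)
qed

text \<open>The gradient is at most \<open>1 / norm (x - a)\<close> on the annulus and zero
  elsewhere. Its square integrates to a logarithm, while the \<open>L^1\<close> norm of the gradient
  and the squared \<open>L^2\<close> norm of the bump are of order \<open>R\<close> and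
  \<open>R^2\<close>: only the Dirichlet energy survives in the limit.\<close>

lemma logarithmic_bump:
  fixes \<rho> R :: real
  assumes \<rho>: "0 < \<rho>" and R: "6 * \<rho>^2 \<le> R^2" "0 < R" and sub: "cball a R \<subseteq> \<Omega>"
  obtains \<Psi> c where "test_function \<Omega> \<Psi>" "\<And>x. (norm (x - a))^2 \<le> 2 * \<rho>^2 \<Longrightarrow> \<Psi> x = c" "\<And>x. norm (x - a) \<ge> R \<Longrightarrow> \<Psi> x = 0 \<and> grad \<Psi> x = 0"
    "c \<ge> ln (R / \<rho>) - ln 6 / 2" "(\<integral>x. (norm (grad \<Psi> x))^2 \<partial>lborel) \<le> 2 * pi * ln (R / \<rho>)"
    "(\<integral>x. norm (grad \<Psi> x) \<partial>lborel) \<le> 2 * pi * R" "(\<integral>x. (\<Psi> x)^2 \<partial>lborel) \<le> 8 * pi * R^2"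
proof (rule logarithmic_profile[OF \<rho> R])
  fix g q :: "real \<Rightarrow> real"
  assume g: "\<And>n. smooth1 n g" "\<And>s. DERIV g s :> - q s" "\<And>s. q s \<ge> 0" "\<And>s. s \<le> 2 * \<rho>^2 \<or> R^2 \<le> s \<Longrightarrow> q s = 0"
    "\<And>s. s > 0 \<Longrightarrow> q s \<le> 1 / (2 * s)" "\<And>s. s \<ge> R^2 \<Longrightarrow> g s = 0" "\<And>s. s \<le> 2 * \<rho>^2 \<Longrightarrow> g s = g 0"
    "g 0 \<ge> ln (R^2 / (6 * \<rho>^2)) / 2" "\<And>s. 0 \<le> g s" "\<And>s. 0 < s \<Longrightarrow> s \<le> R^2 \<Longrightarrow> g s \<le> ln (R^2 / s) / 2"
  define \<Psi> where "\<Psi> x = g ((norm (x - a))^2)" for x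
  have rR: "\<rho> \<le> R"
  proof (rule power2_le_imp_le)
    show "\<rho>^2 \<le> R^2" using R(1) zero_le_power2[of \<rho>] by linarith
  qed (use R in simp)
  have far: "(norm (x - a))^2 \<ge> R^2" if "norm (x - a) \<ge> R" for x using that R by (intro power_mono) auto
  have t: "test_function \<Omega> \<Psi>"
  proof (rule test_functionI[OF _ compact_cball sub])
    show "cont_diff n \<Psi>" for n unfolding \<Psi>_def[abs_def] by (rule cont_diff_compose[OF g(1) cont_diff_dist_sq])
    show "\<Psi> x = 0" if "x \<notin> cball a R" for x
      unfolding \<Psi>_def by (rule g(6)[OF far]) (use that in \<open>auto simp: dist_norm norm_minus_commute\<close>)
  qed
  have gr: "grad \<Psi> x = (- 2 * q ((norm (x - a))^2)) *\<^sub>R (x - a)" for x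
    unfolding \<Psi>_def[abs_def] using grad_eq[OF GDERIV_compose1[OF GDERIV_dist_sq g(2)], of a x] by simp
  have bd: "norm (grad \<Psi> x) \<le> indicator {\<rho>..R} (norm (x - a)) * (1 / norm (x - a))" for x
  proof (cases "norm (x - a) \<in> {\<rho>..R}")
    case True
    then have p: "norm (x - a) > 0" using \<rho> by auto
    have "norm (grad \<Psi> x) = 2 * q ((norm (x - a))^2) * norm (x - a)" using g(3) by (simp add: gr)
    also have "\<dots> \<le> 2 * (1 / (2 * (norm (x - a))^2)) * norm (x - a)"
      using g(5)[of "(norm (x - a))^2"] p by (intro mult_right_mono mult_left_mono) auto
    also have "\<dots> = 1 / norm (x - a)" using p by (simp add: power2_eq_square)
    finally show ?thesis using True by simp
  next
    case False
    have "(norm (x - a))^2 \<le> 2 * \<rho>^2 \<or> R^2 \<le> (norm (x - a))^2"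
    proof (cases "norm (x - a) \<ge> R")
      case True then show ?thesis using far by blast
    next
      case F: False
      then have "norm (x - a) \<le> \<rho>" using False by auto
      then have "(norm (x - a))^2 \<le> \<rho>^2" by (intro power_mono) auto
      then show ?thesis using zero_le_power2[of \<rho>] by linarith
    qed
    then show ?thesis using g(4) by (simp add: gr)
  qed
  note hi2 = has_integral_inverse_norm_sq[OF \<rho> rR, of a, unfolded has_bochner_integral_iff]
  note hi1 = has_integral_inverse_norm[of R a, unfolded has_bochner_integral_iff]
  show ?thesis
  proof (rule that[OF t])
    show "\<Psi> x = g 0" if "(norm (x - a))^2 \<le> 2 * \<rho>^2" for x using g(7)[OF that] by (simp add: \<Psi>_def)
    show "\<Psi> x = 0 \<and> grad \<Psi> x = 0" if "norm (x - a) \<ge> R" for x using g(4,6) far[OF that] by (simp add: \<Psi>_def gr)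
    have "R^2 / (6 * \<rho>^2) = (R / \<rho>)^2 / 6" by (simp add: power_divide)
    moreover have "ln (y^2 / 6) = 2 * ln y - ln 6" if "y > 0" for y :: real using that by (simp add: ln_div ln_realpow)
    moreover have "R / \<rho> > 0" using \<rho> R(2) by simp
    ultimately have "ln (R^2 / (6 * \<rho>^2)) = 2 * ln (R / \<rho>) - ln 6" by (simp only:)
    then have "ln (R^2 / (6 * \<rho>^2)) / 2 = ln (R / \<rho>) - ln 6 / 2" by simp
    then show "g 0 \<ge> ln (R / \<rho>) - ln 6 / 2" using g(8) by simp
    have "(\<integral>x. (norm (grad \<Psi> x))^2 \<partial>lborel) \<le> (\<integral>x. indicator {\<rho>..R} (norm (x - a)) * (1 / (norm (x - a))^2) \<partial>lborel)"
    proof (rule integral_mono'[OF conjunct1[OF hi2]])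
      show "(norm (grad \<Psi> x))^2 \<le> indicator {\<rho>..R} (norm (x - a)) * (1 / (norm (x - a))^2)" for x
        using power_mono[OF bd[of x], of 2] by (auto simp: indicator_def power_divide split: if_splits)
    qed auto
    then show "(\<integral>x. (norm (grad \<Psi> x))^2 \<partial>lborel) \<le> 2 * pi * ln (R / \<rho>)" using hi2 by simp
    have "(\<integral>x. norm (grad \<Psi> x) \<partial>lborel) \<le> (\<integral>x. indicator {0..R} (norm (x - a)) * (1 / norm (x - a)) \<partial>lborel)"
    proof (rule integral_mono')
      show "integrable lborel (\<lambda>x. indicator {0..R} (norm (x - a)) * (1 / norm (x - a)))" using hi1 R by simp
      show "norm (grad \<Psi> x) \<le> indicator {0..R} (norm (x - a)) * (1 / norm (x - a))" for x
      proof -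
        have "indicator {\<rho>..R} t * (1 / t) \<le> indicator {0..R} t * (1 / t)" if "t \<ge> 0" for t :: real
          using that \<rho> by (auto simp: indicator_def of_bool_def)
        then show ?thesis using bd[of x] by (meson norm_ge_zero order_trans)
      qed
    qed auto
    then show "(\<integral>x. norm (grad \<Psi> x) \<partial>lborel) \<le> 2 * pi * R" using hi1 R by simp
    have "(\<integral>x. (\<Psi> x)^2 \<partial>lborel) \<le> (\<integral>x. 4 * R * (indicator {0..R} (norm (x - a)) * (1 / norm (x - a))) \<partial>lborel)"
    proof (rule integral_mono_AE)
      show "integrable lborel (\<lambda>x. 4 * R * (indicator {0..R} (norm (x - a)) * (1 / norm (x - a))))"
        using hi1 R by (intro integrable_mult_right) simp
      have "test_function \<Omega> (\<lambda>x. \<Psi> x * \<Psi> x)" by (rule test_function_mult(1)[OF t t])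
      then show "integrable lborel (\<lambda>x. (\<Psi> x)^2)" using test_function_integrable(1) by (simp add: power2_eq_square)
      have "AE x in lborel. x \<noteq> a" by (rule AE_lborel_singleton)
      then show "AE x in lborel. (\<Psi> x)^2 \<le> 4 * R * (indicator {0..R} (norm (x - a)) * (1 / norm (x - a)))"
      proof eventually_elim
        case (elim x)
        show ?case
        proof (cases "norm (x - a) \<le> R")
          case True
          have p: "norm (x - a) > 0" using elim by simp
          have le: "(norm (x - a))^2 \<le> R^2" using True by (intro power_mono) auto
          have "g ((norm (x - a))^2) \<le> ln (R^2 / (norm (x - a))^2) / 2" using g(10) p le by simp
          also have "\<dots> = ln (R / norm (x - a))" using p R by (simp add: ln_div ln_realpow flip: power_divide)
          finally have "(\<Psi> x)^2 \<le> (ln (R / norm (x - a)))^2" unfolding \<Psi>_def using g(9) by (intro power_mono) auto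
          also have "\<dots> \<le> 4 * (R / norm (x - a))" using p True R by (intro ln_sq_le) auto
          finally show ?thesis using True p by simp
        next
          case False
          then show ?thesis using g(6)[OF far[of x]] by (simp add: \<Psi>_def)
        qed
      qed
    qed
    also have "\<dots> = 4 * R * (2 * pi * R)" using hi1 R by (subst integral_mult_right_zero) simp
    also have "\<dots> = 8 * pi * R^2" by (simp add: power2_eq_square)
    finally show "(\<integral>x. (\<Psi> x)^2 \<partial>lborel) \<le> 8 * pi * R^2" .
  qed
qed

text \<open>Adding \<open>r\<close> to \<open>\<phi>\<close> freezes it at the value
  \<open>\<phi> a\<close> near the hole. The cut-off has slope of order \<open>1 / \<rho>\<close>,
  but it multiplies \<open>\<phi> a - \<phi> x\<close>, which is at most \<open>2 B \<rho>\<close>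
  on the support, so the gradient stays bounded. The \<open>8 C\<close> is the product of
  \<open>2 \<rho>\<close>, \<open>C / \<rho>^2\<close> and \<open>4 \<rho>\<close>.\<close>

lemma flattening_bump:
  assumes \<rho>: "0 < \<rho>" and sub: "cball a (2 * \<rho>) \<subseteq> \<Omega>" and \<phi>: "test_function \<Omega> \<phi>" and B: "B \<ge> 0" "\<And>x. norm (grad \<phi> x) \<le> B" "\<And>x y. \<bar>\<phi> x - \<phi> y\<bar> \<le> B * norm (x - y)"
    and st: "\<And>t. DERIV smooth_step t :> st' t" "\<And>t. \<bar>st' t\<bar> \<le> C"
  obtains r where "test_function \<Omega> r" "\<And>x. (norm (x - a))^2 \<le> 2 * \<rho>^2 \<Longrightarrow> r x = \<phi> a - \<phi> x" "\<And>x. norm (x - a) > 2 * \<rho> \<Longrightarrow> r x = 0 \<and> grad r x = 0"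
    "\<And>x. \<bar>r x\<bar> \<le> 2 * B * \<rho>" "\<And>x. norm (grad r x) \<le> B * (8 * C + 1)"
proof -
  define s where "s x = (norm (x - a))^2" for x :: "real^2"
  define \<eta> where "\<eta> x = smooth_step ((-1 / \<rho>^2) * s x + 3)" for x
  define r where "r x = \<eta> x * (\<phi> a - \<phi> x)" for x
  have r2: "\<rho>^2 > 0" using \<rho> by simp
  have far: "s x \<ge> 4 * \<rho>^2" if "norm (x - a) \<ge> 2 * \<rho>" for x
    using power_mono[OF that, of 2] \<rho> by (simp add: s_def power_mult_distrib)
  have \<eta>0: "\<eta> x = 0" if "norm (x - a) \<ge> 2 * \<rho>" for x
  proof -
    have "3 * \<rho>^2 \<le> s x" using far[OF that] r2 by linarith
    then show ?thesis unfolding \<eta>_def by (intro smooth_step_0) (use r2 in \<open>auto simp: field_simps\<close>)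
  qed
  have \<eta>1: "\<eta> x = 1" if "s x \<le> 2 * \<rho>^2" for x
    unfolding \<eta>_def by (rule smooth_step_1) (use that r2 in \<open>auto simp: field_simps\<close>)
  have \<eta>01: "0 \<le> \<eta> x" "\<eta> x \<le> 1" for x by (simp_all add: \<eta>_def smooth_step_nonneg smooth_step_le_1)
  have c\<eta>: "cont_diff n \<eta>" for n unfolding \<eta>_def[abs_def] s_def
    by (rule cont_diff_compose[OF smooth1_affine[OF smooth1_step] cont_diff_dist_sq])
  have t: "test_function \<Omega> r"
  proof (rule test_functionI[OF _ compact_cball sub])
    show "cont_diff n r" for n unfolding r_def[abs_def]
      using \<phi> by (intro cont_diff_mult c\<eta> cont_diff_diff cont_diff_const) (simp add: test_function_def)
    show "r x = 0" if "x \<notin> cball a (2 * \<rho>)" for x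
      using \<eta>0[of x] that by (simp add: r_def dist_norm norm_minus_commute)
  qed
  have "DERIV (\<lambda>t. smooth_step ((-1 / \<rho>^2) * t + 3)) u :> st' ((-1 / \<rho>^2) * u + 3) * (-1 / \<rho>^2)" for u
  proof -
    have "DERIV (\<lambda>t. (-1 / \<rho>^2) * t + 3) u :> (-1 / \<rho>^2) * 1 + 0"
      by (intro DERIV_add DERIV_cmult DERIV_ident DERIV_const)
    then have "DERIV (\<lambda>t. (-1 / \<rho>^2) * t + 3) u :> (-1 / \<rho>^2)" by simp
    then show ?thesis using DERIV_chain2[OF st(1)] by blast
  qed
  then have "GDERIV \<eta> x :> (st' ((-1 / \<rho>^2) * s x + 3) * (-1 / \<rho>^2)) *\<^sub>R (2 *\<^sub>R (x - a))" for x
    unfolding \<eta>_def[abs_def] s_def using GDERIV_compose1[OF GDERIV_dist_sq, of "\<lambda>t. smooth_step ((-1 / \<rho>^2) * t + 3)"] by blast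
  then have "GDERIV r x :> \<eta> x *\<^sub>R (0 - grad \<phi> x) + (\<phi> a - \<phi> x) *\<^sub>R ((st' ((-1 / \<rho>^2) * s x + 3) * (-1 / \<rho>^2)) *\<^sub>R (2 *\<^sub>R (x - a)))" for x
    unfolding r_def[abs_def] by (intro GDERIV_mult GDERIV_diff GDERIV_const test_function_GDERIV[OF \<phi>])
  then have gr: "grad r x = \<eta> x *\<^sub>R (0 - grad \<phi> x) + (\<phi> a - \<phi> x) *\<^sub>R ((st' ((-1 / \<rho>^2) * s x + 3) * (-1 / \<rho>^2)) *\<^sub>R (2 *\<^sub>R (x - a)))" for x
    by (rule grad_eq)
  have out: "r x = 0 \<and> grad r x = 0" if x: "norm (x - a) > 2 * \<rho>" for x
  proof -
    have "{x. r x \<noteq> 0} \<subseteq> cball a (2 * \<rho>)"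
      using \<eta>0 by (auto simp: r_def dist_norm norm_minus_commute) (meson linear)
    then have "closure {x. r x \<noteq> 0} \<subseteq> cball a (2 * \<rho>)" by (simp add: closure_minimal)
    then have "x \<notin> closure {x. r x \<noteq> 0}" using x by (auto simp: dist_norm norm_minus_commute)
    then show ?thesis using grad_eq_0_outside_support \<eta>0[of x] x by (simp add: r_def)
  qed
  have near: "\<bar>\<phi> a - \<phi> x\<bar> \<le> 2 * B * \<rho>" if "norm (x - a) \<le> 2 * \<rho>" for x
    using B(3)[of a x] mult_left_mono[OF that B(1)] by (simp add: norm_minus_commute)
  have C0: "C \<ge> 0" using st(2)[of 0] by linarith
  show ?thesis
  proof (rule that[OF t])
    show "r x = \<phi> a - \<phi> x" if "(norm (x - a))^2 \<le> 2 * \<rho>^2" for x using \<eta>1[of x] that by (simp add: r_def s_def)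
    show "r x = 0 \<and> grad r x = 0" if "norm (x - a) > 2 * \<rho>" for x by (rule out[OF that])
    show "\<bar>r x\<bar> \<le> 2 * B * \<rho>" for x
    proof (cases "norm (x - a) \<le> 2 * \<rho>")
      case True
      have "\<eta> x * \<bar>\<phi> a - \<phi> x\<bar> \<le> 1 * (2 * B * \<rho>)" by (intro mult_mono \<eta>01 near[OF True]) auto
      then show ?thesis using \<eta>01(1)[of x] by (simp add: r_def abs_mult)
    next
      case False then show ?thesis using out[of x] B \<rho> by simp
    qed
    show "norm (grad r x) \<le> B * (8 * C + 1)" for x
    proof (cases "norm (x - a) \<le> 2 * \<rho>")
      case True
      have "norm (grad r x) \<le> norm (\<eta> x *\<^sub>R (0 - grad \<phi> x)) + norm ((\<phi> a - \<phi> x) *\<^sub>R ((st' ((-1 / \<rho>^2) * s x + 3) * (-1 / \<rho>^2)) *\<^sub>R (2 *\<^sub>R (x - a))))"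
        unfolding gr by (rule norm_triangle_ineq)
      also have "norm (\<eta> x *\<^sub>R (0 - grad \<phi> x)) \<le> 1 * B"
        unfolding norm_scaleR using \<eta>01[of x] B by (intro mult_mono) auto
      also have "norm ((\<phi> a - \<phi> x) *\<^sub>R ((st' ((-1 / \<rho>^2) * s x + 3) * (-1 / \<rho>^2)) *\<^sub>R (2 *\<^sub>R (x - a)))) =
          \<bar>\<phi> a - \<phi> x\<bar> * ((\<bar>st' ((-1 / \<rho>^2) * s x + 3)\<bar> * (1 / \<rho>^2)) * (2 * norm (x - a)))"
        by (simp add: abs_mult)
      also have "\<dots> \<le> (2 * B * \<rho>) * ((C * (1 / \<rho>^2)) * (2 * (2 * \<rho>)))"
        using True near[OF True] st(2) B \<rho> C0 by (intro mult_mono) auto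
      also have "\<dots> = 8 * B * C" using \<rho> by (simp add: power2_eq_square)
      finally show ?thesis by (simp add: algebra_simps)
    next
      case False then show ?thesis using out[of x] B C0 by simp
    qed
  qed
qed

lemma test_function_cmult:
  assumes "test_function \<Omega> f"
  shows "test_function \<Omega> (\<lambda>x. c * f x)" "grad (\<lambda>x. c * f x) = (\<lambda>x. c *\<^sub>R grad f x)"
proof -
  have "grad (\<lambda>x. 0) = (\<lambda>x. 0)" by (rule grad_eqI) (rule GDERIV_const)
  then show "test_function \<Omega> (\<lambda>x. c * f x)" "grad (\<lambda>x. c * f x) = (\<lambda>x. c *\<^sub>R grad f x)"
    using test_function_add[OF test_function_zero assms, of c] grad_add[OF test_function_zero assms, of c] by simp_all
qed

lemma sum_single:
  assumes "finite A" "a \<in> A" "\<And>b. b \<in> A \<Longrightarrow> b \<noteq> a \<Longrightarrow> f b = (0 :: 'c::comm_monoid_add)"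
  shows "sum f A = f a"
  using assms by (simp add: sum.remove[OF assms(1,2)] sum.neutral)

lemma norm_sum_disjoint_sq:
  fixes f :: "'i \<Rightarrow> 'b::real_inner"
  assumes "finite A" "\<And>a b. a \<in> A \<Longrightarrow> b \<in> A \<Longrightarrow> a \<noteq> b \<Longrightarrow> f a = 0 \<or> f b = 0"
  shows "(norm (\<Sum>a\<in>A. f a))^2 = (\<Sum>a\<in>A. (norm (f a))^2)"
  by (rule norm_sum_Pythagorean[OF assms(1)]) (unfold pairwise_def orthogonal_def, metis assms(2) inner_zero_left inner_zero_right)

text \<open>From \<open>t \<le> exp t\<close>; this crude bound already makes the ratio of the
  radius to \<open>e\<close> tend to zero.\<close>

lemma exp_minus_le: "0 < \<gamma> \<Longrightarrow> 0 < e \<Longrightarrow> exp (- \<gamma> / e^2) \<le> e^2 / (\<gamma>::real)"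
proof -
  assume *: "0 < \<gamma>" "0 < e"
  have "\<gamma> / e^2 \<le> exp (\<gamma> / e^2)" using exp_ge_add_one_self[of "\<gamma> / e^2"] by linarith
  moreover have "\<gamma> / e^2 > 0" using * by simp
  ultimately have "inverse (exp (\<gamma> / e^2)) \<le> inverse (\<gamma> / e^2)" by (intro le_imp_inverse_le) auto
  then show ?thesis by (simp add: exp_minus)
qed

lemma centers_balls_disjoint:
  assumes "a \<in> centers \<Omega> p e" "b \<in> centers \<Omega> p e" "a \<noteq> b" "e > 0"
  shows "norm (x - a) \<ge> e / 2 \<or> norm (x - b) \<ge> e / 2"
proof (rule ccontr)
  assume "\<not> ?thesis"
  then have "x \<in> ball a (e/2)" "x \<in> ball b (e/2)" by (auto simp: dist_norm norm_minus_commute)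
  then show False using cells_disjoint[OF assms] ball_subset_cell by blast
qed

text \<open>Integrality gives \<open>\<bar>d\<bar> \<le> d^2\<close>, so the total variation of the
  charges is controlled by the same constant as their squares.\<close>

lemma sum_abs_int_le: "(\<Sum>a\<in>A. \<bar>real_of_int (d a)\<bar>) \<le> (\<Sum>a\<in>A. (real_of_int (d a))^2)"
proof (rule sum_mono)
  fix a
  have "\<bar>d a\<bar> * 1 \<le> \<bar>d a\<bar> * \<bar>d a\<bar>"
  proof (cases "d a = 0")
    case False
    then have "1 \<le> \<bar>d a\<bar>" by linarith
    then show ?thesis by (rule mult_left_mono) simp
  qed simp
  then have "\<bar>d a\<bar> \<le> (d a)^2" by (simp add: power2_eq_square)
  then have "real_of_int \<bar>d a\<bar> \<le> real_of_int ((d a)^2)" by (simp only: of_int_le_iff)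
  then show "\<bar>real_of_int (d a)\<bar> \<le> (real_of_int (d a))^2" by simp
qed

section \<open>Assembling the competitor from bumps with disjoint supports\<close>

context bounded_domain
begin

lemma integral_norm_sq_disjoint_sum:
  fixes f :: "'i \<Rightarrow> real^2 \<Rightarrow> 'b::euclidean_space"
  assumes "finite A" "\<And>a. a \<in> A \<Longrightarrow> sqi M (f a)" 
    "\<And>a b x. a \<in> A \<Longrightarrow> b \<in> A \<Longrightarrow> a \<noteq> b \<Longrightarrow> f a x = 0 \<or> f b x = 0"
  shows "(\<integral>x. (norm (\<Sum>a\<in>A. f a x))^2 \<partial>M) = (\<Sum>a\<in>A. \<integral>x. (norm (f a x))^2 \<partial>M)"
proof -
  have "(\<integral>x. (norm (\<Sum>a\<in>A. f a x))^2 \<partial>M) = (\<integral>x. (\<Sum>a\<in>A. (norm (f a x))^2) \<partial>M)"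
    by (rule Bochner_Integration.integral_cong) (use norm_sum_disjoint_sq[OF assms(1,3)] in auto)
  also have "\<dots> = (\<Sum>a\<in>A. \<integral>x. (norm (f a x))^2 \<partial>M)"
    by (rule Bochner_Integration.integral_sum) (use assms(2) in \<open>auto simp: sqi_def\<close>)
  finally show ?thesis .
qed

abbreviation "vol \<equiv> measure lebesgue \<Omega>"

lemma measure_M: "measure M (space M) = vol"
  using measure_restrict_space[of \<Omega> lebesgue \<Omega>] domain_sets by (simp add: space_restrict_space)

lemma integral_norm_le_vol: "sqi M f \<Longrightarrow> (\<integral>x. norm (f x) \<partial>M) \<le> nrm2 M f * sqrt vol"
  using sqi_integral_norm_le[OF finite_measure_M] measure_M by metis

lemma abs_integral_le_vol:
  fixes f :: "real^2 \<Rightarrow> real"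
  assumes "sqi M f" shows "\<bar>\<integral>x. f x \<partial>M\<bar> \<le> nrm2 M f * sqrt vol"
  using integral_norm_le_vol[OF assms] by (intro order_trans[OF integral_abs_bound]) simp

lemma nrm2_pair_sq:
  fixes w :: "real^2 \<Rightarrow> real \<times> (real^2)"
  assumes "sqi M w"
  shows "(nrm2 M w)^2 = (nrm2 M (\<lambda>x. fst (w x)))^2 + (nrm2 M (\<lambda>x. snd (w x)))^2"
proof -
  have "(nrm2 M w)^2 = (\<integral>x. (norm (fst (w x)))^2 + (norm (snd (w x)))^2 \<partial>M)"
    unfolding nrm2_sq by (rule Bochner_Integration.integral_cong) (auto simp: norm_pair_sq)
  also have "\<dots> = (nrm2 M (\<lambda>x. fst (w x)))^2 + (nrm2 M (\<lambda>x. snd (w x)))^2"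
    using assms unfolding sqi_fst_snd[of M w] nrm2_sq by (intro Bochner_Integration.integral_add) (auto simp: sqi_def)
  finally show ?thesis .
qed

lemma nrm2_add_sq:
  assumes "sqi M f" "sqi M g"
  shows "(nrm2 M (\<lambda>x. f x + g x))^2 = (nrm2 M f)^2 + 2 * (\<integral>x. f x \<bullet> g x \<partial>M) + (nrm2 M g)^2"
proof -
  have "(nrm2 M (\<lambda>x. f x + g x))^2 = (\<integral>x. (norm (f x))^2 + 2 * (f x \<bullet> g x) + (norm (g x))^2 \<partial>M)"
    unfolding nrm2_sq by (rule Bochner_Integration.integral_cong) (auto simp: power2_norm_eq_inner inner_simps inner_commute)
  also have "\<dots> = (nrm2 M f)^2 + 2 * (\<integral>x. f x \<bullet> g x \<partial>M) + (nrm2 M g)^2"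
    using assms sqi_inner[OF assms] unfolding nrm2_sq sqi_def by simp
  finally show ?thesis .
qed

text \<open>Each bump is the fundamental solution cut off between the radii \<open>\<rho>\<close> and \<open>e/2\<close>, so its Dirichlet
  energy is about \<open>2 \<pi> ln (e/\<rho>)\<close>, that is \<open>2 \<pi> \<gamma> / e\<^sup>2\<close>.\<close>

lemma vortex_part:
  fixes d :: "real^2 \<Rightarrow> int" and p :: "real^2" and e \<rho> :: real
  assumes e: "0 < e" and \<rho>: "0 < \<rho>" "6 * \<rho>^2 \<le> (e/2)^2"
  defines "A \<equiv> centers \<Omega> p e"
  defines "Q \<equiv> e^2 * (\<Sum>a\<in>A. (real_of_int (d a))^2)"
  obtains S c where "test_function \<Omega> S" 
    "\<And>a x. a \<in> A \<Longrightarrow> (norm (x - a))^2 \<le> 2 * \<rho>^2 \<Longrightarrow> S x = e^2 * d a * c a"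
    "\<And>a. a \<in> A \<Longrightarrow> c a \<ge> ln (e / 2 / \<rho>) - ln 6 / 2"
    "(nrm2 M S)^2 \<le> 2 * pi * e ^ 4 * Q" "(nrm2 M (grad S))^2 \<le> e^2 * Q * (2 * pi * ln (e / 2 / \<rho>))"
    "(\<integral>x. norm (grad S x) \<partial>M) \<le> pi * e * Q"
proof -
  have fin: "finite A" unfolding A_def by (rule finite_centers[OF e])
  define P where "P a \<Psi> c \<longleftrightarrow> test_function \<Omega> \<Psi> \<and> (\<forall>x. (norm (x - a))^2 \<le> 2 * \<rho>^2 \<longrightarrow> \<Psi> x = c) \<and> (\<forall>x. norm (x - a) \<ge> e/2 \<longrightarrow> \<Psi> x = 0 \<and> grad \<Psi> x = 0) \<and>
    c \<ge> ln (e/2 / \<rho>) - ln 6 / 2 \<and> (\<integral>x. (norm (grad \<Psi> x))^2 \<partial>lborel) \<le> 2 * pi * ln (e/2 / \<rho>) \<and>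
    (\<integral>x. norm (grad \<Psi> x) \<partial>lborel) \<le> 2 * pi * (e/2) \<and> (\<integral>x. (\<Psi> x)^2 \<partial>lborel) \<le> 8 * pi * (e/2)^2" for a \<Psi> c
  have "\<exists>\<Psi> c. P a \<Psi> c" if a: "a \<in> A" for a
  proof (rule logarithmic_bump[OF \<rho>])
    show "cball a (e/2) \<subseteq> \<Omega>" using cball_subset_domain[of a \<Omega> p e "e/2"] a by (simp add: A_def)
  qed (use e in \<open>auto simp: P_def\<close>)
  then obtain \<Psi> c where "\<And>a. a \<in> A \<Longrightarrow> P a (\<Psi> a) (c a)" by metis
  then have \<Psi>: "test_function \<Omega> (\<Psi> a)" "(norm (x - a))^2 \<le> 2 * \<rho>^2 \<Longrightarrow> \<Psi> a x = c a" "norm (x - a) \<ge> e/2 \<Longrightarrow> \<Psi> a x = 0 \<and> grad (\<Psi> a) x = 0"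
    "c a \<ge> ln (e/2 / \<rho>) - ln 6 / 2" "(\<integral>x. (norm (grad (\<Psi> a) x))^2 \<partial>lborel) \<le> 2 * pi * ln (e/2 / \<rho>)"
    "(\<integral>x. norm (grad (\<Psi> a) x) \<partial>lborel) \<le> 2 * pi * (e/2)" "(\<integral>x. (\<Psi> a x)^2 \<partial>lborel) \<le> 8 * pi * (e/2)^2" if "a \<in> A" for a x
    using that unfolding P_def by blast+
  define k where "k a = e^2 * real_of_int (d a)" for a
  define f where "f a x = k a * \<Psi> a x" for a x
  define S where "S x = (\<Sum>a\<in>A. f a x)" for x
  have tf: "test_function \<Omega> (f a)" "grad (f a) = (\<lambda>x. k a *\<^sub>R grad (\<Psi> a) x)" if "a \<in> A" for a
    unfolding f_def[abs_def] using test_function_cmult[OF \<Psi>(1)[OF that]] by blast+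
  have tS: "test_function \<Omega> S" unfolding S_def[abs_def] by (rule test_function_sum[OF fin tf(1)])
  have gS: "grad S = (\<lambda>x. \<Sum>a\<in>A. grad (f a) x)" unfolding S_def[abs_def] by (rule grad_sum[OF fin tf(1)])
  have dis: "norm (x - a) \<ge> e / 2 \<or> norm (x - b) \<ge> e / 2" if "a \<in> A" "b \<in> A" "a \<noteq> b" for a b x
    using centers_balls_disjoint[of a \<Omega> p e b x] that e by (simp add: A_def)
  have f0: "f a x = 0 \<and> grad (f a) x = 0" if "a \<in> A" "norm (x - a) \<ge> e/2" for a x
    using \<Psi>(3)[OF that] tf(2)[OF that(1)] by (simp add: f_def)
  \<comment> \<open>The factor \<open>e^2\<close> left over beside \<open>Q\<close> is the one that
    balances the logarithm in the Dirichlet energy.\<close>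
  have k2: "(\<Sum>a\<in>A. (k a)^2) = e^2 * Q" by (simp add: k_def Q_def power_mult_distrib sum_distrib_left power2_eq_square mult_ac)
  have k1: "(\<Sum>a\<in>A. \<bar>k a\<bar>) \<le> Q"
  proof -
    have "(\<Sum>a\<in>A. \<bar>k a\<bar>) = e^2 * (\<Sum>a\<in>A. \<bar>real_of_int (d a)\<bar>)" by (simp add: k_def abs_mult sum_distrib_left)
    also have "\<dots> \<le> Q" unfolding Q_def by (intro mult_left_mono sum_abs_int_le) auto
    finally show ?thesis .
  qed
  have tr: "(\<integral>x. (norm (grad (\<Psi> a) x))^2 \<partial>M) = (\<integral>x. (norm (grad (\<Psi> a) x))^2 \<partial>lborel)"
    "(\<integral>x. norm (grad (\<Psi> a) x) \<partial>M) = (\<integral>x. norm (grad (\<Psi> a) x) \<partial>lborel)"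
    "(\<integral>x. (\<Psi> a x)^2 \<partial>M) = (\<integral>x. (\<Psi> a x)^2 \<partial>lborel)" if "a \<in> A" for a
    using test_function_measurable[OF \<Psi>(1)[OF that]] test_function_grad_measurable[OF \<Psi>(1)[OF that]]
    by (auto intro!: integral_test_lebesgue_on[OF open_domain \<Psi>(1)[OF that]])
  show ?thesis
  proof (rule that[OF tS])
    show "S x = e^2 * d a * c a" if a: "a \<in> A" "(norm (x - a))^2 \<le> 2 * \<rho>^2" for a x
    proof -
      have "norm (x - a) < e / 2"
      proof (rule power2_less_imp_less)
        have "\<rho>^2 > 0" using \<rho> by simp
        then show "(norm (x - a))^2 < (e/2)^2" using a(2) \<rho>(2) by linarith
      qed (use e in simp)
      then have "f b x = 0" if "b \<in> A" "b \<noteq> a" for b using dis[OF a(1) that(1), of x] f0[OF that(1)] that(2) by force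
      then have "S x = f a x" unfolding S_def by (intro sum_single[OF fin a(1)]) auto
      then show ?thesis using \<Psi>(2)[OF a] by (simp add: f_def k_def)
    qed
    show "c a \<ge> ln (e / 2 / \<rho>) - ln 6 / 2" if "a \<in> A" for a using \<Psi>(4)[OF that] .
    have "(nrm2 M S)^2 = (\<Sum>a\<in>A. \<integral>x. (norm (f a x))^2 \<partial>M)"
      unfolding nrm2_sq S_def
    proof (rule integral_norm_sq_disjoint_sum[OF fin])
      show "sqi M (f a)" if "a \<in> A" for a by (rule test_function_sqi(1)[OF open_domain tf(1)[OF that]])
      show "f a x = 0 \<or> f b x = 0" if "a \<in> A" "b \<in> A" "a \<noteq> b" for a b x
        using dis[OF that, of x] f0[OF that(1), of x] f0[OF that(2), of x] by auto
    qed
    also have "\<dots> = (\<Sum>a\<in>A. (k a)^2 * (\<integral>x. (\<Psi> a x)^2 \<partial>lborel))"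
      by (rule sum.cong) (auto simp: f_def power_mult_distrib tr)
    also have "\<dots> \<le> (\<Sum>a\<in>A. (k a)^2 * (8 * pi * (e/2)^2))"
      by (intro sum_mono mult_left_mono \<Psi>(7)) auto
    also have "\<dots> = 2 * pi * e ^ 4 * Q" unfolding sum_distrib_right[symmetric] k2 by (simp add: power2_eq_square power4_eq_xxxx)
    finally show "(nrm2 M S)^2 \<le> 2 * pi * e ^ 4 * Q" .
    have "(nrm2 M (grad S))^2 = (\<Sum>a\<in>A. \<integral>x. (norm (grad (f a) x))^2 \<partial>M)"
      unfolding nrm2_sq gS
    proof (rule integral_norm_sq_disjoint_sum[OF fin])
      show "sqi M (grad (f a))" if "a \<in> A" for a by (rule test_function_sqi(2)[OF open_domain tf(1)[OF that]])
      show "grad (f a) x = 0 \<or> grad (f b) x = 0" if "a \<in> A" "b \<in> A" "a \<noteq> b" for a b x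
        using dis[OF that, of x] f0[OF that(1), of x] f0[OF that(2), of x] by auto
    qed
    also have "\<dots> = (\<Sum>a\<in>A. (k a)^2 * (\<integral>x. (norm (grad (\<Psi> a) x))^2 \<partial>lborel))"
      by (rule sum.cong) (auto simp: tf(2) power_mult_distrib tr)
    also have "\<dots> \<le> (\<Sum>a\<in>A. (k a)^2 * (2 * pi * ln (e/2 / \<rho>)))"
      by (intro sum_mono mult_left_mono \<Psi>(5)) auto
    also have "\<dots> = e^2 * Q * (2 * pi * ln (e / 2 / \<rho>))" unfolding sum_distrib_right[symmetric] k2 ..
    finally show "(nrm2 M (grad S))^2 \<le> e^2 * Q * (2 * pi * ln (e / 2 / \<rho>))" .
    have ig: "integrable M (\<lambda>x. norm (grad (f a) x))" if "a \<in> A" for a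
      by (intro integrable_norm sqi_integrable[OF finite_measure_M] test_function_sqi[OF open_domain] tf(1)[OF that])
    have "(\<integral>x. norm (grad S x) \<partial>M) \<le> (\<integral>x. (\<Sum>a\<in>A. norm (grad (f a) x)) \<partial>M)"
    proof (rule integral_mono')
      show "integrable M (\<lambda>x. \<Sum>a\<in>A. norm (grad (f a) x))" using ig by (rule Bochner_Integration.integrable_sum)
    qed (auto simp: gS norm_sum sum_nonneg)
    also have "\<dots> = (\<Sum>a\<in>A. \<integral>x. norm (grad (f a) x) \<partial>M)" by (rule Bochner_Integration.integral_sum[OF ig])
    also have "\<dots> = (\<Sum>a\<in>A. \<bar>k a\<bar> * (\<integral>x. norm (grad (\<Psi> a) x) \<partial>lborel))"
      by (rule sum.cong) (auto simp: tf(2) tr)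
    also have "\<dots> \<le> (\<Sum>a\<in>A. \<bar>k a\<bar> * (2 * pi * (e/2)))"
      by (intro sum_mono mult_left_mono \<Psi>(6)) auto
    also have "\<dots> = (\<Sum>a\<in>A. \<bar>k a\<bar>) * (pi * e)" unfolding sum_distrib_right by simp
    also have "\<dots> \<le> Q * (pi * e)" using e by (intro mult_right_mono k1) auto
    finally show "(\<integral>x. norm (grad S x) \<partial>M) \<le> pi * e * Q" by (simp add: mult_ac)
  qed
qed

text \<open>Of the order of \<open>e^-2\<close> corrections, each with bounded value and gradient on
  a disk of area \<open>4 pi \<rho>^2\<close>, have together a norm of order
  \<open>\<rho> / e\<close>. The condition \<open>4 * \<rho> < e\<close> keeps the disks
  disjoint.\<close>

lemma flattening_part:
  assumes \<phi>: "test_function \<Omega> \<phi>" 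
  obtains K where "K \<ge> 0" "\<And>e \<rho> p. 0 < e \<Longrightarrow> 0 < \<rho> \<Longrightarrow> \<rho> \<le> 1 \<Longrightarrow> 4 * \<rho> < e \<Longrightarrow> \<exists>r. test_function \<Omega> r \<and>
    (\<forall>a\<in>centers \<Omega> p e. \<forall>x. (norm (x - a))^2 \<le> 2 * \<rho>^2 \<longrightarrow> r x = \<phi> a - \<phi> x) \<and> nrm2 M (with_grad r) \<le> K * (\<rho> / e)"
proof -
  obtain B where B: "B \<ge> 0" "\<And>x. \<bar>\<phi> x\<bar> \<le> B" "\<And>x. norm (grad \<phi> x) \<le> B" "\<And>x y. \<bar>\<phi> x - \<phi> y\<bar> \<le> B * norm (x - y)"
    using test_function_bounded[OF \<phi>] by metis
  obtain st' C where st: "\<And>t. DERIV smooth_step t :> st' t" "\<And>t. \<bar>st' t\<bar> \<le> C" "C \<ge> 0"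
    using smooth_step_derivative_bounded by metis
  define K2 where "K2 = ((2 * B)^2 + (B * (8 * C + 1))^2) * (4 * pi * vol)"
  have K2: "K2 \<ge> 0" by (simp add: K2_def)
  show ?thesis
  proof (rule that[of "sqrt K2"])
    show "sqrt K2 \<ge> 0" using K2 by simp
    fix e \<rho> :: real and p :: "real^2" assume e: "0 < e" and \<rho>: "0 < \<rho>" "\<rho> \<le> 1" "4 * \<rho> < e"
    let ?A = "centers \<Omega> p e"
    have fin: "finite ?A" by (rule finite_centers[OF e])
    define P where "P a r \<longleftrightarrow> test_function \<Omega> r \<and> (\<forall>x. (norm (x - a))^2 \<le> 2 * \<rho>^2 \<longrightarrow> r x = \<phi> a - \<phi> x) \<and>
      (\<forall>x. norm (x - a) > 2 * \<rho> \<longrightarrow> r x = 0 \<and> grad r x = 0) \<and> (\<forall>x. \<bar>r x\<bar> \<le> 2 * B * \<rho>) \<and> (\<forall>x. norm (grad r x) \<le> B * (8 * C + 1))" for a r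
    have sub: "cball a (2 * \<rho>) \<subseteq> \<Omega>" if "a \<in> ?A" for a using cball_subset_domain[OF that, of "2 * \<rho>"] \<rho> by simp
    have "\<exists>r. P a r" if a: "a \<in> ?A" for a
      by (rule flattening_bump[OF \<rho>(1) sub[OF a] \<phi> B(1,3,4) st(1,2)]) (auto simp: P_def)
    then obtain r where "\<And>a. a \<in> ?A \<Longrightarrow> P a (r a)" by metis
    then have r: "test_function \<Omega> (r a)" "(norm (x - a))^2 \<le> 2 * \<rho>^2 \<Longrightarrow> r a x = \<phi> a - \<phi> x"
      "norm (x - a) > 2 * \<rho> \<Longrightarrow> r a x = 0 \<and> grad (r a) x = 0" "\<bar>r a x\<bar> \<le> 2 * B * \<rho>" "norm (grad (r a) x) \<le> B * (8 * C + 1)" if "a \<in> ?A" for a x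
      using that unfolding P_def by blast+
    define rr where "rr x = (\<Sum>a\<in>?A. r a x)" for x
    have trr: "test_function \<Omega> rr" unfolding rr_def[abs_def] by (rule test_function_sum[OF fin r(1)])
    have grr: "grad rr = (\<lambda>x. \<Sum>a\<in>?A. grad (r a) x)" unfolding rr_def[abs_def] by (rule grad_sum[OF fin r(1)])
    have dis: "norm (x - a) > 2 * \<rho> \<or> norm (x - b) > 2 * \<rho>" if "a \<in> ?A" "b \<in> ?A" "a \<noteq> b" for a b x
      using centers_balls_disjoint[OF that e, of x] \<rho>(3) by linarith
    have W: "with_grad rr = (\<lambda>x. \<Sum>a\<in>?A. with_grad (r a) x)"
      by (auto simp: with_grad_def grr rr_def fun_eq_iff sum_prod[symmetric])
    have "(nrm2 M (with_grad rr))^2 = (\<Sum>a\<in>?A. \<integral>x. (norm (with_grad (r a) x))^2 \<partial>M)"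
      unfolding nrm2_sq W
    proof (rule integral_norm_sq_disjoint_sum[OF fin])
      show "with_grad (r a) x = 0 \<or> with_grad (r b) x = 0" if "a \<in> ?A" "b \<in> ?A" "a \<noteq> b" for a b x
        using dis[OF that, of x] r(3)[OF that(1), of x] r(3)[OF that(2), of x] by (auto simp: with_grad_def zero_prod_def)
    qed (use with_grad_sqi r(1) in blast)
    also have "\<dots> \<le> (\<Sum>a\<in>?A. ((2 * B)^2 + (B * (8 * C + 1))^2) * (4 * pi * \<rho>^2))"
    proof (rule sum_mono)
      fix a assume a: "a \<in> ?A"
      have i: "integrable M (ind (cball a (2 * \<rho>)))" by (rule sqi_integrable[OF finite_measure_M indicator_cball_sqi])
      have "(\<integral>x. (norm (with_grad (r a) x))^2 \<partial>M) \<le> (\<integral>x. ((2 * B)^2 + (B * (8 * C + 1))^2) * ind (cball a (2 * \<rho>)) x \<partial>M)"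
      proof (rule integral_mono')
        fix x
        show "(norm (with_grad (r a) x))^2 \<le> ((2 * B)^2 + (B * (8 * C + 1))^2) * ind (cball a (2 * \<rho>)) x"
        proof (cases "norm (x - a) > 2 * \<rho>")
          case True
          then show ?thesis using r(3)[OF a True] by (simp add: norm_pair_sq with_grad_def)
        next
          case False
          have "2 * B * \<rho> \<le> 2 * B * 1" using B \<rho> by (intro mult_left_mono) auto
          then have "\<bar>r a x\<bar> \<le> 2 * B" using r(4)[OF a, of x] by simp
          then have "(r a x)^2 \<le> (2 * B)^2" using power_mono[of "\<bar>r a x\<bar>" "2 * B" 2] by simp
          moreover have "(norm (grad (r a) x))^2 \<le> (B * (8 * C + 1))^2" by (rule power_mono[OF r(5)[OF a]]) simp
          ultimately show ?thesis using False by (simp add: norm_pair_sq with_grad_def dist_norm norm_minus_commute)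
        qed
      qed (use i in auto)
      also have "\<dots> = ((2 * B)^2 + (B * (8 * C + 1))^2) * (4 * pi * \<rho>^2)"
        using integral_indicator_cball[OF sub[OF a]] \<rho> by (simp add: power_mult_distrib)
      finally show "(\<integral>x. (norm (with_grad (r a) x))^2 \<partial>M) \<le> ((2 * B)^2 + (B * (8 * C + 1))^2) * (4 * pi * \<rho>^2)" .
    qed
    also have "\<dots> = ((2 * B)^2 + (B * (8 * C + 1))^2) * (4 * pi) * (real (card ?A) * e^2) * (\<rho> / e)^2"
      using e by (simp add: power_divide)
    also have "\<dots> \<le> ((2 * B)^2 + (B * (8 * C + 1))^2) * (4 * pi) * vol * (\<rho> / e)^2"
      by (intro mult_right_mono mult_left_mono card_centers[OF e]) auto
    also have "\<dots> = (sqrt K2 * (\<rho> / e))^2" by (simp only: power_mult_distrib[of "sqrt K2"] real_sqrt_pow2[OF K2]) (simp add: K2_def)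
    finally have "(nrm2 M (with_grad rr))^2 \<le> (sqrt K2 * (\<rho> / e))^2" .
    then have le: "nrm2 M (with_grad rr) \<le> sqrt K2 * (\<rho> / e)" by (rule power2_le_imp_le) (use e \<rho> K2 in simp)
    have "rr x = \<phi> a - \<phi> x" if a: "a \<in> ?A" "(norm (x - a))^2 \<le> 2 * \<rho>^2" for a x
    proof -
      have "norm (x - a) \<le> 2 * \<rho>"
      proof (rule power2_le_imp_le)
        have "\<rho>^2 > 0" using \<rho> by simp
        moreover have "(2 * \<rho>)^2 = 4 * \<rho>^2" by simp
        ultimately show "(norm (x - a))^2 \<le> (2 * \<rho>)^2" using a(2) by linarith
      qed (use \<rho> in simp)
      then have "r b x = 0" if "b \<in> ?A" "b \<noteq> a" for b using dis[OF a(1) that(1), of x] r(3)[OF that(1)] that(2) by force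
      then have "rr x = r a x" unfolding rr_def by (intro sum_single[OF fin a(1)]) auto
      then show ?thesis using r(2)[OF a] by simp
    qed
    then show "\<exists>r. test_function \<Omega> r \<and> (\<forall>a\<in>?A. \<forall>x. (norm (x - a))^2 \<le> 2 * \<rho>^2 \<longrightarrow> r x = \<phi> a - \<phi> x) \<and> nrm2 M (with_grad r) \<le> sqrt K2 * (\<rho> / e)"
      using trr le by blast
  qed
qed

end

section \<open>Lower bound for the energy\<close>

text \<open>For this radius \<open>e^2 * l = \<gamma> + e^2 * ln (e / 2)\<close>; the correction is
  negative and, by \<open>ln (2 / e) \<le> 2 / e\<close>, not below \<open>- 2 * e\<close>.\<close>

lemma log_ratio_bounds:
  fixes e \<gamma> :: real
  assumes "0 < e" "e \<le> 1" 
  defines "l \<equiv> ln (e / 2 / exp (- \<gamma> / e^2))"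
  shows "e^2 * l \<le> \<gamma>" "\<gamma> - 2 * e \<le> e^2 * l"
proof -
  have "ln (e / 2 / exp x) = ln (e / 2) - x" for x using assms(1) by (subst ln_div) auto
  then have "l = ln (e / 2) + \<gamma> / e^2" unfolding l_def by simp
  then have l: "e^2 * l = \<gamma> + e^2 * ln (e / 2)" using assms by (simp add: distrib_left)
  have "ln (e / 2) \<le> 0" using assms by simp
  then have "e^2 * ln (e / 2) \<le> 0" by (simp add: mult_nonneg_nonpos)
  then show "e^2 * l \<le> \<gamma>" using l by simp
  have "ln (2 / e) \<le> 2 / e" using assms by (intro ln_bound) auto
  then have "- ln (e / 2) \<le> 2 / e" using assms by (simp add: ln_div)
  then have "e^2 * (- ln (e / 2)) \<le> e^2 * (2 / e)" by (rule mult_left_mono) simp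
  also have "e^2 * (2 / e) = 2 * e" using assms by (simp add: power2_eq_square)
  finally show "\<gamma> - 2 * e \<le> e^2 * l" using l by simp
qed

lemma small_radius:
  fixes e \<gamma> :: real
  assumes "0 < \<gamma>" "0 < e" "e \<le> \<gamma> / 5"
  defines "\<rho> \<equiv> exp (- \<gamma> / e^2)"
  shows "0 < \<rho>" "\<rho> \<le> 1" "\<rho> \<le> e / 5" "6 * \<rho>^2 \<le> (e / 2)^2" "\<rho> / e \<le> e / \<gamma>"
proof -
  show p: "0 < \<rho>" "\<rho> \<le> 1" using assms by (auto simp: \<rho>_def)
  have le: "\<rho> \<le> e^2 / \<gamma>" unfolding \<rho>_def by (rule exp_minus_le[OF assms(1,2)])
  also have "e^2 / \<gamma> = e * (e / \<gamma>)" by (simp add: power2_eq_square)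
  also have "\<dots> \<le> e * (1 / 5)" using assms by (intro mult_left_mono) (auto simp: field_simps)
  finally show r: "\<rho> \<le> e / 5" by simp
  then have "\<rho>^2 \<le> (e / 5)^2" using p by (intro power_mono) auto
  then have "25 * \<rho>^2 \<le> e^2" by (simp add: power_divide)
  moreover have "\<rho>^2 \<ge> 0" by simp
  ultimately have "24 * \<rho>^2 \<le> e^2" by linarith
  then show "6 * \<rho>^2 \<le> (e / 2)^2" unfolding power_divide by simp
  show "\<rho> / e \<le> e / \<gamma>" using le assms by (simp add: divide_le_eq power2_eq_square)
qed

lemma grad_zero_locally_constant:
  assumes "open S" "x \<in> S" "\<And>y. y \<in> S \<Longrightarrow> f y = (c::real)" shows "grad f x = 0"
proof (rule grad_eq)
  have "(f has_derivative (\<lambda>h. 0)) (at x)"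
    by (rule has_derivative_transform_within_open[OF has_derivative_const[of c] assms(1,2)]) (use assms(3) in simp)
  then show "GDERIV f x :> 0" by (simp add: gderiv_def)
qed

context bounded_domain
begin

text \<open>With \<open>Q\<close> the scaled sum of squares, the vortices raise the linear
  functional by about \<open>2 pi \<gamma> Q\<close> and half the squared norm by about
  \<open>pi \<gamma> Q\<close>, which leaves \<open>pi \<gamma> Q\<close>. All remainders are linear
  in \<open>\<epsilon>\<close>, uniformly in the lattice origin and in the tuples with
  \<open>Q \<le> C\<close>.\<close>

lemma E_tilde_lower_bound:
  assumes \<phi>: "test_function \<Omega> \<phi>" and \<sigma>: "\<sigma> \<ge> 0" and \<gamma>: "\<gamma> > 0" and C: "C \<ge> 0"
  obtains K \<epsilon>0 where "\<epsilon>0 > 0" "\<And>\<epsilon> p d. 0 < \<epsilon> \<Longrightarrow> \<epsilon> < \<epsilon>0 \<Longrightarrow> \<epsilon>^2 * (\<Sum>a\<in>centers \<Omega> p \<epsilon>. (real_of_int (d a))^2) \<le> C \<Longrightarrow>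
    E_tilde \<Omega> \<sigma> \<gamma> p \<epsilon> d \<ge> pi * \<gamma> * (\<epsilon>^2 * (\<Sum>a\<in>centers \<Omega> p \<epsilon>. (real_of_int (d a))^2))
      + 2 * pi * (\<epsilon>^2 * (\<Sum>a\<in>centers \<Omega> p \<epsilon>. of_int (d a) * \<phi> a)) - \<sigma> * (\<integral>x. \<phi> x \<partial>M) - (nrm2 M (with_grad \<phi>))^2 / 2 - K * \<epsilon>"
proof -
  obtain B where B: "B \<ge> 0" "\<And>x. \<bar>\<phi> x\<bar> \<le> B" "\<And>x. norm (grad \<phi> x) \<le> B" using test_function_bounded[OF \<phi>] by metis
  obtain K1 where K1: "K1 \<ge> 0" "\<And>\<epsilon> \<rho> p. 0 < \<epsilon> \<Longrightarrow> 0 < \<rho> \<Longrightarrow> \<rho> \<le> 1 \<Longrightarrow> 4 * \<rho> < \<epsilon> \<Longrightarrow> \<exists>r. test_function \<Omega> r \<and>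
    (\<forall>a\<in>centers \<Omega> p \<epsilon>. \<forall>x. (norm (x - a))^2 \<le> 2 * \<rho>^2 \<longrightarrow> r x = \<phi> a - \<phi> x) \<and> nrm2 M (with_grad r) \<le> K1 * (\<rho> / \<epsilon>)"
    using flattening_part[OF \<phi>] by blast
  define n0 where "n0 = nrm2 M (with_grad \<phi>)"
  define m where "m = sqrt vol"
  \<comment> \<open>\<open>s0 * \<epsilon>\<close> will bound the norm of the vortices,
    \<open>T * \<epsilon>\<close> that of the flattening together with its gradient, and
    \<open>XM\<close> the squared norm of \<open>\<phi>\<close> plus vortices; \<open>K\<close>
    collects the coefficients of \<open>\<epsilon>\<close>.\<close>
  define s0 where "s0 = sqrt (2 * pi * C)"
  define T where "T = K1 / \<gamma>"
  define XM where "XM = n0^2 + 2 * (B * (s0 * m) + B * (pi * C)) + 2 * pi * C + 2 * pi * C * \<gamma>"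
  define K where "K = 2 * (pi * C) + pi * C * ln 6 + pi * C + \<sigma> * (s0 * m + T * m) + B * (s0 * m) + B * (pi * C) + sqrt XM * T + T^2 / 2"
  have nn: "m \<ge> 0" "s0 \<ge> 0" "T \<ge> 0" using K1(1) \<gamma> C by (auto simp: m_def s0_def T_def)
  show ?thesis
  proof (rule that[of "min 1 (\<gamma> / 5)" K])
    show "min 1 (\<gamma> / 5) > 0" using \<gamma> by simp
    fix \<epsilon> :: real and p :: "real^2" and d :: "real^2 \<Rightarrow> int"
    let ?A = "centers \<Omega> p \<epsilon>"
    assume \<epsilon>: "0 < \<epsilon>" and \<epsilon>0: "\<epsilon> < min 1 (\<gamma> / 5)" and QC: "\<epsilon>^2 * (\<Sum>a\<in>?A. (real_of_int (d a))^2) \<le> C"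
    define Q where "Q = \<epsilon>^2 * (\<Sum>a\<in>?A. (real_of_int (d a))^2)"
    define \<rho> where "\<rho> = exp (- \<gamma> / \<epsilon>^2)"
    define l where "l = ln (\<epsilon> / 2 / \<rho>)"
    define L where "L = \<epsilon>^2 * (\<Sum>a\<in>?A. of_int (d a) * \<phi> a)"
    have e1: "\<epsilon> \<le> 1" "\<epsilon> \<le> \<gamma> / 5" using \<epsilon>0 by auto
    have e2: "\<epsilon>^2 \<le> \<epsilon>" "\<epsilon> ^ 4 \<le> \<epsilon>" using power_decreasing[of 1 2 \<epsilon>] power_decreasing[of 1 4 \<epsilon>] \<epsilon> e1 by auto
    note r = small_radius[OF \<gamma> \<epsilon> e1(2), folded \<rho>_def]
    note lb = log_ratio_bounds[OF \<epsilon> e1(1), of \<gamma>, folded \<rho>_def, folded l_def]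
    have Q: "Q \<ge> 0" "Q \<le> C" using QC by (auto simp: Q_def sum_nonneg)
    have fin: "finite ?A" by (rule finite_centers[OF \<epsilon>])
    have sub: "cball a \<rho> \<subseteq> \<Omega>" if "a \<in> ?A" for a
      using cball_subset_domain[OF that, of \<rho>] r(3) \<epsilon> by simp
    obtain S c where S: "test_function \<Omega> S" 
      "\<And>a x. a \<in> ?A \<Longrightarrow> (norm (x - a))^2 \<le> 2 * \<rho>^2 \<Longrightarrow> S x = \<epsilon>^2 * d a * c a"
      "\<And>a. a \<in> ?A \<Longrightarrow> c a \<ge> l - ln 6 / 2"
      "(nrm2 M S)^2 \<le> 2 * pi * \<epsilon> ^ 4 * Q" "(nrm2 M (grad S))^2 \<le> \<epsilon>^2 * Q * (2 * pi * l)"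
      "(\<integral>x. norm (grad S x) \<partial>M) \<le> pi * \<epsilon> * Q"
      by (rule vortex_part[OF \<epsilon> r(1,4), of p d, folded Q_def l_def]) blast
    have "4 * \<rho> < \<epsilon>" using r(3) \<epsilon> by simp
    then obtain q where q: "test_function \<Omega> q" "\<And>a x. a \<in> ?A \<Longrightarrow> (norm (x - a))^2 \<le> 2 * \<rho>^2 \<Longrightarrow> q x = \<phi> a - \<phi> x" "nrm2 M (with_grad q) \<le> K1 * (\<rho> / \<epsilon>)"
      using K1(2)[OF \<epsilon> r(1,2)] by blast
    define v where "v x = (\<phi> x + 1 * S x) + 1 * q x" for x
    have tv: "test_function \<Omega> v" unfolding v_def[abs_def] by (intro test_function_add \<phi> S(1) q(1))
    have gv: "grad v = (\<lambda>x. (grad \<phi> x + 1 *\<^sub>R grad S x) + 1 *\<^sub>R grad q x)"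
      unfolding v_def[abs_def] grad_add[OF test_function_add[OF \<phi> S(1)] q(1)] grad_add[OF \<phi> S(1)] ..
    have wv: "with_grad v = (\<lambda>x. (with_grad \<phi> x + with_grad S x) + with_grad q x)"
      by (auto simp: with_grad_def gv v_def fun_eq_iff)
    have vc: "v x = \<phi> a + \<epsilon>^2 * d a * c a" if "a \<in> ?A" "(norm (x - a))^2 \<le> 2 * \<rho>^2" for a x
      using S(2)[OF that] q(2)[OF that] by (simp add: v_def)
    have hole: "(norm (x - a))^2 < 2 * \<rho>^2" if "x \<in> cball a \<rho>" for x a
    proof -
      have "(norm (x - a))^2 \<le> \<rho>^2" using that by (intro power_mono) (auto simp: dist_norm norm_minus_commute)
      moreover have "\<rho>^2 > 0" using r(1) by simp
      ultimately show ?thesis by linarith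
    qed
    \<comment> \<open>The competitor is constant on the open disk
      \<open>norm (x - a)^2 < 2 * \<rho>^2\<close>, which contains the closed hole; hence the
      gradient vanishes also on the boundary of the hole.\<close>
    have gvz: "grad v x = 0" if "a \<in> ?A" "x \<in> cball a \<rho>" for a x
    proof (rule grad_zero_locally_constant)
      show "open {x. (norm (x - a))^2 < 2 * \<rho>^2}" by (intro open_Collect_less continuous_intros)
      show "x \<in> {x. (norm (x - a))^2 < 2 * \<rho>^2}" using hole[OF that(2)] by simp
      show "v y = \<phi> a + \<epsilon>^2 * d a * c a" if "y \<in> {x. (norm (x - a))^2 < 2 * \<rho>^2}" for y
        using vc[OF \<open>a \<in> ?A\<close>, of y] that by simp
    qed
    have vZ: "with_grad v \<in> Z_holes ?A \<rho>"
      using Z_test[OF tv] gvz by (auto simp: Z_holes_def with_grad_def)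
    obtain w where w: "w \<in> Z_holes ?A \<rho>"
      "\<And>u. u \<in> Z_holes ?A \<rho> \<Longrightarrow> (\<integral>x. w x \<bullet> u x \<partial>M) =
      2 * pi * \<epsilon>^2 * (\<Sum>a\<in>?A. of_int (d a) * ((\<integral>x. ind (cball a \<rho>) x * fst (u x) \<partial>M) / (pi * \<rho>^2))) - \<sigma> * (\<integral>x. fst (u x) \<partial>M)"
      "E_tilde \<Omega> \<sigma> \<gamma> p \<epsilon> d = (nrm2 M w)^2 / 2"
      using E_tilde_char[OF fin sub[unfolded \<rho>_def], where \<sigma>=\<sigma> and d=d, folded \<rho>_def] by blast
    have avg: "(\<integral>x. ind (cball a \<rho>) x * v x \<partial>M) / (pi * \<rho>^2) = \<phi> a + \<epsilon>^2 * d a * c a" if a: "a \<in> ?A" for a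
    proof -
      have "(\<integral>x. ind (cball a \<rho>) x * v x \<partial>M) = (\<integral>x. (\<phi> a + \<epsilon>^2 * d a * c a) * ind (cball a \<rho>) x \<partial>M)"
      proof (rule Bochner_Integration.integral_cong[OF refl])
        fix x show "ind (cball a \<rho>) x * v x = (\<phi> a + \<epsilon>^2 * d a * c a) * ind (cball a \<rho>) x"
          using vc[OF a, of x] hole[of x a] by (cases "x \<in> cball a \<rho>") auto
      qed
      also have "\<dots> = (\<phi> a + \<epsilon>^2 * d a * c a) * (pi * \<rho>^2)"
        using integral_indicator_cball[OF sub[OF a]] r(1) by (subst integral_mult_right_zero) simp
      finally show ?thesis using r(1) by simp
    qed
    have ss: "sqi M S" "sqi M (grad S)" "sqi M q" "sqi M \<phi>" "sqi M (grad \<phi>)" "sqi M v"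
      using test_function_sqi[OF open_domain] S(1) q(1) \<phi> tv by blast+
    note sw = with_grad_sqi[OF \<phi>] with_grad_sqi[OF S(1)] with_grad_sqi[OF q(1)]
    have sX: "sqi M (\<lambda>x. with_grad \<phi> x + with_grad S x)" by (rule sqi_add[OF sw(1,2)])
    have wsq: "sqi M w" using w(1) Z_sqi by (simp add: Z_holes_def)

    have sS: "nrm2 M S \<le> s0 * \<epsilon>"
    proof (rule power2_le_imp_le)
      have "(nrm2 M S)^2 \<le> 2 * pi * \<epsilon> ^ 4 * Q" by (rule S(4))
      also have "\<dots> \<le> 2 * pi * \<epsilon> ^ 4 * C" using Q \<epsilon> by (intro mult_left_mono) auto
      also have "\<dots> \<le> 2 * pi * \<epsilon>^2 * C" using power_decreasing[of 2 4 \<epsilon>] \<epsilon> e1 C by (intro mult_right_mono mult_left_mono) auto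
      also have "\<dots> = (s0 * \<epsilon>)^2" unfolding s0_def power_mult_distrib using C by simp
      finally show "(nrm2 M S)^2 \<le> (s0 * \<epsilon>)^2" .
    qed (use nn \<epsilon> in simp)
    have t: "nrm2 M (with_grad q) \<le> T * \<epsilon>"
    proof -
      have "K1 * (\<rho> / \<epsilon>) \<le> K1 * (\<epsilon> / \<gamma>)" by (rule mult_left_mono[OF r(5) K1(1)])
      then show ?thesis using q(3) by (simp add: T_def)
    qed
    have qn: "nrm2 M q \<le> T * \<epsilon>"
    proof -
      have "(nrm2 M q)^2 \<le> (nrm2 M (with_grad q))^2" using nrm2_pair_sq[OF sw(3)] by (simp add: with_grad_def)
      then have "nrm2 M q \<le> nrm2 M (with_grad q)" by (rule power2_le_imp_le) simp
      then show ?thesis using t by simp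
    qed
    have J: "(\<integral>x. norm (grad S x) \<partial>M) \<le> pi * C * \<epsilon>"
    proof -
      have "pi * \<epsilon> * Q \<le> pi * \<epsilon> * C" using Q \<epsilon> by (intro mult_left_mono) auto
      then have "(\<integral>x. norm (grad S x) \<partial>M) \<le> pi * \<epsilon> * C" using S(6) by linarith
      then show ?thesis by (simp add: mult_ac)
    qed
    \<comment> \<open>This cross term is small although the vortex gradient is not small in
      \<open>L^2\<close>: \<open>\<phi>\<close> and its gradient are bounded by \<open>B\<close>,
      and \<open>S\<close> and \<open>grad S\<close> are of order \<open>\<epsilon>\<close> in
      \<open>L^1\<close>.\<close>
    have I: "(\<integral>x. with_grad \<phi> x \<bullet> with_grad S x \<partial>M) \<le> B * (s0 * m) * \<epsilon> + B * (pi * C) * \<epsilon>"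
    proof -
      have iS: "integrable M (\<lambda>x. norm (S x))" "integrable M (\<lambda>x. norm (grad S x))"
        by (intro integrable_norm sqi_integrable[OF finite_measure_M] ss)+
      have "(\<integral>x. with_grad \<phi> x \<bullet> with_grad S x \<partial>M) \<le> (\<integral>x. B * norm (S x) + B * norm (grad S x) \<partial>M)"
      proof (rule integral_mono[OF sqi_inner[OF sw(1,2)]])
        show "integrable M (\<lambda>x. B * norm (S x) + B * norm (grad S x))" using iS by simp
        fix x
        have "\<phi> x * S x \<le> B * norm (S x)"
          using mult_right_mono[OF B(2)[of x] norm_ge_zero[of "S x"]] abs_le_iff[of "\<phi> x * S x"] by (simp add: abs_mult)
        moreover have "grad \<phi> x \<bullet> grad S x \<le> B * norm (grad S x)"
          using norm_cauchy_schwarz[of "grad \<phi> x" "grad S x"] mult_right_mono[OF B(3)[of x] norm_ge_zero[of "grad S x"]] by linarith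
        ultimately show "with_grad \<phi> x \<bullet> with_grad S x \<le> B * norm (S x) + B * norm (grad S x)" by (simp add: with_grad_def)
      qed
      also have "\<dots> = B * (\<integral>x. norm (S x) \<partial>M) + B * (\<integral>x. norm (grad S x) \<partial>M)" using iS by simp
      also have "\<dots> \<le> B * (s0 * \<epsilon> * m) + B * (pi * C * \<epsilon>)"
      proof (intro add_mono mult_left_mono B(1) J)
        show "(\<integral>x. norm (S x) \<partial>M) \<le> s0 * \<epsilon> * m"
          using integral_norm_le_vol[OF ss(1)] mult_right_mono[OF sS nn(1)] by (simp add: m_def)
      qed
      finally show ?thesis by (simp add: mult_ac)
    qed
    have G: "(nrm2 M (with_grad S))^2 \<le> 2 * pi * Q * \<epsilon> + 2 * pi * Q * (\<epsilon>^2 * l)"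
    proof -
      have "2 * pi * Q * \<epsilon> ^ 4 \<le> 2 * pi * Q * \<epsilon>" using e2(2) Q by (intro mult_left_mono) auto
      then show ?thesis using nrm2_pair_sq[OF sw(2)] S(4,5) by (simp add: with_grad_def mult_ac)
    qed
    define X where "X = nrm2 M (\<lambda>x. with_grad \<phi> x + with_grad S x)"
    have X2: "X^2 \<le> n0^2 + 2 * (B * (s0 * m) * \<epsilon> + B * (pi * C) * \<epsilon>) + 2 * pi * Q * \<epsilon> + 2 * pi * Q * (\<epsilon>^2 * l)"
      using nrm2_add_sq[OF sw(1,2)] I G by (simp add: X_def n0_def)
    have XX: "X \<le> sqrt XM"
    proof -
      have "B * (s0 * m) * \<epsilon> \<le> B * (s0 * m) * 1" "B * (pi * C) * \<epsilon> \<le> B * (pi * C) * 1" "2 * pi * Q * \<epsilon> \<le> 2 * pi * C * 1" "2 * pi * Q * (\<epsilon>^2 * l) \<le> 2 * pi * C * \<gamma>"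
      proof -
        show "B * (s0 * m) * \<epsilon> \<le> B * (s0 * m) * 1" "B * (pi * C) * \<epsilon> \<le> B * (pi * C) * 1"
          using e1 B nn C by (intro mult_left_mono; simp)+
        show "2 * pi * Q * \<epsilon> \<le> 2 * pi * C * 1" using e1 \<epsilon> Q C by (intro mult_mono) auto
        have "2 * pi * Q * (\<epsilon>^2 * l) \<le> 2 * pi * Q * \<gamma>" using lb(1) Q by (intro mult_left_mono) auto
        also have "\<dots> \<le> 2 * pi * C * \<gamma>" using Q \<gamma> by (intro mult_right_mono) auto
        finally show "2 * pi * Q * (\<epsilon>^2 * l) \<le> 2 * pi * C * \<gamma>" .
      qed
      then have "X^2 \<le> XM" using X2 unfolding XM_def by argo
      then show ?thesis by (rule real_le_rsqrt)
    qed
    define V where "V = nrm2 M (with_grad v)"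
    have V2: "V^2 \<le> X^2 + 2 * (sqrt XM * T * \<epsilon>) + T^2 * \<epsilon>"
    proof -
      have "V \<le> X + T * \<epsilon>" using nrm2_triangle[OF sX sw(3)] t unfolding wv[symmetric] X_def V_def by linarith
      then have "V^2 \<le> (X + T * \<epsilon>)^2" by (intro power_mono) (simp_all add: V_def)
      also have "\<dots> = X^2 + 2 * (X * (T * \<epsilon>)) + T^2 * \<epsilon>^2" by (simp add: power2_sum power_mult_distrib)
      also have "X * (T * \<epsilon>) \<le> sqrt XM * (T * \<epsilon>)" using XX nn \<epsilon> by (intro mult_right_mono) auto
      also have "T^2 * \<epsilon>^2 \<le> T^2 * \<epsilon>" using e2 by (intro mult_left_mono) auto
      finally show ?thesis by (simp add: mult_ac)
    qed
    have iv: "\<bar>(\<integral>x. v x \<partial>M) - (\<integral>x. \<phi> x \<partial>M)\<bar> \<le> (s0 * m + T * m) * \<epsilon>"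
    proof -
      have "(\<integral>x. v x \<partial>M) = (\<integral>x. \<phi> x \<partial>M) + (\<integral>x. S x \<partial>M) + (\<integral>x. q x \<partial>M)"
        unfolding v_def[abs_def]
        using sqi_integrable[OF finite_measure_M ss(1)] sqi_integrable[OF finite_measure_M ss(3)] sqi_integrable[OF finite_measure_M ss(4)] by simp
      moreover have "\<bar>\<integral>x. S x \<partial>M\<bar> \<le> s0 * \<epsilon> * m" "\<bar>\<integral>x. q x \<partial>M\<bar> \<le> T * \<epsilon> * m"
        using abs_integral_le_vol[OF ss(1)] mult_right_mono[OF sS nn(1)] abs_integral_le_vol[OF ss(3)] mult_right_mono[OF qn nn(1)] by (simp_all add: m_def)
      ultimately have "\<bar>(\<integral>x. v x \<partial>M) - (\<integral>x. \<phi> x \<partial>M)\<bar> \<le> s0 * \<epsilon> * m + T * \<epsilon> * m" by linarith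
      then show ?thesis by (simp add: algebra_simps)
    qed
    have "\<sigma> * (\<integral>x. v x \<partial>M) \<le> \<sigma> * ((\<integral>x. \<phi> x \<partial>M) + (s0 * m + T * m) * \<epsilon>)" using iv \<sigma> by (intro mult_left_mono) auto
    then have iv': "\<sigma> * (\<integral>x. v x \<partial>M) \<le> \<sigma> * (\<integral>x. \<phi> x \<partial>M) + \<sigma> * (s0 * m + T * m) * \<epsilon>" by (simp add: algebra_simps)
    \<comment> \<open>The plateau heights fall short of \<open>l\<close> by at most
      \<open>ln 6 / 2\<close>; weighted with \<open>\<epsilon>^2\<close> this loss is
      harmless.\<close>
    have LL: "2 * pi * \<epsilon>^2 * (\<Sum>a\<in>?A. of_int (d a) * (\<phi> a + \<epsilon>^2 * d a * c a)) \<ge> 2 * pi * L + 2 * pi * Q * (\<epsilon>^2 * l) - pi * C * ln 6 * \<epsilon>"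
    proof -
      have e0: "(\<Sum>a\<in>?A. of_int (d a) * (\<phi> a + \<epsilon>^2 * d a * c a)) = (\<Sum>a\<in>?A. of_int (d a) * \<phi> a) + \<epsilon>^2 * (\<Sum>a\<in>?A. (of_int (d a))^2 * c a)"
        by (simp add: sum.distrib sum_distrib_left algebra_simps power2_eq_square)
      have "(\<Sum>a\<in>?A. (of_int (d a))^2 * c a) \<ge> (\<Sum>a\<in>?A. (of_int (d a))^2 * (l - ln 6 / 2))"
        by (intro sum_mono mult_left_mono S(3)) auto
      then have "\<epsilon>^2 * (\<Sum>a\<in>?A. (of_int (d a))^2 * c a) \<ge> Q * (l - ln 6 / 2)"
        unfolding Q_def sum_distrib_right[symmetric] mult.assoc by (rule mult_left_mono) simp
      then have "2 * pi * \<epsilon>^2 * (\<epsilon>^2 * (\<Sum>a\<in>?A. (of_int (d a))^2 * c a)) \<ge> 2 * pi * \<epsilon>^2 * (Q * (l - ln 6 / 2))"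
        by (rule mult_left_mono) simp
      moreover have "2 * pi * \<epsilon>^2 * (Q * (l - ln 6 / 2)) = 2 * pi * Q * (\<epsilon>^2 * l) - pi * ln 6 * (Q * \<epsilon>^2)" by (simp add: algebra_simps)
      moreover have "pi * ln 6 * (Q * \<epsilon>^2) \<le> pi * ln 6 * (C * \<epsilon>)" using Q C e2 by (intro mult_left_mono mult_mono) auto
      moreover have e1: "2 * pi * \<epsilon>^2 * (u + \<epsilon>^2 * t) = 2 * pi * (\<epsilon>^2 * u) + 2 * pi * \<epsilon>^2 * (\<epsilon>^2 * t)" for u t
        by (simp add: algebra_simps)
      moreover have "pi * ln 6 * (C * \<epsilon>) = pi * C * ln 6 * \<epsilon>" by simp
      ultimately show ?thesis unfolding L_def e0 e1 by linarith
    qed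
    have wvv: "(\<integral>x. w x \<bullet> with_grad v x \<partial>M) = 2 * pi * \<epsilon>^2 * (\<Sum>a\<in>?A. of_int (d a) * (\<phi> a + \<epsilon>^2 * d a * c a)) - \<sigma> * (\<integral>x. v x \<partial>M)"
      using w(2)[OF vZ] avg by (simp add: with_grad_def cong: sum.cong)
    \<comment> \<open>Expanding the squared distance between the solution \<open>w\<close> and the
      competitor \<open>v\<close> gives the variational inequality for \<open>w\<close>.\<close>
    have "0 \<le> (nrm2 M (\<lambda>x. w x - with_grad v x))^2" by simp
    also have "\<dots> = (nrm2 M w)^2 - 2 * (\<integral>x. w x \<bullet> with_grad v x \<partial>M) + V^2"
      using nrm2_add_sq[OF wsq sqi_minus[OF with_grad_sqi[OF tv]]] by (simp add: V_def) (simp add: nrm2_def)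
    finally have E1: "E_tilde \<Omega> \<sigma> \<gamma> p \<epsilon> d \<ge> (\<integral>x. w x \<bullet> with_grad v x \<partial>M) - V^2 / 2" using w(3) by simp
    have pl: "pi * Q * (\<epsilon>^2 * l) \<ge> pi * \<gamma> * Q - 2 * (pi * C) * \<epsilon>"
    proof -
      have "pi * Q * (\<epsilon>^2 * l) \<ge> pi * Q * (\<gamma> - 2 * \<epsilon>)" using lb(2) Q by (intro mult_left_mono) auto
      moreover have "pi * Q * (2 * \<epsilon>) \<le> pi * C * (2 * \<epsilon>)" using Q \<epsilon> by (intro mult_right_mono mult_left_mono) auto
      moreover have "pi * Q * (\<gamma> - 2 * \<epsilon>) = pi * \<gamma> * Q - pi * Q * (2 * \<epsilon>)" "pi * C * (2 * \<epsilon>) = 2 * (pi * C) * \<epsilon>"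
        by (simp_all add: algebra_simps)
      ultimately show ?thesis by linarith
    qed
    have pq: "pi * Q * \<epsilon> \<le> pi * C * \<epsilon>" using Q \<epsilon> by (intro mult_right_mono mult_left_mono) auto
    have "E_tilde \<Omega> \<sigma> \<gamma> p \<epsilon> d \<ge> pi * \<gamma> * Q + 2 * pi * L - \<sigma> * (\<integral>x. \<phi> x \<partial>M) - n0^2 / 2 - (2 * (pi * C) * \<epsilon> + pi * C * ln 6 * \<epsilon> + pi * C * \<epsilon> + \<sigma> * (s0 * m + T * m) * \<epsilon>
       + B * (s0 * m) * \<epsilon> + B * (pi * C) * \<epsilon> + sqrt XM * T * \<epsilon> + T^2 * \<epsilon> / 2)"
      using E1 wvv LL iv' V2 X2 pl pq by argo
    also have "2 * (pi * C) * \<epsilon> + pi * C * ln 6 * \<epsilon> + pi * C * \<epsilon> + \<sigma> * (s0 * m + T * m) * \<epsilon>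
       + B * (s0 * m) * \<epsilon> + B * (pi * C) * \<epsilon> + sqrt XM * T * \<epsilon> + T^2 * \<epsilon> / 2 = K * \<epsilon>" unfolding K_def by (simp add: algebra_simps)
    finally show "E_tilde \<Omega> \<sigma> \<gamma> p \<epsilon> d \<ge> pi * \<gamma> * (\<epsilon>^2 * (\<Sum>a\<in>?A. (real_of_int (d a))^2))
      + 2 * pi * (\<epsilon>^2 * (\<Sum>a\<in>?A. of_int (d a) * \<phi> a)) - \<sigma> * (\<integral>x. \<phi> x \<partial>M) - (nrm2 M (with_grad \<phi>))^2 / 2 - K * \<epsilon>"
      by (simp only: Q_def L_def n0_def)
  qed
qed

end

section \<open>Averages over holes\<close>

lemma integral_lborel_dilation:
  fixes f :: "real^2 \<Rightarrow> real"
  assumes [measurable]: "f \<in> borel_measurable borel" and s: "s > 0"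
  shows "(\<integral>x. f x \<partial>lborel) = s^2 * (\<integral>y. f (a + s *\<^sub>R y) \<partial>lborel)"
proof -
  have "(\<integral>x. f x \<partial>lborel) = (\<integral>x. f x \<partial>density (distr lborel borel (\<lambda>x. a + s *\<^sub>R x)) (\<lambda>_. ennreal (\<bar>s\<bar> ^ DIM(real^2))))"
    using lborel_affine[of s a] s by simp
  also have "\<dots> = (\<integral>x. s^2 * f x \<partial>distr lborel borel (\<lambda>x. a + s *\<^sub>R x))"
    by (subst integral_density) (use s in auto)
  also have "\<dots> = (\<integral>y. s^2 * f (a + s *\<^sub>R y) \<partial>lborel)" by (subst integral_distr) auto
  finally show ?thesis by simp
qed

lemma ray_FTC:
  assumes "test_function \<Omega> \<phi>" "\<rho> \<le> R"
  shows "\<phi> (a + R *\<^sub>R y) - \<phi> (a + \<rho> *\<^sub>R y) = (\<integral>s. ind {\<rho>..R} s * (grad \<phi> (a + s *\<^sub>R y) \<bullet> y) \<partial>lborel)"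
proof -
  have cont: "continuous_on {\<rho>..R} (\<lambda>t. grad \<phi> (a + t *\<^sub>R y) \<bullet> y)"
    by (intro continuous_intros continuous_on_compose2[OF test_function_grad_continuous[OF assms(1)]]) auto
  have der: "((\<lambda>t. \<phi> (a + t *\<^sub>R y)) has_real_derivative grad \<phi> (a + t *\<^sub>R y) \<bullet> y) (at t)" for t
  proof -
    have 1: "(\<phi> has_derivative (\<lambda>k. k \<bullet> grad \<phi> (a + t *\<^sub>R y))) (at (a + t *\<^sub>R y))"
      using test_function_GDERIV[OF assms(1)] by (simp add: gderiv_def)
    have 2: "((\<lambda>t. a + t *\<^sub>R y) has_derivative (\<lambda>s. s *\<^sub>R y)) (at t)"
      by (auto intro!: derivative_eq_intros)
    from diff_chain_at[OF 2 1] show ?thesis by (simp add: has_field_derivative_def o_def inner_commute mult_commute_abs)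
  qed
  have "(\<integral>t. indicator {\<rho>..R} t *\<^sub>R (grad \<phi> (a + t *\<^sub>R y) \<bullet> y) \<partial>lborel) = \<phi> (a + R *\<^sub>R y) - \<phi> (a + \<rho> *\<^sub>R y)"
    by (rule integral_FTC_atLeastAtMost[where F="\<lambda>t. \<phi> (a + t *\<^sub>R y)"])
       (use assms cont der in \<open>auto simp: has_real_derivative_iff_has_vector_derivative[symmetric] intro: has_field_derivative_at_within\<close>)
  then show ?thesis by simp
qed

lemma integral_inverse_cube:
  assumes "0 < \<rho>" "\<rho> \<le> R"
  shows "(\<integral>s. ind {\<rho>..R} s * (1 / s ^ 3) \<partial>lborel) = (1 / \<rho>^2 - 1 / R^2) / 2"
proof -
  have "(\<integral>s. indicator {\<rho>..R} s *\<^sub>R (1 / s ^ 3) \<partial>lborel) = - (1 / (2 * R^2)) - - (1 / (2 * \<rho>^2))"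
  proof (rule integral_FTC_atLeastAtMost[where F="\<lambda>s. - (1 / (2 * s^2))"])
    fix s :: real assume "\<rho> \<le> s" "s \<le> R"
    then have "s > 0" using assms by simp
    then have "((\<lambda>s. - (1 / (2 * s^2))) has_real_derivative 1 / s ^ 3) (at s within {\<rho>..R})"
      by (auto intro!: derivative_eq_intros simp: field_simps power2_eq_square power3_eq_cube power4_eq_xxxx)
    then show "((\<lambda>s. - (1 / (2 * s^2))) has_vector_derivative 1 / s ^ 3) (at s within {\<rho>..R})"
      by (simp add: has_real_derivative_iff_has_vector_derivative)
  qed (use assms in \<open>auto intro!: continuous_intros\<close>)
  then show ?thesis by (simp add: field_simps)
qed

text \<open>Both sides equal \<open>\<integral>\<^bsub>B\<^sub>1\<^esub> (\<phi>(a + R y) - \<phi>(a + \<rho> y)) dy\<close>; rescaling the fundamental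
  theorem of calculus along rays replaces polar coordinates.\<close>

lemma ball_average_identity:
  assumes \<phi>: "test_function \<Omega> \<phi>" and r: "0 < \<rho>" "\<rho> \<le> R"
  shows "(\<integral>x. ind (cball a R) x * \<phi> x \<partial>lborel) / R^2 - (\<integral>x. ind (cball a \<rho>) x * \<phi> x \<partial>lborel) / \<rho>^2 =
    (\<integral>x. ind (cball a R) x * ((1 / (max \<rho> (norm (x - a)))^2 - 1 / R^2) / 2) * ((x - a) \<bullet> grad \<phi> x) \<partial>lborel)"
proof -
  have [measurable]: "\<phi> \<in> borel_measurable borel" "grad \<phi> \<in> borel_measurable borel"
    using test_function_measurable[OF \<phi>] test_function_grad_measurable[OF \<phi>] by auto
  have [measurable]: "cball b t \<in> sets borel" for b :: "real^2" and t by (rule borel_closed[OF closed_cball])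
  obtain B where B: "B \<ge> 0" "\<And>x. \<bar>\<phi> x\<bar> \<le> B" "\<And>x. norm (grad \<phi> x) \<le> B" using test_function_bounded[OF \<phi>] by metis
  let ?I = "ind (cball (0::real^2) 1)"
  have iI: "integrable lborel ?I" by (rule integrable_indicator_bounded) auto
  have mem: "a + s *\<^sub>R y \<in> cball a s \<longleftrightarrow> y \<in> cball 0 1" if "s > 0" for s y
    using that by (simp add: dist_norm mult_le_cancel_left1)
  have sc: "(\<integral>x. ind (cball a s) x * \<phi> x \<partial>lborel) / s^2 = (\<integral>y. ?I y * \<phi> (a + s *\<^sub>R y) \<partial>lborel)" if s: "s > 0" for s
  proof -
    have "(\<integral>x. ind (cball a s) x * \<phi> x \<partial>lborel) = s^2 * (\<integral>y. ind (cball a s) (a + s *\<^sub>R y) * \<phi> (a + s *\<^sub>R y) \<partial>lborel)"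
      by (rule integral_lborel_dilation[OF _ s]) measurable
    also have "(\<lambda>y. ind (cball a s) (a + s *\<^sub>R y) * \<phi> (a + s *\<^sub>R y)) = (\<lambda>y. ?I y * \<phi> (a + s *\<^sub>R y))"
      using mem[OF s] by (auto simp: indicator_def)
    finally show ?thesis using s by simp
  qed
  have ii: "integrable lborel (\<lambda>y. ?I y * \<phi> (a + s *\<^sub>R y))" for s
    by (rule integrable_bounded_support[where S="cball 0 1" and B=B]) (use B in \<open>auto simp: indicator_def\<close>)
  have ind1: "integrable lborel (\<lambda>s::real. c * ind {\<rho>..R} s)" for c
    by (intro integrable_mult_right integrable_indicator_bounded) auto
  have "(\<integral>x. ind (cball a R) x * \<phi> x \<partial>lborel) / R^2 - (\<integral>x. ind (cball a \<rho>) x * \<phi> x \<partial>lborel) / \<rho>^2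
      = (\<integral>y. ?I y * \<phi> (a + R *\<^sub>R y) - ?I y * \<phi> (a + \<rho> *\<^sub>R y) \<partial>lborel)"
    using sc r ii by simp
  also have "\<dots> = (\<integral>y. (\<integral>s. ?I y * (ind {\<rho>..R} s * (grad \<phi> (a + s *\<^sub>R y) \<bullet> y)) \<partial>lborel) \<partial>lborel)"
    using ray_FTC[OF \<phi> r(2), of a] by (simp add: right_diff_distrib[symmetric])
  also have "\<dots> = (\<integral>s. (\<integral>y. ?I y * (ind {\<rho>..R} s * (grad \<phi> (a + s *\<^sub>R y) \<bullet> y)) \<partial>lborel) \<partial>lborel)"
  proof (rule lborel_pair_Fubini[OF _ iI ind1[of B]])
    show "(\<lambda>(y, s). ?I y * (ind {\<rho>..R} s * (grad \<phi> (a + s *\<^sub>R y) \<bullet> y))) \<in> borel_measurable (lborel \<Otimes>\<^sub>M lborel)" by measurable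
    show "\<bar>?I y * (ind {\<rho>..R} s * (grad \<phi> (a + s *\<^sub>R y) \<bullet> y))\<bar> \<le> ?I y * (B * ind {\<rho>..R} s)" for y and s :: real
    proof (cases "y \<in> cball 0 1 \<and> s \<in> {\<rho>..R}")
      case True
      have "\<bar>grad \<phi> (a + s *\<^sub>R y) \<bullet> y\<bar> \<le> norm (grad \<phi> (a + s *\<^sub>R y)) * norm y" by (rule Cauchy_Schwarz_ineq2)
      also have "\<dots> \<le> B * 1" using True B by (intro mult_mono) auto
      finally show ?thesis using True by simp
    qed (auto simp: indicator_def)
  qed
  \<comment> \<open>For fixed \<open>s\<close> the substitution \<open>x = a + s y\<close> is
    undone: \<open>s^-2\<close> is the Jacobian and a further \<open>s^-1\<close> comes from
    \<open>y = (x - a) / s\<close>.\<close>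
  also have "\<dots> = (\<integral>s. (\<integral>x. ind {\<rho>..R} s * (1 / s ^ 3) * (ind (cball a s) x * ((x - a) \<bullet> grad \<phi> x)) \<partial>lborel) \<partial>lborel)"
  proof (rule Bochner_Integration.integral_cong[OF refl])
    fix s :: real
    show "(\<integral>y. ?I y * (ind {\<rho>..R} s * (grad \<phi> (a + s *\<^sub>R y) \<bullet> y)) \<partial>lborel) = (\<integral>x. ind {\<rho>..R} s * (1 / s ^ 3) * (ind (cball a s) x * ((x - a) \<bullet> grad \<phi> x)) \<partial>lborel)"
    proof (cases "s \<in> {\<rho>..R}")
      case True
      then have s: "s > 0" using r by simp
      have "(\<integral>x. ind {\<rho>..R} s * (1 / s ^ 3) * (ind (cball a s) x * ((x - a) \<bullet> grad \<phi> x)) \<partial>lborel) =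
        s^2 * (\<integral>y. ind {\<rho>..R} s * (1 / s ^ 3) * (ind (cball a s) (a + s *\<^sub>R y) * ((a + s *\<^sub>R y - a) \<bullet> grad \<phi> (a + s *\<^sub>R y))) \<partial>lborel)"
        by (rule integral_lborel_dilation[OF _ s]) measurable
      also have "\<dots> = (\<integral>y. s^2 * (ind {\<rho>..R} s * (1 / s ^ 3) * (ind (cball a s) (a + s *\<^sub>R y) * ((a + s *\<^sub>R y - a) \<bullet> grad \<phi> (a + s *\<^sub>R y)))) \<partial>lborel)"
        by (rule integral_mult_right_zero[symmetric])
      also have "\<dots> = (\<integral>y. ?I y * (ind {\<rho>..R} s * (grad \<phi> (a + s *\<^sub>R y) \<bullet> y)) \<partial>lborel)"
      proof (rule Bochner_Integration.integral_cong[OF refl])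
        fix y
        have "ind (cball a s) (a + s *\<^sub>R y) = ?I y" using mem[OF s, of y] by (simp add: indicator_def)
        then show "s^2 * (ind {\<rho>..R} s * (1 / s ^ 3) * (ind (cball a s) (a + s *\<^sub>R y) * ((a + s *\<^sub>R y - a) \<bullet> grad \<phi> (a + s *\<^sub>R y)))) =
           ?I y * (ind {\<rho>..R} s * (grad \<phi> (a + s *\<^sub>R y) \<bullet> y))"
          using s by (simp add: inner_commute power2_eq_square power3_eq_cube)
      qed
      finally show ?thesis by simp
    qed simp
  qed
  also have "\<dots> = (\<integral>x. (\<integral>s. ind {\<rho>..R} s * (1 / s ^ 3) * (ind (cball a s) x * ((x - a) \<bullet> grad \<phi> x)) \<partial>lborel) \<partial>lborel)"
  proof (rule lborel_pair_Fubini[OF _ ind1[of "1 / \<rho> ^ 3"]])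
    show "integrable lborel (\<lambda>x. R * B * ind (cball a R) x)"
      by (intro integrable_mult_right integrable_indicator_bounded) auto
    have "(\<lambda>(s, x). ind {\<rho>..R} s * (1 / s ^ 3) * ((if norm (x - a) \<le> s then 1 else 0) * ((x - a) \<bullet> grad \<phi> x))) \<in> borel_measurable (lborel \<Otimes>\<^sub>M lborel)" by measurable
    moreover have "(if norm (x - a) \<le> s then 1 else 0) = ind (cball a s) x" for s x by (simp add: indicator_def dist_norm norm_minus_commute)
    ultimately show "(\<lambda>(s, x). ind {\<rho>..R} s * (1 / s ^ 3) * (ind (cball a s) x * ((x - a) \<bullet> grad \<phi> x))) \<in> borel_measurable (lborel \<Otimes>\<^sub>M lborel)" by simp
    show "\<bar>ind {\<rho>..R} s * (1 / s ^ 3) * (ind (cball a s) x * ((x - a) \<bullet> grad \<phi> x))\<bar> \<le> 1 / \<rho> ^ 3 * ind {\<rho>..R} s * (R * B * ind (cball a R) x)" for s and x :: "real^2"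
    proof (cases "s \<in> {\<rho>..R} \<and> x \<in> cball a s")
      case True
      then have xR: "norm (x - a) \<le> R" and s: "s \<ge> \<rho>" "s > 0" using r by (auto simp: dist_norm norm_minus_commute)
      have "\<bar>(x - a) \<bullet> grad \<phi> x\<bar> \<le> norm (x - a) * norm (grad \<phi> x)" by (rule Cauchy_Schwarz_ineq2)
      also have "\<dots> \<le> R * B" using xR B r by (intro mult_mono) auto
      finally have 1: "\<bar>(x - a) \<bullet> grad \<phi> x\<bar> \<le> R * B" .
      have "\<rho> ^ 3 \<le> s ^ 3" using s r by (intro power_mono) auto
      then have "1 / s ^ 3 \<le> 1 / \<rho> ^ 3" using r by (intro divide_left_mono) (auto intro: mult_pos_pos simp: s)
      then have "(1 / s ^ 3) * \<bar>(x - a) \<bullet> grad \<phi> x\<bar> \<le> (1 / \<rho> ^ 3) * (R * B)" using 1 s r by (intro mult_mono) auto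
      moreover have "x \<in> cball a R" using xR by (simp add: dist_norm norm_minus_commute)
      ultimately show ?thesis using True s by (simp add: abs_mult)
    next
      case False
      have "0 \<le> 1 / \<rho> ^ 3 * ind {\<rho>..R} s * (R * B * ind (cball a R) x)" using r B by simp
      then show ?thesis using False by auto
    qed
  qed
  \<comment> \<open>For fixed \<open>x\<close> the condition on \<open>s\<close> is
    \<open>s \<ge> norm (x - a)\<close>, so \<open>s^-3\<close> is integrated from
    \<open>max \<rho> (norm (x - a))\<close> to \<open>R\<close>.\<close>
  also have "\<dots> = (\<integral>x. ind (cball a R) x * ((1 / (max \<rho> (norm (x - a)))^2 - 1 / R^2) / 2) * ((x - a) \<bullet> grad \<phi> x) \<partial>lborel)"
  proof (rule Bochner_Integration.integral_cong[OF refl])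
    fix x
    have "(\<integral>s. ind {\<rho>..R} s * (1 / s ^ 3) * (ind (cball a s) x * ((x - a) \<bullet> grad \<phi> x)) \<partial>lborel) =
       (\<integral>s. (ind {max \<rho> (norm (x - a))..R} s * (1 / s ^ 3)) * ((x - a) \<bullet> grad \<phi> x) \<partial>lborel)"
      by (rule Bochner_Integration.integral_cong) (auto simp: indicator_def dist_norm norm_minus_commute)
    also have "\<dots> = (\<integral>s. ind {max \<rho> (norm (x - a))..R} s * (1 / s ^ 3) \<partial>lborel) * ((x - a) \<bullet> grad \<phi> x)"
      by (rule integral_mult_left_zero)
    also have "(\<integral>s. ind {max \<rho> (norm (x - a))..R} s * (1 / s ^ 3) \<partial>lborel) = ind (cball a R) x * ((1 / (max \<rho> (norm (x - a)))^2 - 1 / R^2) / 2)"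
    proof (cases "norm (x - a) \<le> R")
      case True
      then show ?thesis using r by (subst integral_inverse_cube) (auto simp: dist_norm norm_minus_commute)
    next
      case False
      then have "{max \<rho> (norm (x - a))..R} = {}" by auto
      then show ?thesis using False by (simp add: dist_norm norm_minus_commute)
    qed
    finally show "(\<integral>s. ind {\<rho>..R} s * (1 / s ^ 3) * (ind (cball a s) x * ((x - a) \<bullet> grad \<phi> x)) \<partial>lborel) =
      ind (cball a R) x * ((1 / (max \<rho> (norm (x - a)))^2 - 1 / R^2) / 2) * ((x - a) \<bullet> grad \<phi> x)" .
  qed
  finally show ?thesis .
qed

text \<open>On the annulus this field has constant divergence \<open>- 2 / R^2\<close>, and it
  vanishes on the outer circle. Integration by parts against a function that is constant on the hole
  thus yields the difference between its average over the large disk and its value on the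
  hole.\<close>

definition radial_field :: "real \<Rightarrow> real \<Rightarrow> real^2 \<Rightarrow> real^2 \<Rightarrow> real^2" where
  "radial_field \<rho> R a x = (if norm (x - a) \<in> {\<rho><..R} then (1 / (norm (x - a))^2 - 1 / R^2) *\<^sub>R (x - a) else 0)"

lemma radial_field_measurable [measurable]: "radial_field \<rho> R a \<in> borel_measurable borel"
  unfolding radial_field_def[abs_def] by measurable

lemma norm_radial_field:
  assumes "0 < \<rho>"
  shows "norm (radial_field \<rho> R a x) \<le> indicator {\<rho>..R} (norm (x - a)) * (1 / norm (x - a))"
proof (cases "norm (x - a) \<in> {\<rho><..R}")
  case True
  then have p: "norm (x - a) > 0" "norm (x - a) \<le> R" using assms by auto
  then have "(norm (x - a))^2 \<le> R^2" by (intro power_mono) auto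
  then have "1 / R^2 \<le> 1 / (norm (x - a))^2" using p(1) by (intro frac_le) auto
  then have "norm (radial_field \<rho> R a x) = (1 / (norm (x - a))^2 - 1 / R^2) * norm (x - a)" using True by (simp add: radial_field_def)
  also have "\<dots> \<le> 1 / (norm (x - a))^2 * norm (x - a)" by (intro mult_right_mono) auto
  also have "\<dots> = 1 / norm (x - a)" using p by (simp add: power2_eq_square)
  finally show ?thesis using True by simp
qed (auto simp: radial_field_def)

lemma radial_field_zero: "norm (x - a) \<ge> R \<Longrightarrow> radial_field \<rho> R a x = 0"
  by (auto simp: radial_field_def)

lemma radial_field_bounds:
  assumes "0 < \<rho>" "\<rho> \<le> R"
  shows "norm (radial_field \<rho> R a x) \<le> 1 / \<rho>"
    "(\<integral>x. (norm (radial_field \<rho> R a x))^2 \<partial>lborel) \<le> 2 * pi * ln (R / \<rho>)"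
    "(\<integral>x. norm (radial_field \<rho> R a x) \<partial>lborel) \<le> 2 * pi * R"
proof -
  note bd = norm_radial_field[OF assms(1), of R a]
  note hi2 = has_integral_inverse_norm_sq[OF assms, of a, unfolded has_bochner_integral_iff]
  note hi1 = has_integral_inverse_norm[of R a, unfolded has_bochner_integral_iff]
  have "indicator {\<rho>..R} t * (1 / t) \<le> 1 / \<rho>" for t :: real
    using assms by (auto simp: indicator_def intro: divide_left_mono)
  then show "norm (radial_field \<rho> R a x) \<le> 1 / \<rho>" using bd[of x] by (meson order_trans)
  have "(\<integral>x. (norm (radial_field \<rho> R a x))^2 \<partial>lborel) \<le> (\<integral>x. indicator {\<rho>..R} (norm (x - a)) * (1 / (norm (x - a))^2) \<partial>lborel)"
  proof (rule integral_mono'[OF conjunct1[OF hi2]])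
    show "(norm (radial_field \<rho> R a x))^2 \<le> indicator {\<rho>..R} (norm (x - a)) * (1 / (norm (x - a))^2)" for x
      using power_mono[OF bd[of x], of 2] by (auto simp: indicator_def power_divide split: if_splits)
  qed auto
  then show "(\<integral>x. (norm (radial_field \<rho> R a x))^2 \<partial>lborel) \<le> 2 * pi * ln (R / \<rho>)" using hi2 by simp
  have "(\<integral>x. norm (radial_field \<rho> R a x) \<partial>lborel) \<le> (\<integral>x. indicator {0..R} (norm (x - a)) * (1 / norm (x - a)) \<partial>lborel)"
  proof (rule integral_mono')
    show "integrable lborel (\<lambda>x. indicator {0..R} (norm (x - a)) * (1 / norm (x - a)))" using hi1 assms by simp
    show "norm (radial_field \<rho> R a x) \<le> indicator {0..R} (norm (x - a)) * (1 / norm (x - a))" for x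
    proof -
      have "indicator {\<rho>..R} t * (1 / t) \<le> indicator {0..R} t * (1 / t)" if "t \<ge> 0" for t :: real
        using that assms by (auto simp: indicator_def of_bool_def)
      then show ?thesis using bd[of x] by (meson norm_ge_zero order_trans)
    qed
  qed auto
  then show "(\<integral>x. norm (radial_field \<rho> R a x) \<partial>lborel) \<le> 2 * pi * R" using hi1 assms by simp
qed

context bounded_domain
begin

text \<open>The identity for test functions says that \<open>k\<close> is orthogonal to their pairs,
  hence to \<open>Z\<close>. As the gradient of \<open>w\<close> vanishes on the hole, the kernel
  \<open>K\<close> counts only outside it, where it is half the radial field.\<close>

lemma hole_average:
  assumes w: "w \<in> Z" and r: "0 < \<rho>" "\<rho> \<le> R" and sub: "cball a R \<subseteq> \<Omega>"
    and z: "AE x in M. x \<in> cball a \<rho> \<longrightarrow> snd (w x) = 0"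
  shows "(\<integral>x. ind (cball a \<rho>) x * fst (w x) \<partial>M) / (pi * \<rho>^2) =
    (\<integral>x. ind (cball a R) x * fst (w x) \<partial>M) / (pi * R^2) - (\<integral>x. radial_field \<rho> R a x \<bullet> snd (w x) \<partial>M) / (2 * pi)"
proof -
  have [measurable]: "cball b t \<in> sets borel" for b :: "real^2" and t by (rule borel_closed[OF closed_cball])
  define K where "K x = (ind (cball a R) x * ((1 / (max \<rho> (norm (x - a)))^2 - 1 / R^2) / 2)) *\<^sub>R (x - a)" for x
  define k where "k x = (ind (cball a R) x / R^2 - ind (cball a \<rho>) x / \<rho>^2, - K x)" for x
  have [measurable]: "K \<in> borel_measurable borel" unfolding K_def[abs_def] by measurable
  have Kb: "norm (K x) \<le> 1 / \<rho>^2 * R" for x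
  proof (cases "norm (x - a) \<le> R")
    case True
    have "\<rho>^2 \<le> (max \<rho> (norm (x - a)))^2" "(max \<rho> (norm (x - a)))^2 \<le> R^2" using True r by (auto intro!: power_mono)
    then have "1 / (max \<rho> (norm (x - a)))^2 \<le> 1 / \<rho>^2" "1 / R^2 \<le> 1 / (max \<rho> (norm (x - a)))^2"
      using r by (auto intro!: divide_left_mono mult_pos_pos)
    moreover have "1 / R^2 \<ge> 0" by simp
    moreover have "0 \<le> (u - v) / 2 \<and> (u - v) / 2 \<le> t" if "u \<le> t" "v \<le> u" "0 \<le> v" for u v t :: real using that by argo
    ultimately have "0 \<le> (1 / (max \<rho> (norm (x - a)))^2 - 1 / R^2) / 2" "(1 / (max \<rho> (norm (x - a)))^2 - 1 / R^2) / 2 \<le> 1 / \<rho>^2" by blast+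
    then have "\<bar>(1 / (max \<rho> (norm (x - a)))^2 - 1 / R^2) / 2\<bar> * norm (x - a) \<le> 1 / \<rho>^2 * R"
      using True by (intro mult_mono) auto
    then show ?thesis using True by (simp add: K_def dist_norm norm_minus_commute)
  qed (use r in \<open>auto simp: K_def dist_norm norm_minus_commute\<close>)
  have sK: "sqi M K" by (rule sqi_bounded[OF finite_measure_M borel_measurable_M Kb]) measurable
  have sk: "sqi M k"
    unfolding sqi_fst_snd[of M k] k_def fst_conv snd_conv
    using sqi_diff[OF sqi_cmult[OF indicator_cball_sqi, of "1 / R^2"] sqi_cmult[OF indicator_cball_sqi, of "1 / \<rho>^2"], of a R a \<rho>] sqi_minus[OF sK] by simp
  have "(\<integral>x. k x \<bullet> w x \<partial>M) = 0"
  proof (rule Z_orthogonal[OF w sk])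
    fix \<phi> assume \<phi>: "test_function \<Omega> \<phi>"
    have [measurable]: "\<phi> \<in> borel_measurable borel" "grad \<phi> \<in> borel_measurable borel"
      using test_function_measurable[OF \<phi>] test_function_grad_measurable[OF \<phi>] by auto
    obtain B where B: "B \<ge> 0" "\<And>x. \<bar>\<phi> x\<bar> \<le> B" "\<And>x. norm (grad \<phi> x) \<le> B" using test_function_bounded[OF \<phi>] by metis
    have i1: "integrable lborel (\<lambda>x. ind (cball a s) x * \<phi> x)" for s
      by (rule integrable_bounded_support[where S="cball a s" and B=B]) (use B in \<open>auto simp: indicator_def\<close>)
    have i2: "integrable lborel (\<lambda>x. K x \<bullet> grad \<phi> x)"
    proof (rule integrable_bounded_support[where S="cball a R" and B="1 / \<rho>^2 * R * B"])
      show "norm (K x \<bullet> grad \<phi> x) \<le> 1 / \<rho>^2 * R * B" for x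
        using Cauchy_Schwarz_ineq2[of "K x" "grad \<phi> x"] mult_mono[OF Kb[of x] B(3)[of x]] r by (simp add: order_trans)
    qed (auto simp: K_def)
    have "(\<integral>x. k x \<bullet> with_grad \<phi> x \<partial>M) = (\<integral>x. (ind (cball a R) x * \<phi> x / R^2 - ind (cball a \<rho>) x * \<phi> x / \<rho>^2) - K x \<bullet> grad \<phi> x \<partial>M)"
      by (rule Bochner_Integration.integral_cong) (auto simp: k_def with_grad_def algebra_simps)
    also have "\<dots> = (\<integral>x. (ind (cball a R) x * \<phi> x / R^2 - ind (cball a \<rho>) x * \<phi> x / \<rho>^2) - K x \<bullet> grad \<phi> x \<partial>lborel)"
      by (rule integral_test_lebesgue_on[OF open_domain \<phi>]) auto
    also have "\<dots> = (\<integral>x. ind (cball a R) x * \<phi> x \<partial>lborel) / R^2 - (\<integral>x. ind (cball a \<rho>) x * \<phi> x \<partial>lborel) / \<rho>^2 - (\<integral>x. K x \<bullet> grad \<phi> x \<partial>lborel)"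
      using i1 i2 by simp
    also have "(\<integral>x. K x \<bullet> grad \<phi> x \<partial>lborel) = (\<integral>x. ind (cball a R) x * ((1 / (max \<rho> (norm (x - a)))^2 - 1 / R^2) / 2) * ((x - a) \<bullet> grad \<phi> x) \<partial>lborel)"
      by (rule Bochner_Integration.integral_cong) (auto simp: K_def)
    finally show "(\<integral>x. k x \<bullet> with_grad \<phi> x \<partial>M) = 0" using ball_average_identity[OF \<phi> r, of a] by simp
  qed
  moreover have "(\<integral>x. k x \<bullet> w x \<partial>M) = (\<integral>x. ind (cball a R) x * fst (w x) \<partial>M) / R^2 - (\<integral>x. ind (cball a \<rho>) x * fst (w x) \<partial>M) / \<rho>^2 - (\<integral>x. K x \<bullet> snd (w x) \<partial>M)"
  proof -
    have "(\<integral>x. k x \<bullet> w x \<partial>M) = (\<integral>x. (ind (cball a R) x * fst (w x) / R^2 - ind (cball a \<rho>) x * fst (w x) / \<rho>^2) - K x \<bullet> snd (w x) \<partial>M)"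
      by (rule Bochner_Integration.integral_cong) (auto simp: k_def inner_prod_def algebra_simps)
    then show ?thesis
      using sqi_mult[OF indicator_cball_sqi Z_fst[OF w]] sqi_inner[OF sK Z_snd[OF w]] by simp
  qed
  moreover have "(\<integral>x. K x \<bullet> snd (w x) \<partial>M) = (\<integral>x. (radial_field \<rho> R a x \<bullet> snd (w x)) / 2 \<partial>M)"
  proof (rule integral_cong_AE)
    show "AE x in M. K x \<bullet> snd (w x) = (radial_field \<rho> R a x \<bullet> snd (w x)) / 2" using z
    proof eventually_elim
      case (elim x)
      show ?case
      proof (cases "x \<in> cball a \<rho>")
        case True then show ?thesis using elim by simp
      next
        case False
        then have "norm (x - a) > \<rho>" by (simp add: dist_norm norm_minus_commute)
        then have "K x = (1/2) *\<^sub>R radial_field \<rho> R a x"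
          by (auto simp: K_def radial_field_def dist_norm norm_minus_commute max_def)
        then show ?thesis by simp
      qed
    qed
    show "(\<lambda>x. K x \<bullet> snd (w x)) \<in> borel_measurable M" using sK Z_snd[OF w] by (auto simp: sqi_def)
    show "(\<lambda>x. (radial_field \<rho> R a x \<bullet> snd (w x)) / 2) \<in> borel_measurable M"
      using borel_measurable_M[OF radial_field_measurable] Z_snd[OF w] by (auto simp: sqi_def)
  qed
  moreover have "(\<integral>x. (radial_field \<rho> R a x \<bullet> snd (w x)) / 2 \<partial>M) = (\<integral>x. radial_field \<rho> R a x \<bullet> snd (w x) \<partial>M) / 2" by simp
  ultimately have "(\<integral>x. ind (cball a \<rho>) x * fst (w x) \<partial>M) / \<rho>^2 = (\<integral>x. ind (cball a R) x * fst (w x) \<partial>M) / R^2 - (\<integral>x. radial_field \<rho> R a x \<bullet> snd (w x) \<partial>M) / 2"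
    by linarith
  then have "(\<integral>x. ind (cball a \<rho>) x * fst (w x) \<partial>M) / \<rho>^2 / pi = ((\<integral>x. ind (cball a R) x * fst (w x) \<partial>M) / R^2 - (\<integral>x. radial_field \<rho> R a x \<bullet> snd (w x) \<partial>M) / 2) / pi"
    by simp
  then show ?thesis by (simp add: diff_divide_distrib mult.commute)
qed


text \<open>Translation and Fubini arguments take place on the whole plane with Borel functions;
  this supplies a representative that vanishes outside the domain and keeps the norm.\<close>

lemma borel_version:
  fixes g :: "real^2 \<Rightarrow> real"
  assumes g: "sqi M g"
  obtains g' where "g' \<in> borel_measurable borel" "\<And>x. x \<notin> \<Omega> \<Longrightarrow> g' x = 0" "AE x in M. g' x = g x" "sqi M g'"
    "sqi lborel g'" "nrm2 lborel g' = nrm2 M g" "integrable lborel g'"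
proof -
  have "(\<lambda>x. ind \<Omega> x * g x) \<in> borel_measurable lebesgue"
    using g domain_sets by (simp add: sqi_def borel_measurable_restrict_space_iff)
  then obtain h where h: "h \<in> borel_measurable lborel" "AE x in lborel. ind \<Omega> x * g x = h x"
    using completion_ex_borel_measurable_real by blast
  define g' where "g' x = ind \<Omega> x * h x" for x
  have m: "g' \<in> borel_measurable borel"
    unfolding g'_def[abs_def] using h(1) open_domain by (intro borel_measurable_times borel_measurable_indicator) auto
  have z: "g' x = 0" if "x \<notin> \<Omega>" for x using that by (simp add: g'_def)
  have "AE x in lebesgue. ind \<Omega> x * g x = h x" using h(2) by (simp add: AE_completion)
  then have ae: "AE x in M. g' x = g x"
    using domain_sets by (auto simp: AE_restrict_space_iff g'_def indicator_def elim: eventually_mono)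
  have sg: "sqi M g'" by (rule sqi_AE_cong[OF g borel_measurable_M[OF m] ae])
  have m2: "(\<lambda>x. (norm (g' x))^2) \<in> borel_measurable borel" using m by measurable
  have sl: "sqi lborel g'"
    using sg integrable_lebesgue_on_borel[OF domain_sets m2] z m by (simp add: sqi_def)
  have n: "nrm2 lborel g' = nrm2 M g"
  proof -
    have "(\<integral>x. (norm (g' x))^2 \<partial>M) = (\<integral>x. (norm (g' x))^2 \<partial>lborel)" by (rule integral_lebesgue_on_borel[OF domain_sets m2]) (simp add: z)
    moreover have "(\<integral>x. (norm (g' x))^2 \<partial>M) = (\<integral>x. (norm (g x))^2 \<partial>M)"
      by (rule integral_norm_sq_AE_cong[OF _ _ ae]) (use g sg in \<open>auto simp: sqi_def\<close>)
    ultimately show ?thesis by (simp add: nrm2_def)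
  qed
  have i: "integrable lborel g'"
    using sqi_integrable[OF finite_measure_M sg] integrable_lebesgue_on_borel[OF domain_sets m] z by simp
  show ?thesis by (rule that[OF m z ae sg sl n i])
qed

text \<open>The first term on the right bounds the contribution of \<open>\<phi>\<close> minus its average over balls
  of radius \<open>\<delta>\<close>; moving the average from \<open>\<phi>\<close> to \<open>g\<close> gives the second one.\<close>

lemma averaging_bound:
  fixes g :: "real^2 \<Rightarrow> real"
  assumes g: "sqi M g" and \<phi>: "test_function \<Omega> \<phi>" and \<delta>: "\<delta> > 0"
  defines "G \<equiv> \<lambda>z. \<integral>x. ind (cball z \<delta>) x * g x \<partial>M"
  shows "sqi M G"
    and "pi * \<delta>^2 * \<bar>\<integral>x. g x * \<phi> x \<partial>M\<bar> \<le> pi * \<delta>^2 * (\<delta> * nrm2 M g * nrm2 M (grad \<phi>)) + nrm2 M G * nrm2 M \<phi>"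
proof -
  obtain g' where g': "g' \<in> borel_measurable borel" "\<And>x. x \<notin> \<Omega> \<Longrightarrow> g' x = 0" "AE x in M. g' x = g x" "sqi M g'"
    "sqi lborel g'" "nrm2 lborel g' = nrm2 M g" "integrable lborel g'" using borel_version[OF g] by blast
  have [measurable]: "g' \<in> borel_measurable borel" "\<phi> \<in> borel_measurable borel" "grad \<phi> \<in> borel_measurable borel"
    using g'(1) test_function_measurable[OF \<phi>] test_function_grad_measurable[OF \<phi>] by auto
  have [measurable]: "cball b t \<in> sets borel" for b :: "real^2" and t by (rule borel_closed[OF closed_cball])
  have Gb: "\<bar>G z\<bar> \<le> nrm2 M g * sqrt vol" for z
  proof -
    have "\<bar>G z\<bar> \<le> nrm2 M (ind (cball z \<delta>)) * nrm2 M g"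
      unfolding G_def using Cauchy_Schwarz_integral[OF indicator_cball_sqi g, of z \<delta>] by simp
    also have "\<dots> \<le> sqrt vol * nrm2 M g"
    proof (rule mult_right_mono)
      have "(\<integral>x. (norm (ind (cball z \<delta>) x))^2 \<partial>M) \<le> (\<integral>x. 1 \<partial>M)"
        by (rule integral_mono') (use finite_measure.integrable_const[OF finite_measure_M, of "1::real"] in \<open>auto simp: indicator_def\<close>)
      then show "nrm2 M (ind (cball z \<delta>)) \<le> sqrt vol" unfolding nrm2_def using measure_M by simp
    qed simp
    finally show ?thesis by (simp add: mult.commute)
  qed
  have G': "G z = (\<integral>x. (if norm (z - x) \<le> \<delta> then 1 else 0) * g' x \<partial>lborel)" for z
  proof -
    have "G z = (\<integral>x. ind (cball z \<delta>) x * g' x \<partial>M)"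
      unfolding G_def
    proof (rule integral_cong_AE)
      show "AE x in M. ind (cball z \<delta>) x * g x = ind (cball z \<delta>) x * g' x" using g'(3) by eventually_elim simp
    qed (use g g'(4) indicator_cball_measurable in \<open>auto simp: sqi_def\<close>)
    also have "\<dots> = (\<integral>x. ind (cball z \<delta>) x * g' x \<partial>lborel)"
      by (rule integral_lebesgue_on_borel[OF domain_sets]) (use g'(2) in auto)
    also have "\<dots> = (\<integral>x. (if norm (z - x) \<le> \<delta> then 1 else 0) * g' x \<partial>lborel)"
      by (rule Bochner_Integration.integral_cong) (auto simp: indicator_def dist_norm)
    finally show ?thesis .
  qed
  have Gm: "G \<in> borel_measurable borel"
  proof -
    have "(\<lambda>z. \<integral>x. (if norm (z - x) \<le> \<delta> then 1 else 0) * g' x \<partial>lborel) \<in> borel_measurable borel" by measurable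
    then show ?thesis by (simp add: G'[abs_def])
  qed
  show sG: "sqi M G"
    by (rule sqi_bounded[OF finite_measure_M borel_measurable_M[OF Gm]]) (use Gb in simp)
  obtain B where B: "B \<ge> 0" "\<And>x. \<bar>\<phi> x\<bar> \<le> B" "\<And>x. norm (grad \<phi> x) \<le> B" using test_function_bounded[OF \<phi>] by metis
  let ?I = "ind (cball (0::real^2) \<delta>)"
  have iI: "integrable lborel ?I" by (rule integrable_indicator_bounded) auto
  have vI: "(\<integral>y. ?I y \<partial>lborel) = pi * \<delta>^2"
    using content_cball[of \<delta> "0::real^2"] \<delta> by (simp add: unit_ball_vol_2)
  have tr: "(\<integral>x. g x * \<phi> x \<partial>M) = (\<integral>x. g' x * \<phi> x \<partial>lborel)"
  proof -
    have "(\<integral>x. g x * \<phi> x \<partial>M) = (\<integral>x. g' x * \<phi> x \<partial>M)"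
    proof (rule integral_cong_AE)
      show "AE x in M. g x * \<phi> x = g' x * \<phi> x" using g'(3) by eventually_elim simp
    qed (use g g'(4) test_function_sqi(1)[OF open_domain \<phi>] in \<open>auto simp: sqi_def\<close>)
    also have "\<dots> = (\<integral>x. g' x * \<phi> x \<partial>lborel)" by (rule integral_test_lebesgue_on[OF open_domain \<phi>]) auto
    finally show ?thesis .
  qed
  have ig: "integrable lborel (\<lambda>x. g' x * \<phi> (x + y))" for y
    by (rule Bochner_Integration.integrable_bound[of _ "\<lambda>x. B * \<bar>g' x\<bar>"]) (use g'(7) B in \<open>auto simp: abs_mult mult.commute[of B] intro!: AE_I2 mult_left_mono\<close>)
  have ig0: "integrable lborel (\<lambda>x. g' x * \<phi> x)" using ig[of 0] by simp
  define U where "U y = (\<integral>x. g' x * (\<phi> (x + y) - \<phi> x) \<partial>lborel)" for y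
  have Ueq: "U y = (\<integral>x. g' x * \<phi> (x + y) \<partial>lborel) - (\<integral>x. g' x * \<phi> x \<partial>lborel)" for y
    unfolding U_def using ig[of y] ig0 by (simp add: right_diff_distrib)
  have ngr: "nrm2 lborel (grad \<phi>) = nrm2 M (grad \<phi>)"
    unfolding nrm2_def using integral_test_lebesgue_on[OF open_domain \<phi>, of "\<lambda>x. (norm (grad \<phi> x))^2"] by simp
  have sgr: "sqi lborel (\<lambda>x. grad \<phi> (x + h))" for h
  proof -
    have "integrable M (\<lambda>x. (norm (grad \<phi> x))^2)" using test_function_sqi(2)[OF open_domain \<phi>] by (simp add: sqi_def)
    moreover obtain K where "K \<subseteq> \<Omega>" "\<And>x. x \<notin> K \<Longrightarrow> grad \<phi> x = 0" using test_function_support[OF \<phi>] by metis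
    ultimately have "integrable lborel (\<lambda>x. (norm (grad \<phi> x))^2)"
      using integrable_lebesgue_on_borel[OF domain_sets, of "\<lambda>x. (norm (grad \<phi> x))^2"] by auto
    then show ?thesis using integrable_lborel_translation[of "\<lambda>x. (norm (grad \<phi> x))^2" h] by (simp add: sqi_def)
  qed
  have Ub: "\<bar>U y\<bar> \<le> \<delta> * nrm2 M g * nrm2 M (grad \<phi>)" if y: "norm y \<le> \<delta>" for y
    unfolding U_def
  proof (rule translation_bound[OF \<phi> g'(7)])
    fix t :: real
    let ?h = "\<lambda>x. grad \<phi> (x + t *\<^sub>R y)"
    have n: "nrm2 lborel ?h = nrm2 M (grad \<phi>)"
    proof -
      have "nrm2 lborel ?h = nrm2 lborel (grad \<phi>)"
        unfolding nrm2_def using integral_lborel_translation[of "\<lambda>x. (norm (grad \<phi> x))^2" "t *\<^sub>R y"] by simp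
      then show ?thesis by (simp add: ngr)
    qed
    have "\<bar>\<integral>x. g' x * (?h x \<bullet> y) \<partial>lborel\<bar> \<le> (\<integral>x. \<bar>g' x * (?h x \<bullet> y)\<bar> \<partial>lborel)" by (rule integral_abs_bound)
    also have "\<dots> \<le> (\<integral>x. norm y * (norm (g' x) * norm (?h x)) \<partial>lborel)"
    proof (rule integral_mono')
      show "integrable lborel (\<lambda>x. norm y * (norm (g' x) * norm (?h x)))"
        by (intro integrable_mult_right sqi_mult sqi_norm g'(5) sgr)
      fix x
      have "\<bar>g' x\<bar> * \<bar>?h x \<bullet> y\<bar> \<le> \<bar>g' x\<bar> * (norm (?h x) * norm y)" by (intro mult_left_mono Cauchy_Schwarz_ineq2) simp
      then show "\<bar>g' x * (?h x \<bullet> y)\<bar> \<le> norm y * (norm (g' x) * norm (?h x))" by (simp add: abs_mult mult_ac)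
    qed auto
    also have "\<dots> = norm y * (\<integral>x. norm (g' x) * norm (?h x) \<partial>lborel)" by simp
    also have "\<dots> \<le> \<delta> * (nrm2 lborel g' * nrm2 lborel ?h)"
      using Cauchy_Schwarz_integral_norm[OF g'(5) sgr[of "t *\<^sub>R y"]] y \<delta> by (intro mult_mono) auto
    finally show "\<bar>\<integral>x. g' x * (?h x \<bullet> y) \<partial>lborel\<bar> \<le> \<delta> * nrm2 M g * nrm2 M (grad \<phi>)" unfolding n g'(6) by (simp add: mult_ac)
  qed
  have F1: "(\<integral>y. (\<integral>x. ?I y * (g' x * \<phi> (x + y)) \<partial>lborel) \<partial>lborel) = (\<integral>x. (\<integral>y. ?I y * (g' x * \<phi> (x + y)) \<partial>lborel) \<partial>lborel)"
  proof (rule lborel_pair_Fubini[OF _ iI])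
    show "integrable lborel (\<lambda>x. B * \<bar>g' x\<bar>)" using g'(7) by simp
    show "\<bar>?I y * (g' x * \<phi> (x + y))\<bar> \<le> ?I y * (B * \<bar>g' x\<bar>)" for x y
      using mult_left_mono[OF B(2)[of "x + y"] abs_ge_zero[of "g' x"]] by (auto simp: indicator_def abs_mult mult.commute)
  qed measurable
  also have "\<dots> = (\<integral>x. (\<integral>z. (if norm (z - x) \<le> \<delta> then 1 else 0) * (g' x * \<phi> z) \<partial>lborel) \<partial>lborel)"
  proof (rule Bochner_Integration.integral_cong[OF refl])
    fix x
    have "(\<integral>z. (if norm (z - x) \<le> \<delta> then 1 else 0) * (g' x * \<phi> z) \<partial>lborel) = (\<integral>y. (if norm (y + x - x) \<le> \<delta> then 1 else 0) * (g' x * \<phi> (y + x)) \<partial>lborel)"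
      by (rule integral_lborel_translation[symmetric]) measurable
    also have "\<dots> = (\<integral>y. ?I y * (g' x * \<phi> (x + y)) \<partial>lborel)"
      by (rule Bochner_Integration.integral_cong) (auto simp: indicator_def add.commute)
    finally show "(\<integral>y. ?I y * (g' x * \<phi> (x + y)) \<partial>lborel) = (\<integral>z. (if norm (z - x) \<le> \<delta> then 1 else 0) * (g' x * \<phi> z) \<partial>lborel)" by simp
  qed
  also have "\<dots> = (\<integral>z. (\<integral>x. (if norm (z - x) \<le> \<delta> then 1 else 0) * (g' x * \<phi> z) \<partial>lborel) \<partial>lborel)"
  proof (rule lborel_pair_Fubini)
    show "integrable lborel (\<lambda>x. \<bar>g' x\<bar>)" "integrable lborel (\<lambda>z. \<bar>\<phi> z\<bar>)" using g'(7) test_function_integrable(1)[OF \<phi>] by auto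
  qed (auto simp: abs_mult)
  also have "\<dots> = (\<integral>z. G z * \<phi> z \<partial>lborel)"
    unfolding G' by (rule Bochner_Integration.integral_cong) (auto simp flip: integral_mult_left_zero simp: mult.assoc)
  also have "\<dots> = (\<integral>z. G z * \<phi> z \<partial>M)"
    by (rule integral_test_lebesgue_on[OF open_domain \<phi>, symmetric]) (use Gm in auto)
  finally have F: "(\<integral>y. ?I y * (\<integral>x. g' x * \<phi> (x + y) \<partial>lborel) \<partial>lborel) = (\<integral>z. G z * \<phi> z \<partial>M)" by simp
  have iU: "integrable lborel (\<lambda>y. ?I y * U y)"
  proof (rule integrable_bounded_support[where S="cball 0 \<delta>" and B="\<delta> * nrm2 M g * nrm2 M (grad \<phi>)"])
    show "(\<lambda>y. ?I y * U y) \<in> borel_measurable borel" unfolding U_def[abs_def] by measurable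
    show "norm (?I y * U y) \<le> \<delta> * nrm2 M g * nrm2 M (grad \<phi>)" for y
      using Ub[of y] \<delta> by (cases "norm y \<le> \<delta>") (auto simp: indicator_def)
  qed auto
  have "(\<integral>y. ?I y * (\<integral>x. g' x * \<phi> (x + y) \<partial>lborel) \<partial>lborel) = (\<integral>y. ?I y * U y + (\<integral>x. g' x * \<phi> x \<partial>lborel) * ?I y \<partial>lborel)"
    by (rule Bochner_Integration.integral_cong) (auto simp: Ueq algebra_simps)
  also have "\<dots> = (\<integral>y. ?I y * U y \<partial>lborel) + (\<integral>x. g' x * \<phi> x \<partial>lborel) * (pi * \<delta>^2)"
    unfolding vI[symmetric] using iU iI by (subst Bochner_Integration.integral_add) auto
  finally have main: "(\<integral>x. g x * \<phi> x \<partial>M) * (pi * \<delta>^2) = (\<integral>z. G z * \<phi> z \<partial>M) - (\<integral>y. ?I y * U y \<partial>lborel)"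
    using F tr by simp
  have A: "\<bar>\<integral>z. G z * \<phi> z \<partial>M\<bar> \<le> nrm2 M G * nrm2 M \<phi>"
    using Cauchy_Schwarz_integral[OF sG test_function_sqi(1)[OF open_domain \<phi>]] by simp
  have "\<bar>\<integral>y. ?I y * U y \<partial>lborel\<bar> \<le> (\<integral>y. \<bar>?I y * U y\<bar> \<partial>lborel)" by (rule integral_abs_bound)
  also have "\<dots> \<le> (\<integral>y. (\<delta> * nrm2 M g * nrm2 M (grad \<phi>)) * ?I y \<partial>lborel)"
  proof (rule integral_mono')
    show "integrable lborel (\<lambda>y. (\<delta> * nrm2 M g * nrm2 M (grad \<phi>)) * ?I y)" by (rule integrable_mult_right[OF iI])
    show "\<bar>?I y * U y\<bar> \<le> (\<delta> * nrm2 M g * nrm2 M (grad \<phi>)) * ?I y" for y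
      using Ub[of y] by (auto simp: indicator_def)
  qed (use \<delta> in simp)
  also have "\<dots> = (\<delta> * nrm2 M g * nrm2 M (grad \<phi>)) * (pi * \<delta>^2)" unfolding vI[symmetric] by (rule integral_mult_right_zero)
  finally have B': "\<bar>\<integral>y. ?I y * U y \<partial>lborel\<bar> \<le> pi * \<delta>^2 * (\<delta> * nrm2 M g * nrm2 M (grad \<phi>))" by (simp add: mult_ac)
  have "pi * \<delta>^2 * \<bar>\<integral>x. g x * \<phi> x \<partial>M\<bar> = \<bar>(\<integral>x. g x * \<phi> x \<partial>M) * (pi * \<delta>^2)\<bar>" by (simp add: abs_mult)
  also have "\<dots> \<le> \<bar>\<integral>z. G z * \<phi> z \<partial>M\<bar> + \<bar>\<integral>y. ?I y * U y \<partial>lborel\<bar>" unfolding main by (rule abs_triangle_ineq4)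
  finally show "pi * \<delta>^2 * \<bar>\<integral>x. g x * \<phi> x \<partial>M\<bar> \<le> pi * \<delta>^2 * (\<delta> * nrm2 M g * nrm2 M (grad \<phi>)) + nrm2 M G * nrm2 M \<phi>"
    using A B' by linarith
qed

section \<open>Weak convergence in \<open>L^2\<close> and its strong form in the dual of
  \<open>H10\<close>\<close>

lemma weak_convergence_L2:
  fixes f :: "real \<Rightarrow> real^2 \<Rightarrow> real" and D g :: "real^2 \<Rightarrow> real"
  assumes f: "\<forall>\<^sub>F \<epsilon> in at_right 0. sqi M (f \<epsilon>) \<and> nrm2 M (f \<epsilon>) \<le> c" and D: "sqi M D"
    and lim: "\<And>\<phi>. test_function \<Omega> \<phi> \<Longrightarrow> ((\<lambda>\<epsilon>. \<integral>x. f \<epsilon> x * \<phi> x \<partial>M) \<longlongrightarrow> (\<integral>x. D x * \<phi> x \<partial>M)) (at_right 0)"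
    and g: "sqi M g"
  shows "((\<lambda>\<epsilon>. \<integral>x. f \<epsilon> x * g x \<partial>M) \<longlongrightarrow> (\<integral>x. D x * g x \<partial>M)) (at_right 0)"
proof (rule tendstoI)
  fix e :: real assume e: "e > 0"
  define k where "k = \<bar>c\<bar> + nrm2 M D + 1"
  have k: "k > 0" using nrm2_nonneg[of M D] unfolding k_def by linarith
  obtain \<phi> where \<phi>: "test_function \<Omega> \<phi>" "nrm2 M (\<lambda>x. g x - \<phi> x) < e / (3 * k)"
    using test_functions_dense[OF g, of "e / (3 * k)"] e k by auto
  note sp = test_function_sqi(1)[OF open_domain \<phi>(1)]
  have sd: "sqi M (\<lambda>x. g x - \<phi> x)" by (rule sqi_diff[OF g sp])
  have split: "\<bar>(\<integral>x. h x * g x \<partial>M) - (\<integral>x. h x * \<phi> x \<partial>M)\<bar> \<le> k * (e / (3 * k))" if h: "sqi M h" "nrm2 M h \<le> k" for h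
  proof -
    have "(\<integral>x. h x * g x \<partial>M) - (\<integral>x. h x * \<phi> x \<partial>M) = (\<integral>x. h x \<bullet> (g x - \<phi> x) \<partial>M)"
      using sqi_mult[OF h(1) g] sqi_mult[OF h(1) sp] by (simp add: right_diff_distrib)
    moreover have "\<bar>\<integral>x. h x \<bullet> (g x - \<phi> x) \<partial>M\<bar> \<le> nrm2 M h * nrm2 M (\<lambda>x. g x - \<phi> x)" by (rule Cauchy_Schwarz_integral[OF h(1) sd])
    moreover have "nrm2 M h * nrm2 M (\<lambda>x. g x - \<phi> x) \<le> k * (e / (3 * k))" using h(2) \<phi>(2) k by (intro mult_mono) auto
    ultimately show ?thesis by simp
  qed
  have kk: "k * (e / (3 * k)) = e / 3" using k by simp
  have D1: "\<bar>(\<integral>x. D x * g x \<partial>M) - (\<integral>x. D x * \<phi> x \<partial>M)\<bar> \<le> e / 3"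
    using split[OF D] unfolding kk by (simp add: k_def)
  have "\<forall>\<^sub>F \<epsilon> in at_right 0. dist (\<integral>x. f \<epsilon> x * \<phi> x \<partial>M) (\<integral>x. D x * \<phi> x \<partial>M) < e / 3"
    by (rule tendstoD[OF lim[OF \<phi>(1)]]) (use e in simp)
  with f show "\<forall>\<^sub>F \<epsilon> in at_right 0. dist (\<integral>x. f \<epsilon> x * g x \<partial>M) (\<integral>x. D x * g x \<partial>M) < e"
  proof eventually_elim
    case (elim \<epsilon>)
    have "nrm2 M (f \<epsilon>) \<le> k" using elim nrm2_nonneg[of M D] unfolding k_def by linarith
    then have "\<bar>(\<integral>x. f \<epsilon> x * g x \<partial>M) - (\<integral>x. f \<epsilon> x * \<phi> x \<partial>M)\<bar> \<le> e / 3" using split[of "f \<epsilon>"] elim unfolding kk by simp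
    then show ?case using D1 elim unfolding dist_real_def by linarith
  qed
qed

text \<open>Compactness of the embedding of \<open>L^2\<close> into the dual of \<open>H10\<close>,
  proved by averaging over disks of a fixed radius: the averages of \<open>f - D\<close> tend to
  zero in \<open>L^2\<close>, and the rest is small with the radius.\<close>

lemma weak_to_strong_dual:
  fixes f :: "real \<Rightarrow> real^2 \<Rightarrow> real" and D :: "real^2 \<Rightarrow> real"
  assumes f: "\<forall>\<^sub>F \<epsilon> in at_right 0. sqi M (f \<epsilon>) \<and> nrm2 M (f \<epsilon>) \<le> c" and D: "sqi M D"
    and lim: "\<And>\<phi>. test_function \<Omega> \<phi> \<Longrightarrow> ((\<lambda>\<epsilon>. \<integral>x. f \<epsilon> x * \<phi> x \<partial>M) \<longlongrightarrow> (\<integral>x. D x * \<phi> x \<partial>M)) (at_right 0)"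
    and e: "e > 0"
  shows "\<forall>\<^sub>F \<epsilon> in at_right 0. \<forall>w\<in>Z. \<bar>\<integral>x. (f \<epsilon> x - D x) * fst (w x) \<partial>M\<bar> \<le> e * nrm2 M w"
proof -
  define k where "k = \<bar>c\<bar> + nrm2 M D + 1"
  have k: "k > 0" using nrm2_nonneg[of M D] unfolding k_def by linarith
  \<comment> \<open>With this radius the first term of \<open>averaging_bound\<close> takes half of
    the tolerance \<open>e\<close>; the radius stays fixed while \<open>\<epsilon>\<close> tends to
    zero.\<close>
  define \<delta> where "\<delta> = e / (2 * k)"
  have \<delta>: "\<delta> > 0" using e k by (simp add: \<delta>_def)
  define g where "g \<epsilon> x = f \<epsilon> x - D x" for \<epsilon> x
  define G where "G \<epsilon> z = (\<integral>x. ind (cball z \<delta>) x * g \<epsilon> x \<partial>M)" for \<epsilon> z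
  have g: "\<forall>\<^sub>F \<epsilon> in at_right 0. sqi M (g \<epsilon>) \<and> nrm2 M (g \<epsilon>) \<le> k" using f
  proof eventually_elim
    case (elim \<epsilon>)
    have "nrm2 M (\<lambda>x. f \<epsilon> x + - D x) \<le> nrm2 M (f \<epsilon>) + nrm2 M (\<lambda>x. - D x)" using elim D by (intro nrm2_triangle sqi_minus) auto
    moreover have "nrm2 M (\<lambda>x. - D x) = nrm2 M D" by (simp add: nrm2_def)
    moreover have "nrm2 M (g \<epsilon>) = nrm2 M (\<lambda>x. f \<epsilon> x + - D x)" by (simp add: g_def[abs_def])
    ultimately have "nrm2 M (g \<epsilon>) \<le> k" using elim abs_ge_self[of c] unfolding k_def by linarith
    then show ?case using sqi_diff[of M "f \<epsilon>" D] elim D by (simp add: g_def[abs_def])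
  qed
  have G0: "((\<lambda>\<epsilon>. G \<epsilon> z) \<longlongrightarrow> 0) (at_right 0)" for z
  proof -
    have "((\<lambda>\<epsilon>. (\<integral>x. f \<epsilon> x * ind (cball z \<delta>) x \<partial>M) - (\<integral>x. D x * ind (cball z \<delta>) x \<partial>M)) \<longlongrightarrow> 0) (at_right 0)"
      using tendsto_diff[OF weak_convergence_L2[OF f D lim indicator_cball_sqi[of z \<delta>]] tendsto_const[of "\<integral>x. D x * ind (cball z \<delta>) x \<partial>M"]] by simp
    moreover have "\<forall>\<^sub>F \<epsilon> in at_right 0. (\<integral>x. f \<epsilon> x * ind (cball z \<delta>) x \<partial>M) - (\<integral>x. D x * ind (cball z \<delta>) x \<partial>M) = G \<epsilon> z" using f
    proof eventually_elim
      case (elim \<epsilon>)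
      have "(\<integral>x. f \<epsilon> x * ind (cball z \<delta>) x \<partial>M) - (\<integral>x. D x * ind (cball z \<delta>) x \<partial>M) = (\<integral>x. f \<epsilon> x * ind (cball z \<delta>) x - D x * ind (cball z \<delta>) x \<partial>M)"
        by (rule Bochner_Integration.integral_diff[symmetric]; intro sqi_mult indicator_cball_sqi) (use elim D in auto)
      also have "\<dots> = G \<epsilon> z" unfolding G_def g_def by (rule Bochner_Integration.integral_cong) (auto simp: algebra_simps)
      finally show ?case .
    qed
    ultimately show ?thesis by (rule Lim_transform_eventually)
  qed
  have Gb: "\<forall>\<^sub>F \<epsilon> in at_right 0. (\<forall>z. \<bar>G \<epsilon> z\<bar> \<le> sqrt vol * k) \<and> sqi M (G \<epsilon>)" using g
  proof eventually_elim
    case (elim \<epsilon>)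
    have "\<bar>G \<epsilon> z\<bar> \<le> sqrt vol * k" for z
    proof -
      have "\<bar>G \<epsilon> z\<bar> \<le> nrm2 M (ind (cball z \<delta>)) * nrm2 M (g \<epsilon>)"
        unfolding G_def using Cauchy_Schwarz_integral[OF indicator_cball_sqi, of "g \<epsilon>" z \<delta>] elim by simp
      also have "\<dots> \<le> sqrt vol * k"
      proof (rule mult_mono)
        have "(\<integral>x. (norm (ind (cball z \<delta>) x))^2 \<partial>M) \<le> (\<integral>x. 1 \<partial>M)"
          by (rule integral_mono') (use finite_measure.integrable_const[OF finite_measure_M, of "1::real"] in \<open>auto simp: indicator_def\<close>)
        then show "nrm2 M (ind (cball z \<delta>)) \<le> sqrt vol" unfolding nrm2_def using measure_M by simp
      qed (use elim in auto)
      finally show ?thesis .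
    qed
    then show ?case using averaging_bound(1)[OF _ test_function_zero \<delta>, of "g \<epsilon>"] elim by (simp add: G_def[abs_def])
  qed
  \<comment> \<open>The averages tend to zero at every centre, by weak convergence tested with the
    indicator of a disk, and share a common bound. Dominated convergence is available along
    sequences, hence the reduction.\<close>
  have nG: "((\<lambda>\<epsilon>. \<integral>z. (norm (G \<epsilon> z))^2 \<partial>M) \<longlongrightarrow> 0) (at_right 0)"
  proof (rule tendsto_at_right_sequentially[of 0 1])
    fix s :: "nat \<Rightarrow> real" assume s: "\<And>n. 0 < s n" "s \<longlonglongrightarrow> 0"
    have "s n \<noteq> 0" for n using s(1)[of n] by simp
    then have fl: "filterlim s (at_right 0) sequentially"
      using s by (auto simp: filterlim_at intro!: always_eventually)
    have "\<forall>\<^sub>F n in sequentially. (\<forall>z. \<bar>G (s n) z\<bar> \<le> sqrt vol * k) \<and> sqi M (G (s n))"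
      by (rule eventually_compose_filterlim[OF Gb fl])
    then obtain N where N: "\<And>n. n \<ge> N \<Longrightarrow> (\<forall>z. \<bar>G (s n) z\<bar> \<le> sqrt vol * k) \<and> sqi M (G (s n))" by (auto simp: eventually_sequentially)
    have "(\<lambda>n. \<integral>z. (norm (G (s (n + N)) z))^2 \<partial>M) \<longlonglongrightarrow> (\<integral>z. 0 \<partial>M)"
    proof (rule integral_dominated_convergence[where w="\<lambda>z. (sqrt vol * k)^2"])
      show "integrable M (\<lambda>z. (sqrt vol * k)^2)" by (rule finite_measure.integrable_const[OF finite_measure_M])
      show "(\<lambda>z. (norm (G (s (n + N)) z))^2) \<in> borel_measurable M" for n using N[of "n + N"] by (auto simp: sqi_def)
      show "AE z in M. (\<lambda>n. (norm (G (s (n + N)) z))^2) \<longlonglongrightarrow> 0"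
      proof (rule AE_I2)
        fix z
        have "(\<lambda>n. G (s n) z) \<longlonglongrightarrow> 0" by (rule filterlim_compose[OF G0 fl])
        then have "(\<lambda>n. G (s (n + N)) z) \<longlonglongrightarrow> 0" by (rule LIMSEQ_ignore_initial_segment)
        from tendsto_power[OF tendsto_norm[OF this], of 2] show "(\<lambda>n. (norm (G (s (n + N)) z))^2) \<longlonglongrightarrow> 0" by simp
      qed
      show "AE z in M. norm ((norm (G (s (n + N)) z))^2) \<le> (sqrt vol * k)^2" for n
      proof (rule AE_I2)
        fix z
        have "\<bar>G (s (n + N)) z\<bar>\<^sup>2 \<le> (sqrt vol * k)^2" by (rule power_mono) (use N[of "n + N"] in auto)
        then show "norm ((norm (G (s (n + N)) z))^2) \<le> (sqrt vol * k)^2" by simp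
      qed
    qed simp
    then show "(\<lambda>n. \<integral>z. (norm (G (s n) z))^2 \<partial>M) \<longlonglongrightarrow> 0" by (simp only: Bochner_Integration.integral_zero) (rule LIMSEQ_offset[where k=N])
  qed simp
  have "((\<lambda>\<epsilon>. nrm2 M (G \<epsilon>)) \<longlongrightarrow> 0) (at_right 0)" unfolding nrm2_def using tendsto_real_sqrt[OF nG] unfolding real_sqrt_zero .
  moreover have "0 < pi * \<delta>^2 * (e / 2)" by (intro mult_pos_pos zero_less_power) (use \<delta> e in simp_all)
  ultimately have "\<forall>\<^sub>F \<epsilon> in at_right 0. nrm2 M (G \<epsilon>) < pi * \<delta>^2 * (e / 2)" by (rule order_tendstoD(2))
  with g show ?thesis
  proof eventually_elim
    case (elim \<epsilon>)
    have sg: "sqi M (g \<epsilon>)" using elim by blast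
    show ?case
    proof
      fix w assume w: "w \<in> Z"
      define kk where "kk x = (g \<epsilon> x, 0 :: real^2)" for x
      have sk: "sqi M kk" unfolding sqi_fst_snd[of M kk] using sg by (simp add: kk_def sqi_zero)
      have "\<bar>\<integral>x. kk x \<bullet> w x \<partial>M\<bar> \<le> e * nrm2 M w"
      proof (rule Z_bound[OF w sk])
        fix \<phi> assume \<phi>: "test_function \<Omega> \<phi>"
        have np: "(nrm2 M (with_grad \<phi>))^2 = (nrm2 M \<phi>)^2 + (nrm2 M (grad \<phi>))^2" using nrm2_pair_sq[OF with_grad_sqi[OF \<phi>]] by (simp add: with_grad_def)
        have n: "nrm2 M \<phi> \<le> nrm2 M (with_grad \<phi>)" "nrm2 M (grad \<phi>) \<le> nrm2 M (with_grad \<phi>)"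
          by (rule power2_le_imp_le; use np zero_le_power2[of "nrm2 M \<phi>"] zero_le_power2[of "nrm2 M (grad \<phi>)"] nrm2_nonneg[of M "with_grad \<phi>"] in linarith)+
        have "pi * \<delta>^2 * \<bar>\<integral>x. g \<epsilon> x * \<phi> x \<partial>M\<bar> \<le> pi * \<delta>^2 * (\<delta> * nrm2 M (g \<epsilon>) * nrm2 M (grad \<phi>)) + nrm2 M (G \<epsilon>) * nrm2 M \<phi>"
          using averaging_bound(2)[OF sg \<phi> \<delta>] by (simp add: G_def[abs_def])
        also have "\<dots> \<le> pi * \<delta>^2 * (\<delta> * k * nrm2 M (with_grad \<phi>)) + pi * \<delta>^2 * (e / 2) * nrm2 M (with_grad \<phi>)"
        proof (rule add_mono)
          have "\<delta> * nrm2 M (g \<epsilon>) * nrm2 M (grad \<phi>) \<le> \<delta> * k * nrm2 M (with_grad \<phi>)"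
          proof (rule mult_mono)
            show "\<delta> * nrm2 M (g \<epsilon>) \<le> \<delta> * k" by (rule mult_left_mono) (use elim \<delta> in simp_all)
            show "nrm2 M (grad \<phi>) \<le> nrm2 M (with_grad \<phi>)" by (rule n(2))
            show "0 \<le> \<delta> * k" by (rule mult_nonneg_nonneg) (use k \<delta> in simp_all)
          qed simp
          then show "pi * \<delta>^2 * (\<delta> * nrm2 M (g \<epsilon>) * nrm2 M (grad \<phi>)) \<le> pi * \<delta>^2 * (\<delta> * k * nrm2 M (with_grad \<phi>))"
            by (rule mult_left_mono) simp
          show "nrm2 M (G \<epsilon>) * nrm2 M \<phi> \<le> pi * \<delta>^2 * (e / 2) * nrm2 M (with_grad \<phi>)"
          proof (rule mult_mono)
            show "nrm2 M (G \<epsilon>) \<le> pi * \<delta>^2 * (e / 2)" using elim by simp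
            show "0 \<le> pi * \<delta>^2 * (e / 2)" by (intro mult_nonneg_nonneg) (use e in simp_all)
          qed (use n(1) in simp_all)
        qed
        also have "\<dots> = pi * \<delta>^2 * (e * nrm2 M (with_grad \<phi>))" using k by (simp add: \<delta>_def algebra_simps)
        finally have "\<bar>\<integral>x. g \<epsilon> x * \<phi> x \<partial>M\<bar> \<le> e * nrm2 M (with_grad \<phi>)" using \<delta> by simp
        then show "\<bar>\<integral>x. kk x \<bullet> with_grad \<phi> x \<partial>M\<bar> \<le> e * nrm2 M (with_grad \<phi>)" by (simp add: kk_def with_grad_def)
      qed (use e in simp)
      then show "\<bar>\<integral>x. (f \<epsilon> x - D x) * fst (w x) \<partial>M\<bar> \<le> e * nrm2 M w" by (simp add: kk_def inner_prod_def g_def)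
    qed
  qed
qed


section \<open>Densities of charges, the flux field and the upper bound\<close>

lemma piecewise_constant:
  fixes S :: "'i \<Rightarrow> (real^2) set" and c :: "'i \<Rightarrow> real"
  assumes fin: "finite A" and S: "\<And>a. a \<in> A \<Longrightarrow> S a \<in> sets borel \<and> S a \<subseteq> \<Omega> \<and> measure lborel (S a) = m"
    and dis: "\<And>a b. a \<in> A \<Longrightarrow> b \<in> A \<Longrightarrow> a \<noteq> b \<Longrightarrow> S a \<inter> S b = {}"
  shows "a \<in> A \<Longrightarrow> sqi M (ind (S a))" "a \<in> A \<Longrightarrow> (\<integral>x. ind (S a) x \<partial>M) = m"
    "sqi M (\<lambda>x. \<Sum>a\<in>A. c a * ind (S a) x)"
    "(nrm2 M (\<lambda>x. \<Sum>a\<in>A. c a * ind (S a) x))^2 = (\<Sum>a\<in>A. (c a)^2) * m"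
proof -
  have sI: "sqi M (ind (S a))" if "a \<in> A" for a
    by (rule sqi_bounded[OF finite_measure_M borel_measurable_M, of _ 1]) (use S[OF that] in \<open>auto intro!: borel_measurable_indicator simp: indicator_def\<close>)
  have mI: "(\<integral>x. ind (S a) x \<partial>M) = m" if "a \<in> A" for a
  proof -
    have "(\<integral>x. ind (S a) x \<partial>M) = (\<integral>x. ind (S a) x \<partial>lborel)"
      by (rule integral_lebesgue_on_borel[OF domain_sets]) (use S[OF that] in \<open>auto intro!: borel_measurable_indicator simp: indicator_def\<close>)
    then show ?thesis using S[OF that] by simp
  qed
  show "a \<in> A \<Longrightarrow> sqi M (ind (S a))" "a \<in> A \<Longrightarrow> (\<integral>x. ind (S a) x \<partial>M) = m" by (fact sI mI)+
  show "sqi M (\<lambda>x. \<Sum>a\<in>A. c a * ind (S a) x)" by (intro sqi_sum fin sqi_cmult sI)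
  have "(nrm2 M (\<lambda>x. \<Sum>a\<in>A. c a * ind (S a) x))^2 = (\<Sum>a\<in>A. \<integral>x. (norm (c a * ind (S a) x))^2 \<partial>M)"
    unfolding nrm2_sq
  proof (rule integral_norm_sq_disjoint_sum[OF fin])
    show "c a * ind (S a) x = 0 \<or> c b * ind (S b) x = 0" if "a \<in> A" "b \<in> A" "a \<noteq> b" for a b x
      using dis[OF that] by (auto simp: indicator_def)
  qed (intro sqi_cmult sI)
  also have "\<dots> = (\<Sum>a\<in>A. (c a)^2 * m)"
  proof (rule sum.cong[OF refl])
    fix a assume a: "a \<in> A"
    have "(\<integral>x. (norm (c a * ind (S a) x))^2 \<partial>M) = (\<integral>x. (c a)^2 * ind (S a) x \<partial>M)"
      by (rule Bochner_Integration.integral_cong) (auto simp: indicator_def power_mult_distrib)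
    also have "\<dots> = (c a)^2 * m" unfolding mI[OF a, symmetric] by (rule integral_mult_right_zero)
    finally show "(\<integral>x. (norm (c a * ind (S a) x))^2 \<partial>M) = (c a)^2 * m" .
  qed
  finally show "(nrm2 M (\<lambda>x. \<Sum>a\<in>A. c a * ind (S a) x))^2 = (\<Sum>a\<in>A. (c a)^2) * m" by (simp add: sum_distrib_right)
qed

text \<open>The shape \<open>S\<close> is a parameter because two are used: disks with
  \<open>\<kappa> = pi / 4\<close>, which match the averages of the upper bound, and cells with
  \<open>\<kappa> = 1\<close>, for which the density is integer valued, as the lower bound for the
  charges demands.\<close>

lemma discretization:
  fixes d :: "real \<Rightarrow> real^2 \<Rightarrow> int" and S :: "real \<Rightarrow> real^2 \<Rightarrow> (real^2) set"
  assumes ev: "\<forall>\<^sub>F e in at_right 0. e^2 * (\<Sum>a\<in>centers \<Omega> (p e) e. (real_of_int (d e a))^2) \<le> C"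
    and vort: "vorticity_converges \<Omega> p d D" and \<kappa>: "\<kappa> > 0"
    and S: "\<And>e a. e > 0 \<Longrightarrow> a \<in> centers \<Omega> (p e) e \<Longrightarrow> S e a \<in> sets borel \<and> S e a \<subseteq> \<Omega> \<and> S e a \<subseteq> cball a e \<and> measure lborel (S e a) = \<kappa> * e^2"
    and dis: "\<And>e a b. e > 0 \<Longrightarrow> a \<in> centers \<Omega> (p e) e \<Longrightarrow> b \<in> centers \<Omega> (p e) e \<Longrightarrow> a \<noteq> b \<Longrightarrow> S e a \<inter> S e b = {}"
  defines "f \<equiv> \<lambda>e x. \<Sum>a\<in>centers \<Omega> (p e) e. (of_int (d e a) / \<kappa>) * ind (S e a) x"
  shows "\<forall>\<^sub>F e in at_right 0. sqi M (f e) \<and> nrm2 M (f e) \<le> sqrt (C / \<kappa>)"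
    and "\<And>\<phi>. test_function \<Omega> \<phi> \<Longrightarrow> ((\<lambda>e. \<integral>x. f e x * \<phi> x \<partial>M) \<longlongrightarrow> (\<integral>x. D x * \<phi> x \<partial>M)) (at_right 0)"
proof -
  have SS: "S e a \<in> sets borel \<and> S e a \<subseteq> \<Omega> \<and> measure lborel (S e a) = \<kappa> * e^2" if "e > 0" "a \<in> centers \<Omega> (p e) e" for e a
    using S[OF that] by blast
  note pc = piecewise_constant[OF finite_centers SS dis]
  have sI: "sqi M (ind (S e a))" if "e > 0" "a \<in> centers \<Omega> (p e) e" for e a
    by (rule pc(1)[OF that(1,1) _ that(1) _ _ _ that(2)])
  have mI: "(\<integral>x. ind (S e a) x \<partial>M) = \<kappa> * e^2" if "e > 0" "a \<in> centers \<Omega> (p e) e" for e a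
    by (rule pc(2)[OF that(1,1) _ that(1) _ _ _ that(2)])
  have sf: "sqi M (f e)" if "e > 0" for e
    unfolding f_def by (rule pc(3)[OF that that _ that])
  have ev0: "\<forall>\<^sub>F e in at_right (0::real). e > 0" by (rule eventually_at_right_less)
  show "\<forall>\<^sub>F e in at_right 0. sqi M (f e) \<and> nrm2 M (f e) \<le> sqrt (C / \<kappa>)" using ev ev0
  proof eventually_elim
    case (elim e)
    have "(nrm2 M (f e))^2 = (\<Sum>a\<in>centers \<Omega> (p e) e. (of_int (d e a) / \<kappa>)^2) * (\<kappa> * e^2)"
      unfolding f_def by (rule pc(4)[OF elim(2) elim(2) _ elim(2)])
    also have "\<dots> = e^2 * (\<Sum>a\<in>centers \<Omega> (p e) e. (real_of_int (d e a))^2) / \<kappa>"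
      using \<kappa> by (simp add: power_divide flip: sum_divide_distrib) (simp add: power2_eq_square)
    also have "\<dots> \<le> C / \<kappa>" using elim \<kappa> by (intro divide_right_mono) auto
    finally have "nrm2 M (f e) \<le> sqrt (C / \<kappa>)" by (rule real_le_rsqrt)
    then show ?case using sf[OF elim(2)] by blast
  qed
  fix \<phi> assume \<phi>: "test_function \<Omega> \<phi>"
  obtain B where B: "B \<ge> 0" "\<And>x y. \<bar>\<phi> x - \<phi> y\<bar> \<le> B * norm (x - y)" using test_function_bounded[OF \<phi>] by metis
  note sp = test_function_sqi(1)[OF open_domain \<phi>]
  \<comment> \<open>Replacing \<open>\<phi>\<close> on \<open>S e a\<close> by
    \<open>\<phi> a\<close> costs at most \<open>B e\<close> per unit of total variation, and the
    scaled total variation is at most \<open>C\<close> because the charges are integers.\<close>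
  have bd: "\<forall>\<^sub>F e in at_right 0. \<bar>(\<integral>x. f e x * \<phi> x \<partial>M) - e^2 * (\<Sum>a\<in>centers \<Omega> (p e) e. of_int (d e a) * \<phi> a)\<bar> \<le> B * C * e"
    using ev ev0
  proof eventually_elim
    case (elim e)
    let ?A = "centers \<Omega> (p e) e"
    have fin: "finite ?A" by (rule finite_centers[OF elim(2)])
    have iI: "integrable M (\<lambda>x. ind (S e a) x * \<phi> x)" "integrable M (ind (S e a))" if "a \<in> ?A" for a
      using sqi_mult[OF sI[OF elim(2) that] sp] sqi_integrable[OF finite_measure_M sI[OF elim(2) that]] by auto
    have "(\<integral>x. f e x * \<phi> x \<partial>M) = (\<integral>x. (\<Sum>a\<in>?A. (of_int (d e a) / \<kappa>) * (ind (S e a) x * \<phi> x)) \<partial>M)"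
      unfolding f_def by (simp add: sum_distrib_right mult.assoc)
    also have "\<dots> = (\<Sum>a\<in>?A. (of_int (d e a) / \<kappa>) * (\<integral>x. ind (S e a) x * \<phi> x \<partial>M))"
      by (subst Bochner_Integration.integral_sum) (use iI in \<open>auto intro!: sum.cong simp del: times_divide_eq_left\<close>)
    also have "\<dots> - e^2 * (\<Sum>a\<in>?A. of_int (d e a) * \<phi> a) = (\<Sum>a\<in>?A. (of_int (d e a) / \<kappa>) * ((\<integral>x. ind (S e a) x * \<phi> x \<partial>M) - \<phi> a * (\<kappa> * e^2)))"
      using \<kappa> by (simp add: sum_distrib_left sum_subtractf right_diff_distrib mult_ac)
    finally have "\<bar>(\<integral>x. f e x * \<phi> x \<partial>M) - e^2 * (\<Sum>a\<in>?A. of_int (d e a) * \<phi> a)\<bar>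
        = \<bar>\<Sum>a\<in>?A. (of_int (d e a) / \<kappa>) * ((\<integral>x. ind (S e a) x * \<phi> x \<partial>M) - \<phi> a * (\<kappa> * e^2))\<bar>" by simp
    also have "\<dots> \<le> (\<Sum>a\<in>?A. \<bar>(of_int (d e a) / \<kappa>) * ((\<integral>x. ind (S e a) x * \<phi> x \<partial>M) - \<phi> a * (\<kappa> * e^2))\<bar>)" by (rule sum_abs)
    also have "\<dots> \<le> (\<Sum>a\<in>?A. \<bar>real_of_int (d e a)\<bar> * (B * e * e^2))"
    proof (rule sum_mono)
      fix a assume a: "a \<in> ?A"
      have "(\<integral>x. ind (S e a) x * \<phi> x \<partial>M) - \<phi> a * (\<kappa> * e^2) = (\<integral>x. ind (S e a) x * \<phi> x - \<phi> a * ind (S e a) x \<partial>M)"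
        unfolding mI[OF elim(2) a, symmetric] using iI[OF a] by (subst Bochner_Integration.integral_diff) auto
      also have "\<bar>\<dots>\<bar> \<le> (\<integral>x. \<bar>ind (S e a) x * \<phi> x - \<phi> a * ind (S e a) x\<bar> \<partial>M)" by (rule integral_abs_bound)
      also have "\<dots> \<le> (\<integral>x. B * e * ind (S e a) x \<partial>M)"
      proof (rule integral_mono')
        show "integrable M (\<lambda>x. B * e * ind (S e a) x)" using iI(2)[OF a] by (rule integrable_mult_right)
        fix x
        show "\<bar>ind (S e a) x * \<phi> x - \<phi> a * ind (S e a) x\<bar> \<le> B * e * ind (S e a) x"
        proof (cases "x \<in> S e a")
          case True
          then have "norm (x - a) \<le> e" using S[OF elim(2) a] by (auto simp: subset_iff dist_norm norm_minus_commute)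
          then have "B * norm (x - a) \<le> B * e" using B(1) by (rule mult_left_mono)
          then show ?thesis using B(2)[of x a] True by simp
        qed simp
        show "0 \<le> B * e * ind (S e a) x" using B(1) elim by simp
      qed
      also have "\<dots> = B * e * (\<kappa> * e^2)" unfolding mI[OF elim(2) a, symmetric] by (rule integral_mult_right_zero)
      finally have "\<bar>of_int (d e a) / \<kappa>\<bar> * \<bar>(\<integral>x. ind (S e a) x * \<phi> x \<partial>M) - \<phi> a * (\<kappa> * e^2)\<bar> \<le> \<bar>of_int (d e a) / \<kappa>\<bar> * (B * e * (\<kappa> * e^2))"
        by (rule mult_left_mono) simp
      then show "\<bar>(of_int (d e a) / \<kappa>) * ((\<integral>x. ind (S e a) x * \<phi> x \<partial>M) - \<phi> a * (\<kappa> * e^2))\<bar> \<le> \<bar>real_of_int (d e a)\<bar> * (B * e * e^2)"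
        using \<kappa> by (simp add: abs_mult)
    qed
    also have "\<dots> = B * e * (e^2 * (\<Sum>a\<in>?A. \<bar>real_of_int (d e a)\<bar>))" by (simp add: sum_distrib_left mult_ac)
    also have "\<dots> \<le> B * e * C"
    proof (intro mult_left_mono)
      have "e^2 * (\<Sum>a\<in>?A. \<bar>real_of_int (d e a)\<bar>) \<le> e^2 * (\<Sum>a\<in>?A. (real_of_int (d e a))^2)" by (intro mult_left_mono sum_abs_int_le) simp
      then show "e^2 * (\<Sum>a\<in>?A. \<bar>real_of_int (d e a)\<bar>) \<le> C" using elim by linarith
    qed (use B elim in simp)
    finally show ?case by (simp add: mult_ac)
  qed
  have "((\<lambda>e. (\<integral>x. f e x * \<phi> x \<partial>M) - e^2 * (\<Sum>a\<in>centers \<Omega> (p e) e. of_int (d e a) * \<phi> a)) \<longlongrightarrow> 0) (at_right 0)"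
  proof (rule Lim_null_comparison)
    show "\<forall>\<^sub>F e in at_right 0. norm ((\<integral>x. f e x * \<phi> x \<partial>M) - e^2 * (\<Sum>a\<in>centers \<Omega> (p e) e. of_int (d e a) * \<phi> a)) \<le> B * C * e" using bd by simp
    show "((\<lambda>e. B * C * e) \<longlongrightarrow> 0) (at_right 0)" by (auto intro!: tendsto_eq_intros)
  qed
  from tendsto_add[OF this vort[unfolded vorticity_converges_def, rule_format, OF \<phi>]] show "((\<lambda>e. \<integral>x. f e x * \<phi> x \<partial>M) \<longlongrightarrow> (\<integral>x. D x * \<phi> x \<partial>M)) (at_right 0)"
    by simp
qed

text \<open>Bounded in \<open>L^2\<close> and of order \<open>e\<close> in \<open>L^1\<close>: the
  field concentrates, which is what will make its cross terms negligible.\<close>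

lemma flux_field:
  fixes d :: "real^2 \<Rightarrow> int" and p :: "real^2" and e \<rho> :: real
  assumes e: "0 < e" and \<rho>: "0 < \<rho>" "\<rho> \<le> e / 2"
  defines "A \<equiv> centers \<Omega> p e"
  defines "Q \<equiv> e^2 * (\<Sum>a\<in>A. (real_of_int (d a))^2)"
  defines "F \<equiv> \<lambda>x. \<Sum>a\<in>A. (e^2 * d a) *\<^sub>R radial_field \<rho> (e/2) a x"
  shows "sqi M F" "(nrm2 M F)^2 \<le> e^2 * Q * (2 * pi * ln (e / 2 / \<rho>))" "(\<integral>x. norm (F x) \<partial>M) \<le> pi * e * Q"
    "sqi M v \<Longrightarrow> (\<integral>x. F x \<bullet> v x \<partial>M) = (\<Sum>a\<in>A. e^2 * d a * (\<integral>x. radial_field \<rho> (e/2) a x \<bullet> v x \<partial>M))"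
proof -
  have fin: "finite A" unfolding A_def by (rule finite_centers[OF e])
  let ?r = "\<lambda>a. radial_field \<rho> (e/2) a"
  have out: "?r a x = 0" if "a \<in> A" "x \<notin> \<Omega>" for a x
  proof (rule radial_field_zero)
    have "cball a (e/2) \<subseteq> \<Omega>" using cball_subset_domain[of a \<Omega> p e "e/2"] that(1) by (simp add: A_def)
    then show "norm (x - a) \<ge> e/2" using that(2) by (force simp: dist_norm norm_minus_commute)
  qed
  have sr: "sqi M (?r a)" for a
    by (rule sqi_bounded[OF finite_measure_M borel_measurable_M radial_field_bounds(1)[OF \<rho>]]) measurable
  have ss: "sqi M (\<lambda>x. (e^2 * d a) *\<^sub>R ?r a x)" for a by (rule sqi_scaleR[OF sr])
  show "sqi M F" unfolding F_def by (intro sqi_sum[OF fin] ss)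
  have tr: "(\<integral>x. (norm (?r a x))^2 \<partial>M) = (\<integral>x. (norm (?r a x))^2 \<partial>lborel)" "(\<integral>x. norm (?r a x) \<partial>M) = (\<integral>x. norm (?r a x) \<partial>lborel)" if "a \<in> A" for a
    by (rule integral_lebesgue_on_borel[OF domain_sets]; use out[OF that] in auto)+
  have "(nrm2 M F)^2 = (\<Sum>a\<in>A. \<integral>x. (norm ((e^2 * d a) *\<^sub>R ?r a x))^2 \<partial>M)"
    unfolding nrm2_sq F_def
  proof (rule integral_norm_sq_disjoint_sum[OF fin ss])
    fix a b x assume "a \<in> A" "b \<in> A" "a \<noteq> b"
    then have "norm (x - a) \<ge> e / 2 \<or> norm (x - b) \<ge> e / 2" using centers_balls_disjoint[of a \<Omega> p e b x] e by (simp add: A_def)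
    then show "(e^2 * d a) *\<^sub>R ?r a x = 0 \<or> (e^2 * d b) *\<^sub>R ?r b x = 0" using radial_field_zero by force
  qed
  also have "\<dots> = (\<Sum>a\<in>A. (e^2 * d a)^2 * (\<integral>x. (norm (?r a x))^2 \<partial>lborel))"
    by (rule sum.cong) (auto simp: power_mult_distrib tr)
  also have "\<dots> \<le> (\<Sum>a\<in>A. (e^2 * d a)^2 * (2 * pi * ln (e / 2 / \<rho>)))"
    by (intro sum_mono mult_left_mono radial_field_bounds(2)[OF \<rho>]) auto
  also have "\<dots> = e^2 * Q * (2 * pi * ln (e / 2 / \<rho>))"
    unfolding sum_distrib_right[symmetric] by (simp add: Q_def power_mult_distrib sum_distrib_left power2_eq_square mult_ac)
  finally show "(nrm2 M F)^2 \<le> e^2 * Q * (2 * pi * ln (e / 2 / \<rho>))" .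
  have ig: "integrable M (\<lambda>x. norm ((e^2 * d a) *\<^sub>R ?r a x))" for a
    by (intro integrable_norm sqi_integrable[OF finite_measure_M] ss)
  have "(\<integral>x. norm (F x) \<partial>M) \<le> (\<integral>x. (\<Sum>a\<in>A. norm ((e^2 * d a) *\<^sub>R ?r a x)) \<partial>M)"
  proof (rule integral_mono')
    show "integrable M (\<lambda>x. \<Sum>a\<in>A. norm ((e^2 * d a) *\<^sub>R ?r a x))" using ig by (rule Bochner_Integration.integrable_sum)
    show "norm (F x) \<le> (\<Sum>a\<in>A. norm ((e^2 * d a) *\<^sub>R ?r a x))" for x unfolding F_def by (rule norm_sum)
  qed (auto intro: sum_nonneg)
  also have "\<dots> = (\<Sum>a\<in>A. \<integral>x. norm ((e^2 * d a) *\<^sub>R ?r a x) \<partial>M)" by (rule Bochner_Integration.integral_sum[OF ig])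
  also have "\<dots> = (\<Sum>a\<in>A. \<bar>e\<^sup>2 * d a\<bar> * (\<integral>x. norm (?r a x) \<partial>lborel))"
    by (rule sum.cong) (auto simp: tr)
  also have "\<dots> \<le> (\<Sum>a\<in>A. \<bar>e\<^sup>2 * d a\<bar> * (2 * pi * (e/2)))"
    by (intro sum_mono mult_left_mono radial_field_bounds(3)[OF \<rho>]) auto
  also have "\<dots> = (e^2 * (\<Sum>a\<in>A. \<bar>real_of_int (d a)\<bar>)) * (pi * e)"
    unfolding sum_distrib_right[symmetric] by (simp add: sum_distrib_left abs_mult)
  also have "\<dots> \<le> Q * (pi * e)" unfolding Q_def using e by (intro mult_right_mono mult_left_mono sum_abs_int_le) auto
  finally show "(\<integral>x. norm (F x) \<partial>M) \<le> pi * e * Q" by (simp add: mult_ac)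
  assume v: "sqi M v"
  have "(\<integral>x. F x \<bullet> v x \<partial>M) = (\<integral>x. (\<Sum>a\<in>A. e^2 * d a * (?r a x \<bullet> v x)) \<partial>M)"
    unfolding F_def by (simp add: inner_sum_left)
  also have "\<dots> = (\<Sum>a\<in>A. \<integral>x. e^2 * d a * (?r a x \<bullet> v x) \<partial>M)"
    by (rule Bochner_Integration.integral_sum) (intro integrable_mult_right sqi_inner sr v)
  also have "\<dots> = (\<Sum>a\<in>A. e^2 * d a * (\<integral>x. ?r a x \<bullet> v x \<partial>M))"
    by (rule sum.cong[OF refl], rule integral_mult_right_zero)
  finally show "(\<integral>x. F x \<bullet> v x \<partial>M) = (\<Sum>a\<in>A. e^2 * d a * (\<integral>x. ?r a x \<bullet> v x \<partial>M))" .
qed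

text \<open>The equation for \<open>w\<close> is tested with \<open>w\<close> itself, and each hole
  value is rewritten by \<open>hole_average\<close>. Up to a term of size \<open>2 pi \<eta>\<close>
  times the norm of \<open>w\<close>, the right-hand side is the pairing of \<open>w\<close> with
  \<open>w0 - (0, F)\<close>, so the norm of \<open>w\<close> is at most about that of
  \<open>w0 - (0, F)\<close>.\<close>

lemma E_tilde_upper_bound:
  fixes d :: "real \<Rightarrow> real^2 \<Rightarrow> int" and p :: "real \<Rightarrow> real^2" and D :: "real^2 \<Rightarrow> real" and \<sigma> \<gamma> C e :: real
  defines "Q \<equiv> \<lambda>\<epsilon>. \<epsilon>^2 * (\<Sum>a\<in>centers \<Omega> (p \<epsilon>) \<epsilon>. (real_of_int (d \<epsilon> a))^2)"
  assumes \<gamma>: "\<gamma> > 0" and C: "C \<ge> 0" and ev: "\<forall>\<^sub>F \<epsilon> in at_right 0. Q \<epsilon> \<le> C"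
    and vort: "vorticity_converges \<Omega> p d D" and D: "sqi M D" and e: "e > 0"
    and w0: "w0 \<in> Z" "\<And>v. v \<in> Z \<Longrightarrow> (\<integral>x. w0 x \<bullet> v x \<partial>M) = 2 * pi * (\<integral>x. D x * fst (v x) \<partial>M) - \<sigma> * (\<integral>x. fst (v x) \<partial>M)"
  shows "\<forall>\<^sub>F \<epsilon> in at_right 0. E_tilde \<Omega> \<sigma> \<gamma> (p \<epsilon>) \<epsilon> (d \<epsilon>) \<le> (nrm2 M w0)^2 / 2 + pi * \<gamma> * Q \<epsilon> + e"
proof -
  define n0 where "n0 = nrm2 M w0"
  define km where "km = sqrt (n0^2 + 1 + 2 * pi * \<gamma> * C)"
  have km: "km \<ge> 0" using \<gamma> C by (simp add: km_def)
  \<comment> \<open>\<open>km\<close> bounds the norm \<open>N\<close> of \<open>k1\<close> below in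
    advance, and \<open>\<eta>\<close> is so small that \<open>(2 * pi * \<eta> + N)^2\<close>
    exceeds \<open>N^2\<close> by at most \<open>e\<close>.\<close>
  define \<eta> where "\<eta> = min 1 (e / (4 * pi * (km + pi)))"
  have kp: "km + pi > 0" using km pi_gt_zero by linarith
  have \<eta>: "\<eta> > 0" "\<eta> \<le> 1" "2 * pi * \<eta> * (km + pi * \<eta>) \<le> e / 2"
  proof -
    show p: "\<eta> > 0" using e kp by (simp add: \<eta>_def)
    show le: "\<eta> \<le> 1" by (simp add: \<eta>_def)
    have "2 * pi * \<eta> * (km + pi * \<eta>) \<le> 2 * pi * (e / (4 * pi * (km + pi))) * (km + pi)"
    proof (rule mult_mono)
      show "2 * pi * \<eta> \<le> 2 * pi * (e / (4 * pi * (km + pi)))" unfolding \<eta>_def by (rule mult_left_mono) auto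
      show "0 \<le> 2 * pi * (e / (4 * pi * (km + pi)))" using e kp by (intro mult_nonneg_nonneg divide_nonneg_nonneg) auto
    qed (use p le km in \<open>auto intro: add_nonneg_nonneg\<close>)
    also have "\<dots> = e / 2"
    proof -
      have "2 * pi * (e / (4 * pi * X)) * X = e / 2" if "X > 0" for X using that by (simp add: field_simps)
      then show ?thesis using kp .
    qed
    finally show "2 * pi * \<eta> * (km + pi * \<eta>) \<le> e / 2" .
  qed
  define sF where "sF = sqrt (2 * pi * \<gamma> * C)"
  have sF: "sF \<ge> 0" using \<gamma> C by (simp add: sF_def)
  \<comment> \<open>The cross term enters as \<open>2 * c0\<close>: at most 1 for the a priori bound
    \<open>km\<close>, at most \<open>e\<close> in the final estimate.\<close>
  define c0 where "c0 = min (1/2) (e/2)"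
  have c0: "c0 > 0" using e by (simp add: c0_def)
  obtain \<phi> where \<phi>: "test_function \<Omega> \<phi>" "nrm2 M (\<lambda>x. w0 x - with_grad \<phi> x) < c0 / (2 * (sF + 1))"
    using Z_approx[OF w0(1), of "c0 / (2 * (sF + 1))"] c0 sF by auto
  obtain B where B: "B \<ge> 0" "\<And>x. norm (grad \<phi> x) \<le> B" using test_function_bounded[OF \<phi>(1)] by metis
  define f where "f \<epsilon> x = (\<Sum>a\<in>centers \<Omega> (p \<epsilon>) \<epsilon>. (of_int (d \<epsilon> a) / (pi/4)) * ind (ball a (\<epsilon>/2)) x)" for \<epsilon> x
  have bS: "ball a (\<epsilon>/2) \<in> sets borel \<and> ball a (\<epsilon>/2) \<subseteq> \<Omega> \<and> ball a (\<epsilon>/2) \<subseteq> cball a \<epsilon> \<and> measure lborel (ball a (\<epsilon>/2)) = pi/4 * \<epsilon>^2"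
    if "\<epsilon> > 0" "a \<in> centers \<Omega> (p \<epsilon>) \<epsilon>" for \<epsilon> a
    using that cball_subset_domain[OF that(2), of "\<epsilon>/2"] content_ball[of "\<epsilon>/2" a] ball_subset_cball[of a "\<epsilon>/2"]
    by (auto simp: unit_ball_vol_2 power_divide)
  have bD: "ball a (\<epsilon>/2) \<inter> ball b (\<epsilon>/2) = {}" if "\<epsilon> > 0" "a \<in> centers \<Omega> (p \<epsilon>) \<epsilon>" "b \<in> centers \<Omega> (p \<epsilon>) \<epsilon>" "a \<noteq> b" for \<epsilon> a b
    using cells_disjoint[OF that(2,3,4,1)] ball_subset_cell by blast
  have pi4: "pi/4 > 0" by simp
  have disc1: "\<forall>\<^sub>F \<epsilon> in at_right 0. sqi M (f \<epsilon>) \<and> nrm2 M (f \<epsilon>) \<le> sqrt (C / (pi/4))"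
    unfolding f_def by (rule discretization(1)[OF ev[unfolded Q_def] vort pi4, where S="\<lambda>\<epsilon> a. ball a (\<epsilon>/2)"]; fact bS bD)
  have disc2: "((\<lambda>\<epsilon>. \<integral>x. f \<epsilon> x * \<phi> x \<partial>M) \<longlongrightarrow> (\<integral>x. D x * \<phi> x \<partial>M)) (at_right 0)" if "test_function \<Omega> \<phi>" for \<phi>
    unfolding f_def by (rule discretization(2)[OF ev[unfolded Q_def] vort pi4 _ _ that, where S="\<lambda>\<epsilon> a. ball a (\<epsilon>/2)"]; fact bS bD)
  have R: "\<forall>\<^sub>F \<epsilon> in at_right 0. \<forall>w\<in>Z. \<bar>\<integral>x. (f \<epsilon> x - D x) * fst (w x) \<partial>M\<bar> \<le> \<eta> * nrm2 M w"
    by (rule weak_to_strong_dual[OF disc1 D disc2 \<eta>(1)])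
  have "((\<lambda>\<epsilon>. B * (pi * C) * \<epsilon>) \<longlongrightarrow> 0) (at_right 0)" by (auto intro!: tendsto_eq_intros)
  then have evB: "\<forall>\<^sub>F \<epsilon> in at_right 0. B * (pi * C) * \<epsilon> < c0 / 2" by (rule order_tendstoD(2)) (use c0 in simp)
  have evS: "\<forall>\<^sub>F \<epsilon> in at_right 0. \<epsilon> < min 1 (\<gamma> / 5)" using \<gamma> by (intro order_tendstoD(2)[of "\<lambda>x. x" 0]) auto
  have ev0: "\<forall>\<^sub>F \<epsilon> in at_right (0::real). \<epsilon> > 0" by (rule eventually_at_right_less)
  from ev disc1 R evB evS ev0 show ?thesis
  proof eventually_elim
    case (elim \<epsilon>)
    let ?A = "centers \<Omega> (p \<epsilon>) \<epsilon>"
    define q where "q = Q \<epsilon>"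
    have qd: "\<epsilon>^2 * (\<Sum>a\<in>?A. (real_of_int (d \<epsilon> a))^2) = q" by (simp add: q_def Q_def)
    have \<epsilon>: "0 < \<epsilon>" "\<epsilon> \<le> 1" "\<epsilon> \<le> \<gamma> / 5" using elim by auto
    have q: "0 \<le> q" "q \<le> C" using elim by (auto simp: q_def Q_def sum_nonneg)
    define \<rho> where "\<rho> = exp (- \<gamma> / \<epsilon>^2)"
    define l where "l = ln (\<epsilon> / 2 / \<rho>)"
    note r = small_radius[OF \<gamma> \<epsilon>(1,3), folded \<rho>_def]
    note lb = log_ratio_bounds[OF \<epsilon>(1,2), of \<gamma>, folded \<rho>_def, folded l_def]
    have rle: "\<rho> \<le> \<epsilon> / 2" using r(3) \<epsilon> by simp
    have fin: "finite ?A" by (rule finite_centers[OF \<epsilon>(1)])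
    have sub: "cball a \<rho> \<subseteq> \<Omega>" if "a \<in> ?A" for a using cball_subset_domain[OF that rle] .
    define F where "F x = (\<Sum>a\<in>?A. (\<epsilon>^2 * d \<epsilon> a) *\<^sub>R radial_field \<rho> (\<epsilon>/2) a x)" for x
    note F = flux_field[OF \<epsilon>(1) r(1) rle, where p="p \<epsilon>" and d="d \<epsilon>", folded F_def F_def[abs_def] l_def, unfolded qd]
    obtain w where w: "w \<in> Z_holes ?A \<rho>"
      "\<And>u. u \<in> Z_holes ?A \<rho> \<Longrightarrow> (\<integral>x. w x \<bullet> u x \<partial>M) =
      2 * pi * \<epsilon>^2 * (\<Sum>a\<in>?A. of_int (d \<epsilon> a) * ((\<integral>x. ind (cball a \<rho>) x * fst (u x) \<partial>M) / (pi * \<rho>^2))) - \<sigma> * (\<integral>x. fst (u x) \<partial>M)"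
      "E_tilde \<Omega> \<sigma> \<gamma> (p \<epsilon>) \<epsilon> (d \<epsilon>) = (nrm2 M w)^2 / 2"
      using E_tilde_char[OF fin sub[unfolded \<rho>_def], where \<sigma>=\<sigma> and d="d \<epsilon>", folded \<rho>_def] by blast
    have wZ: "w \<in> Z" and w0h: "\<And>a. a \<in> ?A \<Longrightarrow> AE x in M. x \<in> cball a \<rho> \<longrightarrow> snd (w x) = 0" using w(1) by (auto simp: Z_holes_def)
    define n where "n = nrm2 M w"
    \<comment> \<open>Neighbouring closed disks touch, so the density is built on open ones, while
      \<open>hole_average\<close> uses closed ones; the circles are null sets.\<close>
    have bc: "(\<integral>x. ind (cball a (\<epsilon>/2)) x * fst (w x) \<partial>M) = (\<integral>x. ind (ball a (\<epsilon>/2)) x * fst (w x) \<partial>M)" for a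
    proof (rule integral_cong_AE)
      have "sphere a (\<epsilon>/2) \<in> null_sets lebesgue" by (simp add: negligible_sphere negligible_iff_null_sets[symmetric])
      then have "AE x in lebesgue. x \<notin> sphere a (\<epsilon>/2)" by (rule AE_not_in)
      then have "AE x in M. x \<notin> sphere a (\<epsilon>/2)" using domain_sets by (auto simp: AE_restrict_space_iff elim: eventually_mono)
      then show "AE x in M. ind (cball a (\<epsilon>/2)) x * fst (w x) = ind (ball a (\<epsilon>/2)) x * fst (w x)"
        by eventually_elim (auto simp: indicator_def)
      have "ind (ball a (\<epsilon>/2)) \<in> borel_measurable M" by (intro borel_measurable_M borel_measurable_indicator borel_open open_ball)
      then show "(\<lambda>x. ind (ball a (\<epsilon>/2)) x * fst (w x)) \<in> borel_measurable M" using Z_fst[OF wZ] by (auto simp: sqi_def)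
    qed (use Z_fst[OF wZ] indicator_cball_measurable in \<open>auto simp: sqi_def\<close>)
    have iB: "integrable M (\<lambda>x. ind (ball a (\<epsilon>/2)) x * fst (w x))" for a
      by (rule sqi_mult[OF sqi_bounded[OF finite_measure_M, of _ 1] Z_fst[OF wZ]])
         (auto intro!: borel_measurable_M borel_measurable_indicator borel_open open_ball simp: indicator_def)
    have avg: "(\<integral>x. ind (cball a \<rho>) x * fst (w x) \<partial>M) / (pi * \<rho>^2) =
      (\<integral>x. ind (ball a (\<epsilon>/2)) x * fst (w x) \<partial>M) / (pi * (\<epsilon>/2)^2) - (\<integral>x. radial_field \<rho> (\<epsilon>/2) a x \<bullet> snd (w x) \<partial>M) / (2 * pi)" if "a \<in> ?A" for a
      using hole_average[OF wZ r(1) rle cball_subset_domain[OF that order_refl] w0h[OF that]] by (simp only: bc)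
    have fw: "(\<integral>x. f \<epsilon> x * fst (w x) \<partial>M) = (\<Sum>a\<in>?A. of_int (d \<epsilon> a) / (pi/4) * (\<integral>x. ind (ball a (\<epsilon>/2)) x * fst (w x) \<partial>M))"
    proof -
      have "(\<integral>x. f \<epsilon> x * fst (w x) \<partial>M) = (\<integral>x. (\<Sum>a\<in>?A. of_int (d \<epsilon> a) / (pi/4) * (ind (ball a (\<epsilon>/2)) x * fst (w x))) \<partial>M)"
        unfolding f_def by (simp add: sum_distrib_right mult.assoc)
      also have "\<dots> = (\<Sum>a\<in>?A. \<integral>x. of_int (d \<epsilon> a) / (pi/4) * (ind (ball a (\<epsilon>/2)) x * fst (w x)) \<partial>M)"
        by (rule Bochner_Integration.integral_sum) (intro integrable_mult_right iB)
      also have "\<dots> = (\<Sum>a\<in>?A. of_int (d \<epsilon> a) / (pi/4) * (\<integral>x. ind (ball a (\<epsilon>/2)) x * fst (w x) \<partial>M))"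
        by (rule sum.cong[OF refl], rule integral_mult_right_zero)
      finally show ?thesis .
    qed
    have sum_eq: "2 * pi * \<epsilon>^2 * (\<Sum>a\<in>?A. of_int (d \<epsilon> a) * ((\<integral>x. ind (cball a \<rho>) x * fst (w x) \<partial>M) / (pi * \<rho>^2))) =
       2 * pi * (\<integral>x. f \<epsilon> x * fst (w x) \<partial>M) - (\<integral>x. F x \<bullet> snd (w x) \<partial>M)"
    proof -
      have key: "2 * pi * \<epsilon>^2 * (of_int (d \<epsilon> a) * ((\<integral>x. ind (cball a \<rho>) x * fst (w x) \<partial>M) / (pi * \<rho>^2))) =
         2 * pi * (of_int (d \<epsilon> a) / (pi/4) * (\<integral>x. ind (ball a (\<epsilon>/2)) x * fst (w x) \<partial>M)) - \<epsilon>^2 * d \<epsilon> a * (\<integral>x. radial_field \<rho> (\<epsilon>/2) a x \<bullet> snd (w x) \<partial>M)" if "a \<in> ?A" for a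
        unfolding avg[OF that] using \<epsilon>(1) by (simp add: field_simps)
      show ?thesis
        unfolding fw F(4)[OF Z_snd[OF wZ]] sum_distrib_left sum_subtractf[symmetric] by (rule sum.cong[OF refl key])
    qed
    \<comment> \<open>With this \<open>k1\<close> the equation tested with \<open>w\<close> becomes
      a small multiple of the pairing of \<open>f \<epsilon> - D\<close> with \<open>fst w\<close>
      plus the pairing of \<open>k1\<close> with \<open>w\<close>; the former is controlled by
      \<open>weak_to_strong_dual\<close>.\<close>
    define k1 where "k1 x = w0 x + (0, - F x)" for x
    have sFF: "sqi M (\<lambda>x. (0 :: real, - F x))"
      unfolding sqi_fst_snd[of M "\<lambda>x. (0 :: real, - F x)"] using sqi_minus[OF F(1)] by (simp add: sqi_zero)
    have sk: "sqi M k1" unfolding k1_def[abs_def] by (rule sqi_add[OF Z_sqi[OF w0(1)] sFF])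
    have k1w: "(\<integral>x. k1 x \<bullet> w x \<partial>M) = (\<integral>x. w0 x \<bullet> w x \<partial>M) - (\<integral>x. F x \<bullet> snd (w x) \<partial>M)"
    proof -
      have "(\<integral>x. k1 x \<bullet> w x \<partial>M) = (\<integral>x. w0 x \<bullet> w x - F x \<bullet> snd (w x) \<partial>M)"
        by (rule Bochner_Integration.integral_cong) (auto simp: k1_def inner_add_left inner_diff_left inner_prod_def)
      then show ?thesis using sqi_inner[OF Z_sqi[OF w0(1)] Z_sqi[OF wZ]] sqi_inner[OF F(1) Z_snd[OF wZ]] by simp
    qed
    have fDw: "(\<integral>x. (f \<epsilon> x - D x) * fst (w x) \<partial>M) = (\<integral>x. f \<epsilon> x * fst (w x) \<partial>M) - (\<integral>x. D x * fst (w x) \<partial>M)"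
    proof -
      have sf: "sqi M (f \<epsilon>)" using elim by blast
      show ?thesis using sqi_mult[OF sf Z_fst[OF wZ]] sqi_mult[OF D Z_fst[OF wZ]] by (simp add: left_diff_distrib)
    qed
    have n2: "n^2 = 2 * pi * (\<integral>x. (f \<epsilon> x - D x) * fst (w x) \<partial>M) + (\<integral>x. k1 x \<bullet> w x \<partial>M)"
    proof -
      have "n^2 = (\<integral>x. w x \<bullet> w x \<partial>M)" by (simp add: n_def nrm2_sq power2_norm_eq_inner)
      then show ?thesis using w(2)[OF w(1)] sum_eq w0(2)[OF wZ] k1w fDw by (simp add: right_diff_distrib)
    qed
    define N where "N = nrm2 M k1"
    have "\<bar>\<integral>x. (f \<epsilon> x - D x) * fst (w x) \<partial>M\<bar> \<le> \<eta> * n" using elim wZ unfolding n_def by blast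
    then have "2 * pi * (\<integral>x. (f \<epsilon> x - D x) * fst (w x) \<partial>M) \<le> 2 * pi * (\<eta> * n)" by (intro mult_left_mono) auto
    moreover have "(\<integral>x. k1 x \<bullet> w x \<partial>M) \<le> N * n" using Cauchy_Schwarz_integral[OF sk Z_sqi[OF wZ]] by (simp add: N_def n_def)
    ultimately have "n^2 \<le> 2 * pi * (\<eta> * n) + N * n" using n2 by linarith
    then have "n * n \<le> (2 * pi * \<eta> + N) * n" unfolding power2_eq_square distrib_right by (simp only: mult.assoc)
    moreover have n0': "n \<ge> 0" "N \<ge> 0" by (simp_all add: n_def N_def)
    ultimately have nle: "n \<le> 2 * pi * \<eta> + N"
      using \<eta>(1) by (cases "n = 0") auto
    have elq: "\<epsilon>^2 * q * (2 * pi * l) \<le> 2 * pi * \<gamma> * q"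
    proof -
      have "q * 2 * pi * (\<epsilon>^2 * l) \<le> q * 2 * pi * \<gamma>" using lb(1) q by (intro mult_left_mono) auto
      then show ?thesis by (simp add: mult_ac)
    qed
    have FF: "(nrm2 M F)^2 \<le> 2 * pi * \<gamma> * q" using F(2) elq by linarith
    have "2 * pi * \<gamma> * q \<le> 2 * pi * \<gamma> * C" using q \<gamma> by (intro mult_left_mono) auto
    then have nF: "nrm2 M F \<le> sF" unfolding sF_def using FF by (intro real_le_rsqrt) linarith
    \<comment> \<open>The gradient of \<open>w0\<close> is split into that of a test function,
      bounded and hence small against \<open>F\<close> in \<open>L^1\<close>, and a rest small in
      \<open>L^2\<close>, against which \<open>F\<close> is bounded.\<close>
    have cross: "\<bar>\<integral>x. snd (w0 x) \<bullet> F x \<partial>M\<bar> \<le> c0"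
    proof -
      note sg = test_function_sqi(2)[OF open_domain \<phi>(1)]
      have sd: "sqi M (\<lambda>x. snd (w0 x) - grad \<phi> x)" by (rule sqi_diff[OF Z_snd[OF w0(1)] sg])
      have sw: "sqi M (\<lambda>x. w0 x - with_grad \<phi> x)" by (rule sqi_diff[OF Z_sqi[OF w0(1)] with_grad_sqi[OF \<phi>(1)]])
      have nd: "nrm2 M (\<lambda>x. snd (w0 x) - grad \<phi> x) \<le> c0 / (2 * (sF + 1))"
      proof -
        have "nrm2 M (\<lambda>x. snd (w0 x) - grad \<phi> x) \<le> nrm2 M (\<lambda>x. w0 x - with_grad \<phi> x)"
          by (rule power2_le_imp_le) (use nrm2_pair_sq[OF sw] in \<open>auto simp: with_grad_def\<close>)
        then show ?thesis using \<phi>(2) by simp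
      qed
      have "(\<integral>x. snd (w0 x) \<bullet> F x \<partial>M) = (\<integral>x. (snd (w0 x) - grad \<phi> x) \<bullet> F x \<partial>M) + (\<integral>x. grad \<phi> x \<bullet> F x \<partial>M)"
        using sqi_inner[OF sd F(1)] sqi_inner[OF sg F(1)] by (subst Bochner_Integration.integral_add[symmetric]) (auto simp: inner_diff_left)
      moreover have "\<bar>\<integral>x. (snd (w0 x) - grad \<phi> x) \<bullet> F x \<partial>M\<bar> \<le> c0 / 2"
      proof -
        have "\<bar>\<integral>x. (snd (w0 x) - grad \<phi> x) \<bullet> F x \<partial>M\<bar> \<le> nrm2 M (\<lambda>x. snd (w0 x) - grad \<phi> x) * nrm2 M F" by (rule Cauchy_Schwarz_integral[OF sd F(1)])
        also have "\<dots> \<le> c0 / (2 * (sF + 1)) * (sF + 1)" using nd nF c0 sF by (intro mult_mono) auto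
        also have "\<dots> = c0 / 2" using sF by (simp add: field_simps)
        finally show ?thesis .
      qed
      moreover have "\<bar>\<integral>x. grad \<phi> x \<bullet> F x \<partial>M\<bar> \<le> c0 / 2"
      proof -
        have "\<bar>\<integral>x. grad \<phi> x \<bullet> F x \<partial>M\<bar> \<le> (\<integral>x. \<bar>grad \<phi> x \<bullet> F x\<bar> \<partial>M)" by (rule integral_abs_bound)
        also have "\<dots> \<le> (\<integral>x. B * norm (F x) \<partial>M)"
        proof (rule integral_mono')
          show "integrable M (\<lambda>x. B * norm (F x))" by (intro integrable_mult_right integrable_norm sqi_integrable[OF finite_measure_M F(1)])
          show "\<bar>grad \<phi> x \<bullet> F x\<bar> \<le> B * norm (F x)" for x
            using Cauchy_Schwarz_ineq2[of "grad \<phi> x" "F x"] mult_right_mono[OF B(2)[of x] norm_ge_zero[of "F x"]] by linarith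
        qed (use B(1) in auto)
        also have "\<dots> = B * (\<integral>x. norm (F x) \<partial>M)" by simp
        also have "\<dots> \<le> B * (pi * \<epsilon> * C)"
        proof (intro mult_left_mono B(1))
          have "pi * \<epsilon> * q \<le> pi * \<epsilon> * C" using q \<epsilon> by (intro mult_left_mono) auto
          then show "(\<integral>x. norm (F x) \<partial>M) \<le> pi * \<epsilon> * C" using F(3) by linarith
        qed
        also have "\<dots> \<le> c0 / 2" using elim by (simp add: mult_ac)
        finally show ?thesis .
      qed
      ultimately show ?thesis by linarith
    qed
    have N2: "N^2 \<le> n0^2 + 2 * c0 + 2 * pi * \<gamma> * q"
    proof -
      have "N^2 = n0^2 + 2 * (\<integral>x. w0 x \<bullet> (0, - F x) \<partial>M) + (nrm2 M (\<lambda>x. (0 :: real, - F x)))^2"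
        unfolding N_def n0_def k1_def[abs_def] by (rule nrm2_add_sq[OF Z_sqi[OF w0(1)] sFF])
      moreover have "(\<integral>x. w0 x \<bullet> (0, - F x) \<partial>M) = - (\<integral>x. snd (w0 x) \<bullet> F x \<partial>M)" by (simp add: inner_prod_def)
      moreover have "(nrm2 M (\<lambda>x. (0 :: real, - F x)))^2 = (nrm2 M F)^2" by (simp add: nrm2_sq norm_pair_sq)
      ultimately show ?thesis using FF cross by linarith
    qed
    have "N \<le> km" unfolding km_def
    proof (rule real_le_rsqrt)
      have "2 * pi * \<gamma> * q \<le> 2 * pi * \<gamma> * C" using q \<gamma> by (intro mult_left_mono) auto
      moreover have "2 * c0 \<le> 1" by (simp add: c0_def)
      ultimately show "N^2 \<le> n0^2 + 1 + 2 * pi * \<gamma> * C" using N2 by linarith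
    qed
    have "n^2 \<le> (2 * pi * \<eta> + N)^2" using nle n0' by (intro power_mono)
    also have "\<dots> = N^2 + 2 * (2 * pi * \<eta> * (N + pi * \<eta>))" by (simp add: power2_eq_square algebra_simps)
    also have "2 * pi * \<eta> * (N + pi * \<eta>) \<le> 2 * pi * \<eta> * (km + pi * \<eta>)" using \<open>N \<le> km\<close> \<eta>(1) by (intro mult_left_mono) auto
    also have "\<dots> \<le> e / 2" by (rule \<eta>(3))
    finally have "n^2 \<le> n0^2 + 2 * c0 + 2 * pi * \<gamma> * q + e" using N2 by linarith
    moreover have "2 * c0 \<le> e" by (simp add: c0_def)
    ultimately have "n^2 / 2 \<le> n0^2 / 2 + pi * \<gamma> * q + e" by linarith
    then show ?case using w(3) by (simp add: n_def n0_def q_def)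
  qed
qed

end

section \<open>The charge density\<close>

text \<open>The affine function with index \<open>k\<close> is the chord of the parabola
  \<open>t^2\<close> between \<open>k\<close> and \<open>k + 1\<close>. With
  \<open>j = \<lfloor>t\<rfloor>\<close>, the chord for \<open>j\<close> minus the chord for
  \<open>k\<close> factors as \<open>(j - k) * (2 t - 1 - j - k)\<close>, and the two factors never
  have opposite signs.\<close>

lemma floor_tangent: "(2 * real_of_int k + 1) * t - k - (real_of_int k)^2 \<le> (2 * real_of_int \<lfloor>t\<rfloor> + 1) * t - \<lfloor>t\<rfloor> - (real_of_int \<lfloor>t\<rfloor>)^2"
proof -
  define j where "j = \<lfloor>t\<rfloor>"
  have j: "real_of_int j \<le> t" "t < real_of_int j + 1" by (simp_all add: j_def)
  have "0 \<le> (real_of_int j - k) * (2 * t - 1 - j - k)"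
  proof -
    consider "k = j" | "k \<le> j - 1" | "j + 1 \<le> k" by linarith
    then show ?thesis
    proof cases
      case 2
      then have "real_of_int k \<le> real_of_int j - 1" by linarith
      then show ?thesis using j by (intro mult_nonneg_nonneg) auto
    next
      case 3
      then have "real_of_int j + 1 \<le> real_of_int k" by linarith
      then show ?thesis using j by (intro mult_nonpos_nonpos) auto
    qed simp
  qed
  then show ?thesis unfolding j_def[symmetric] by (simp add: algebra_simps power2_eq_square)
qed

lemma Phi_floor: "Phi t = (2 * real_of_int \<lfloor>t\<rfloor> + 1) * t - \<lfloor>t\<rfloor> - (real_of_int \<lfloor>t\<rfloor>)^2"
proof -
  define F where "F t = (2 * real_of_int \<lfloor>t\<rfloor> + 1) * t - \<lfloor>t\<rfloor> - (real_of_int \<lfloor>t\<rfloor>)^2" for t :: real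
  have le: "F (- t) \<le> F t" for t
  proof -
    have "F (- t) = (2 * real_of_int (- \<lfloor>- t\<rfloor> - 1) + 1) * t - real_of_int (- \<lfloor>- t\<rfloor> - 1) - (real_of_int (- \<lfloor>- t\<rfloor> - 1))^2"
      unfolding F_def by (simp add: algebra_simps power2_eq_square)
    then show ?thesis using floor_tangent[of "- \<lfloor>- t\<rfloor> - 1" t] unfolding F_def by linarith
  qed
  have "F (- t) = F t" using le[of t] le[of "- t"] by simp
  then have "F \<bar>t\<bar> = F t" by (cases "t \<ge> 0") auto
  then show ?thesis by (simp add: Phi_def F_def Let_def)
qed

lemma Phi_tangent: "(2 * real_of_int k + 1) * t - k - (real_of_int k)^2 \<le> Phi t"
  using floor_tangent[of k t] by (simp add: Phi_floor)

text \<open>No integer lies strictly between \<open>k\<close> and \<open>k + 1\<close>, so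
  \<open>(d - k) * (d - k - 1)\<close> is not negative.\<close>

lemma int_square_tangent: "(2 * real_of_int k + 1) * real_of_int d - k - (real_of_int k)^2 \<le> (real_of_int d)^2"
proof -
  have "0 \<le> (d - k) * (d - k - 1)" by (cases "d \<le> k") (auto intro: mult_nonpos_nonpos mult_nonneg_nonneg)
  then have "0 \<le> real_of_int ((d - k) * (d - k - 1))" by linarith
  then show ?thesis by (simp add: algebra_simps power2_eq_square)
qed

lemma Phi_nonneg: "0 \<le> Phi t"
  using Phi_tangent[of 0 t] Phi_tangent[of "-1" t] by (cases "t \<ge> 0") auto

lemma Phi_le: "Phi t \<le> t^2 + 1"
proof -
  define s where "s = t - real_of_int \<lfloor>t\<rfloor>"
  have "0 \<le> (s - 1/2)^2" by simp
  then have "- 1 \<le> s * s - s" by (simp add: power2_eq_square algebra_simps)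
  then show ?thesis unfolding Phi_floor s_def by (simp add: algebra_simps power2_eq_square)
qed

lemma Phi_measurable: "Phi \<in> borel_measurable borel"
proof -
  have "(\<lambda>t. (2 * real_of_int \<lfloor>t\<rfloor> + 1) * t - \<lfloor>t\<rfloor> - (real_of_int \<lfloor>t\<rfloor>)^2) \<in> borel_measurable borel" by measurable
  then show ?thesis by (simp only: Phi_floor[symmetric])
qed

context bounded_domain
begin

lemma floor_sqi:
  assumes D: "sqi M (D :: real^2 \<Rightarrow> real)" shows "sqi M (\<lambda>x. real_of_int \<lfloor>D x\<rfloor>)"
  unfolding sqi_def
proof
  have Dm: "D \<in> borel_measurable M" using D by (simp add: sqi_def)
  show m: "(\<lambda>x. real_of_int \<lfloor>D x\<rfloor>) \<in> borel_measurable M" using Dm by measurable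
  have "sqi M (\<lambda>x. norm (D x) + 1)" by (intro sqi_add sqi_norm D sqi_const finite_measure_M)
  then have i: "integrable M (\<lambda>x. (norm (norm (D x) + 1))^2)" by (simp add: sqi_def)
  show "integrable M (\<lambda>x. (norm (real_of_int \<lfloor>D x\<rfloor>))^2)"
  proof (rule Bochner_Integration.integrable_bound[OF i])
    show "(\<lambda>x. (norm (real_of_int \<lfloor>D x\<rfloor>))^2) \<in> borel_measurable M" using m by measurable
    have "(norm (real_of_int \<lfloor>t\<rfloor>))^2 \<le> (norm (norm t + 1))^2" for t :: real by (intro power_mono) (simp_all, linarith)
    then show "AE x in M. norm ((norm (real_of_int \<lfloor>D x\<rfloor>))^2) \<le> norm ((norm (norm (D x) + 1))^2)"
      by (intro AE_I2) simp
  qed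
qed

lemma Phi_integrable:
  assumes D: "sqi M D" shows "integrable M (\<lambda>x. Phi (D x))"
proof -
  have i: "integrable M (\<lambda>x. (norm (D x))^2 + 1)" 
    using D finite_measure.integrable_const[OF finite_measure_M, of "1::real"] by (simp add: sqi_def)
  have Dm: "D \<in> borel_measurable M" using D by (simp add: sqi_def)
  show ?thesis
  proof (rule Bochner_Integration.integrable_bound[OF i])
    show "(\<lambda>x. Phi (D x)) \<in> borel_measurable M" by (rule measurable_compose[OF Dm Phi_measurable])
    show "AE x in M. norm (Phi (D x)) \<le> norm ((norm (D x))^2 + 1)" using Phi_nonneg Phi_le by (intro AE_I2) simp
  qed
qed

text \<open>With \<open>k = \<lfloor>D\<rfloor>\<close> frozen, the lower bound for the squared
  density is affine in the density and passes to the weak limit; at \<open>D\<close> itself it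
  equals \<open>Phi (D x)\<close>.\<close>

lemma charge_lower_bound:
  fixes d :: "real \<Rightarrow> real^2 \<Rightarrow> int"
  assumes ev: "\<forall>\<^sub>F e in at_right 0. e^2 * (\<Sum>a\<in>centers \<Omega> (p e) e. (real_of_int (d e a))^2) \<le> C"
    and vort: "vorticity_converges \<Omega> p d D" and D: "sqi M D" and \<eta>: "\<eta> > 0"
  shows "\<forall>\<^sub>F e in at_right 0. (\<integral>x. Phi (D x) \<partial>M) - \<eta> \<le> e^2 * (\<Sum>a\<in>centers \<Omega> (p e) e. (real_of_int (d e a))^2)"
proof -
  define f where "f e x = (\<Sum>a\<in>centers \<Omega> (p e) e. (of_int (d e a) / 1) * ind (cell e a) x)" for e x
  have cS: "cell e a \<in> sets borel \<and> cell e a \<subseteq> \<Omega> \<and> cell e a \<subseteq> cball a e \<and> measure lborel (cell e a) = 1 * e^2"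
    if "e > 0" "a \<in> centers \<Omega> (p e) e" for e a
    using cell_subset[OF that(2)] cell_subset_cball[of e a] measure_cell[OF that(1), of a] that by (auto simp: measure_def cell_def)
  have cD: "cell e a \<inter> cell e b = {}" if "e > 0" "a \<in> centers \<Omega> (p e) e" "b \<in> centers \<Omega> (p e) e" "a \<noteq> b" for e a b
    by (rule cells_disjoint[OF that(2,3,4,1)])
  have disc1: "\<forall>\<^sub>F e in at_right 0. sqi M (f e) \<and> nrm2 M (f e) \<le> sqrt (C / 1)"
    unfolding f_def by (rule discretization(1)[OF ev vort zero_less_one, where S="\<lambda>e a. cell e a"]; fact cS cD)
  have disc2: "((\<lambda>e. \<integral>x. f e x * \<phi> x \<partial>M) \<longlongrightarrow> (\<integral>x. D x * \<phi> x \<partial>M)) (at_right 0)" if "test_function \<Omega> \<phi>" for \<phi>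
    unfolding f_def by (rule discretization(2)[OF ev vort zero_less_one _ _ that, where S="\<lambda>e a. cell e a"]; fact cS cD)
  define k where "k x = real_of_int \<lfloor>D x\<rfloor>" for x
  have sk: "sqi M k" unfolding k_def[abs_def] by (rule floor_sqi[OF D])
  define g where "g x = 2 * k x + 1" for x
  have sg: "sqi M g" unfolding g_def[abs_def] by (intro sqi_add sqi_cmult sk sqi_const finite_measure_M)
  have ik: "integrable M (\<lambda>x. k x + (k x)^2)" using sqi_integrable[OF finite_measure_M sk] sk by (simp add: sqi_def)
  have "(\<integral>x. Phi (D x) \<partial>M) = (\<integral>x. D x * g x - (k x + (k x)^2) \<partial>M)"
    by (rule Bochner_Integration.integral_cong) (auto simp: Phi_floor g_def k_def algebra_simps)
  also have "\<dots> = (\<integral>x. D x * g x \<partial>M) - (\<integral>x. k x + (k x)^2 \<partial>M)" by (rule Bochner_Integration.integral_diff[OF sqi_mult[OF D sg] ik])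
  finally have P: "(\<integral>x. Phi (D x) \<partial>M) = (\<integral>x. D x * g x \<partial>M) - (\<integral>x. k x + (k x)^2 \<partial>M)" .
  have "\<forall>\<^sub>F e in at_right 0. (\<integral>x. D x * g x \<partial>M) - \<eta> < (\<integral>x. f e x * g x \<partial>M)"
    by (rule order_tendstoD(1)[OF weak_convergence_L2[OF disc1 D disc2 sg]]) (use \<eta> in simp_all)
  moreover have "\<forall>\<^sub>F e in at_right (0::real). e > 0" by (rule eventually_at_right_less)
  ultimately show ?thesis
  proof eventually_elim
    case (elim e)
    have fin: "finite (centers \<Omega> (p e) e)" by (rule finite_centers[OF elim(2)])
    have S: "cell e a \<in> sets borel \<and> cell e a \<subseteq> \<Omega> \<and> measure lborel (cell e a) = e^2" if "a \<in> centers \<Omega> (p e) e" for a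
      using cS[OF elim(2) that] by simp
    note pc = piecewise_constant[OF fin S cD[OF elim(2)]]
    have sf: "sqi M (f e)" unfolding f_def by (rule pc(3))
    have nf: "(nrm2 M (f e))^2 = e^2 * (\<Sum>a\<in>centers \<Omega> (p e) e. (real_of_int (d e a))^2)"
      using pc(4)[where c="\<lambda>a. of_int (d e a) / 1"] unfolding f_def by simp
    have "(\<integral>x. f e x * g x \<partial>M) - (\<integral>x. k x + (k x)^2 \<partial>M) = (\<integral>x. f e x * g x - (k x + (k x)^2) \<partial>M)"
      by (rule Bochner_Integration.integral_diff[symmetric, OF sqi_mult[OF sf sg] ik])
    also have "\<dots> \<le> (\<integral>x. (norm (f e x))^2 \<partial>M)"
    proof (rule integral_mono)
      show "integrable M (\<lambda>x. f e x * g x - (k x + (k x)^2))" by (rule Bochner_Integration.integrable_diff[OF sqi_mult[OF sf sg] ik])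
      show "integrable M (\<lambda>x. (norm (f e x))^2)" using sf by (simp add: sqi_def)
      fix x
      \<comment> \<open>The density is an integer at every point, including zero off the cells, so
        the inequality for integer squares applies pointwise.\<close>
      define z where "z = (\<Sum>a\<in>centers \<Omega> (p e) e. d e a * of_bool (x \<in> cell e a))"
      have "f e x = real_of_int z" unfolding f_def z_def by (simp add: indicator_def of_bool_def if_distrib cong: if_cong)
      then show "f e x * g x - (k x + (k x)^2) \<le> (norm (f e x))^2"
        using int_square_tangent[of "\<lfloor>D x\<rfloor>" z] by (simp add: g_def k_def mult.commute)
    qed
    finally show ?case using elim(1) P nf nrm2_sq[of M "f e"] by linarith
  qed
qed

lemma charges_boundedD:
  assumes "charges_bounded \<Omega> p d"
  obtains C where "C \<ge> 0" "\<forall>\<^sub>F e in at_right 0. e^2 * (\<Sum>a\<in>centers \<Omega> (p e) e. (real_of_int (d e a))^2) \<le> C"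
proof -
  obtain C where C: "\<forall>\<^sub>F e in at_right 0. (\<Sum>a\<in>centers \<Omega> (p e) e. (real_of_int (d e a))^2) \<le> C / e^2"
    using assms by (auto simp: charges_bounded_def)
  have ev0: "\<forall>\<^sub>F e in at_right (0::real). e > 0" by (rule eventually_at_right_less)
  have "\<forall>\<^sub>F e in at_right 0. e^2 * (\<Sum>a\<in>centers \<Omega> (p e) e. (real_of_int (d e a))^2) \<le> max C 0" using C ev0
  proof eventually_elim
    case (elim e)
    then have "e^2 * (\<Sum>a\<in>centers \<Omega> (p e) e. (real_of_int (d e a))^2) \<le> e^2 * (C / e^2)" by (intro mult_left_mono) auto
    then show ?case using elim(2) by simp
  qed
  then show ?thesis by (rule that[rotated]) simp
qed

lemma gamma_liminf:
  assumes \<sigma>: "\<sigma> \<ge> 0" and \<gamma>: "\<gamma> > 0" and D: "sqi M D"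
    and cb: "charges_bounded \<Omega> p d" and vort: "vorticity_converges \<Omega> p d D"
  shows "ereal (E_0 \<Omega> \<sigma> \<gamma> D) \<le> Liminf (at_right 0) (\<lambda>\<epsilon>. ereal (E_tilde \<Omega> \<sigma> \<gamma> (p \<epsilon>) \<epsilon> (d \<epsilon>)))"
proof (rule ereal_le_epsilon2)
  fix e :: real assume e: "e > 0"
  obtain C where C: "C \<ge> 0" "\<forall>\<^sub>F \<epsilon> in at_right 0. \<epsilon>^2 * (\<Sum>a\<in>centers \<Omega> (p \<epsilon>) \<epsilon>. (real_of_int (d \<epsilon> a))^2) \<le> C"
    using charges_boundedD[OF cb] by blast
  obtain w where w: "w \<in> Z" "\<And>v. v \<in> Z \<Longrightarrow> (\<integral>x. w x \<bullet> v x \<partial>M) = 2 * pi * (\<integral>x. D x * fst (v x) \<partial>M) - \<sigma> * (\<integral>x. fst (v x) \<partial>M)"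
    "E_0 \<Omega> \<sigma> \<gamma> D = (nrm2 M w)^2 / 2 + pi * \<gamma> * (\<integral>x. Phi (D x) \<partial>M)"
    using E_0_char[OF D] by blast
  have "sqrt (e / 2) > 0" using e by simp
  then obtain \<phi> where \<phi>: "test_function \<Omega> \<phi>" "nrm2 M (\<lambda>x. w x - with_grad \<phi> x) < sqrt (e / 2)" by (rule Z_approx[OF w(1)])
  define G where "G = with_grad \<phi>"
  have sG: "sqi M G" unfolding G_def by (rule with_grad_sqi[OF \<phi>(1)])
  have "(nrm2 M (\<lambda>x. w x - G x))^2 \<le> (sqrt (e / 2))^2" using \<phi>(2) unfolding G_def by (intro power_mono) auto
  then have near: "(nrm2 M (\<lambda>x. w x - G x))^2 \<le> e / 2" using e by simp
  have Gw: "(\<lambda>x. G x + (w x - G x)) = w" by auto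
  \<comment> \<open>Expanding about \<open>G\<close> shows that
    \<open>\<integral> w \<bullet> G\<close> minus half the squared norm of \<open>G\<close> misses
    half the squared norm of \<open>w\<close> only by half the squared distance of \<open>w\<close>
    and \<open>G\<close>, at most \<open>e / 4\<close>.\<close>
  have "(nrm2 M w)^2 = (nrm2 M G)^2 + 2 * (\<integral>x. G x \<bullet> (w x - G x) \<partial>M) + (nrm2 M (\<lambda>x. w x - G x))^2"
    by (rule nrm2_add_sq[OF sG sqi_diff[OF Z_sqi[OF w(1)] sG], unfolded Gw])
  moreover have "(\<integral>x. G x \<bullet> (w x - G x) \<partial>M) = (\<integral>x. w x \<bullet> G x \<partial>M) - (nrm2 M G)^2"
    using sqi_inner[OF sG Z_sqi[OF w(1)]] sqi_inner[OF sG sG]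
    by (simp add: inner_diff_right nrm2_sq power2_norm_eq_inner inner_commute[of "w _"])
  moreover have "(\<integral>x. w x \<bullet> G x \<partial>M) = 2 * pi * (\<integral>x. D x * \<phi> x \<partial>M) - \<sigma> * (\<integral>x. \<phi> x \<partial>M)"
    using w(2)[OF Z_test[OF \<phi>(1)]] by (simp add: G_def with_grad_def)
  ultimately have main: "(nrm2 M w)^2 / 2 - e / 4 \<le> 2 * pi * (\<integral>x. D x * \<phi> x \<partial>M) - \<sigma> * (\<integral>x. \<phi> x \<partial>M) - (nrm2 M G)^2 / 2"
    using near by argo
  obtain K \<epsilon>0 where K: "\<epsilon>0 > 0" "\<And>\<epsilon> p d. 0 < \<epsilon> \<Longrightarrow> \<epsilon> < \<epsilon>0 \<Longrightarrow> \<epsilon>^2 * (\<Sum>a\<in>centers \<Omega> p \<epsilon>. (real_of_int (d a))^2) \<le> C \<Longrightarrow>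
    E_tilde \<Omega> \<sigma> \<gamma> p \<epsilon> d \<ge> pi * \<gamma> * (\<epsilon>^2 * (\<Sum>a\<in>centers \<Omega> p \<epsilon>. (real_of_int (d a))^2))
      + 2 * pi * (\<epsilon>^2 * (\<Sum>a\<in>centers \<Omega> p \<epsilon>. of_int (d a) * \<phi> a)) - \<sigma> * (\<integral>x. \<phi> x \<partial>M) - (nrm2 M G)^2 / 2 - K * \<epsilon>"
    unfolding G_def by (rule E_tilde_lower_bound[OF \<phi>(1) \<sigma> \<gamma> C(1)]) blast
  \<comment> \<open>The tolerance \<open>e\<close> is spent as \<open>e / 4\<close> on approximating
    \<open>w\<close>, \<open>e / 4\<close> on the charge term, and \<open>e / 2\<close> on the
    convergence of the vorticity together with \<open>K * \<epsilon>\<close>.\<close>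
  have "e / (4 * pi * \<gamma>) > 0" using e \<gamma> by simp
  from charge_lower_bound[OF C(2) vort D this]
  have ev1: "\<forall>\<^sub>F \<epsilon> in at_right 0. (\<integral>x. Phi (D x) \<partial>M) - e / (4 * pi * \<gamma>) \<le> \<epsilon>^2 * (\<Sum>a\<in>centers \<Omega> (p \<epsilon>) \<epsilon>. (real_of_int (d \<epsilon> a))^2)" .
  have "((\<lambda>\<epsilon>. 2 * pi * (\<epsilon>^2 * (\<Sum>a\<in>centers \<Omega> (p \<epsilon>) \<epsilon>. of_int (d \<epsilon> a) * \<phi> a)) - K * \<epsilon>) \<longlongrightarrow> 2 * pi * (\<integral>x. D x * \<phi> x \<partial>M) - K * 0) (at_right 0)"
    by (intro tendsto_intros vort[unfolded vorticity_converges_def, rule_format, OF \<phi>(1)])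
  then have ev2: "\<forall>\<^sub>F \<epsilon> in at_right 0. 2 * pi * (\<integral>x. D x * \<phi> x \<partial>M) - e / 2 < 2 * pi * (\<epsilon>^2 * (\<Sum>a\<in>centers \<Omega> (p \<epsilon>) \<epsilon>. of_int (d \<epsilon> a) * \<phi> a)) - K * \<epsilon>"
    by (rule order_tendstoD(1)) (use e in simp)
  have ev3: "\<forall>\<^sub>F \<epsilon> in at_right (0::real). 0 < \<epsilon> \<and> \<epsilon> < \<epsilon>0" using K(1) by (auto simp: eventually_at_right_field)
  have "\<forall>\<^sub>F \<epsilon> in at_right 0. ereal (E_0 \<Omega> \<sigma> \<gamma> D - e) \<le> ereal (E_tilde \<Omega> \<sigma> \<gamma> (p \<epsilon>) \<epsilon> (d \<epsilon>))" using C(2) ev1 ev2 ev3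
  proof eventually_elim
    case (elim \<epsilon>)
    define q where "q = \<epsilon>^2 * (\<Sum>a\<in>centers \<Omega> (p \<epsilon>) \<epsilon>. (real_of_int (d \<epsilon> a))^2)"
    have "pi * \<gamma> * ((\<integral>x. Phi (D x) \<partial>M) - e / (4 * pi * \<gamma>)) \<le> pi * \<gamma> * q" using elim(2) \<gamma> unfolding q_def by (intro mult_left_mono) auto
    moreover have "pi * \<gamma> * ((\<integral>x. Phi (D x) \<partial>M) - e / (4 * pi * \<gamma>)) = pi * \<gamma> * (\<integral>x. Phi (D x) \<partial>M) - e / 4" using \<gamma> by (simp add: right_diff_distrib)
    moreover note K(2)[OF conjunct1[OF elim(4)] conjunct2[OF elim(4)] elim(1), folded q_def]
    ultimately have "E_0 \<Omega> \<sigma> \<gamma> D - e \<le> E_tilde \<Omega> \<sigma> \<gamma> (p \<epsilon>) \<epsilon> (d \<epsilon>)" using main elim(3) w(3) by linarith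
    then show ?case by simp
  qed
  then have "ereal (E_0 \<Omega> \<sigma> \<gamma> D - e) \<le> Liminf (at_right 0) (\<lambda>\<epsilon>. ereal (E_tilde \<Omega> \<sigma> \<gamma> (p \<epsilon>) \<epsilon> (d \<epsilon>)))" by (rule Liminf_bounded)
  then show "ereal (E_0 \<Omega> \<sigma> \<gamma> D) \<le> Liminf (at_right 0) (\<lambda>\<epsilon>. ereal (E_tilde \<Omega> \<sigma> \<gamma> (p \<epsilon>) \<epsilon> (d \<epsilon>))) + ereal e"
    by (cases "Liminf (at_right 0) (\<lambda>\<epsilon>. ereal (E_tilde \<Omega> \<sigma> \<gamma> (p \<epsilon>) \<epsilon> (d \<epsilon>)))") auto
qed

end

section \<open>Recovery sequences\<close>

text \<open>For \<open>\<theta>\<close> in the unit interval the floor exceeds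
  \<open>\<lfloor>y\<rfloor>\<close> by one exactly from \<open>1 - f\<close> on, where
  \<open>f\<close> is the fractional part of \<open>y\<close>.\<close>

lemma floor_average:
  fixes y :: real
  shows "integrable (lebesgue_on {0..1}) (\<lambda>\<theta>. real_of_int \<lfloor>y + \<theta>\<rfloor>)"
    "(\<integral>\<theta>. real_of_int \<lfloor>y + \<theta>\<rfloor> \<partial>lebesgue_on {0..1}) = y"
proof -
  let ?U = "lebesgue_on {0..1::real}"
  have fm: "finite_measure ?U" by (rule finite_measure_lebesgue_on) (simp add: lmeasurable_interval)
  have m1: "measure ?U (space ?U) = 1" by (simp add: measure_restrict_space)
  define f where "f = y - of_int \<lfloor>y\<rfloor>"
  have f: "0 \<le> f" "f < 1" unfolding f_def by linarith+
  have eq: "real_of_int \<lfloor>y + \<theta>\<rfloor> = of_int \<lfloor>y\<rfloor> + ind {1 - f..1} \<theta>" if "\<theta> \<in> space ?U" for \<theta>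
  proof (cases "\<theta> \<ge> 1 - f")
    case True
    have "\<lfloor>y + \<theta>\<rfloor> = \<lfloor>y\<rfloor> + 1" using True that f unfolding f_def by (intro floor_unique) auto
    then show ?thesis using True that by simp
  next
    case False
    have "\<theta> \<ge> 0" using that by simp
    then have "\<lfloor>y + \<theta>\<rfloor> = \<lfloor>y\<rfloor>" using False of_int_floor_le[of y] unfolding f_def by linarith
    then show ?thesis using False by simp
  qed
  have A: "{1 - f..1} \<in> sets ?U" using f by (simp add: sets_restrict_space_iff)
  have iI: "integrable ?U (ind {1 - f..1})"
    using A finite_measure.emeasure_finite[OF fm, of "{1 - f..1}"] by (simp add: less_top)
  have "measure ?U {1 - f..1} = measure lebesgue {1 - f..1}" using f by (intro measure_restrict_space) auto
  then have mA: "(\<integral>\<theta>. ind {1 - f..1} \<theta> \<partial>?U) = f" using f by (simp add: Int_absorb1)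
  have ic: "integrable ?U (\<lambda>\<theta>. real_of_int \<lfloor>y\<rfloor>)" by (rule finite_measure.integrable_const[OF fm])
  show "integrable ?U (\<lambda>\<theta>. real_of_int \<lfloor>y + \<theta>\<rfloor>)"
  proof -
    have "integrable ?U (\<lambda>\<theta>. real_of_int \<lfloor>y + \<theta>\<rfloor>) = integrable ?U (\<lambda>\<theta>. of_int \<lfloor>y\<rfloor> + ind {1 - f..1} \<theta>)"
      by (rule Bochner_Integration.integrable_cong[OF refl]) (rule eq)
    then show ?thesis using Bochner_Integration.integrable_add[OF ic iI] by metis
  qed
  have "(\<integral>\<theta>. real_of_int \<lfloor>y + \<theta>\<rfloor> \<partial>?U) = (\<integral>\<theta>. of_int \<lfloor>y\<rfloor> + ind {1 - f..1} \<theta> \<partial>?U)"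
    by (rule Bochner_Integration.integral_cong[OF refl eq])
  also have "\<dots> = (\<integral>\<theta>. of_int \<lfloor>y\<rfloor> \<partial>?U) + (\<integral>\<theta>. ind {1 - f..1} \<theta> \<partial>?U)" by (rule Bochner_Integration.integral_add[OF ic iI])
  also have "\<dots> = y" unfolding mA using m1 by (simp add: f_def)
  finally show "(\<integral>\<theta>. real_of_int \<lfloor>y + \<theta>\<rfloor> \<partial>?U) = y" .
qed

text \<open>For every shift the rounded increments are one of the two integers next to
  \<open>g i j\<close>, so the sum of their squares is affine in them and its mean over the shift is
  the sum of \<open>Phi (g i j)\<close>. A single shift for all rows then does at least as well as
  the mean. The potential \<open>T\<close> is the error of the rounded partial sums.\<close>

lemma row_rounding:
  fixes g :: "'i \<Rightarrow> nat \<Rightarrow> real"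
  assumes fin: "finite R"
  obtains \<delta> :: "'i \<Rightarrow> nat \<Rightarrow> int" and T :: "'i \<Rightarrow> nat \<Rightarrow> real"
  where "\<And>i j. g i j = 0 \<Longrightarrow> \<delta> i j = 0"
    "(\<Sum>i\<in>R. \<Sum>j<n. (real_of_int (\<delta> i j))^2) \<le> (\<Sum>i\<in>R. \<Sum>j<n. Phi (g i j))"
    "\<And>i j. real_of_int (\<delta> i j) - g i j = T i (Suc j) - T i j" "\<And>i j. \<bar>T i j\<bar> \<le> 1"
proof -
  let ?U = "lebesgue_on {0..1::real}"
  have fm: "finite_measure ?U" by (rule finite_measure_lebesgue_on) (simp add: lmeasurable_interval)
  define S where "S i j = (\<Sum>j'<j. g i j')" for i j
  define \<delta> where "\<delta> \<theta> i j = \<lfloor>S i (Suc j) + \<theta>\<rfloor> - \<lfloor>S i j + \<theta>\<rfloor>" for \<theta> i j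
  define h where "h \<theta> = (\<Sum>i\<in>R. \<Sum>j<n. (2 * real_of_int \<lfloor>g i j\<rfloor> + 1) * ((real_of_int \<lfloor>S i (Suc j) + \<theta>\<rfloor> - real_of_int \<lfloor>S i j + \<theta>\<rfloor>) - g i j))" for \<theta>
  have Sg: "S i (Suc j) = S i j + g i j" for i j by (simp add: S_def)
  have sq: "(real_of_int (\<delta> \<theta> i j))^2 = Phi (g i j) + (2 * real_of_int \<lfloor>g i j\<rfloor> + 1) * ((real_of_int \<lfloor>S i (Suc j) + \<theta>\<rfloor> - real_of_int \<lfloor>S i j + \<theta>\<rfloor>) - g i j)" for \<theta> i j
  proof -
    \<comment> \<open>Floors of two numbers that differ by \<open>g i j\<close> differ by
      \<open>k\<close> or \<open>k + 1\<close>, and on these two integers the square coincides with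
      the chord of index \<open>k\<close>; the excess over \<open>Phi\<close> is therefore linear in
      the rounding error.\<close>
    define k where "k = \<lfloor>g i j\<rfloor>"
    have "k \<le> \<delta> \<theta> i j" "\<delta> \<theta> i j \<le> k + 1" unfolding k_def \<delta>_def Sg by linarith+
    then have "\<delta> \<theta> i j = k \<or> \<delta> \<theta> i j = k + 1" by linarith
    then have sq': "(real_of_int (\<delta> \<theta> i j))^2 = (2 * real_of_int k + 1) * \<delta> \<theta> i j - k - (real_of_int k)^2"
      by (elim disjE) (simp_all add: algebra_simps power2_eq_square)
    have dd: "real_of_int (\<delta> \<theta> i j) = real_of_int \<lfloor>S i (Suc j) + \<theta>\<rfloor> - real_of_int \<lfloor>S i j + \<theta>\<rfloor>" by (simp add: \<delta>_def)
    show ?thesis unfolding Phi_floor k_def[symmetric] dd[symmetric] sq' by (simp add: algebra_simps)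
  qed
  have i1: "integrable ?U (\<lambda>\<theta>. (2 * real_of_int \<lfloor>g i j\<rfloor> + 1) * ((real_of_int \<lfloor>S i (Suc j) + \<theta>\<rfloor> - real_of_int \<lfloor>S i j + \<theta>\<rfloor>) - g i j))" for i j
    by (intro integrable_mult_right Bochner_Integration.integrable_diff floor_average finite_measure.integrable_const[OF fm])
  have z1: "(\<integral>\<theta>. (2 * real_of_int \<lfloor>g i j\<rfloor> + 1) * ((real_of_int \<lfloor>S i (Suc j) + \<theta>\<rfloor> - real_of_int \<lfloor>S i j + \<theta>\<rfloor>) - g i j) \<partial>?U) = 0" for i j
  proof -
    have "(\<integral>\<theta>. (real_of_int \<lfloor>S i (Suc j) + \<theta>\<rfloor> - real_of_int \<lfloor>S i j + \<theta>\<rfloor>) - g i j \<partial>?U) = (S i (Suc j) - S i j) - (\<integral>\<theta>. g i j \<partial>?U)"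
      by (subst Bochner_Integration.integral_diff Bochner_Integration.integral_diff[OF floor_average(1) floor_average(1)],
          intro Bochner_Integration.integrable_diff floor_average finite_measure.integrable_const[OF fm],
          intro finite_measure.integrable_const[OF fm],
          subst Bochner_Integration.integral_diff[OF floor_average(1) floor_average(1)], simp only: floor_average(2))
    moreover have "(\<integral>\<theta>. g i j \<partial>?U) = g i j" by (simp add: measure_restrict_space)
    ultimately show ?thesis unfolding integral_mult_right_zero by (simp add: Sg)
  qed
  have ih: "integrable ?U h" unfolding h_def[abs_def] by (intro Bochner_Integration.integrable_sum i1)
  have zh: "(\<integral>\<theta>. h \<theta> \<partial>?U) = 0" unfolding h_def[abs_def]
    by (subst Bochner_Integration.integral_sum, intro Bochner_Integration.integrable_sum i1,
        subst Bochner_Integration.integral_sum, intro i1, simp only: z1 sum.neutral_const)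
  \<comment> \<open>A function with integral zero over the unit interval cannot be positive
    everywhere.\<close>
  obtain \<theta> where \<theta>: "0 \<le> \<theta>" "\<theta> \<le> 1" "h \<theta> \<le> 0"
  proof (rule ccontr)
    assume "\<not> thesis"
    then have pos: "h \<theta> > 0" if "\<theta> \<in> space ?U" for \<theta> using that \<open>\<And>\<theta>. 0 \<le> \<theta> \<Longrightarrow> \<theta> \<le> 1 \<Longrightarrow> h \<theta> \<le> 0 \<Longrightarrow> thesis\<close> by (force simp: not_le)
    have "(\<integral>\<theta>. 0 \<partial>?U) < (\<integral>\<theta>. h \<theta> \<partial>?U)"
    proof (rule finite_measure.integral_less_AE_space[OF fm _ ih])
      show "AE x in ?U. 0 < h x" using pos by (rule AE_I2)
      show "emeasure ?U (space ?U) \<noteq> 0" by (simp add: emeasure_restrict_space)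
    qed simp
    then show False using zh by simp
  qed
  define T where "T i j = real_of_int \<lfloor>S i j + \<theta>\<rfloor> - S i j" for i j
  show thesis
  proof (rule that[of "\<delta> \<theta>" T])
    show "\<delta> \<theta> i j = 0" if "g i j = 0" for i j using that by (simp add: \<delta>_def Sg)
    have "(\<Sum>i\<in>R. \<Sum>j<n. (real_of_int (\<delta> \<theta> i j))^2) = (\<Sum>i\<in>R. \<Sum>j<n. Phi (g i j)) + h \<theta>"
      unfolding sq h_def by (simp only: sum.distrib)
    then show "(\<Sum>i\<in>R. \<Sum>j<n. (real_of_int (\<delta> \<theta> i j))^2) \<le> (\<Sum>i\<in>R. \<Sum>j<n. Phi (g i j))" using \<theta>(3) by simp
    show "real_of_int (\<delta> \<theta> i j) - g i j = T i (Suc j) - T i j" for i j by (simp add: \<delta>_def T_def Sg)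
    show "\<bar>T i j\<bar> \<le> 1" for i j
    proof -
      have "real_of_int \<lfloor>S i j + \<theta>\<rfloor> \<le> S i j + \<theta>" "S i j + \<theta> < real_of_int \<lfloor>S i j + \<theta>\<rfloor> + 1" by linarith+
      then show ?thesis using \<theta>(1,2) unfolding T_def by linarith
    qed
  qed
qed

text \<open>Abel summation: two boundary terms of size \<open>B\<close> and \<open>n\<close>
  increments of size \<open>L\<close>, all weighted by a potential of size at most 1.\<close>

lemma summation_by_parts_bound:
  fixes T \<psi> :: "nat \<Rightarrow> real"
  assumes T: "\<And>j. \<bar>T j\<bar> \<le> 1" and \<psi>: "\<And>j. \<bar>\<psi> j\<bar> \<le> B" and L: "\<And>j. \<bar>\<psi> (Suc j) - \<psi> j\<bar> \<le> L"
  shows "\<bar>\<Sum>j<n. (T (Suc j) - T j) * \<psi> j\<bar> \<le> 2 * B + n * L"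
proof -
  have "(\<Sum>j<n. (T (Suc j) - T j) * \<psi> j) = T n * \<psi> n - T 0 * \<psi> 0 - (\<Sum>j<n. T (Suc j) * (\<psi> (Suc j) - \<psi> j))"
    by (induction n) (simp_all add: algebra_simps)
  moreover have m: "\<bar>x * y\<bar> \<le> b" if "\<bar>x\<bar> \<le> 1" "\<bar>y\<bar> \<le> b" for x y b :: real
    using mult_mono[OF that] by (simp add: abs_mult)
  have "\<bar>\<Sum>j<n. T (Suc j) * (\<psi> (Suc j) - \<psi> j)\<bar> \<le> (\<Sum>j<n. L)"
    by (rule order_trans[OF sum_abs sum_mono]) (rule m[OF T L])
  moreover have "\<bar>T n * \<psi> n\<bar> \<le> B" "\<bar>T 0 * \<psi> 0\<bar> \<le> B" by (rule m[OF T \<psi>])+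
  ultimately show ?thesis by (simp add: abs_le_iff)
qed

text \<open>A row of the lattice may leave \<open>A\<close> and enter it again, since the domain is
  not assumed convex. Sites outside \<open>A\<close> are filled with the value 0; they receive the
  charge 0, and each row can be rounded without interruption.\<close>

lemma lattice_rounding:
  fixes m :: "'a \<Rightarrow> real" and c :: "'i \<times> nat \<Rightarrow> 'a"
  assumes fin: "finite R" and inj: "inj_on c (R \<times> {..<n})" and A: "A \<subseteq> c ` (R \<times> {..<n})"
  obtains d :: "'a \<Rightarrow> int" where "(\<Sum>a\<in>A. (real_of_int (d a))^2) \<le> (\<Sum>a\<in>A. Phi (m a))"
    "\<And>\<phi> (B :: real) (L :: real). (\<And>a. \<bar>\<phi> a\<bar> \<le> B) \<Longrightarrow> (\<And>i j. \<bar>\<phi> (c (i, Suc j)) - \<phi> (c (i, j))\<bar> \<le> L) \<Longrightarrow>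
      \<bar>\<Sum>a\<in>A. (real_of_int (d a) - m a) * \<phi> a\<bar> \<le> card R * (2 * B + n * L)"
proof -
  define g where "g i j = (if c (i, j) \<in> A then m (c (i, j)) else 0)" for i j
  obtain \<delta> :: "'i \<Rightarrow> nat \<Rightarrow> int" and T where \<delta>: "\<And>i j. g i j = 0 \<Longrightarrow> \<delta> i j = 0"
    "(\<Sum>i\<in>R. \<Sum>j<n. (real_of_int (\<delta> i j))^2) \<le> (\<Sum>i\<in>R. \<Sum>j<n. Phi (g i j))"
    "\<And>i j. real_of_int (\<delta> i j) - g i j = T i (Suc j) - T i j" "\<And>i j. \<bar>T i j\<bar> \<le> 1"
    by (rule row_rounding[OF fin, of g n]) blast
  define d where "d a = (case inv_into (R \<times> {..<n}) c a of (i, j) \<Rightarrow> \<delta> i j)" for a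
  have d: "d (c (i, j)) = \<delta> i j" if "i \<in> R" "j < n" for i j
    using inv_into_f_f[OF inj, of "(i, j)"] that by (simp add: d_def)
  \<comment> \<open>The condition that \<open>F\<close> vanishes at zero charge and zero average is
    what makes the filled-in sites contribute nothing.\<close>
  have sum_A: "(\<Sum>a\<in>A. F (d a) (m a) a) = (\<Sum>i\<in>R. \<Sum>j<n. F (\<delta> i j) (g i j) (c (i, j)))"
    if F: "\<And>a. F 0 0 a = 0" for F :: "int \<Rightarrow> real \<Rightarrow> 'a \<Rightarrow> real"
  proof -
    have "(\<Sum>i\<in>R. \<Sum>j<n. F (\<delta> i j) (g i j) (c (i, j))) = (\<Sum>q\<in>R \<times> {..<n}. if c q \<in> A then F (d (c q)) (m (c q)) (c q) else 0)"
      unfolding sum.cartesian_product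
    proof (rule sum.cong[OF refl], clarify)
      fix i j assume ij: "i \<in> R" "j < n"
      show "F (\<delta> i j) (g i j) (c (i, j)) = (if c (i, j) \<in> A then F (d (c (i, j))) (m (c (i, j))) (c (i, j)) else 0)"
        using d[OF ij] \<delta>(1)[of i j] F by (auto simp: g_def)
    qed
    also have "\<dots> = (\<Sum>a\<in>c ` (R \<times> {..<n}). if a \<in> A then F (d a) (m a) a else 0)" by (simp add: sum.reindex[OF inj])
    also have "\<dots> = (\<Sum>a\<in>A. F (d a) (m a) a)" using A fin by (simp add: sum.If_cases Int_absorb1)
    finally show ?thesis ..
  qed
  show thesis
  proof (rule that[of d])
    show "(\<Sum>a\<in>A. (real_of_int (d a))^2) \<le> (\<Sum>a\<in>A. Phi (m a))"
      using \<delta>(2) sum_A[of "\<lambda>d m a. (real_of_int d)^2"] sum_A[of "\<lambda>d m a. Phi m"] by (simp add: Phi_floor[of 0])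
    fix \<phi> B L assume \<phi>: "\<And>a. \<bar>\<phi> a\<bar> \<le> (B :: real)" "\<And>i j. \<bar>\<phi> (c (i, Suc j)) - \<phi> (c (i, j))\<bar> \<le> (L :: real)"
    have "(\<Sum>a\<in>A. (real_of_int (d a) - m a) * \<phi> a) = (\<Sum>i\<in>R. \<Sum>j<n. (T i (Suc j) - T i j) * \<phi> (c (i, j)))"
      using sum_A[of "\<lambda>d m a. (real_of_int d - m) * \<phi> a"] by (simp add: \<delta>(3))
    also have "\<bar>\<dots>\<bar> \<le> (\<Sum>i\<in>R. 2 * B + n * L)"
      by (rule order_trans[OF sum_abs sum_mono]) (rule summation_by_parts_bound; intro \<delta> \<phi>)
    finally show "\<bar>\<Sum>a\<in>A. (real_of_int (d a) - m a) * \<phi> a\<bar> \<le> card R * (2 * B + n * L)" by simp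
  qed
qed

section \<open>Cell averages along the rows of the lattice\<close>

lemma int_interval:
  fixes e \<beta> q t :: real and i :: int
  assumes e: "e > 0" and \<beta>: "\<beta> \<ge> 0"
  shows "\<bar>q + e * (of_int i + 1/2)\<bar> \<le> \<beta> \<Longrightarrow> \<lceil>(- \<beta> - q) / e - 1/2\<rceil> \<le> i \<and> i \<le> \<lfloor>(\<beta> - q) / e - 1/2\<rfloor>"
    "real (nat (\<lfloor>(\<beta> - q) / e - 1/2\<rfloor> - \<lceil>(- \<beta> - q) / e - 1/2\<rceil> + 1)) \<le> 2 * \<beta> / e + 1"
proof -
  assume a: "\<bar>q + e * (of_int i + 1/2)\<bar> \<le> \<beta>"
  have "e * (of_int i + 1/2) \<le> \<beta> - q" "- \<beta> - q \<le> e * (of_int i + 1/2)" using a by linarith+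
  then have "of_int i + 1/2 \<le> (\<beta> - q) / e" "(- \<beta> - q) / e \<le> of_int i + 1/2" using e by (simp_all add: pos_le_divide_eq pos_divide_le_eq mult.commute)
  then show "\<lceil>(- \<beta> - q) / e - 1/2\<rceil> \<le> i \<and> i \<le> \<lfloor>(\<beta> - q) / e - 1/2\<rfloor>" unfolding le_floor_iff ceiling_le_iff by linarith
next
  have "(\<beta> - q) / e - (- \<beta> - q) / e = 2 * \<beta> / e" by (simp add: diff_divide_distrib)
  then have "real_of_int (\<lfloor>(\<beta> - q) / e - 1/2\<rfloor> - \<lceil>(- \<beta> - q) / e - 1/2\<rceil> + 1) \<le> 2 * \<beta> / e + 1" by linarith
  moreover have "0 \<le> 2 * \<beta> / e" using e \<beta> by simp
  ultimately show "real (nat (\<lfloor>(\<beta> - q) / e - 1/2\<rfloor> - \<lceil>(- \<beta> - q) / e - 1/2\<rceil> + 1)) \<le> 2 * \<beta> / e + 1" by linarith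
qed

lemma AE_cell:
  fixes p :: "real^2"
  assumes e: "e > 0"
  shows "AE x in lebesgue. \<exists>k :: int^2. x \<in> cell e (p + e *\<^sub>R (\<chi> i. of_int (k $ i) + 1/2))"
proof -
  define N where "N = (\<Union>(i, k)\<in>(UNIV :: (2 \<times> int) set). {x :: real^2. axis i 1 \<bullet> x = p $ i + e * of_int k})"
  have "negligible N" unfolding N_def
    by (rule negligible_countable_Union) (auto intro!: negligible_hyperplane simp: axis_eq_0_iff)
  then have "N \<in> null_sets lebesgue" by (simp add: negligible_iff_null_sets)
  then have "AE x in lebesgue. x \<notin> N" by (rule AE_not_in)
  then show ?thesis
  proof eventually_elim
    case (elim x)
    define k :: "int^2" where "k = (\<chi> i. \<lfloor>(x $ i - p $ i) / e\<rfloor>)"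
    have "\<bar>x $ i - (p + e *\<^sub>R (\<chi> i. of_int (k $ i) + 1/2)) $ i\<bar> < e / 2" for i
    proof -
      define t where "t = (x $ i - p $ i) / e"
      have x: "x $ i = p $ i + e * t" using e by (simp add: t_def)
      have "x $ i \<noteq> p $ i + e * of_int \<lfloor>t\<rfloor>" using elim unfolding N_def by (auto simp: inner_axis')
      then have "t \<noteq> of_int \<lfloor>t\<rfloor>" using x by auto
      then have "\<bar>t - (of_int \<lfloor>t\<rfloor> + 1/2)\<bar> < 1/2" by linarith
      then have "e * \<bar>t - (of_int \<lfloor>t\<rfloor> + 1/2)\<bar> < e * (1/2)" using e by (rule mult_strict_left_mono)
      moreover have "k $ i = \<lfloor>t\<rfloor>" by (simp add: k_def t_def)
      then have "x $ i - (p + e *\<^sub>R (\<chi> i. of_int (k $ i) + 1/2)) $ i = e * (t - (of_int \<lfloor>t\<rfloor> + 1/2))"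
        unfolding x by (simp add: algebra_simps)
      ultimately show ?thesis using e by (simp add: abs_mult)
    qed
    then show ?case unfolding mem_cell by blast
  qed
qed

context bounded_domain
begin

text \<open>The centres are embedded in a rectangle of indices with rows \<open>R\<close> and
  \<open>n\<close> sites per row, both of order \<open>1 / e\<close>. Consecutive sites of a row are
  at distance \<open>e\<close>, so a Lipschitz function changes by a multiple of \<open>e\<close>
  from one to the next.\<close>

lemma lattice_index:
  assumes e: "e > 0" and \<beta>: "\<And>x. x \<in> \<Omega> \<Longrightarrow> norm x \<le> \<beta>" "\<beta> \<ge> 0"
  obtains R :: "int set" and n :: nat and c :: "int \<times> nat \<Rightarrow> real^2"
  where "finite R" "real (card R) \<le> 2 * \<beta> / e + 1" "real n \<le> 2 * \<beta> / e + 1" "inj_on c (R \<times> {..<n})"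
    "centers \<Omega> p e \<subseteq> c ` (R \<times> {..<n})" "\<And>i j. norm (c (i, Suc j) - c (i, j)) = e"
proof
  define lo where "lo i = \<lceil>(- \<beta> - p $ i) / e - 1/2\<rceil>" for i :: 2
  define hi where "hi i = \<lfloor>(\<beta> - p $ i) / e - 1/2\<rfloor>" for i :: 2
  define R where "R = {lo 1..hi 1}"
  define n where "n = nat (hi 2 - lo 2 + 1)"
  define c :: "int \<times> nat \<Rightarrow> real^2" where "c = (\<lambda>(i, j). \<chi> l. p $ l + e * (of_int (if l = 1 then i else lo 2 + int j) + 1/2))"
  show "finite R" by (simp add: R_def)
  show "real (card R) \<le> 2 * \<beta> / e + 1" using int_interval(2)[OF e \<beta>(2), of "p $ 1"] by (simp add: R_def lo_def hi_def)
  show "real n \<le> 2 * \<beta> / e + 1" using int_interval(2)[OF e \<beta>(2), of "p $ 2"] by (simp add: n_def lo_def hi_def)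
  show "inj_on c (R \<times> {..<n})" using e by (auto simp: inj_on_def c_def vec_eq_iff forall_2)
  show "centers \<Omega> p e \<subseteq> c ` (R \<times> {..<n})"
  proof
    fix a assume a: "a \<in> centers \<Omega> p e"
    obtain k :: "2 \<Rightarrow> int" where k: "\<And>i. a $ i = p $ i + e * (of_int (k i) + 1/2)" using center_coordinates[OF a] by metis
    have kb: "lo i \<le> k i \<and> k i \<le> hi i" for i
    proof -
      have "\<bar>a $ i\<bar> \<le> \<beta>" using component_le_norm_cart[of a i] \<beta>(1)[OF center_in_domain[OF a e]] by linarith
      then show ?thesis using int_interval(1)[OF e \<beta>(2), of "p $ i" "k i"] k[of i] by (simp add: lo_def hi_def)
    qed
    have "a = c (k 1, nat (k 2 - lo 2))" using kb[of 2] k by (simp add: c_def vec_eq_iff forall_2)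
    moreover have "(k 1, nat (k 2 - lo 2)) \<in> R \<times> {..<n}" using kb[of 1] kb[of 2] by (auto simp: R_def n_def)
    ultimately show "a \<in> c ` (R \<times> {..<n})" by blast
  qed
  show "norm (c (i, Suc j) - c (i, j)) = e" for i j
  proof -
    have "c (i, Suc j) - c (i, j) = axis 2 e" by (simp add: c_def vec_eq_iff forall_2 axis_def algebra_simps)
    then show ?thesis using e by (simp add: norm_vec_def L2_set_def sum_2 axis_def)
  qed
qed

text \<open>Jensen's inequality on each cell: the chord indexed by the floor of the cell mean lies
  below \<open>Phi\<close> and touches it at the mean. Outside the cells \<open>Phi\<close> is not
  negative.\<close>

lemma cell_average_Phi:
  fixes D :: "real^2 \<Rightarrow> real"
  assumes e: "e > 0" and D: "sqi M D"
  shows "e^2 * (\<Sum>a\<in>centers \<Omega> p e. Phi ((\<integral>x. ind (cell e a) x * D x \<partial>M) / e^2)) \<le> (\<integral>x. Phi (D x) \<partial>M)"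
proof -
  let ?A = "centers \<Omega> p e"
  have fin: "finite ?A" by (rule finite_centers[OF e])
  have S: "cell e a \<in> sets borel \<and> cell e a \<subseteq> \<Omega> \<and> measure lborel (cell e a) = e^2" if "a \<in> ?A" for a
    using cell_subset[OF that] measure_cell[OF e, of a] e by (auto simp: measure_def cell_def)
  have dis: "cell e a \<inter> cell e b = {}" if "a \<in> ?A" "b \<in> ?A" "a \<noteq> b" for a b
    by (rule cells_disjoint[OF that e])
  have iP: "integrable M (\<lambda>x. ind (cell e a) x * Phi (D x))" if "a \<in> ?A" for a
  proof (rule Bochner_Integration.integrable_bound[OF Phi_integrable[OF D]])
    have "sqi M (ind (cell e a))" by (rule piecewise_constant(1)[OF fin S dis that])
    then show "(\<lambda>x. ind (cell e a) x * Phi (D x)) \<in> borel_measurable M"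
      using Phi_integrable[OF D] by (auto simp: sqi_def)
    show "AE x in M. norm (ind (cell e a) x * Phi (D x)) \<le> norm (Phi (D x))" by (intro AE_I2) (auto simp: indicator_def)
  qed
  have "e^2 * Phi ((\<integral>x. ind (cell e a) x * D x \<partial>M) / e^2) \<le> (\<integral>x. ind (cell e a) x * Phi (D x) \<partial>M)" if a: "a \<in> ?A" for a
  proof -
    have s1: "sqi M (ind (cell e a))" by (rule piecewise_constant(1)[OF fin S dis a])
    have m1: "(\<integral>x. ind (cell e a) x \<partial>M) = e^2" by (rule piecewise_constant(2)[OF fin S dis a])
    define I where "I = (\<integral>x. ind (cell e a) x * D x \<partial>M)"
    define k where "k = real_of_int \<lfloor>I / e^2\<rfloor>"
    have i1: "integrable M (\<lambda>x. ind (cell e a) x * D x)" by (rule sqi_mult[OF s1 D])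
    have i2: "integrable M (ind (cell e a))" by (rule sqi_integrable[OF finite_measure_M s1])
    have "e^2 * Phi (I / e^2) = (2 * k + 1) * I - (k + k^2) * e^2"
      using e unfolding Phi_floor k_def[symmetric] by (simp add: field_simps)
    also have "\<dots> = (\<integral>x. (2 * k + 1) * (ind (cell e a) x * D x) - (k + k^2) * ind (cell e a) x \<partial>M)"
      unfolding I_def m1[symmetric] using i1 i2 by simp
    also have "\<dots> \<le> (\<integral>x. ind (cell e a) x * Phi (D x) \<partial>M)"
    proof (rule integral_mono)
      show "integrable M (\<lambda>x. (2 * k + 1) * (ind (cell e a) x * D x) - (k + k^2) * ind (cell e a) x)" using i1 i2 by simp
      show "(2 * k + 1) * (ind (cell e a) x * D x) - (k + k^2) * ind (cell e a) x \<le> ind (cell e a) x * Phi (D x)" for x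
        using Phi_tangent[of "\<lfloor>I / e^2\<rfloor>" "D x"] by (cases "x \<in> cell e a") (simp_all add: k_def)
    qed (rule iP[OF a])
    finally show ?thesis unfolding I_def .
  qed
  then have "e^2 * (\<Sum>a\<in>?A. Phi ((\<integral>x. ind (cell e a) x * D x \<partial>M) / e^2)) \<le> (\<Sum>a\<in>?A. \<integral>x. ind (cell e a) x * Phi (D x) \<partial>M)"
    unfolding sum_distrib_left by (rule sum_mono)
  also have "\<dots> = (\<integral>x. (\<Sum>a\<in>?A. ind (cell e a) x * Phi (D x)) \<partial>M)" by (rule Bochner_Integration.integral_sum[symmetric, OF iP])
  also have "\<dots> \<le> (\<integral>x. Phi (D x) \<partial>M)"
  proof (rule integral_mono)
    show "integrable M (\<lambda>x. \<Sum>a\<in>?A. ind (cell e a) x * Phi (D x))" by (rule Bochner_Integration.integrable_sum[OF iP])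
    fix x
    show "(\<Sum>a\<in>?A. ind (cell e a) x * Phi (D x)) \<le> Phi (D x)"
    proof (cases "\<exists>a\<in>?A. x \<in> cell e a")
      case True
      then obtain a where a: "a \<in> ?A" "x \<in> cell e a" by blast
      have "(\<Sum>b\<in>?A. ind (cell e b) x * Phi (D x)) = ind (cell e a) x * Phi (D x)"
        by (rule sum_single[OF fin a(1)]) (use dis[OF a(1)] a(2) in \<open>auto simp: indicator_def\<close>)
      then show ?thesis using a by simp
    qed (use Phi_nonneg in \<open>simp add: indicator_def\<close>)
  qed (rule Phi_integrable[OF D])
  finally show ?thesis .
qed

text \<open>The sum is the integral of \<open>D\<close> against the step function
  \<open>\<psi>\<close> with the values of \<open>\<phi>\<close> at the centres. Cells cut by the
  boundary are missing from it, but for small \<open>e\<close> they do not meet the support of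
  \<open>\<phi>\<close>.\<close>

lemma cell_sum_limit:
  fixes D :: "real^2 \<Rightarrow> real"
  assumes D: "sqi M D" and \<phi>: "test_function \<Omega> \<phi>"
  obtains e0 B where "e0 > 0" "B \<ge> 0" "\<And>e p. 0 < e \<Longrightarrow> e < e0 \<Longrightarrow>
    \<bar>(\<Sum>a\<in>centers \<Omega> p e. \<phi> a * (\<integral>x. ind (cell e a) x * D x \<partial>M)) - (\<integral>x. D x * \<phi> x \<partial>M)\<bar> \<le> B * e"
proof -
  obtain B where B: "B \<ge> 0" "\<And>x y. \<bar>\<phi> x - \<phi> y\<bar> \<le> B * norm (x - y)" using test_function_bounded[OF \<phi>] by metis
  have K: "compact (closure {x. \<phi> x \<noteq> 0})" "closure {x. \<phi> x \<noteq> 0} \<subseteq> \<Omega>" using \<phi> by (auto simp: test_function_def)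
  obtain r where r: "r > 0" "(\<Union>x\<in>closure {x. \<phi> x \<noteq> 0}. cball x r) \<subseteq> \<Omega>"
    using compact_subset_open_imp_cball_epsilon_subset[OF K(1) open_domain K(2)] by metis
  note sp = test_function_sqi(1)[OF open_domain \<phi>]
  note iD = sqi_integrable[OF finite_measure_M D]
  have main: "\<bar>(\<Sum>a\<in>centers \<Omega> p e. \<phi> a * (\<integral>x. ind (cell e a) x * D x \<partial>M)) - (\<integral>x. D x * \<phi> x \<partial>M)\<bar> \<le> B * e * (\<integral>x. \<bar>D x\<bar> \<partial>M)"
    if e: "0 < e" "e < r / 2" for e p
  proof -
    let ?A = "centers \<Omega> p e"
    have fin: "finite ?A" by (rule finite_centers[OF e(1)])
    have S: "cell e a \<in> sets borel \<and> cell e a \<subseteq> \<Omega> \<and> measure lborel (cell e a) = e^2" if "a \<in> ?A" for a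
      using cell_subset[OF that] measure_cell[OF e(1), of a] e by (auto simp: measure_def cell_def)
    have dis: "cell e a \<inter> cell e b = {}" if "a \<in> ?A" "b \<in> ?A" "a \<noteq> b" for a b
      by (rule cells_disjoint[OF that e(1)])
    define \<psi> where "\<psi> x = (\<Sum>a\<in>?A. \<phi> a * ind (cell e a) x)" for x
    have s\<psi>: "sqi M \<psi>" unfolding \<psi>_def[abs_def] by (rule piecewise_constant(3)[OF fin S dis])
    have s1: "sqi M (ind (cell e a))" if "a \<in> ?A" for a by (rule piecewise_constant(1)[OF fin S dis that])
    have "(\<Sum>a\<in>?A. \<phi> a * (\<integral>x. ind (cell e a) x * D x \<partial>M)) = (\<Sum>a\<in>?A. (\<integral>x. \<phi> a * (ind (cell e a) x * D x) \<partial>M))"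
      by simp
    also have "\<dots> = (\<integral>x. (\<Sum>a\<in>?A. \<phi> a * (ind (cell e a) x * D x)) \<partial>M)"
      by (rule Bochner_Integration.integral_sum[symmetric]) (intro integrable_mult_right sqi_mult s1 D)
    also have "\<dots> = (\<integral>x. \<psi> x * D x \<partial>M)" by (simp add: \<psi>_def sum_distrib_right mult.assoc)
    also have "\<dots> - (\<integral>x. D x * \<phi> x \<partial>M) = (\<integral>x. \<psi> x * D x - D x * \<phi> x \<partial>M)"
      by (rule Bochner_Integration.integral_diff[symmetric, OF sqi_mult[OF s\<psi> D] sqi_mult[OF D sp]])
    also have "\<bar>\<dots>\<bar> \<le> (\<integral>x. \<bar>\<psi> x * D x - D x * \<phi> x\<bar> \<partial>M)" by (rule integral_abs_bound)
    also have "\<dots> \<le> (\<integral>x. B * e * \<bar>D x\<bar> \<partial>M)"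
    proof (rule integral_mono_AE)
      show "integrable M (\<lambda>x. \<bar>\<psi> x * D x - D x * \<phi> x\<bar>)"
        by (intro integrable_abs Bochner_Integration.integrable_diff sqi_mult s\<psi> D sp)
      show "integrable M (\<lambda>x. B * e * \<bar>D x\<bar>)" by (intro integrable_mult_right integrable_abs iD)
      have "AE x in M. \<exists>k :: int^2. x \<in> cell e (p + e *\<^sub>R (\<chi> i. of_int (k $ i) + 1/2))"
        using AE_cell[OF e(1), of p] domain_sets by (auto simp: AE_restrict_space_iff elim: eventually_mono)
      then show "AE x in M. \<bar>\<psi> x * D x - D x * \<phi> x\<bar> \<le> B * e * \<bar>D x\<bar>"
      proof eventually_elim
        case (elim x)
        have "\<bar>\<psi> x - \<phi> x\<bar> \<le> B * e"
        proof (cases "\<exists>a\<in>?A. x \<in> cell e a")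
          case True
          then obtain a where a: "a \<in> ?A" "x \<in> cell e a" by blast
          have "\<psi> x = \<phi> a * ind (cell e a) x" unfolding \<psi>_def
            by (rule sum_single[OF fin a(1)]) (use dis[OF a(1)] a(2) in \<open>auto simp: indicator_def\<close>)
          moreover have "norm (a - x) \<le> e" using cell_subset_cball[of e a] a(2) by (auto simp: dist_norm)
          then have "B * norm (a - x) \<le> B * e" using B(1) by (rule mult_left_mono)
          ultimately show ?thesis using B(2)[of a x] a(2) by simp
        next
          case False
          then have "\<psi> x = 0" by (simp add: \<psi>_def indicator_def)
          \<comment> \<open>Almost every such \<open>x\<close> lies in a lattice square that is not
            contained in the domain. Any lattice square with \<open>x\<close> inside fits into
            \<open>cball x r\<close>, because \<open>2 * e < r\<close>, so \<open>x\<close> cannot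
            be a point of the support.\<close>
          moreover have "\<phi> x = 0"
          proof (rule ccontr)
            assume nz: "\<phi> x \<noteq> 0"
            obtain k :: "int^2" where k: "x \<in> cell e (p + e *\<^sub>R (\<chi> i. of_int (k $ i) + 1/2))" using elim by blast
            define a where "a = p + e *\<^sub>R (\<chi> i. of_int (k $ i) + 1/2)"
            have xa: "x \<in> cell e a" using k by (simp add: a_def)
            have "cbox (a - vec (e/2)) (a + vec (e/2)) \<subseteq> cball x r"
            proof
              fix y assume "y \<in> cbox (a - vec (e/2)) (a + vec (e/2))"
              then have b: "a $ i - e/2 \<le> y $ i \<and> y $ i \<le> a $ i + e/2" for i by (simp add: mem_box_cart)
              have d: "\<bar>(x - y) $ i\<bar> \<le> e" for i
                using b[of i] xa[unfolded mem_cell, rule_format, of i] unfolding vector_minus_component by argo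
              have "norm (x - y) \<le> e + e" using norm_le_l1_cart[of "x - y"] d[of 1] d[of 2] unfolding sum_2 by linarith
              then show "y \<in> cball x r" using e(2) by (simp add: dist_norm)
            qed
            also have "cball x r \<subseteq> (\<Union>x\<in>closure {x. \<phi> x \<noteq> 0}. cball x r)"
              by (rule UN_upper, rule subsetD[OF closure_subset]) (simp add: nz)
            also note r(2)
            finally have sub: "cbox (a - vec (e/2)) (a + vec (e/2)) \<subseteq> \<Omega>" .
            have "a \<in> ?A" unfolding centers_def by (rule CollectI, rule conjI[OF exI[of _ k] sub]) (rule a_def)
            with False xa show False by blast
          qed
          ultimately show ?thesis using B(1) e by simp
        qed
        then have "\<bar>\<psi> x - \<phi> x\<bar> * \<bar>D x\<bar> \<le> B * e * \<bar>D x\<bar>" by (rule mult_right_mono) simp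
        moreover have "\<psi> x * D x - D x * \<phi> x = (\<psi> x - \<phi> x) * D x" by (simp add: algebra_simps)
        ultimately show ?case by (simp only: abs_mult)
      qed
    qed
    also have "\<dots> = B * e * (\<integral>x. \<bar>D x\<bar> \<partial>M)" by (rule integral_mult_right_zero)
    finally show ?thesis .
  qed
  show ?thesis
  proof (rule that[of "r / 2" "B * (\<integral>x. \<bar>D x\<bar> \<partial>M)"])
    show "0 < r / 2" using r by simp
    show "0 \<le> B * (\<integral>x. \<bar>D x\<bar> \<partial>M)" using B by simp
  qed (use main in \<open>simp add: mult_ac\<close>)
qed

text \<open>One tuple per \<open>e\<close> must serve all test functions. The predicate
  \<open>P\<close> therefore contains the vorticity estimate for every function with bound and
  Lipschitz constant \<open>B\<close> at once, and the tuples are chosen before any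
  \<open>\<phi>\<close> is fixed.\<close>

lemma recovery_sequence:
  assumes D: "sqi M D"
  obtains d :: "real \<Rightarrow> real^2 \<Rightarrow> int" where
    "\<And>e. e > 0 \<Longrightarrow> e^2 * (\<Sum>a\<in>centers \<Omega> (p e) e. (real_of_int (d e a))^2) \<le> (\<integral>x. Phi (D x) \<partial>M)"
    "vorticity_converges \<Omega> p d D"
proof -
  obtain \<beta> where \<beta>: "\<beta> > 0" "\<And>x. x \<in> \<Omega> \<Longrightarrow> norm x \<le> \<beta>" using bounded_domain by (auto simp: bounded_pos)
  define I where "I e a = (\<integral>x. ind (cell e a) x * D x \<partial>M)" for e a
  \<comment> \<open>The number of rows times the summation by parts bound for one row. Telescoping
    makes this of order \<open>1 / e\<close> instead of \<open>1 / e^2\<close>, so that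
    \<open>e^2 * W e B\<close> tends to zero.\<close>
  define W where "W e B = (2 * \<beta> / e + 1) * (2 * B + (2 * \<beta> / e + 1) * (B * e))" for e B :: real
  define P where "P e d \<longleftrightarrow> e^2 * (\<Sum>a\<in>centers \<Omega> (p e) e. (real_of_int (d a))^2) \<le> (\<integral>x. Phi (D x) \<partial>M) \<and>
    (\<forall>\<phi> B. (\<forall>a. \<bar>\<phi> a\<bar> \<le> B) \<longrightarrow> (\<forall>x y. \<bar>\<phi> x - \<phi> y\<bar> \<le> B * norm (x - y)) \<longrightarrow>
      \<bar>\<Sum>a\<in>centers \<Omega> (p e) e. (real_of_int (d a) - I e a / e^2) * \<phi> a\<bar> \<le> W e B)" for e and d :: "real^2 \<Rightarrow> int"
  have "\<exists>d. P e d" if e: "e > 0" for e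
  proof -
    obtain R :: "int set" and n :: nat and c :: "int \<times> nat \<Rightarrow> real^2" where
      c: "finite R" "real (card R) \<le> 2 * \<beta> / e + 1" "real n \<le> 2 * \<beta> / e + 1" "inj_on c (R \<times> {..<n})"
        "centers \<Omega> (p e) e \<subseteq> c ` (R \<times> {..<n})" "\<And>i j. norm (c (i, Suc j) - c (i, j)) = e"
      by (rule lattice_index[OF e \<beta>(2) less_imp_le[OF \<beta>(1)], of "p e"]) blast+
    obtain d where d: "(\<Sum>a\<in>centers \<Omega> (p e) e. (real_of_int (d a))^2) \<le> (\<Sum>a\<in>centers \<Omega> (p e) e. Phi (I e a / e^2))"
      "\<And>\<phi> (B :: real) (L :: real). (\<And>a. \<bar>\<phi> a\<bar> \<le> B) \<Longrightarrow> (\<And>i j. \<bar>\<phi> (c (i, Suc j)) - \<phi> (c (i, j))\<bar> \<le> L) \<Longrightarrow>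
        \<bar>\<Sum>a\<in>centers \<Omega> (p e) e. (real_of_int (d a) - I e a / e^2) * \<phi> a\<bar> \<le> card R * (2 * B + n * L)"
      by (rule lattice_rounding[OF c(1,4,5), of "\<lambda>a. I e a / e^2"]) blast
    have "P e d" unfolding P_def
    proof (intro conjI allI impI)
      have "e^2 * (\<Sum>a\<in>centers \<Omega> (p e) e. (real_of_int (d a))^2) \<le> e^2 * (\<Sum>a\<in>centers \<Omega> (p e) e. Phi (I e a / e^2))"
        using d(1) by (rule mult_left_mono) simp
      also have "\<dots> \<le> (\<integral>x. Phi (D x) \<partial>M)" unfolding I_def by (rule cell_average_Phi[OF e D])
      finally show "e^2 * (\<Sum>a\<in>centers \<Omega> (p e) e. (real_of_int (d a))^2) \<le> (\<integral>x. Phi (D x) \<partial>M)" .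
    next
      fix \<phi> :: "real^2 \<Rightarrow> real" and B :: real assume \<phi>: "\<forall>a. \<bar>\<phi> a\<bar> \<le> B" "\<forall>x y. \<bar>\<phi> x - \<phi> y\<bar> \<le> B * norm (x - y)"
      have B: "B \<ge> 0" using \<phi>(1) abs_ge_zero order_trans by blast
      have st: "\<bar>\<phi> (c (i, Suc j)) - \<phi> (c (i, j))\<bar> \<le> B * e" for i j using \<phi>(2)[rule_format, of "c (i, Suc j)" "c (i, j)"] by (simp only: c(6))
      have "\<bar>\<Sum>a\<in>centers \<Omega> (p e) e. (real_of_int (d a) - I e a / e^2) * \<phi> a\<bar> \<le> card R * (2 * B + n * (B * e))"
        by (rule d(2)[OF \<phi>(1)[rule_format] st])
      also have "\<dots> \<le> (2 * \<beta> / e + 1) * (2 * B + (2 * \<beta> / e + 1) * (B * e))"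
      proof (rule mult_mono)
        show "2 * B + n * (B * e) \<le> 2 * B + (2 * \<beta> / e + 1) * (B * e)" using c(3) B e by (intro add_left_mono mult_right_mono) auto
      qed (use c(2) B e \<beta>(1) in \<open>auto intro!: add_nonneg_nonneg\<close>)
      finally show "\<bar>\<Sum>a\<in>centers \<Omega> (p e) e. (real_of_int (d a) - I e a / e^2) * \<phi> a\<bar> \<le> W e B" unfolding W_def .
    qed
    then show "\<exists>d. P e d" by (rule exI[where x=d])
  qed
  then have "\<exists>d. \<forall>e. e > 0 \<longrightarrow> P e (d e)" by (intro choice) blast
  then obtain d where d: "\<And>e. e > 0 \<Longrightarrow> P e (d e)" by blast
  show ?thesis
  proof (rule that[of d])
    show "e^2 * (\<Sum>a\<in>centers \<Omega> (p e) e. (real_of_int (d e a))^2) \<le> (\<integral>x. Phi (D x) \<partial>M)" if "e > 0" for e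
      using d[OF that] by (simp add: P_def)
    show "vorticity_converges \<Omega> p d D" unfolding vorticity_converges_def
    proof (intro allI impI)
      fix \<phi> assume \<phi>: "test_function \<Omega> \<phi>"
      obtain B where B: "B \<ge> 0" "\<And>x. \<bar>\<phi> x\<bar> \<le> B" "\<And>x y. \<bar>\<phi> x - \<phi> y\<bar> \<le> B * norm (x - y)" using test_function_bounded[OF \<phi>] by metis
      obtain e0 K where K: "e0 > 0" "K \<ge> 0" "\<And>e p. 0 < e \<Longrightarrow> e < e0 \<Longrightarrow>
        \<bar>(\<Sum>a\<in>centers \<Omega> p e. \<phi> a * I e a) - (\<integral>x. D x * \<phi> x \<partial>M)\<bar> \<le> K * e"
        unfolding I_def by (rule cell_sum_limit[OF D \<phi>]) blast
      have ev3: "\<forall>\<^sub>F e in at_right (0::real). 0 < e \<and> e < e0" using K(1) by (auto simp: eventually_at_right_field)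
      define Y where "Y e = (2 * \<beta> + e) * (2 * B * e + (2 * \<beta> + e) * (B * e)) + K * e" for e :: real
      have "\<forall>\<^sub>F e in at_right 0. norm (e^2 * (\<Sum>a\<in>centers \<Omega> (p e) e. of_int (d e a) * \<phi> a) - (\<integral>x. D x * \<phi> x \<partial>M)) \<le> Y e"
        using ev3
      proof eventually_elim
        case (elim e)
        define s where "s = (\<Sum>a\<in>centers \<Omega> (p e) e. (real_of_int (d e a) - I e a / e^2) * \<phi> a)"
        have "\<bar>s\<bar> \<le> W e B" using d[of e] elim B unfolding P_def s_def by blast
        then have "e^2 * \<bar>s\<bar> \<le> e^2 * W e B" by (rule mult_left_mono) simp
        moreover have "e^2 * W e B = (2 * \<beta> + e) * (2 * B * e + (2 * \<beta> + e) * (B * e))"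
          using elim unfolding W_def by (simp add: field_simps power2_eq_square)
        moreover have "e^2 * (\<Sum>a\<in>centers \<Omega> (p e) e. of_int (d e a) * \<phi> a) = e^2 * s + (\<Sum>a\<in>centers \<Omega> (p e) e. \<phi> a * I e a)"
          using elim unfolding s_def sum_distrib_left sum.distrib[symmetric] by (intro sum.cong refl) (simp add: field_simps)
        moreover have "\<bar>e\<^sup>2 * s\<bar> = e^2 * \<bar>s\<bar>" by (simp add: abs_mult)
        moreover have "\<bar>(\<Sum>a\<in>centers \<Omega> (p e) e. \<phi> a * I e a) - (\<integral>x. D x * \<phi> x \<partial>M)\<bar> \<le> K * e" using K(3) elim by blast
        ultimately show ?case unfolding Y_def real_norm_def by linarith
      qed
      moreover have "(Y \<longlongrightarrow> 0) (at_right 0)" unfolding Y_def[abs_def] by (auto intro!: tendsto_eq_intros)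
      ultimately have "((\<lambda>e. e^2 * (\<Sum>a\<in>centers \<Omega> (p e) e. of_int (d e a) * \<phi> a) - (\<integral>x. D x * \<phi> x \<partial>M)) \<longlongrightarrow> 0) (at_right 0)"
        by (rule Lim_null_comparison)
      then show "((\<lambda>e. e^2 * (\<Sum>a\<in>centers \<Omega> (p e) e. of_int (d e a) * \<phi> a)) \<longlongrightarrow> (\<integral>x. D x * \<phi> x \<partial>M)) (at_right 0)"
        by (simp only: LIM_zero_iff)
    qed
  qed
qed

text \<open>The recovery charges satisfy \<open>Q \<le> \<integral> Phi (D x)\<close> for every
  \<open>\<epsilon>\<close>, not only in the limit. The same constant thus bounds the charges, and
  the upper bound for the energy turns directly into one by \<open>E_0\<close>.\<close>

lemma gamma_limsup:
  assumes \<gamma>: "\<gamma> > 0" and D: "sqi M D"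
  obtains d where "charges_bounded \<Omega> p d" "vorticity_converges \<Omega> p d D"
    "Limsup (at_right 0) (\<lambda>\<epsilon>. ereal (E_tilde \<Omega> \<sigma> \<gamma> (p \<epsilon>) \<epsilon> (d \<epsilon>))) \<le> ereal (E_0 \<Omega> \<sigma> \<gamma> D)"
proof -
  define C where "C = (\<integral>x. Phi (D x) \<partial>M)"
  have C: "C \<ge> 0" unfolding C_def by (rule Bochner_Integration.integral_nonneg) (rule Phi_nonneg)
  obtain d where d: "\<And>\<epsilon>. \<epsilon> > 0 \<Longrightarrow> \<epsilon>^2 * (\<Sum>a\<in>centers \<Omega> (p \<epsilon>) \<epsilon>. (real_of_int (d \<epsilon> a))^2) \<le> C" "vorticity_converges \<Omega> p d D"
    unfolding C_def by (rule recovery_sequence[OF D, of p]) blast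
  have ev0: "\<forall>\<^sub>F \<epsilon> in at_right (0::real). \<epsilon> > 0" by (rule eventually_at_right_less)
  have ev: "\<forall>\<^sub>F \<epsilon> in at_right 0. \<epsilon>^2 * (\<Sum>a\<in>centers \<Omega> (p \<epsilon>) \<epsilon>. (real_of_int (d \<epsilon> a))^2) \<le> C"
    using ev0 by (rule eventually_mono) (rule d(1))
  obtain w where w: "w \<in> Z" "\<And>v. v \<in> Z \<Longrightarrow> (\<integral>x. w x \<bullet> v x \<partial>M) = 2 * pi * (\<integral>x. D x * fst (v x) \<partial>M) - \<sigma> * (\<integral>x. fst (v x) \<partial>M)"
    "E_0 \<Omega> \<sigma> \<gamma> D = (nrm2 M w)^2 / 2 + pi * \<gamma> * C"
    unfolding C_def by (rule E_0_char[OF D, of \<sigma> \<gamma>]) blast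
  show ?thesis
  proof (rule that[OF _ d(2)])
    show "charges_bounded \<Omega> p d" unfolding charges_bounded_def
    proof (intro exI)
      show "\<forall>\<^sub>F \<epsilon> in at_right 0. (\<Sum>a\<in>centers \<Omega> (p \<epsilon>) \<epsilon>. (real_of_int (d \<epsilon> a))^2) \<le> C / \<epsilon>^2"
        using ev0
      proof eventually_elim
        case (elim \<epsilon>)
        then show ?case using d(1)[OF elim] by (simp add: pos_le_divide_eq mult.commute)
      qed
    qed
    show "Limsup (at_right 0) (\<lambda>\<epsilon>. ereal (E_tilde \<Omega> \<sigma> \<gamma> (p \<epsilon>) \<epsilon> (d \<epsilon>))) \<le> ereal (E_0 \<Omega> \<sigma> \<gamma> D)"
    proof (rule ereal_le_epsilon2)
      fix e :: real assume e: "e > 0"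
      have "\<forall>\<^sub>F \<epsilon> in at_right 0. E_tilde \<Omega> \<sigma> \<gamma> (p \<epsilon>) \<epsilon> (d \<epsilon>) \<le> (nrm2 M w)^2 / 2 + pi * \<gamma> * (\<epsilon>^2 * (\<Sum>a\<in>centers \<Omega> (p \<epsilon>) \<epsilon>. (real_of_int (d \<epsilon> a))^2)) + e"
        by (rule E_tilde_upper_bound[OF \<gamma> C ev d(2) D e w(1,2)])
      with ev have "\<forall>\<^sub>F \<epsilon> in at_right 0. ereal (E_tilde \<Omega> \<sigma> \<gamma> (p \<epsilon>) \<epsilon> (d \<epsilon>)) \<le> ereal (E_0 \<Omega> \<sigma> \<gamma> D) + ereal e"
      proof eventually_elim
        case (elim \<epsilon>)
        have "pi * \<gamma> * (\<epsilon>^2 * (\<Sum>a\<in>centers \<Omega> (p \<epsilon>) \<epsilon>. (real_of_int (d \<epsilon> a))^2)) \<le> pi * \<gamma> * C"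
          using elim(1) \<gamma> by (intro mult_left_mono) auto
        then have "E_tilde \<Omega> \<sigma> \<gamma> (p \<epsilon>) \<epsilon> (d \<epsilon>) \<le> E_0 \<Omega> \<sigma> \<gamma> D + e" using elim(2) w(3) by linarith
        then show ?case by simp
      qed
      then show "Limsup (at_right 0) (\<lambda>\<epsilon>. ereal (E_tilde \<Omega> \<sigma> \<gamma> (p \<epsilon>) \<epsilon> (d \<epsilon>))) \<le> ereal (E_0 \<Omega> \<sigma> \<gamma> D) + ereal e" by (rule Limsup_bounded)
    qed
  qed
qed

end

theorem theorem3p2:
  fixes \<Omega> :: "(real^2) set" and \<sigma> \<gamma> :: real and p :: "real \<Rightarrow> real^2"
  assumes "open \<Omega>" and "connected \<Omega>" and "\<Omega> \<noteq> {}"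
    and "simply_connected \<Omega>" and "bounded \<Omega>"
    and "\<sigma> > 0" and "\<gamma> > 0"
  shows "(\<forall>D d. L2 \<Omega> D \<and> charges_bounded \<Omega> p d \<and> vorticity_converges \<Omega> p d D \<longrightarrow>
            ereal (E_0 \<Omega> \<sigma> \<gamma> D) \<le>
              Liminf (at_right 0) (\<lambda>\<epsilon>. ereal (E_tilde \<Omega> \<sigma> \<gamma> (p \<epsilon>) \<epsilon> (d \<epsilon>)))) \<and>
         (\<forall>D. L2 \<Omega> D \<longrightarrow>
            (\<exists>d. charges_bounded \<Omega> p d \<and> vorticity_converges \<Omega> p d D \<and>
              Limsup (at_right 0) (\<lambda>\<epsilon>. ereal (E_tilde \<Omega> \<sigma> \<gamma> (p \<epsilon>) \<epsilon> (d \<epsilon>)))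
                \<le> ereal (E_0 \<Omega> \<sigma> \<gamma> D)))"
proof -
  interpret bounded_domain \<Omega> by unfold_locales fact+
  show ?thesis
  proof (intro conjI allI impI)
    fix D d assume "L2 \<Omega> D \<and> charges_bounded \<Omega> p d \<and> vorticity_converges \<Omega> p d D"
    then show "ereal (E_0 \<Omega> \<sigma> \<gamma> D) \<le> Liminf (at_right 0) (\<lambda>\<epsilon>. ereal (E_tilde \<Omega> \<sigma> \<gamma> (p \<epsilon>) \<epsilon> (d \<epsilon>)))"
      using \<open>\<sigma> > 0\<close> \<open>\<gamma> > 0\<close> by (intro gamma_liminf) (simp_all add: L2_iff)
  next
    fix D :: "real^2 \<Rightarrow> real" assume "L2 \<Omega> D"
    then have "sqi M D" by (simp add: L2_iff)
    from gamma_limsup[OF \<open>\<gamma> > 0\<close> this, of p \<sigma>]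
    show "\<exists>d. charges_bounded \<Omega> p d \<and> vorticity_converges \<Omega> p d D \<and>
      Limsup (at_right 0) (\<lambda>\<epsilon>. ereal (E_tilde \<Omega> \<sigma> \<gamma> (p \<epsilon>) \<epsilon> (d \<epsilon>))) \<le> ereal (E_0 \<Omega> \<sigma> \<gamma> D)" by metis
  qed
qed

end
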